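(* Let $n\ge3$, $r_0>0$, $M^n=\mathbb{S}^{n-1}\times(r_0,\infty)$ and $g=u^2(\theta,r)\,dr^2+r^2g_{\mathbb{S}^{n-1}}$ with $u\in C^\infty(M)$, $u>0$. Suppose there is a bounded function $V\in C^\infty(M)$ (not assumed positive and with no assumed asymptotics) satisfying $\mathrm{Hess}_gV=V\,\mathrm{Ric}_g$ and $\Delta_gV=0$. Then there is a constant $m\in\mathbb{R}$ with $r_0\ge r_m$ such that $u=(1-2mr^{2-n})^{-1/2}$, i.e. $g=g_m$ is the Schwarzschild metric, and $V$ is a constant multiple of the Schwarzschild potential $V_m$; in particular (after normalizing $V\to1$) $(M,g,V)$ is the Schwarzschild space $(\mathbb{S}^{n-1}\times(r_0,\infty),g_m,V_m)$.
   Context: For $m\in\mathbb{R}$, the Schwarzschild space of mass $m$ is $\mathbb{S}^{n-1}\times(r_m,\infty)$ with $g_m=(1-2mr^{2-n})^{-1}dr^2+r^2g_{\mathbb{S}^{n-1}}$ and potential $V_m=\sqrt{1-2mr^{2-n}}$, where $r_m^{n-2}=\max\{2m,0\}$ and $g_{\mathbb{S}^{n-1}}$ is the round unit-sphere metric.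
   Formalization: The formal theorem additionally assumes that V is not identically zero; without this the claim fails, since V = 0 satisfies both equations for every u (for example u = 2, which is not a Schwarzschild coefficient). *)

theory Defs
  imports "HOL-Analysis.Analysis"
begin

text \<open>Coordinates: M = S^(n-1) x (r0,oo) is identified with the exterior region
  {x in R^n. |x| > r0} via (theta, r) <-> r*theta.  Functions on M are functions on R^n
  restricted to this open set.\<close>

definition ext_region :: "real \<Rightarrow> (real^'n) set" where
  "ext_region r0 = {x. norm x > r0}"

definition pd :: "'n::finite \<Rightarrow> (real^'n \<Rightarrow> real) \<Rightarrow> real^'n \<Rightarrow> real" where
  "pd i f x = frechet_derivative f (at x) (axis i 1)"

fun Ck_on :: "nat \<Rightarrow> (real^'n::finite \<Rightarrow> real) \<Rightarrow> (real^'n) set \<Rightarrow> bool" where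
  "Ck_on 0 f U = continuous_on U f"
| "Ck_on (Suc k) f U = (continuous_on U f \<and> f differentiable_on U \<and> (\<forall>i. Ck_on k (pd i f) U))"

definition smooth_on :: "(real^'n::finite \<Rightarrow> real) \<Rightarrow> (real^'n) set \<Rightarrow> bool" where
  "smooth_on f U = (\<forall>k. Ck_on k f U)"

text \<open>The metric g = u^2 dr^2 + r^2 g_{S^{n-1}} in Cartesian coordinates:
  since dr^2 + r^2 g_S is the Euclidean metric, g = delta + (u^2 - 1) dr (x) dr,
  with dr = x/|x|.\<close>
definition warped_metric :: "(real^'n::finite \<Rightarrow> real) \<Rightarrow> real^'n \<Rightarrow> real^'n^'n" where
  "warped_metric u x = (\<chi> i j. (if i = j then 1 else 0) + ((u x)\<^sup>2 - 1) * (x$i) * (x$j) / (norm x)\<^sup>2)"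

definition ginv :: "(real^'n::finite \<Rightarrow> real^'n^'n) \<Rightarrow> real^'n \<Rightarrow> real^'n^'n" where
  "ginv G x = matrix_inv (G x)"

definition christoffel :: "(real^'n::finite \<Rightarrow> real^'n^'n) \<Rightarrow> 'n \<Rightarrow> 'n \<Rightarrow> 'n \<Rightarrow> real^'n \<Rightarrow> real" where
  "christoffel G k i j x = (1/2) * (\<Sum>l\<in>UNIV. ginv G x $ k $ l *
      (pd i (\<lambda>y. G y $ j $ l) x + pd j (\<lambda>y. G y $ i $ l) x - pd l (\<lambda>y. G y $ i $ j) x))"

definition hessian :: "(real^'n::finite \<Rightarrow> real^'n^'n) \<Rightarrow> (real^'n \<Rightarrow> real) \<Rightarrow> 'n \<Rightarrow> 'n \<Rightarrow> real^'n \<Rightarrow> real" where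
  "hessian G f i j x = pd i (pd j f) x - (\<Sum>k\<in>UNIV. christoffel G k i j x * pd k f x)"

definition ricci :: "(real^'n::finite \<Rightarrow> real^'n^'n) \<Rightarrow> 'n \<Rightarrow> 'n \<Rightarrow> real^'n \<Rightarrow> real" where
  "ricci G i j x = (\<Sum>k\<in>UNIV.
      pd k (christoffel G k i j) x - pd j (christoffel G k i k) x
      + (\<Sum>l\<in>UNIV. christoffel G k k l x * christoffel G l i j x
                   - christoffel G k j l x * christoffel G l i k x))"

definition laplacian :: "(real^'n::finite \<Rightarrow> real^'n^'n) \<Rightarrow> (real^'n \<Rightarrow> real) \<Rightarrow> real^'n \<Rightarrow> real" where
  "laplacian G f x = (\<Sum>i\<in>UNIV. \<Sum>j\<in>UNIV. ginv G x $ i $ j * hessian G f i j x)"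

definition schw_rm :: "nat \<Rightarrow> real \<Rightarrow> real" where
  "schw_rm n m = root (n - 2) (max (2*m) 0)"

definition schw_V :: "nat \<Rightarrow> real \<Rightarrow> real \<Rightarrow> real" where
  "schw_V n m r = sqrt (1 - 2*m * r powr (2 - real n))"

end

theory Submission
  imports Defs
begin

text \<open>
  Let \<open>E = r d/dr\<close>, \<open>\<omega> = u^(-2)\<close> and let \<open>L\<close> run over the infinitesimal rotations. The static
  equations split into a mixed equation \<open>L(EV) = LV + (Lu/u)(EV + (n-2)V)\<close>, a tangential equation
  saying that \<open>u V_XY + V u_XY\<close> is pure trace on spheres, and, since \<open>V\<close> vanishes on no open set,
  the scalar equation \<open>\<Delta>u/u - (n-1)\<omega>Eu/u = (n-1)(n-2)(1-\<omega>)/2\<close>, with \<open>\<Delta>\<close> the spherical Laplacian.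
  The commutators of rotations applied to the mixed equation make the tangential gradients of \<open>u\<close>
  and \<open>V\<close> parallel. Hence, near a point where \<open>u\<close> is not radial, the whole system lives on a plane
  through the origin, where it is an overdetermined system of first order for \<open>E\<close> and one rotation \<open>S\<close>;
  its integrability conditions are three polynomial relations. At a maximum of \<open>|d log u|\<close> these
  have no solution if \<open>Z = Su/u\<close> is small and dominates \<open>Y = SV/V\<close>.

  The scalar equation is parabolic with \<open>log r\<close> as time. The maximum principle, applied to
  \<open>(1-\<omega>) r^(n-2)\<close> and, in Bernstein's manner, to the gradient of \<open>u\<close>, gives decay of \<open>1-\<omega>\<close> and
  of the tangential gradient; the boundedness of \<open>V\<close> and the mixed equation then give \<open>EV \<rightarrow> 0\<close>, a
  positive lower bound for \<open>|V|\<close>, and \<open>|Y| < Z\<close> at a maximum of a weighted \<open>|d log u|\<close> over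
  \<open>|x| \<ge> R\<close>. So \<open>u\<close> is radial near infinity. On the inner boundary sphere of the maximal radial
  region the mixed equation gives \<open>Y/Z \<rightarrow> 0\<close>, and the same contradiction shows that the region is
  everything. For radial \<open>u\<close> the scalar equation integrates to \<open>(1-\<omega>) r^(n-2) = 2m\<close>, and \<open>uV\<close> is
  constant.
\<close>

section \<open>Directional derivatives and smooth functions\<close>

text \<open>All calculus on spheres uses linear vector fields: \<open>E\<close> commutes with
  rotations, brackets of rotations are rotations, and half the sum of squares of the coordinate
  rotations is the spherical Laplacian. No charts are needed. At the maximum \<open>S Z = 0\<close>,
  which expresses \<open>l\<close> by \<open>c\<close> and \<open>Z\<close>; only \<open>c\<close>
  remains unknown. As Z tends to 0, \<open>pPhi\<close> and \<open>pF2\<close> pin down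
  \<open>c / Z\<close>, and the leading term of \<open>pF2\<close> is a multiple of \<omega>
  (\<omega> - 1) (x (N + 1) - 2) with x = 1 + Y/Z. It excludes \<omega> \<noteq> 1 if Y/Z tends to
  0, but is void at \<omega> = 1, the limit at infinity. There \<open>pF3\<close> decides, and for
  it |Y| \<le> |Z| is enough. Hence the different demands on Y near infinity and at an inner sphere.
  \<open>S Z = 0\<close> uses maximality on one sphere only, so radial weights are free; near
  infinity the weight must make the maximum exist and still give |Y| < Z. V may change sign and has
  no prescribed limit, so each division by V or by E V + (n - 2) V needs a reason: unique
  continuation, a lower bound from the maximum principle, or closeness to a sphere where the value
  is known.\<close>

definition dd :: "real^'n \<Rightarrow> (real^'n::finite \<Rightarrow> real) \<Rightarrow> real^'n \<Rightarrow> real" where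
  "dd v f x = frechet_derivative f (at x) v"

text \<open>Linear vector fields suffice: \<open>A = id\<close> gives \<open>E\<close>, skew
  \<open>A\<close> gives the infinitesimal rotations, and the bracket of two linear fields is again
  linear.\<close>

definition ld :: "(real^'n \<Rightarrow> real^'n) \<Rightarrow> (real^'n::finite \<Rightarrow> real) \<Rightarrow> real^'n \<Rightarrow> real" where
  "ld A f x = dd (A x) f x"

lemma pd_eq_dd: "pd i f x = dd (axis i 1) f x"
  by (simp add: pd_def dd_def)

lemma dd_unique: "(f has_derivative f') (at x) \<Longrightarrow> dd v f x = f' v"
  unfolding dd_def by (metis frechet_derivative_at)

lemma has_derivative_dd: "f differentiable (at x) \<Longrightarrow> (f has_derivative (\<lambda>v. dd v f x)) (at x)"
  unfolding dd_def by (metis frechet_derivative_works)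

lemma linear_dd: "f differentiable (at x) \<Longrightarrow> linear (\<lambda>v. dd v f x)"
  unfolding dd_def by (metis linear_frechet_derivative)

lemma dd_lin:
  assumes "f differentiable (at x)"
  shows "dd (v + w) f x = dd v f x + dd w f x" "dd (v - w) f x = dd v f x - dd w f x"
    "dd (c *\<^sub>R v) f x = c * dd v f x" "dd (- v) f x = - dd v f x" "dd 0 f x = 0"
    "dd (\<Sum>i\<in>I. g i) f x = (\<Sum>i\<in>I. dd (g i) f x)"
  using linear_add[OF linear_dd[OF assms], of v w] linear_diff[OF linear_dd[OF assms], of v w]
    linear_scale[OF linear_dd[OF assms], of c v] linear_neg[OF linear_dd[OF assms], of v]
    linear_0[OF linear_dd[OF assms]] linear_sum[OF linear_dd[OF assms], of g I]
  by simp_all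

lemma dd_sum_pd: "f differentiable (at x) \<Longrightarrow> dd v f x = (\<Sum>i\<in>UNIV. v $ i * pd i f x)"
proof -
  assume f: "f differentiable (at x)"
  have "v = (\<Sum>i\<in>UNIV. v $ i *\<^sub>R axis i 1)"
    by (simp add: basis_expansion flip: scalar_mult_eq_scaleR)
  then have "dd v f x = dd (\<Sum>i\<in>UNIV. v $ i *\<^sub>R axis i 1) f x" by simp
  also have "\<dots> = (\<Sum>i\<in>UNIV. v $ i * pd i f x)"
    by (simp add: dd_lin[OF f] pd_eq_dd)
  finally show ?thesis .
qed

lemma dd_cong_open:
  assumes "open U" "x \<in> U" "\<And>y. y \<in> U \<Longrightarrow> f y = g y"
  shows "dd v f x = dd v g x"
proof -
  have "(f has_derivative D) (at x) \<longleftrightarrow> (g has_derivative D) (at x)" for D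
    using has_derivative_transform_within_open[OF _ assms(1,2)] assms(3) by metis
  then show ?thesis unfolding dd_def frechet_derivative_def by simp
qed

lemma ld_cong_open:
  assumes "open U" "x \<in> U" "\<And>y. y \<in> U \<Longrightarrow> f y = g y"
  shows "ld A f x = ld A g x"
  unfolding ld_def by (rule dd_cong_open[OF assms])

lemma pd_cong_open:
  assumes "open U" "x \<in> U" "\<And>y. y \<in> U \<Longrightarrow> f y = g y"
  shows "pd i f x = pd i g x"
  unfolding pd_eq_dd by (rule dd_cong_open[OF assms])

lemma dd_simps:
  assumes "f differentiable (at x)" "g differentiable (at x)"
  shows "dd v (\<lambda>y. f y + g y) x = dd v f x + dd v g x"
    "dd v (\<lambda>y. f y - g y) x = dd v f x - dd v g x"
    "dd v (\<lambda>y. f y * g y) x = f x * dd v g x + dd v f x * g x"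
  using has_derivative_dd[OF assms(1)] has_derivative_dd[OF assms(2)]
  by (auto intro!: dd_unique derivative_eq_intros)

lemma dd_const [simp]: "dd v (\<lambda>y. c) x = 0"
  by (rule dd_unique[where f'="\<lambda>v. 0"]) simp

lemma dd_minus: "f differentiable (at x) \<Longrightarrow> dd v (\<lambda>y. - f y) x = - dd v f x"
  using has_derivative_dd by (auto intro!: dd_unique derivative_eq_intros)

lemma dd_inverse:
  "f differentiable (at x) \<Longrightarrow> f x \<noteq> 0 \<Longrightarrow> dd v (\<lambda>y. inverse (f y)) x = - (dd v f x * (inverse (f x) * inverse (f x)))"
  using has_derivative_dd[of f x]
  by (auto intro!: dd_unique derivative_eq_intros)

lemma dd_inner [simp]: "dd v (\<lambda>y. y \<bullet> a) x = v \<bullet> a"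
  by (rule dd_unique) (auto intro!: derivative_eq_intros)

lemma dd_nth [simp]: "dd v (\<lambda>y. y $ i) x = v $ i"
  using dd_inner[of v "axis i 1" x] by (simp add: inner_axis)

lemma differentiable_nth [simp]: "(\<lambda>y::real^'n. y $ i) differentiable (at x)"
  by (rule bounded_linear_imp_differentiable) (rule bounded_linear_vec_nth)

lemma dd_sum_fun:
  assumes "\<And>i. i \<in> I \<Longrightarrow> f i differentiable (at x)"
  shows "dd v (\<lambda>y. \<Sum>i\<in>I. f i y) x = (\<Sum>i\<in>I. dd v (f i) x)"
  by (rule dd_unique) (auto intro!: derivative_eq_intros has_derivative_dd assms)

section \<open>Closure of smooth functions under algebra and differentiation\<close>

lemma Ck_on_cong:
  assumes "open U" "\<And>x. x \<in> U \<Longrightarrow> f x = g x"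
  shows "Ck_on k f U \<longleftrightarrow> Ck_on k g U"
  using assms(2)
proof (induction k arbitrary: f g)
  case 0
  then show ?case by (simp cong: continuous_on_cong)
next
  case (Suc k)
  have "\<And>x i. x \<in> U \<Longrightarrow> pd i f x = pd i g x"
    using pd_cong_open[OF assms(1)] Suc.prems by blast
  then have "Ck_on k (pd i f) U \<longleftrightarrow> Ck_on k (pd i g) U" for i
    using Suc.IH by blast
  moreover have "f differentiable_on U \<longleftrightarrow> g differentiable_on U"
  proof -
    have "(f has_derivative D) (at x) \<longleftrightarrow> (g has_derivative D) (at x)" if "x \<in> U" for D x
      using has_derivative_transform_within_open[OF _ assms(1) that] Suc.prems by metis
    then show ?thesis
      unfolding differentiable_on_eq_differentiable_at[OF assms(1)] differentiable_def by blast
  qed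
  moreover have "continuous_on U f \<longleftrightarrow> continuous_on U g"
    using Suc.prems by (simp cong: continuous_on_cong)
  ultimately show ?case by simp
qed

lemma Ck_on_continuous: "Ck_on k f U \<Longrightarrow> continuous_on U f"
  by (cases k) auto

lemma Ck_on_Suc_imp: "Ck_on (Suc k) f U \<Longrightarrow> Ck_on k f U"
  by (induction k arbitrary: f) auto

lemma differentiable_on_at: "open U \<Longrightarrow> f differentiable_on U \<Longrightarrow> x \<in> U \<Longrightarrow> f differentiable (at x)"
  by (metis at_within_open differentiable_on_def)

lemma Ck_on_const: "Ck_on k (\<lambda>x. c) U"
proof (induction k arbitrary: c)
  case (Suc k)
  have "pd i (\<lambda>x. c) = (\<lambda>x. 0)" for i :: 'a by (simp add: pd_eq_dd fun_eq_iff)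
  then show ?case using Suc by simp
qed simp

lemma Ck_on_nth: "Ck_on k (\<lambda>x. x $ j) U"
proof (cases k)
  case 0 then show ?thesis by (simp add: continuous_intros)
next
  case (Suc k)
  have "pd i (\<lambda>x. x $ j) = (\<lambda>x. axis i 1 $ j)" for i :: 'a by (simp add: pd_eq_dd fun_eq_iff)
  then show ?thesis using Suc by (simp add: Ck_on_const continuous_intros differentiable_on_def differentiable_at_withinI)
qed

lemma Ck_on_add:
  assumes "open U" shows "Ck_on k f U \<Longrightarrow> Ck_on k g U \<Longrightarrow> Ck_on k (\<lambda>x. f x + g x) U"
proof (induction k arbitrary: f g)
  case 0 then show ?case by (simp add: continuous_intros)
next
  case (Suc k)
  have d: "f differentiable (at x)" "g differentiable (at x)" if "x \<in> U" for x
    using Suc.prems differentiable_on_at[OF assms _ that] by auto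
  have "Ck_on k (pd i (\<lambda>x. f x + g x)) U" for i
  proof -
    have "Ck_on k (\<lambda>x. pd i f x + pd i g x) U" using Suc.IH[of "pd i f" "pd i g"] Suc.prems by simp
    moreover have "pd i (\<lambda>x. f x + g x) x = pd i f x + pd i g x" if "x \<in> U" for x
      using d[OF that] by (simp add: pd_eq_dd dd_simps)
    ultimately show ?thesis
      using Ck_on_cong[OF assms, of "pd i (\<lambda>x. f x + g x)" "\<lambda>x. pd i f x + pd i g x" k] by simp
  qed
  then show ?case using Suc.prems by (auto intro!: continuous_intros differentiable_on_add)
qed

lemma Ck_on_mult:
  assumes "open U" shows "Ck_on k f U \<Longrightarrow> Ck_on k g U \<Longrightarrow> Ck_on k (\<lambda>x. f x * g x) U"
proof (induction k arbitrary: f g)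
  case 0 then show ?case by (simp add: continuous_intros)
next
  case (Suc k)
  have d: "f differentiable (at x)" "g differentiable (at x)" if "x \<in> U" for x
    using Suc.prems differentiable_on_at[OF assms _ that] by auto
  have "Ck_on k (pd i (\<lambda>x. f x * g x)) U" for i
  proof -
    have "Ck_on k f U" "Ck_on k g U" using Suc.prems Ck_on_Suc_imp by blast+
    then have "Ck_on k (\<lambda>x. f x * pd i g x + pd i f x * g x) U"
      using Suc.IH[of "f" "pd i g"] Suc.IH[of "pd i f" g] Suc.prems by (intro Ck_on_add[OF assms]) auto
    moreover have "pd i (\<lambda>x. f x * g x) x = f x * pd i g x + pd i f x * g x" if "x \<in> U" for x
      using d[OF that] by (simp add: pd_eq_dd dd_simps)
    ultimately show ?thesis
      using Ck_on_cong[OF assms, of "pd i (\<lambda>x. f x * g x)" "\<lambda>x. f x * pd i g x + pd i f x * g x" k] by simp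
  qed
  then show ?case using Suc.prems by (auto intro!: continuous_intros differentiable_on_mult)
qed

lemma Ck_on_inverse:
  assumes "open U" "\<And>x. x \<in> U \<Longrightarrow> f x \<noteq> 0"
  shows "Ck_on k f U \<Longrightarrow> Ck_on k (\<lambda>x. inverse (f x)) U"
proof (induction k)
  case 0 then show ?case using assms by (simp add: continuous_intros)
next
  case (Suc k)
  have d: "f differentiable (at x)" if "x \<in> U" for x
    using Suc.prems differentiable_on_at[OF assms(1) _ that] by auto
  have IH: "Ck_on k (\<lambda>x. inverse (f x)) U" using Suc Ck_on_Suc_imp by blast
  have "Ck_on k (\<lambda>x. (-1) * (pd i f x * (inverse (f x) * inverse (f x)))) U" for i
    using Suc.prems IH by (intro Ck_on_mult[OF assms(1)] Ck_on_const) auto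
  then have "Ck_on k (pd i (\<lambda>x. inverse (f x))) U" for i
    by (subst Ck_on_cong[OF assms(1), where g="\<lambda>x. (-1) * (pd i f x * (inverse (f x) * inverse (f x)))"])
      (auto simp: pd_eq_dd dd_inverse d assms)
  moreover have "(\<lambda>x. inverse (f x)) differentiable_on U"
    using Suc.prems assms(2) by (auto intro!: differentiable_on_inverse)
  ultimately show ?case using Suc.prems assms(2) by (auto intro!: continuous_intros)
qed

named_theorems smooth_intros "closure properties of smooth functions"

lemma smooth_const [smooth_intros]: "smooth_on (\<lambda>x. c) U" by (simp add: smooth_on_def Ck_on_const)
lemma smooth_nth [smooth_intros]: "smooth_on (\<lambda>x. x $ i) U" by (simp add: smooth_on_def Ck_on_nth)
lemma smooth_add [smooth_intros]: "open U \<Longrightarrow> smooth_on f U \<Longrightarrow> smooth_on g U \<Longrightarrow> smooth_on (\<lambda>x. f x + g x) U"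
  by (simp add: smooth_on_def Ck_on_add)
lemma smooth_mult [smooth_intros]: "open U \<Longrightarrow> smooth_on f U \<Longrightarrow> smooth_on g U \<Longrightarrow> smooth_on (\<lambda>x. f x * g x) U"
  by (simp add: smooth_on_def Ck_on_mult)
lemma smooth_minus [smooth_intros]: "open U \<Longrightarrow> smooth_on f U \<Longrightarrow> smooth_on (\<lambda>x. - f x) U"
  using smooth_mult[OF _ smooth_const[of "-1"], of U f] by simp
lemma smooth_diff [smooth_intros]: "open U \<Longrightarrow> smooth_on f U \<Longrightarrow> smooth_on g U \<Longrightarrow> smooth_on (\<lambda>x. f x - g x) U"
  using smooth_add[OF _ _ smooth_minus, of U f g] by simp
lemma smooth_inverse [smooth_intros]: "open U \<Longrightarrow> (\<And>x. x \<in> U \<Longrightarrow> f x \<noteq> 0) \<Longrightarrow> smooth_on f U \<Longrightarrow> smooth_on (\<lambda>x. inverse (f x)) U"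
  by (simp add: smooth_on_def Ck_on_inverse)
lemma smooth_divide [smooth_intros]: "open U \<Longrightarrow> (\<And>x. x \<in> U \<Longrightarrow> g x \<noteq> 0) \<Longrightarrow> smooth_on f U \<Longrightarrow> smooth_on g U \<Longrightarrow> smooth_on (\<lambda>x. f x / g x) U"
  unfolding divide_inverse by (rule smooth_mult[OF _ _ smooth_inverse])
lemma smooth_power [smooth_intros]: "open U \<Longrightarrow> smooth_on f U \<Longrightarrow> smooth_on (\<lambda>x. f x ^ k) U"
  by (induction k) (simp_all add: smooth_const smooth_mult)
lemma smooth_sum [smooth_intros]: "open U \<Longrightarrow> (\<And>i. i \<in> I \<Longrightarrow> smooth_on (f i) U) \<Longrightarrow> smooth_on (\<lambda>x. \<Sum>i\<in>I. f i x) U"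
  by (induction I rule: infinite_finite_induct) (simp_all add: smooth_const smooth_add)
lemma smooth_inner [smooth_intros]: "open U \<Longrightarrow> smooth_on (\<lambda>x. x \<bullet> a) U"
  unfolding inner_vec_def inner_real_def by (intro smooth_sum smooth_mult smooth_const smooth_nth)
lemma smooth_norm2 [smooth_intros]: "open U \<Longrightarrow> smooth_on (\<lambda>x. x \<bullet> x) U"
  unfolding inner_vec_def inner_real_def by (intro smooth_sum smooth_mult smooth_nth)

lemma smooth_on_cong: "open U \<Longrightarrow> (\<And>x. x \<in> U \<Longrightarrow> f x = g x) \<Longrightarrow> smooth_on f U \<longleftrightarrow> smooth_on g U"
  using Ck_on_cong[of U f g] unfolding smooth_on_def by simp

lemma smooth_continuous: "smooth_on f U \<Longrightarrow> continuous_on U f"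
  unfolding smooth_on_def using Ck_on_continuous by blast

lemma smooth_pd [smooth_intros]: "smooth_on f U \<Longrightarrow> smooth_on (pd i f) U"
proof -
  assume "smooth_on f U"
  then have "Ck_on (Suc k) f U" for k unfolding smooth_on_def by blast
  then show ?thesis unfolding smooth_on_def by simp
qed

lemma smooth_diffble: "open U \<Longrightarrow> smooth_on f U \<Longrightarrow> x \<in> U \<Longrightarrow> f differentiable (at x)"
proof -
  assume "open U" "smooth_on f U" "x \<in> U"
  then have "Ck_on (Suc 0) f U" unfolding smooth_on_def by blast
  then show ?thesis using differentiable_on_at[OF \<open>open U\<close> _ \<open>x \<in> U\<close>] by auto
qed

lemma smooth_vdd:
  assumes "open U" "smooth_on f U" "\<And>i. smooth_on (\<lambda>x. A x $ i) U"
  shows "smooth_on (\<lambda>x. dd (A x) f x) U"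
proof -
  have "smooth_on (\<lambda>x. \<Sum>i\<in>UNIV. A x $ i * pd i f x) U"
    by (intro smooth_sum smooth_mult smooth_pd assms)
  then show ?thesis
    using smooth_on_cong[OF assms(1), of "\<lambda>x. dd (A x) f x" "\<lambda>x. \<Sum>i\<in>UNIV. A x $ i * pd i f x"]
      dd_sum_pd[OF smooth_diffble[OF assms(1,2)]] by simp
qed

lemma smooth_dd [smooth_intros]: "open U \<Longrightarrow> smooth_on f U \<Longrightarrow> smooth_on (dd v f) U"
  using smooth_vdd[of U f "\<lambda>x. v"] smooth_const by fastforce

lemma linear_nth_smooth: "open U \<Longrightarrow> linear A \<Longrightarrow> smooth_on (\<lambda>x::real^'n. (A x :: real^'m) $ i) U"
proof -
  assume "open U" "linear A"
  have "A x $ i = (\<Sum>j\<in>UNIV. x $ j * A (axis j 1) $ i)" for x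
  proof -
    have "A x = A (\<Sum>j\<in>UNIV. x $ j *\<^sub>R axis j 1)" by (simp add: basis_expansion flip: scalar_mult_eq_scaleR)
    then show ?thesis using \<open>linear A\<close> by (simp add: linear_sum linear_scale)
  qed
  then have "(\<lambda>x. A x $ i) = (\<lambda>x. \<Sum>j\<in>UNIV. x $ j * A (axis j 1) $ i)" by blast
  moreover have "smooth_on (\<lambda>x. \<Sum>j\<in>UNIV. x $ j * A (axis j 1) $ i) U"
    using \<open>open U\<close> by (intro smooth_sum smooth_mult smooth_nth smooth_const)
  ultimately show ?thesis by simp
qed

lemma smooth_ld [smooth_intros]: "open U \<Longrightarrow> linear A \<Longrightarrow> smooth_on f U \<Longrightarrow> smooth_on (ld A f) U"
  unfolding ld_def by (rule smooth_vdd) (simp_all add: linear_nth_smooth)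

lemma smooth_on_subset: 
  assumes "smooth_on f U" "T \<subseteq> U" "open T" "open U" shows "smooth_on f T"
proof -
  have "Ck_on k f U \<Longrightarrow> Ck_on k f T" for k
  proof (induction k arbitrary: f)
    case 0 then show ?case using assms continuous_on_subset by auto
  next
    case (Suc k) then show ?case using assms(2) by (auto intro: continuous_on_subset differentiable_on_subset)
  qed
  then show ?thesis using assms(1) unfolding smooth_on_def by blast
qed

section \<open>Derivatives along curves, symmetry of second derivatives, commutators\<close>

lemma has_real_derivative_curve:
  assumes "f differentiable (at (\<gamma> t))" "(\<gamma> has_vector_derivative v) (at t)"
  shows "((\<lambda>t. f (\<gamma> t)) has_real_derivative dd v f (\<gamma> t)) (at t)"
proof -
  have "((f \<circ> \<gamma>) has_derivative (\<lambda>w. dd w f (\<gamma> t)) \<circ> (\<lambda>h. h *\<^sub>R v)) (at t)"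
    using assms(2) has_derivative_dd[OF assms(1)] unfolding has_vector_derivative_def
    by (rule diff_chain_at)
  then show ?thesis
    by (simp add: o_def dd_lin[OF assms(1)] has_field_derivative_def mult_commute_abs)
qed

lemma has_real_derivative_line:
  assumes "f differentiable (at (x + t *\<^sub>R v))"
  shows "((\<lambda>t. f (x + t *\<^sub>R v)) has_real_derivative dd v f (x + t *\<^sub>R v)) (at t)"
proof -
  have "((\<lambda>t. x + t *\<^sub>R v) has_vector_derivative v) (at t)"
    by (auto intro!: derivative_eq_intros)
  then show ?thesis
    using has_real_derivative_curve[where f=f and \<gamma>="\<lambda>t. x + t *\<^sub>R v" and t=t and v=v] assms by simp
qed

lemma dd_line_eq:
  assumes "f differentiable (at x)" "((\<lambda>t. f (x + t *\<^sub>R v)) has_real_derivative D) (at 0)"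
  shows "dd v f x = D"
  using has_real_derivative_line[of f x 0 v] assms DERIV_unique by fastforce

text \<open>Two applications of the mean value theorem: in the direction \<open>v\<close> to the
  increment \<open>g\<close> over the \<open>w\<close>-side, then in the direction \<open>w\<close>
  to \<open>dd v f\<close>.\<close>

lemma second_difference:
  assumes "open U" "smooth_on f U" "h > 0"
    and in_U: "\<And>s t. 0 \<le> s \<Longrightarrow> s \<le> h \<Longrightarrow> 0 \<le> t \<Longrightarrow> t \<le> h \<Longrightarrow> x + s *\<^sub>R v + t *\<^sub>R w \<in> U"
  shows "\<exists>s t. 0 < s \<and> s < h \<and> 0 < t \<and> t < h \<and>
     f (x + h *\<^sub>R v + h *\<^sub>R w) - f (x + h *\<^sub>R v) - f (x + h *\<^sub>R w) + f x
       = h * h * dd w (dd v f) (x + s *\<^sub>R v + t *\<^sub>R w)"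
proof -
  note df = smooth_diffble[OF assms(1,2)]
  note ddf = smooth_diffble[OF assms(1) smooth_dd[OF assms(1,2)]]
  define g where "g = (\<lambda>s. f (x + s *\<^sub>R v + h *\<^sub>R w) - f (x + s *\<^sub>R v))"
  have g: "(g has_real_derivative (dd v f (x + s *\<^sub>R v + h *\<^sub>R w) - dd v f (x + s *\<^sub>R v))) (at s)"
    if "0 \<le> s" "s \<le> h" for s
  proof -
    have 1: "x + h *\<^sub>R w + s *\<^sub>R v \<in> U" using in_U[of s h] that \<open>h > 0\<close> by (simp add: algebra_simps)
    have 2: "x + s *\<^sub>R v \<in> U" using in_U[of s 0] that \<open>h > 0\<close> by simp
    show ?thesis
      using DERIV_diff[OF has_real_derivative_line[OF df[OF 1]] has_real_derivative_line[OF df[OF 2]]]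
      by (simp add: g_def algebra_simps)
  qed
  obtain s where s: "0 < s" "s < h" "g h - g 0 = h * (dd v f (x + s *\<^sub>R v + h *\<^sub>R w) - dd v f (x + s *\<^sub>R v))"
    using MVT2[OF \<open>h > 0\<close>, of g "\<lambda>s. dd v f (x + s *\<^sub>R v + h *\<^sub>R w) - dd v f (x + s *\<^sub>R v)"] g by auto
  define k where "k = (\<lambda>t. dd v f (x + s *\<^sub>R v + t *\<^sub>R w))"
  have k: "(k has_real_derivative dd w (dd v f) (x + s *\<^sub>R v + t *\<^sub>R w)) (at t)" if "0 \<le> t" "t \<le> h" for t
  proof -
    have 1: "x + s *\<^sub>R v + t *\<^sub>R w \<in> U" using in_U[of s t] that s by simp
    show ?thesis using has_real_derivative_line[OF ddf[OF 1]] by (simp add: k_def)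
  qed
  obtain t where t: "0 < t" "t < h" "k h - k 0 = h * dd w (dd v f) (x + s *\<^sub>R v + t *\<^sub>R w)"
    using MVT2[OF \<open>h > 0\<close>, of k "\<lambda>t. dd w (dd v f) (x + s *\<^sub>R v + t *\<^sub>R w)"] k by auto
  have "g h - g 0 = h * (h * dd w (dd v f) (x + s *\<^sub>R v + t *\<^sub>R w))"
    using s(3) t(3) by (simp add: k_def)
  then have "f (x + h *\<^sub>R v + h *\<^sub>R w) - f (x + h *\<^sub>R v) - f (x + h *\<^sub>R w) + f x
       = h * h * dd w (dd v f) (x + s *\<^sub>R v + t *\<^sub>R w)"
    by (simp add: g_def)
  then show ?thesis using s(1,2) t(1,2) by blast
qed

text \<open>Schwarz's theorem. The second difference over a small parallelogram is symmetric in
  \<open>v\<close> and \<open>w\<close>, so the two mixed derivatives agree at two points near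
  \<open>x\<close>; by continuity they cannot differ at \<open>x\<close>.\<close>

lemma dd_commute:
  assumes "open U" "smooth_on f U" "x \<in> U"
  shows "dd v (dd w f) x = dd w (dd v f) x"
proof (rule ccontr)
  assume ne: "dd v (dd w f) x \<noteq> dd w (dd v f) x"
  define e where "e = \<bar>dd v (dd w f) x - dd w (dd v f) x\<bar> / 2"
  have e: "e > 0" using ne by (simp add: e_def)
  have c: "continuous (at x) (dd v (dd w f))" for v w
    using smooth_diffble[OF assms(1) smooth_dd[OF assms(1) smooth_dd[OF assms(1,2)]] assms(3)]
    by (rule differentiable_imp_continuous_within)
  obtain d1 where d1: "d1 > 0" "\<And>y. dist y x < d1 \<Longrightarrow> dist (dd v (dd w f) y) (dd v (dd w f) x) < e"
    using c[of v w] e unfolding continuous_at_eps_delta by blast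
  obtain d2 where d2: "d2 > 0" "\<And>y. dist y x < d2 \<Longrightarrow> dist (dd w (dd v f) y) (dd w (dd v f) x) < e"
    using c[of w v] e unfolding continuous_at_eps_delta by blast
  note d = d1 d2
  obtain d3 where d3: "d3 > 0" "ball x d3 \<subseteq> U" using assms(1,3) open_contains_ball by blast
  define m where "m = min d1 (min d2 d3)"
  have m: "m > 0" using d d3 by (simp add: m_def)
  \<comment> \<open>Keeps the parallelogram with parameter \<open>h\<close> inside the ball of
    radius \<open>m\<close>; the summand 1 covers \<open>v = w = 0\<close>.\<close>
  define h where "h = m / (norm v + norm w + 1)"
  have den: "norm v + norm w + 1 > 0" by (smt (verit) norm_ge_zero)
  have h: "h > 0" using m den by (simp add: h_def)
  have near: "dist (x + s *\<^sub>R v + t *\<^sub>R w) x < m" if "0 \<le> s" "s \<le> h" "0 \<le> t" "t \<le> h" for s t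
  proof -
    have "dist (x + s *\<^sub>R v + t *\<^sub>R w) x = norm (s *\<^sub>R v + t *\<^sub>R w)" by (simp add: dist_norm)
    also have "\<dots> \<le> s * norm v + t * norm w" using norm_triangle_ineq[of "s *\<^sub>R v" "t *\<^sub>R w"] that by simp
    also have "\<dots> \<le> h * norm v + h * norm w" using that by (intro add_mono mult_right_mono) auto
    also have "\<dots> < h * (norm v + norm w + 1)" using h by (simp add: algebra_simps)
    also have "\<dots> = m" using den by (simp add: h_def)
    finally show ?thesis .
  qed
  have inU: "x + s *\<^sub>R v + t *\<^sub>R w \<in> U" if "0 \<le> s" "s \<le> h" "0 \<le> t" "t \<le> h" for s t
  proof -
    have "dist x (x + s *\<^sub>R v + t *\<^sub>R w) < d3" using near[OF that] by (simp add: m_def dist_commute)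
    then show ?thesis using d3(2) mem_ball by blast
  qed
  have inU': "x + s *\<^sub>R w + t *\<^sub>R v \<in> U" if "0 \<le> s" "s \<le> h" "0 \<le> t" "t \<le> h" for s t
    using inU[of t s] that by (simp add: algebra_simps)
  obtain s t where st: "0 < s" "s < h" "0 < t" "t < h" 
    "f (x + h *\<^sub>R v + h *\<^sub>R w) - f (x + h *\<^sub>R v) - f (x + h *\<^sub>R w) + f x = h * h * dd w (dd v f) (x + s *\<^sub>R v + t *\<^sub>R w)"
    using second_difference[OF assms(1,2) h inU] by blast
  obtain s' t' where st': "0 < s'" "s' < h" "0 < t'" "t' < h" 
    "f (x + h *\<^sub>R w + h *\<^sub>R v) - f (x + h *\<^sub>R w) - f (x + h *\<^sub>R v) + f x = h * h * dd v (dd w f) (x + s' *\<^sub>R w + t' *\<^sub>R v)"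
    using second_difference[OF assms(1,2) h inU'] by blast
  have eq: "x + h *\<^sub>R v + h *\<^sub>R w = x + h *\<^sub>R w + h *\<^sub>R v" by (simp add: algebra_simps)
  have "h * h * dd w (dd v f) (x + s *\<^sub>R v + t *\<^sub>R w) = h * h * dd v (dd w f) (x + s' *\<^sub>R w + t' *\<^sub>R v)"
    using st(5) st'(5) unfolding eq by linarith
  then have "dd w (dd v f) (x + s *\<^sub>R v + t *\<^sub>R w) = dd v (dd w f) (x + s' *\<^sub>R w + t' *\<^sub>R v)"
    using h by simp
  moreover have "dist (x + s *\<^sub>R v + t *\<^sub>R w) x < d2" using near[of s t] st by (simp add: m_def)
  moreover have "dist (x + s' *\<^sub>R w + t' *\<^sub>R v) x < d1"
    using near[of t' s'] st' by (simp add: m_def algebra_simps)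
  ultimately show False
    using d(2)[of "x + s' *\<^sub>R w + t' *\<^sub>R v"] d(4)[of "x + s *\<^sub>R v + t *\<^sub>R w"]
    unfolding e_def dist_real_def by argo
qed

text \<open>The field \<open>A x\<close> itself varies with \<open>x\<close>; differentiating its
  coefficients contributes the first order term \<open>dd (A v) f\<close>.\<close>

lemma dd_ld:
  assumes "open U" "smooth_on f U" "x \<in> U" "linear A"
  shows "dd v (ld A f) x = dd v (dd (A x) f) x + dd (A v) f x"
proof -
  have d: "f differentiable (at y)" if "y \<in> U" for y using smooth_diffble[OF assms(1,2) that] .
  have "dd v (ld A f) x = dd v (\<lambda>y. \<Sum>i\<in>UNIV. A y $ i * pd i f y) x"
    using d by (intro dd_cong_open[OF assms(1,3)]) (simp add: ld_def dd_sum_pd)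
  also have "\<dots> = (\<Sum>i\<in>UNIV. dd v (\<lambda>y. A y $ i * pd i f y) x)"
    by (intro dd_sum_fun smooth_diffble[OF assms(1) _ assms(3)] smooth_intros assms linear_nth_smooth)
  also have "\<dots> = (\<Sum>i\<in>UNIV. A x $ i * dd v (pd i f) x + A v $ i * pd i f x)"
  proof (rule sum.cong)
    fix i
    have "dd v (\<lambda>y. A y $ i) x = A v $ i"
      by (rule dd_unique) (intro bounded_linear_imp_has_derivative bounded_linear_compose[OF bounded_linear_vec_nth] linear_conv_bounded_linear[THEN iffD1] assms)
    then show "dd v (\<lambda>y. A y $ i * pd i f y) x = A x $ i * dd v (pd i f) x + A v $ i * pd i f x"
      by (subst dd_simps) (auto intro!: smooth_diffble[OF assms(1) _ assms(3)] smooth_intros assms linear_nth_smooth)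
  qed simp
  also have "\<dots> = dd v (dd (A x) f) x + dd (A v) f x"
  proof -
    have "dd v (dd (A x) f) x = dd v (\<lambda>y. \<Sum>i\<in>UNIV. A x $ i * pd i f y) x"
      using d by (intro dd_cong_open[OF assms(1,3)]) (simp add: dd_sum_pd)
    also have "\<dots> = (\<Sum>i\<in>UNIV. dd v (\<lambda>y. A x $ i * pd i f y) x)"
      by (intro dd_sum_fun smooth_diffble[OF assms(1) _ assms(3)] smooth_intros assms)
    also have "\<dots> = (\<Sum>i\<in>UNIV. A x $ i * dd v (pd i f) x)"
      by (intro sum.cong refl, subst dd_simps) (auto intro!: smooth_diffble[OF assms(1) _ assms(3)] smooth_intros assms)
    finally show ?thesis by (simp add: sum.distrib dd_sum_pd[OF d[OF assms(3)], of "A v"])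
  qed
  finally show ?thesis .
qed

text \<open>The second derivatives cancel by symmetry, and the variation of the two fields leaves
  the commutator of the linear maps.\<close>

lemma ld_commutator:
  assumes "open U" "smooth_on f U" "x \<in> U" "linear A" "linear B"
  shows "ld A (ld B f) x - ld B (ld A f) x = dd (B (A x) - A (B x)) f x"
proof -
  have d: "f differentiable (at x)" using smooth_diffble[OF assms(1-3)] .
  show ?thesis
    unfolding ld_def[of A "ld B f"] ld_def[of B "ld A f"]
    by (simp add: dd_ld[OF assms(1-3)] assms dd_commute[OF assms(1-3), of "A x" "B x"] dd_lin[OF d])
qed

section \<open>Curvature of the metric in Cartesian coordinates\<close>

definition kd :: "'n \<Rightarrow> 'n \<Rightarrow> real" where "kd i j = (if i = j then 1 else 0)"

lemma kd_sums [simp]: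
  fixes f :: "'n::finite \<Rightarrow> real"
  shows "(\<Sum>l\<in>UNIV. kd i l * f l) = f i" "(\<Sum>l\<in>UNIV. kd l i * f l) = f i"
    "(\<Sum>l\<in>UNIV. f l * kd i l) = f i" "(\<Sum>l\<in>UNIV. f l * kd l i) = f i"
    "(\<Sum>l\<in>UNIV. kd i l) = 1" "(\<Sum>l\<in>UNIV. kd l i) = 1"
proof -
  have "kd i l * f l = (if i = l then f l else 0)" "kd l i * f l = (if i = l then f l else 0)"
    "f l * kd i l = (if i = l then f l else 0)" "f l * kd l i = (if i = l then f l else 0)"
    "kd i l = (if i = l then 1 else 0)" "kd l i = (if i = l then 1 else 0)" for l
    by (auto simp: kd_def)
  then show "(\<Sum>l\<in>UNIV. kd i l * f l) = f i" "(\<Sum>l\<in>UNIV. kd l i * f l) = f i"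
    "(\<Sum>l\<in>UNIV. f l * kd i l) = f i" "(\<Sum>l\<in>UNIV. f l * kd l i) = f i"
    "(\<Sum>l\<in>UNIV. kd i l) = 1" "(\<Sum>l\<in>UNIV. kd l i) = 1"
    by simp_all
qed

lemma kd_axis: "axis i 1 $ j = kd i j"
  by (simp add: kd_def axis_def)

lemma kd_refl [simp]: "kd i i = 1" by (simp add: kd_def)

lemma kd_sym: "kd i j = kd j i" by (simp add: kd_def)

lemma inner_sum: "x \<bullet> y = (\<Sum>i\<in>UNIV. x $ i * y $ i)" for x y :: "real^'n"
  by (simp add: inner_vec_def)

definition grd :: "(real^'n::finite \<Rightarrow> real) \<Rightarrow> real^'n \<Rightarrow> real^'n" where
  "grd f x = (\<chi> i. pd i f x)"

lemma grd_inner: "f differentiable (at x) \<Longrightarrow> v \<bullet> grd f x = dd v f x"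
  by (simp add: inner_sum grd_def dd_sum_pd)

definition lapl :: "(real^'n::finite \<Rightarrow> real) \<Rightarrow> real^'n \<Rightarrow> real" where
  "lapl f x = (\<Sum>i\<in>UNIV. pd i (pd i f) x)"

text \<open>The polar decomposition r^2 \<Delta> = E^2 + (n - 2) E + \<Delta>_S of the flat
  Laplacian, solved for the Laplacian of the unit sphere. In this form it acts on functions on the
  exterior region.\<close>

definition lapS :: "(real^'n::finite \<Rightarrow> real) \<Rightarrow> real^'n \<Rightarrow> real" where
  "lapS f x = (x \<bullet> x) * lapl f x - ld id (ld id f) x - (real CARD('n) - 2) * ld id f x"

lemma dd2_sum_pd:
  assumes "open U" "smooth_on f U" "x \<in> U"
  shows "(\<Sum>i\<in>UNIV. \<Sum>j\<in>UNIV. X $ i * Y $ j * pd i (pd j f) x) = dd X (dd Y f) x"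
proof -
  have "dd X (dd Y f) x = dd X (\<lambda>y. \<Sum>j\<in>UNIV. Y $ j * pd j f y) x"
    by (intro dd_cong_open[OF assms(1,3)] dd_sum_pd smooth_diffble[OF assms(1,2)])
  also have "\<dots> = (\<Sum>j\<in>UNIV. dd X (\<lambda>y. Y $ j * pd j f y) x)"
    by (intro dd_sum_fun smooth_diffble[OF assms(1) _ assms(3)] smooth_mult smooth_const smooth_pd assms)
  also have "\<dots> = (\<Sum>j\<in>UNIV. Y $ j * dd X (pd j f) x)"
    by (intro sum.cong refl, subst dd_simps)
      (auto intro!: smooth_diffble[OF assms(1) _ assms(3)] smooth_const smooth_pd assms(2))
  also have "\<dots> = (\<Sum>j\<in>UNIV. \<Sum>i\<in>UNIV. X $ i * Y $ j * pd i (pd j f) x)"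
    by (intro sum.cong refl, subst dd_sum_pd)
      (auto intro!: smooth_diffble[OF assms(1) _ assms(3)] smooth_pd assms(2) simp: sum_distrib_left mult_ac)
  finally show ?thesis by (subst sum.swap) simp
qed

lemma dd_inner2 [simp]: "dd v (\<lambda>y. y \<bullet> y) x = 2 * (x \<bullet> v)"
  by (rule dd_unique[where f'="\<lambda>v. 2 * (x \<bullet> v)"]) (auto intro!: derivative_eq_intros simp: inner_commute)

lemma linear_id' [simp]: "linear (id :: real^'n \<Rightarrow> real^'n)" by (simp add: linear_id)

lemma matrix_inv_eqI:
  fixes A B :: "real^'n^'n"
  assumes "A ** B = mat 1" shows "matrix_inv A = B"
proof -
  have BA: "B ** A = mat 1" using assms matrix_left_right_inverse by blast
  have "\<exists>A'. A ** A' = mat 1 \<and> A' ** A = mat 1" using assms BA by blast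
  then have "A ** matrix_inv A = mat 1 \<and> matrix_inv A ** A = mat 1"
    unfolding matrix_inv_def by (rule someI_ex)
  then show ?thesis using BA assms by (metis matrix_mul_assoc matrix_mul_lid matrix_mul_rid)
qed

section \<open>Christoffel symbols and Ricci tensor\<close>

locale qsm =
  fixes U :: "(real^'n::finite) set" and u :: "real^'n \<Rightarrow> real"
  assumes openU: "open U" and zero: "0 \<notin> U" and su: "smooth_on u U" and u0: "\<And>x. x \<in> U \<Longrightarrow> u x > 0"
begin

text \<open>The metric is the rank one perturbation \<open>kd i j + psi x * x $ i * x $ j\<close> of
  the flat one, its inverse is \<open>kd i j - chi x * x $ i * x $ j\<close>, and \<open>om\<close>
  is the squared length of dr. \<open>Ss i j\<close> is the factor of \<open>x $ k\<close> in the
  Christoffel symbols, and \<open>SS\<close> is the same object as a bilinear form.\<close>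

definition psi where "psi x = ((u x)\<^sup>2 - 1) / (x \<bullet> x)"
definition om where "om x = 1 / (u x)\<^sup>2"
definition chi where "chi x = (1 - om x) / (x \<bullet> x)"
definition Ss where "Ss i j x = om x * (pd i psi x * x $ j + pd j psi x * x $ i) / 2 + chi x * kd i j
    + chi x * ld id psi x * x $ i * x $ j / 2"
definition SS where "SS X Y x = om x * (dd X psi x * (x \<bullet> Y) + dd Y psi x * (x \<bullet> X)) / 2 + chi x * (X \<bullet> Y)
    + chi x * ld id psi x * (x \<bullet> X) * (x \<bullet> Y) / 2"

lemma R0: "x \<in> U \<Longrightarrow> x \<bullet> x \<noteq> 0" using zero by auto
lemma u_nonzero: "x \<in> U \<Longrightarrow> u x \<noteq> 0" using u0 by fastforce

lemma smooth_coefficients [smooth_intros]: "smooth_on psi U" "smooth_on om U" "smooth_on chi U"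
proof -
  show p: "smooth_on psi U" unfolding psi_def
    by (intro smooth_divide smooth_diff smooth_power smooth_const smooth_norm2 openU su R0)
  show "smooth_on om U" unfolding om_def
    by (intro smooth_divide smooth_power smooth_const openU su) (use u_nonzero in auto)
  then show "smooth_on chi U" unfolding chi_def
    by (intro smooth_divide smooth_diff smooth_const smooth_norm2 openU R0)
qed

lemma smS [smooth_intros]: "smooth_on (Ss i j) U" "smooth_on (SS X Y) U"
  unfolding Ss_def SS_def divide_inverse
  by (intro smooth_add smooth_mult smooth_const smooth_pd smooth_coefficients smooth_nth openU smooth_ld linear_id' smooth_dd smooth_inner)+

lemmas diffble_U = smooth_diffble[OF openU]

text \<open>These polynomial relations, rather than the quotients that define the coefficients, are
  what is differentiated below.\<close>

lemma rel: assumes "x \<in> U"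
  shows "(x \<bullet> x) * psi x = (u x)\<^sup>2 - 1" "om x * (u x)\<^sup>2 = 1" "om x + chi x * (x \<bullet> x) = 1" "chi x = psi x * om x"
  using R0[OF assms] u_nonzero[OF assms] by (auto simp: psi_def om_def chi_def field_simps)

lemma psi_dd: assumes "x \<in> U"
  shows "2 * u x * dd v u x = 2 * (x \<bullet> v) * psi x + (x \<bullet> x) * dd v psi x"
proof -
  have "dd v (\<lambda>y. u y * u y) x = dd v (\<lambda>y. (y \<bullet> y) * psi y + 1) x"
    by (rule dd_cong_open[OF openU assms]) (simp add: rel(1) power2_eq_square)
  then show ?thesis
    by (simp add: dd_simps diffble_U[OF su assms] diffble_U[OF smooth_coefficients(1) assms] diffble_U[OF smooth_norm2 assms] openU
        diffble_U[OF smooth_mult[OF openU smooth_norm2[OF openU] smooth_coefficients(1)] assms] algebra_simps)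
qed

lemma psi_dd2: assumes "x \<in> U"
  shows "2 * dd v u x * dd w u x + 2 * u x * dd v (dd w u) x
    = 2 * (v \<bullet> w) * psi x + 2 * (x \<bullet> w) * dd v psi x + 2 * (x \<bullet> v) * dd w psi x + (x \<bullet> x) * dd v (dd w psi) x"
proof -
  have "dd v (\<lambda>y. 2 * (u y * dd w u y)) x = dd v (\<lambda>y. 2 * ((y \<bullet> w) * psi y) + (y \<bullet> y) * dd w psi y) x"
    by (rule dd_cong_open[OF openU assms]) (use psi_dd[of _ w] in \<open>simp add: algebra_simps\<close>)
  moreover have "dd v (\<lambda>y. 2 * (u y * dd w u y)) x = 2 * dd v u x * dd w u x + 2 * u x * dd v (dd w u) x"
    by (subst dd_simps dd_const | (intro diffble_U[OF _ assms] smooth_mult smooth_const su smooth_dd openU))+ (simp add: algebra_simps)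
  moreover have "dd v (\<lambda>y. 2 * ((y \<bullet> w) * psi y) + (y \<bullet> y) * dd w psi y) x
     = 2 * (v \<bullet> w) * psi x + 2 * (x \<bullet> w) * dd v psi x + 2 * (x \<bullet> v) * dd w psi x + (x \<bullet> x) * dd v (dd w psi) x"
    by (subst dd_simps dd_const dd_inner dd_inner2 | (intro diffble_U[OF _ assms] smooth_mult smooth_const smooth_coefficients smooth_dd openU smooth_inner smooth_norm2))+
      (simp add: algebra_simps)
  ultimately show ?thesis by simp
qed

lemma metric_eq: "x \<in> U \<Longrightarrow> warped_metric u x $ i $ j = kd i j + psi x * (x $ i * x $ j)"
  by (simp add: warped_metric_def kd_def psi_def power2_norm_eq_inner)

lemma pd_metric: assumes "x \<in> U"
  shows "pd k (\<lambda>y. warped_metric u y $ i $ j) x = pd k psi x * (x $ i * x $ j) + psi x * (kd k i * x $ j + x $ i * kd k j)"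
proof -
  have "pd k (\<lambda>y. warped_metric u y $ i $ j) x = pd k (\<lambda>y. kd i j + psi y * (y $ i * y $ j)) x"
    by (rule pd_cong_open[OF openU assms]) (rule metric_eq)
  also have "\<dots> = pd k psi x * (x $ i * x $ j) + psi x * (kd k i * x $ j + x $ i * kd k j)"
    unfolding pd_eq_dd
    by (subst dd_simps dd_const dd_nth | (intro diffble_U[OF _ assms] smooth_mult smooth_const smooth_coefficients smooth_nth openU))+
      (simp add: kd_axis algebra_simps)
  finally show ?thesis .
qed

text \<open>Inverse of a rank one perturbation of the identity (Sherman-Morrison).\<close>

lemma ginv_eq: assumes "x \<in> U"
  shows "ginv (warped_metric u) x $ k $ l = kd k l - chi x * (x $ k * x $ l)"
proof -
  define B where "B = (\<chi> k l. kd k l - chi x * (x $ k * x $ l))"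
  have "warped_metric u x ** B = mat 1"
  proof -
    have "(\<Sum>l\<in>UNIV. (kd i l + psi x * (x $ i * x $ l)) * (kd l j - chi x * (x $ l * x $ j))) = kd i j" for i j
    proof -
      have "(\<Sum>l\<in>UNIV. (kd i l + psi x * (x $ i * x $ l)) * (kd l j - chi x * (x $ l * x $ j)))
         = (\<Sum>l\<in>UNIV. kd i l * kd l j) - (\<Sum>l\<in>UNIV. kd i l * (chi x * (x $ l * x $ j)))
           + (\<Sum>l\<in>UNIV. (psi x * (x $ i * x $ l)) * kd l j) - psi x * chi x * (x $ i * x $ j) * (\<Sum>l\<in>UNIV. x $ l * x $ l)"
        by (simp only: sum_distrib_left flip: sum.distrib sum_subtractf) (rule sum.cong, simp_all add: algebra_simps)
      also have "\<dots> = kd i j + (x $ i * x $ j) * (psi x - chi x - psi x * chi x * (x \<bullet> x))"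
        by (simp only: kd_sums inner_sum) (simp add: algebra_simps)
      also have "psi x - chi x - psi x * chi x * (x \<bullet> x) = 0"
      proof -
        have "psi x - chi x - psi x * chi x * (x \<bullet> x) = psi x * (1 - (om x + chi x * (x \<bullet> x)))"
          using rel(4)[OF assms] by (simp add: algebra_simps)
        then show ?thesis using rel(3)[OF assms] by simp
      qed
      finally show ?thesis by simp
    qed
    then show ?thesis
      by (simp add: vec_eq_iff matrix_matrix_mult_def metric_eq[OF assms] B_def mat_def kd_def)
  qed
  then have "matrix_inv (warped_metric u x) = B" by (rule matrix_inv_eqI)
  then show ?thesis by (simp add: ginv_def B_def)
qed

lemma sum_x_pd: "f differentiable (at x) \<Longrightarrow> (\<Sum>l\<in>UNIV. x $ l * pd l f x) = ld id f x"
  by (simp add: ld_def dd_sum_pd)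

text \<open>\<open>T l\<close> is the symbol with lowered index. Raising the index with the rank one
  correction of the flat inverse only adds multiples of \<open>x $ k\<close>, so the gradient of
  \<open>psi\<close> is the only part in other directions.\<close>

lemma christoffel_eq: assumes "x \<in> U"
  shows "christoffel (warped_metric u) k i j x = x $ k * Ss i j x - pd k psi x * (x $ i * x $ j) / 2"
proof -
  define T where "T l = (pd i psi x * (x $ j * x $ l) + pd j psi x * (x $ i * x $ l) - pd l psi x * (x $ i * x $ j)) / 2
      + psi x * kd i j * x $ l" for l
  have 1: "(1/2) * (pd i (\<lambda>y. warped_metric u y $ j $ l) x + pd j (\<lambda>y. warped_metric u y $ i $ l) x
       - pd l (\<lambda>y. warped_metric u y $ i $ j) x) = T l" for l
    by (simp add: pd_metric[OF assms] T_def kd_sym[of j i] kd_sym[of l i] kd_sym[of l j] field_simps)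
  have "christoffel (warped_metric u) k i j x = (\<Sum>l\<in>UNIV. (kd k l - chi x * (x $ k * x $ l)) * T l)"
    unfolding christoffel_def sum_distrib_left ginv_eq[OF assms]
    by (rule sum.cong, simp, subst 1[symmetric], simp only: mult_ac)
  also have "\<dots> = (\<Sum>l\<in>UNIV. kd k l * T l) - chi x * x $ k * (\<Sum>l\<in>UNIV. x $ l * T l)"
    by (simp only: left_diff_distrib sum_subtractf sum_distrib_left mult.assoc)
  also have "(\<Sum>l\<in>UNIV. x $ l * T l) = (pd i psi x * x $ j + pd j psi x * x $ i) / 2 * (\<Sum>l\<in>UNIV. x $ l * x $ l)
      - x $ i * x $ j / 2 * (\<Sum>l\<in>UNIV. x $ l * pd l psi x) + psi x * kd i j * (\<Sum>l\<in>UNIV. x $ l * x $ l)"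
    by (simp only: sum_distrib_left flip: sum.distrib sum_subtractf) (rule sum.cong, simp_all add: T_def field_simps)
  also have "\<dots> = (pd i psi x * x $ j + pd j psi x * x $ i) / 2 * (x \<bullet> x)
      - x $ i * x $ j / 2 * ld id psi x + psi x * kd i j * (x \<bullet> x)"
    by (simp add: sum_x_pd diffble_U[OF smooth_coefficients(1) assms] inner_sum)
  finally have e: "christoffel (warped_metric u) k i j x = T k - chi x * x $ k * ((pd i psi x * x $ j + pd j psi x * x $ i) / 2 * (x \<bullet> x)
      - x $ i * x $ j / 2 * ld id psi x + psi x * kd i j * (x \<bullet> x))" by simp
  have o: "om x = 1 - chi x * (x \<bullet> x)" using rel(3)[OF assms] by simp
  have c: "chi x = psi x * (1 - chi x * (x \<bullet> x))" using rel(4)[OF assms] o by simp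
  have c': "chi x * kd i j = psi x * (1 - chi x * (x \<bullet> x)) * kd i j" using c by simp
  have SsE: "Ss i j x = (1 - chi x * (x \<bullet> x)) * (pd i psi x * x $ j + pd j psi x * x $ i) / 2 + psi x * (1 - chi x * (x \<bullet> x)) * kd i j
    + chi x * ld id psi x * x $ i * x $ j / 2"
    unfolding Ss_def o c' ..
  show ?thesis unfolding e T_def SsE by (simp add: field_simps)
qed

text \<open>The determinant of the metric is u^2, so both traces are the logarithmic derivative of
  its square root.\<close>

lemma trace_christoffel: assumes "x \<in> U"
  shows "(\<Sum>k\<in>UNIV. christoffel (warped_metric u) k i k x) = pd i u x / u x"
    "(\<Sum>k\<in>UNIV. christoffel (warped_metric u) k k i x) = pd i u x / u x"
proof -
  have S1: "(\<Sum>k\<in>UNIV. x $ k * Ss i k x) = om x * (pd i psi x * (x \<bullet> x) + ld id psi x * x $ i) / 2 + chi x * x $ i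
      + chi x * ld id psi x * (x \<bullet> x) * x $ i / 2"
  proof -
    have "(\<Sum>k\<in>UNIV. x $ k * Ss i k x) = om x * pd i psi x / 2 * (\<Sum>k\<in>UNIV. x $ k * x $ k)
       + om x * x $ i / 2 * (\<Sum>k\<in>UNIV. x $ k * pd k psi x) + chi x * (\<Sum>k\<in>UNIV. x $ k * kd i k)
       + chi x * ld id psi x * x $ i / 2 * (\<Sum>k\<in>UNIV. x $ k * x $ k)"
      by (simp only: sum_distrib_left flip: sum.distrib) (rule sum.cong, simp_all add: Ss_def field_simps)
    then show ?thesis by (simp add: sum_x_pd diffble_U[OF smooth_coefficients(1) assms] inner_sum algebra_simps)
  qed
  have "(\<Sum>k\<in>UNIV. christoffel (warped_metric u) k i k x) = (\<Sum>k\<in>UNIV. x $ k * Ss i k x) - x $ i / 2 * (\<Sum>k\<in>UNIV. x $ k * pd k psi x)"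
    by (simp only: sum_distrib_left christoffel_eq[OF assms] flip: sum_subtractf) (rule sum.cong, simp_all add: field_simps)
  also have "\<dots> = chi x * x $ i + om x * pd i psi x * (x \<bullet> x) / 2 + x $ i * ld id psi x / 2 * (om x + chi x * (x \<bullet> x) - 1)"
    by (simp add: S1 sum_x_pd diffble_U[OF smooth_coefficients(1) assms] field_simps)
  also have "\<dots> = om x * (2 * (x $ i) * psi x + (x \<bullet> x) * pd i psi x) / 2"
    by (simp add: rel(3)[OF assms]) (simp add: rel(4)[OF assms] field_simps)
  also have "\<dots> = om x * (u x * pd i u x)"
    using psi_dd[OF assms, of "axis i 1"] by (simp add: pd_eq_dd inner_axis)
  also have "\<dots> = pd i u x / u x" using u_nonzero[OF assms] by (simp add: om_def field_simps power2_eq_square)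
  finally show r: "(\<Sum>k\<in>UNIV. christoffel (warped_metric u) k i k x) = pd i u x / u x" .
  have "christoffel (warped_metric u) k k i x = christoffel (warped_metric u) k i k x" for k
    by (simp add: christoffel_eq[OF assms] Ss_def kd_sym[of k i] algebra_simps)
  then show "(\<Sum>k\<in>UNIV. christoffel (warped_metric u) k k i x) = pd i u x / u x" using r by simp
qed

lemma SS_sum: assumes "x \<in> U"
  shows "(\<Sum>i\<in>UNIV. \<Sum>j\<in>UNIV. X $ i * Y $ j * Ss i j x) = SS X Y x"
    "(\<Sum>j\<in>UNIV. Y $ j * Ss i j x) = SS (axis i 1) Y x"
proof -
  show *: "(\<Sum>j\<in>UNIV. Y $ j * Ss i j x) = SS (axis i 1) Y x" for i
  proof -
    have "(\<Sum>j\<in>UNIV. Y $ j * Ss i j x) = om x * pd i psi x / 2 * (\<Sum>k\<in>UNIV. x $ k * Y $ k)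
       + om x * x $ i / 2 * (\<Sum>k\<in>UNIV. Y $ k * pd k psi x) + chi x * (\<Sum>k\<in>UNIV. Y $ k * kd i k)
       + chi x * ld id psi x * x $ i / 2 * (\<Sum>k\<in>UNIV. x $ k * Y $ k)"
      by (simp only: sum_distrib_left flip: sum.distrib) (rule sum.cong, simp_all add: Ss_def field_simps)
    then show ?thesis
      unfolding SS_def dd_sum_pd[OF diffble_U[OF smooth_coefficients(1) assms], of Y] by (simp add: inner_sum inner_axis kd_axis pd_eq_dd algebra_simps)
  qed
  have "(\<Sum>i\<in>UNIV. \<Sum>j\<in>UNIV. X $ i * Y $ j * Ss i j x) = (\<Sum>i\<in>UNIV. X $ i * SS (axis i 1) Y x)"
    by (simp add: *[symmetric] sum_distrib_left mult_ac)
  also have "\<dots> = om x * (x \<bullet> Y) / 2 * (\<Sum>i\<in>UNIV. X $ i * pd i psi x) + om x * dd Y psi x / 2 * (\<Sum>i\<in>UNIV. x $ i * X $ i)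
      + chi x * (\<Sum>i\<in>UNIV. X $ i * Y $ i) + chi x * ld id psi x * (x \<bullet> Y) / 2 * (\<Sum>i\<in>UNIV. x $ i * X $ i)"
    by (simp only: sum_distrib_left flip: sum.distrib) (rule sum.cong, simp_all add: SS_def inner_axis inner_axis' pd_eq_dd field_simps)
  also have "\<dots> = SS X Y x"
    unfolding SS_def dd_sum_pd[OF diffble_U[OF smooth_coefficients(1) assms], of X] by (simp add: inner_sum field_simps)
  finally show "(\<Sum>i\<in>UNIV. \<Sum>j\<in>UNIV. X $ i * Y $ j * Ss i j x) = SS X Y x" .
qed

lemma pd_christoffel: assumes "x \<in> U"
  shows "pd l (christoffel (warped_metric u) k i j) x = kd l k * Ss i j x + x $ k * pd l (Ss i j) x
     - (pd l (pd k psi) x * (x $ i * x $ j) + pd k psi x * (kd l i * x $ j + x $ i * kd l j)) / 2"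
proof -
  have "pd l (christoffel (warped_metric u) k i j) x = pd l (\<lambda>y. y $ k * Ss i j y - (1/2) * (pd k psi y * (y $ i * y $ j))) x"
    by (rule pd_cong_open[OF openU assms]) (simp add: christoffel_eq)
  also have "\<dots> = kd l k * Ss i j x + x $ k * pd l (Ss i j) x
     - (pd l (pd k psi) x * (x $ i * x $ j) + pd k psi x * (kd l i * x $ j + x $ i * kd l j)) / 2"
    unfolding pd_eq_dd[of l]
    by (subst dd_simps dd_const dd_nth | (intro diffble_U[OF _ assms] smooth_mult smooth_const smooth_coefficients smS smooth_nth openU smooth_pd))+
      (simp add: kd_axis field_simps)
  finally show ?thesis .
qed

lemma smooth_christoffel: "smooth_on (christoffel (warped_metric u) k i j) U"
  by (subst smooth_on_cong[OF openU, where g="\<lambda>y. y $ k * Ss i j y - (1/2) * (pd k psi y * (y $ i * y $ j))"])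
    (simp add: christoffel_eq, intro smooth_diff smooth_mult smooth_const smooth_coefficients smS smooth_nth openU smooth_pd)

text \<open>The blocks \<open>a\<close>, \<open>b\<close>, \<open>c\<close>, \<open>d\<close> are
  the four terms of the definition. The traces in \<open>b\<close> and \<open>c\<close> are du/u; in
  \<open>d\<close> each double sum splits into products of single sums because the Christoffel
  symbols are sums of products.\<close>

lemma ricci_eq: assumes "x \<in> U"
  shows "ricci (warped_metric u) i j x =
     real CARD('n) * Ss i j x + ld id (Ss i j) x - lapl psi x * (x $ i * x $ j) / 2
     - (pd i psi x * x $ j + pd j psi x * x $ i) / 2 - pd j (\<lambda>y. pd i u y / u y) x
     + (ld id u x / u x) * Ss i j x - dd (grd u x) psi x / u x * (x $ i * x $ j) / 2
     - SS (axis i 1) x x * SS (axis j 1) x x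
     + (x \<bullet> x) * (x $ i * SS (axis j 1) (grd psi x) x + x $ j * SS (axis i 1) (grd psi x) x) / 2
     - (ld id psi x)\<^sup>2 * (x $ i * x $ j) / 4"
proof -
  let ?G = "warped_metric u"
  have dpsi: "psi differentiable (at x)" using diffble_U[OF smooth_coefficients(1) assms] .
  have Ssym: "Ss a b x = Ss b a x" for a b by (simp add: Ss_def kd_sym[of b a] algebra_simps)
  have a: "(\<Sum>k\<in>UNIV. pd k (christoffel ?G k i j) x) = real CARD('n) * Ss i j x + ld id (Ss i j) x
      - lapl psi x * (x $ i * x $ j) / 2 - (pd i psi x * x $ j + pd j psi x * x $ i) / 2"
  proof -
    have "(\<Sum>k\<in>UNIV. pd k (christoffel ?G k i j) x) = (\<Sum>k\<in>(UNIV::'n set). Ss i j x) + (\<Sum>k\<in>UNIV. x $ k * pd k (Ss i j) x)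
       - x $ i * x $ j / 2 * (\<Sum>k\<in>UNIV. pd k (pd k psi) x)
       - x $ j / 2 * (\<Sum>k\<in>UNIV. pd k psi x * kd k i) - x $ i / 2 * (\<Sum>k\<in>UNIV. pd k psi x * kd k j)"
      by (simp only: pd_christoffel[OF assms] sum_distrib_left flip: sum.distrib sum_subtractf)
        (rule sum.cong, simp_all add: field_simps)
    then show ?thesis
      by (simp only: kd_sums sum_x_pd[OF diffble_U[OF smS(1) assms]] lapl_def) (simp add: field_simps)
  qed
  have b: "(\<Sum>k\<in>UNIV. pd j (christoffel ?G k i k) x) = pd j (\<lambda>y. pd i u y / u y) x"
  proof -
    have "pd j (\<lambda>y. pd i u y / u y) x = pd j (\<lambda>y. \<Sum>k\<in>UNIV. christoffel ?G k i k y) x"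
      by (rule pd_cong_open[OF openU assms]) (simp add: trace_christoffel)
    also have "\<dots> = (\<Sum>k\<in>UNIV. pd j (christoffel ?G k i k) x)"
      unfolding pd_eq_dd by (rule dd_sum_fun) (rule diffble_U[OF smooth_christoffel assms])
    finally show ?thesis by simp
  qed
  have c: "(\<Sum>k\<in>UNIV. \<Sum>l\<in>UNIV. christoffel ?G k k l x * christoffel ?G l i j x)
     = (ld id u x / u x) * Ss i j x - dd (grd u x) psi x / u x * (x $ i * x $ j) / 2"
  proof -
    have "(\<Sum>k\<in>UNIV. \<Sum>l\<in>UNIV. christoffel ?G k k l x * christoffel ?G l i j x)
       = (\<Sum>l\<in>UNIV. (\<Sum>k\<in>UNIV. christoffel ?G k k l x) * christoffel ?G l i j x)"
      by (subst sum.swap) (simp add: sum_distrib_right)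
    also have "\<dots> = Ss i j x / u x * (\<Sum>l\<in>UNIV. x $ l * pd l u x) - x $ i * x $ j / (2 * u x) * (\<Sum>l\<in>UNIV. pd l u x * pd l psi x)"
      unfolding trace_christoffel[OF assms]
      using u_nonzero[OF assms] by (simp only: christoffel_eq[OF assms] sum_distrib_left flip: sum_subtractf)
        (rule sum.cong, simp_all add: field_simps)
    also have "(\<Sum>l\<in>UNIV. pd l u x * pd l psi x) = dd (grd u x) psi x"
      by (simp add: dd_sum_pd[OF dpsi] grd_def)
    finally show ?thesis by (simp add: sum_x_pd diffble_U[OF su assms] field_simps)
  qed
  have d: "(\<Sum>k\<in>UNIV. \<Sum>l\<in>UNIV. christoffel ?G k j l x * christoffel ?G l i k x)
     = SS (axis i 1) x x * SS (axis j 1) x x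
     - (x \<bullet> x) * (x $ i * SS (axis j 1) (grd psi x) x + x $ j * SS (axis i 1) (grd psi x) x) / 2
     + (ld id psi x)\<^sup>2 * (x $ i * x $ j) / 4"
  proof -
    have "(\<Sum>k\<in>UNIV. \<Sum>l\<in>UNIV. christoffel ?G k j l x * christoffel ?G l i k x)
     = (\<Sum>k\<in>UNIV. \<Sum>l\<in>UNIV. (x $ k * Ss i k x) * (x $ l * Ss j l x) - (x $ i / 2) * ((x $ k * x $ k) * (grd psi x $ l * Ss j l x))
         - (x $ j / 2) * ((grd psi x $ k * Ss i k x) * (x $ l * x $ l)) + (x $ i * x $ j / 4) * ((x $ k * pd k psi x) * (x $ l * pd l psi x)))"
      by (intro sum.cong refl) (simp add: christoffel_eq[OF assms] grd_def field_simps)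
    also have "\<dots> = (\<Sum>k\<in>UNIV. x $ k * Ss i k x) * (\<Sum>l\<in>UNIV. x $ l * Ss j l x)
         - x $ i / 2 * ((\<Sum>k\<in>UNIV. x $ k * x $ k) * (\<Sum>l\<in>UNIV. grd psi x $ l * Ss j l x))
         - x $ j / 2 * ((\<Sum>k\<in>UNIV. grd psi x $ k * Ss i k x) * (\<Sum>l\<in>UNIV. x $ l * x $ l))
         + x $ i * x $ j / 4 * ((\<Sum>k\<in>UNIV. x $ k * pd k psi x) * (\<Sum>l\<in>UNIV. x $ l * pd l psi x))"
      by (simp only: sum.distrib sum_subtractf sum_product) (simp only: sum_distrib_left)
    also have "\<dots> = SS (axis i 1) x x * SS (axis j 1) x x - x $ i / 2 * ((x \<bullet> x) * SS (axis j 1) (grd psi x) x)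
         - x $ j / 2 * (SS (axis i 1) (grd psi x) x * (x \<bullet> x)) + x $ i * x $ j / 4 * (ld id psi x * ld id psi x)"
      by (simp only: SS_sum(2)[OF assms] sum_x_pd[OF dpsi] inner_sum)
    finally show ?thesis by (simp add: field_simps power2_eq_square)
  qed
  have "ricci ?G i j x = (\<Sum>k\<in>UNIV. pd k (christoffel ?G k i j) x) - (\<Sum>k\<in>UNIV. pd j (christoffel ?G k i k) x)
      + (\<Sum>k\<in>UNIV. \<Sum>l\<in>UNIV. christoffel ?G k k l x * christoffel ?G l i j x)
      - (\<Sum>k\<in>UNIV. \<Sum>l\<in>UNIV. christoffel ?G k j l x * christoffel ?G l i k x)"
    by (simp add: ricci_def sum.distrib sum_subtractf)
  then show ?thesis unfolding a b c d by (simp add: algebra_simps)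
qed

lemma SS_lin: assumes "x \<in> U" shows "(\<Sum>i\<in>UNIV. X $ i * SS (axis i 1) Y x) = SS X Y x"
proof -
  have "(\<Sum>i\<in>UNIV. X $ i * SS (axis i 1) Y x) = (\<Sum>i\<in>UNIV. \<Sum>j\<in>UNIV. X $ i * Y $ j * Ss i j x)"
    by (simp add: SS_sum(2)[OF assms, symmetric] sum_distrib_left mult_ac)
  then show ?thesis using SS_sum(1)[OF assms] by simp
qed

definition ric where "ric X Y x = (\<Sum>i\<in>UNIV. \<Sum>j\<in>UNIV. X $ i * Y $ j * ricci (warped_metric u) i j x)"

text \<open>\<open>X\<close> and \<open>Y\<close> are constant vectors, so derivatives pass through
  the contraction; they are specialised to radial or tangential ones only at the point
  \<open>x\<close>.\<close>

lemma ric_eq: assumes "x \<in> U"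
  shows "ric X Y x = real CARD('n) * SS X Y x + dd x (SS X Y) x - lapl psi x * ((x \<bullet> X) * (x \<bullet> Y)) / 2
     - (dd X psi x * (x \<bullet> Y) + dd Y psi x * (x \<bullet> X)) / 2 - dd Y (\<lambda>y. dd X u y / u y) x
     + (ld id u x / u x) * SS X Y x - dd (grd u x) psi x / u x * ((x \<bullet> X) * (x \<bullet> Y)) / 2
     - SS X x x * SS Y x x
     + (x \<bullet> x) * ((x \<bullet> X) * SS Y (grd psi x) x + (x \<bullet> Y) * SS X (grd psi x) x) / 2
     - (ld id psi x)\<^sup>2 * ((x \<bullet> X) * (x \<bullet> Y)) / 4"
proof -
  have e1: "(\<Sum>i\<in>UNIV. \<Sum>j\<in>UNIV. X $ i * Y $ j * ld id (Ss i j) x) = dd x (SS X Y) x"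
  proof -
    have "dd x (SS X Y) x = dd x (\<lambda>y. \<Sum>i\<in>UNIV. \<Sum>j\<in>UNIV. (X $ i * Y $ j) * Ss i j y) x"
      by (rule dd_cong_open[OF openU assms]) (simp add: SS_sum)
    also have "\<dots> = (\<Sum>i\<in>UNIV. \<Sum>j\<in>UNIV. dd x (\<lambda>y. (X $ i * Y $ j) * Ss i j y) x)"
      by (subst dd_sum_fun | (intro diffble_U[OF _ assms] smooth_sum smooth_mult smooth_const smS openU))+ simp
    also have "\<dots> = (\<Sum>i\<in>UNIV. \<Sum>j\<in>UNIV. X $ i * Y $ j * ld id (Ss i j) x)"
      by (intro sum.cong refl, subst dd_simps) (auto intro!: diffble_U[OF _ assms] smooth_const smS simp: ld_def)
    finally show ?thesis by simp
  qed
  have e2: "(\<Sum>i\<in>UNIV. \<Sum>j\<in>UNIV. X $ i * Y $ j * pd j (\<lambda>y. pd i u y / u y) x) = dd Y (\<lambda>y. dd X u y / u y) x"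
  proof -
    have s: "smooth_on (\<lambda>y. pd i u y / u y) U" for i
      by (intro smooth_divide openU smooth_pd su) (use u_nonzero in auto)
    have "dd Y (\<lambda>y. dd X u y / u y) x = dd Y (\<lambda>y. \<Sum>i\<in>UNIV. X $ i * (pd i u y / u y)) x"
      by (rule dd_cong_open[OF openU assms]) (simp add: dd_sum_pd diffble_U[OF su] sum_divide_distrib)
    also have "\<dots> = (\<Sum>i\<in>UNIV. dd Y (\<lambda>y. X $ i * (pd i u y / u y)) x)"
      by (intro dd_sum_fun diffble_U[OF _ assms] smooth_mult smooth_const s openU)
    also have "\<dots> = (\<Sum>i\<in>UNIV. X $ i * dd Y (\<lambda>y. pd i u y / u y) x)"
      by (intro sum.cong refl, subst dd_simps) (auto intro!: diffble_U[OF _ assms] smooth_const s)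
    also have "\<dots> = (\<Sum>i\<in>UNIV. \<Sum>j\<in>UNIV. X $ i * Y $ j * pd j (\<lambda>y. pd i u y / u y) x)"
      by (intro sum.cong refl, subst dd_sum_pd[OF diffble_U[OF s assms]]) (simp add: sum_distrib_left mult_ac)
    finally show ?thesis by simp
  qed
  have X: "x \<bullet> X = (\<Sum>i\<in>UNIV. X $ i * x $ i)" for X by (simp add: inner_sum mult.commute)
  have "ric X Y x = real CARD('n) * (\<Sum>i\<in>UNIV. \<Sum>j\<in>UNIV. X $ i * Y $ j * Ss i j x)
     + (\<Sum>i\<in>UNIV. \<Sum>j\<in>UNIV. X $ i * Y $ j * ld id (Ss i j) x)
     - lapl psi x / 2 * ((\<Sum>i\<in>UNIV. X $ i * x $ i) * (\<Sum>j\<in>UNIV. Y $ j * x $ j))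
     - 1 / 2 * ((\<Sum>i\<in>UNIV. X $ i * pd i psi x) * (\<Sum>j\<in>UNIV. Y $ j * x $ j))
     - 1 / 2 * ((\<Sum>i\<in>UNIV. X $ i * x $ i) * (\<Sum>j\<in>UNIV. Y $ j * pd j psi x))
     - (\<Sum>i\<in>UNIV. \<Sum>j\<in>UNIV. X $ i * Y $ j * pd j (\<lambda>y. pd i u y / u y) x)
     + (ld id u x / u x) * (\<Sum>i\<in>UNIV. \<Sum>j\<in>UNIV. X $ i * Y $ j * Ss i j x)
     - dd (grd u x) psi x / u x / 2 * ((\<Sum>i\<in>UNIV. X $ i * x $ i) * (\<Sum>j\<in>UNIV. Y $ j * x $ j))
     - (\<Sum>i\<in>UNIV. X $ i * SS (axis i 1) x x) * (\<Sum>j\<in>UNIV. Y $ j * SS (axis j 1) x x)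
     + (x \<bullet> x) / 2 * ((\<Sum>i\<in>UNIV. X $ i * x $ i) * (\<Sum>j\<in>UNIV. Y $ j * SS (axis j 1) (grd psi x) x))
     + (x \<bullet> x) / 2 * ((\<Sum>i\<in>UNIV. X $ i * SS (axis i 1) (grd psi x) x) * (\<Sum>j\<in>UNIV. Y $ j * x $ j))
     - (ld id psi x)\<^sup>2 / 4 * ((\<Sum>i\<in>UNIV. X $ i * x $ i) * (\<Sum>j\<in>UNIV. Y $ j * x $ j))"
    unfolding sum_product unfolding sum_distrib_left unfolding ric_def ricci_eq[OF assms]
    unfolding sum.distrib[symmetric] sum_subtractf[symmetric]
    using u_nonzero[OF assms] by (intro sum.cong refl) (simp add: field_simps)
  then show ?thesis
    unfolding e1 e2 SS_sum(1)[OF assms] SS_lin[OF assms] X[symmetric]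
    by (simp add: dd_sum_pd[OF diffble_U[OF smooth_coefficients(1) assms], symmetric] field_simps)
qed

lemma dinv: "x \<in> U \<Longrightarrow> (\<lambda>y. inverse (u y)) differentiable (at x)"
  by (rule diffble_U[OF smooth_inverse[OF openU u_nonzero su]])

lemma dd_om: "x \<in> U \<Longrightarrow> dd v om x = - 2 * om x * dd v u x / u x"
proof -
  assume x: "x \<in> U"
  have "dd v om x = dd v (\<lambda>y. inverse (u y) * inverse (u y)) x"
    by (rule dd_cong_open[OF openU x]) (simp add: om_def power2_eq_square field_simps)
  also have "\<dots> = - 2 * om x * dd v u x / u x"
    unfolding dd_simps[OF dinv[OF x] dinv[OF x]] dd_inverse[OF diffble_U[OF su x] u_nonzero[OF x]]
    using u_nonzero[OF x] by (simp add: om_def field_simps power2_eq_square)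
  finally show ?thesis .
qed

lemma dd_chi: "x \<in> U \<Longrightarrow> (x \<bullet> x) * dd v chi x = 2 * om x * dd v u x / u x - 2 * (x \<bullet> v) * chi x"
proof -
  assume x: "x \<in> U"
  have "dd v (\<lambda>y. (y \<bullet> y) * chi y + om y) x = dd v (\<lambda>y. 1) x"
    by (rule dd_cong_open[OF openU x]) (use rel(3) in \<open>simp add: algebra_simps\<close>)
  moreover have "dd v (\<lambda>y. (y \<bullet> y) * chi y + om y) x = (x \<bullet> x) * dd v chi x + 2 * (x \<bullet> v) * chi x + dd v om x"
    by (subst dd_simps dd_inner2 | (intro diffble_U[OF _ x] smooth_mult smooth_coefficients openU smooth_norm2))+ simp
  ultimately show ?thesis using dd_om[OF x, of v] by simp
qed

lemma dd_SS: assumes "x \<in> U"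
  shows "dd x (SS X Y) x = (dd x om x * (dd X psi x * (x \<bullet> Y) + dd Y psi x * (x \<bullet> X))
     + om x * (dd x (dd X psi) x * (x \<bullet> Y) + dd X psi x * (x \<bullet> Y) + dd x (dd Y psi) x * (x \<bullet> X) + dd Y psi x * (x \<bullet> X))) / 2
     + dd x chi x * (X \<bullet> Y)
     + (dd x chi x * ld id psi x + chi x * (dd x (dd x psi) x + ld id psi x) + 2 * chi x * ld id psi x) * (x \<bullet> X) * (x \<bullet> Y) / 2"
proof -
  have "dd x (SS X Y) x = dd x (\<lambda>y. (1/2) * (om y * (dd X psi y * (y \<bullet> Y) + dd Y psi y * (y \<bullet> X))) + chi y * (X \<bullet> Y)
    + (1/2) * (chi y * (ld id psi y * ((y \<bullet> X) * (y \<bullet> Y))))) x"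
    by (rule dd_cong_open[OF openU assms]) (simp add: SS_def)
  also have "\<dots> = (dd x om x * (dd X psi x * (x \<bullet> Y) + dd Y psi x * (x \<bullet> X))
     + om x * (dd x (dd X psi) x * (x \<bullet> Y) + dd X psi x * (x \<bullet> Y) + dd x (dd Y psi) x * (x \<bullet> X) + dd Y psi x * (x \<bullet> X))) / 2
     + dd x chi x * (X \<bullet> Y)
     + (dd x chi x * ld id psi x + chi x * dd x (ld id psi) x + 2 * chi x * ld id psi x) * (x \<bullet> X) * (x \<bullet> Y) / 2"
    by (subst dd_simps dd_const dd_inner | (intro diffble_U[OF _ assms] smooth_add smooth_mult smooth_const smooth_coefficients openU smooth_inner smooth_dd smooth_ld linear_id'))+
      (simp add: field_simps)
  also have "dd x (ld id psi) x = dd x (dd x psi) x + ld id psi x"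
    by (subst dd_ld[OF openU smooth_coefficients(1) assms]) (simp_all add: ld_def)
  finally show ?thesis .
qed

lemma SS_tx: assumes "x \<in> U" "x \<bullet> X = 0" shows "SS X x x = dd X u x / u x" "SS x X x = dd X u x / u x"
proof -
  have "2 * u x * dd X u x = (x \<bullet> x) * dd X psi x" using psi_dd[OF assms(1), of X] assms(2) by simp
  then have "om x * ((x \<bullet> x) * dd X psi x) / 2 = dd X u x / u x"
    using u_nonzero[OF assms(1)] by (simp add: om_def field_simps power2_eq_square)
  then show "SS X x x = dd X u x / u x" "SS x X x = dd X u x / u x"
    using assms(2) by (simp_all add: SS_def inner_commute algebra_simps)
qed

lemma dd_quot: assumes "x \<in> U" shows "dd Y (\<lambda>y. dd X u y / u y) x = dd Y (dd X u) x / u x - dd X u x * dd Y u x / (u x)\<^sup>2"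
proof -
  have "dd Y (\<lambda>y. dd X u y / u y) x = dd Y (\<lambda>y. dd X u y * inverse (u y)) x" by (simp add: divide_inverse)
  also have "\<dots> = dd Y (dd X u) x / u x - dd X u x * dd Y u x / (u x)\<^sup>2"
    unfolding dd_simps[OF diffble_U[OF smooth_dd[OF openU su] assms] dinv[OF assms]] dd_inverse[OF diffble_U[OF su assms] u_nonzero[OF assms]]
    using u_nonzero[OF assms] by (simp add: field_simps power2_eq_square)
  finally show ?thesis .
qed

text \<open>Terms with \<open>x \<bullet> X\<close> or \<open>x \<bullet> Y\<close> drop, and the
  product of first derivatives from \<open>dd_quot\<close> cancels against
  \<open>SS X x x * SS Y x x\<close>.\<close>

lemma ric_tt: assumes "x \<in> U" "x \<bullet> X = 0" "x \<bullet> Y = 0"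
  shows "ric X Y x = (real CARD('n) * chi x + dd x chi x + chi x * (ld id u x / u x)) * (X \<bullet> Y) - dd Y (dd X u) x / u x"
  unfolding ric_eq[OF assms(1)] dd_SS[OF assms(1)] dd_quot[OF assms(1)] SS_tx(1)[OF assms(1,2)] SS_tx(1)[OF assms(1,3)]
  by (simp add: SS_def assms algebra_simps power2_eq_square)

lemma psi_vals: assumes "x \<in> U"
  shows "psi x = ((u x)\<^sup>2 - 1) / (x \<bullet> x)"
    "dd v psi x = (2 * u x * dd v u x - 2 * (x \<bullet> v) * psi x) / (x \<bullet> x)"
    "dd v (dd w psi) x = (2 * dd v u x * dd w u x + 2 * u x * dd v (dd w u) x
       - 2 * (v \<bullet> w) * psi x - 2 * (x \<bullet> w) * dd v psi x - 2 * (x \<bullet> v) * dd w psi x) / (x \<bullet> x)"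
  using psi_dd[OF assms, of v] psi_dd2[OF assms, of v w] R0[OF assms] by (auto simp: psi_def field_simps)

text \<open>All second derivatives cancel: the mixed Ricci component is of first order in u, so the
  mixed static equation contains only first derivatives of u.\<close>

lemma ric_xt: assumes "x \<in> U" "x \<bullet> Y = 0"
  shows "ric x Y x = (real CARD('n) - 2) * (dd Y u x / u x)"
proof -
  have xu: "u x \<noteq> 0" and xR: "x \<bullet> x \<noteq> 0" using u_nonzero R0 assms by auto
  have dpsi: "psi differentiable (at x)" using diffble_U[OF smooth_coefficients(1) assms(1)] .
  have pY: "dd Y psi x = 2 * u x * dd Y u x / (x \<bullet> x)" using psi_vals(2)[OF assms(1), of Y] assms(2) by simp
  have px: "dd x psi x = (2 * u x * dd x u x - 2 * (x \<bullet> x) * psi x) / (x \<bullet> x)" using psi_vals(2)[OF assms(1), of x] by simp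
  have pxY: "dd x (dd Y psi) x = (2 * dd x u x * dd Y u x + 2 * u x * dd x (dd Y u) x - 2 * (x \<bullet> x) * dd Y psi x) / (x \<bullet> x)"
    using psi_vals(3)[OF assms(1), of x Y] assms(2) by simp
  have c: "dd Y (dd x u) x = dd x (dd Y u) x" by (rule dd_commute[OF openU su assms(1)])
  have g: "SS Y (grd psi x) x = om x * (dd Y psi x * dd x psi x) / 2 + chi x * dd Y psi x"
    by (simp add: SS_def assms(2) grd_inner[OF dpsi])
  have E: "ric x Y x = real CARD('n) * (dd Y u x / u x) + (dd x om x * (dd Y psi x * (x \<bullet> x)) + om x * (dd x (dd Y psi) x * (x \<bullet> x) + dd Y psi x * (x \<bullet> x))) / 2
      - dd Y psi x * (x \<bullet> x) / 2 - (dd x (dd Y u) x / u x - dd x u x * dd Y u x / (u x)\<^sup>2) + dd x u x / u x * (dd Y u x / u x)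
      - SS x x x * (dd Y u x / u x) + (x \<bullet> x) * ((x \<bullet> x) * SS Y (grd psi x) x) / 2"
    unfolding ric_eq[OF assms(1)] dd_SS[OF assms(1)] dd_quot[OF assms(1)] c SS_tx[OF assms]
    by (simp add: assms(2) ld_def)
  have S: "SS x x x = om x * dd x psi x * (x \<bullet> x) + chi x * (x \<bullet> x) + chi x * dd x psi x * (x \<bullet> x) * (x \<bullet> x) / 2"
    by (simp add: SS_def ld_def field_simps)
  show ?thesis
    unfolding E g S pxY pY px dd_om[OF assms(1)] unfolding psi_def chi_def om_def
    using xu xR by (simp add: field_simps power2_eq_square power3_eq_cube power4_eq_xxxx)
qed

lemma lapl_psi: assumes "x \<in> U"
  shows "(x \<bullet> x) * lapl psi x = 2 * (grd u x \<bullet> grd u x) + 2 * u x * lapl u x - 2 * real CARD('n) * psi x - 4 * dd x psi x"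
proof -
  have "pd i (pd i f) x = dd (axis i 1) (dd (axis i 1) f) x" for i f
  proof -
    have "pd i f = dd (axis i 1) f" by (simp add: pd_eq_dd fun_eq_iff)
    then show ?thesis by (simp add: pd_eq_dd)
  qed
  then have e: "(x \<bullet> x) * pd i (pd i psi) x = 2 * (grd u x $ i * grd u x $ i) + 2 * u x * pd i (pd i u) x - 2 * psi x
      - 4 * (x $ i * pd i psi x)" for i
    using psi_dd2[OF assms, of "axis i 1" "axis i 1"]
    by (simp add: grd_def pd_eq_dd inner_axis algebra_simps)
  have "(x \<bullet> x) * lapl psi x = (\<Sum>i\<in>UNIV. (x \<bullet> x) * pd i (pd i psi) x)" by (simp add: lapl_def sum_distrib_left)
  also have "\<dots> = 2 * (\<Sum>i\<in>UNIV. grd u x $ i * grd u x $ i) + 2 * u x * (\<Sum>i\<in>UNIV. pd i (pd i u) x)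
      - (\<Sum>i\<in>(UNIV::'n set). 2 * psi x) - 4 * (\<Sum>i\<in>UNIV. x $ i * pd i psi x)"
    unfolding e by (simp only: sum.distrib sum_subtractf sum_distrib_left)
  finally show ?thesis by (simp add: lapl_def inner_sum sum_x_pd diffble_U[OF smooth_coefficients(1) assms] ld_def)
qed

text \<open>Since \<open>x\<close> has g-length r u, the left hand side is r^2 times the Ricci
  curvature in the unit radial direction. The second radial derivatives of u cancel, and only the
  spherical Laplacian is left.\<close>

lemma ric_xx: assumes "x \<in> U"
  shows "om x * ric x x x = (real CARD('n) - 1) * om x * (dd x u x / u x) - lapS u x / u x"
proof -
  have xu: "u x \<noteq> 0" and xR: "x \<bullet> x \<noteq> 0" using u_nonzero R0 assms by auto
  have dpsi: "psi differentiable (at x)" using diffble_U[OF smooth_coefficients(1) assms] .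
  have du: "u differentiable (at x)" using diffble_U[OF su assms] .
  \<comment> \<open>The claim depends on u only through its value and a few scalar combinations of
    derivatives at \<open>x\<close>. With names for these and \<open>psi\<close> eliminated, it is
    an identity of rational functions.\<close>
  define R where "R = x \<bullet> x"
  define p where "p = dd x u x"
  define h where "h = dd x (dd x u) x"
  define g where "g = grd u x \<bullet> grd u x"
  define k where "k = lapl u x"
  define n where "n = real CARD('n)"
  define U0 where "U0 = u x"
  define P where "P = (U0\<^sup>2 - 1) / R"
  define q where "q = (2 * U0 * p - 2 * R * P) / R"
  have P: "psi x = P" by (simp add: psi_def P_def R_def U0_def)
  have px: "dd x psi x = q" using psi_vals(2)[OF assms, of x] unfolding P by (simp add: q_def R_def p_def U0_def)
  have pxx: "dd x (dd x psi) x = (2 * p * p + 2 * U0 * h - 2 * R * P - 4 * R * q) / R"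
    using psi_vals(3)[OF assms, of x x] unfolding P px by (simp add: R_def p_def h_def U0_def algebra_simps)
  have lp: "lapl psi x = (2 * g + 2 * U0 * k - 2 * n * P - 4 * q) / R"
    using lapl_psi[OF assms] xR unfolding P px by (simp add: R_def g_def k_def n_def U0_def field_simps)
  have gp: "grd psi x = (2 * U0 / R) *\<^sub>R grd u x - (2 * P / R) *\<^sub>R x"
  proof -
    have "pd i psi x = 2 * U0 / R * pd i u x - 2 * P / R * x $ i" for i
      using psi_vals(2)[OF assms, of "axis i 1"] xR unfolding P
      by (simp add: pd_eq_dd inner_axis R_def U0_def field_simps)
    then show ?thesis by (simp add: vec_eq_iff grd_def)
  qed
  have gu: "dd (grd u x) psi x = (2 * U0 * g - 2 * P * p) / R"
  proof -
    have "dd (grd u x) u x = g" using grd_inner[OF du, of "grd u x"] by (simp add: g_def)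
    moreover have "x \<bullet> grd u x = p" using grd_inner[OF du, of x] by (simp add: p_def)
    ultimately show ?thesis using psi_vals(2)[OF assms, of "grd u x"] unfolding P by (simp add: U0_def R_def)
  qed
  have gg: "dd (grd psi x) psi x = (4 * U0\<^sup>2 * g - 8 * U0 * P * p + 4 * P\<^sup>2 * R) / R\<^sup>2"
  proof -
    have "dd (grd psi x) psi x = 2 * U0 / R * dd (grd u x) psi x - 2 * P / R * dd x psi x"
      by (subst gp) (simp add: dd_lin[OF dpsi])
    also have "\<dots> = (4 * U0\<^sup>2 * g - 8 * U0 * P * p + 4 * P\<^sup>2 * R) / R\<^sup>2"
      unfolding gu px q_def using xR by (simp add: R_def[symmetric] field_simps power2_eq_square)
    finally show ?thesis .
  qed
  have oU: "om x = 1 / U0\<^sup>2" by (simp add: om_def U0_def)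
  have c: "chi x = (1 - 1 / U0\<^sup>2) / R" by (simp add: chi_def om_def U0_def R_def)
  have oE: "dd x om x = - 2 * (1 / U0\<^sup>2) * p / U0" using dd_om[OF assms, of x] by (simp add: oU p_def U0_def)
  have cE: "dd x chi x = (2 * (1 / U0\<^sup>2) * p / U0 - 2 * R * chi x) / R"
    using dd_chi[OF assms, of x] xR by (simp add: oU p_def U0_def R_def field_simps)
  have S: "SS x x x = om x * q * R + chi x * R + chi x * q * R * R / 2"
    by (simp add: SS_def ld_def px R_def[symmetric])
  have G: "SS x (grd psi x) x = om x * (q * q + dd (grd psi x) psi x * R) / 2 + chi x * q + chi x * q * R * q / 2"
    by (simp add: SS_def ld_def px R_def[symmetric] grd_inner[OF dpsi])
  have E: "ric x x x = n * SS x x x + ((dd x om x * (q * R + q * R)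
     + om x * (dd x (dd x psi) x * R + q * R + dd x (dd x psi) x * R + q * R)) / 2
     + dd x chi x * R
     + (dd x chi x * q + chi x * (dd x (dd x psi) x + q) + 2 * chi x * q) * R * R / 2)
     - lapl psi x * (R * R) / 2 - (q * R + q * R) / 2 - (h / U0 - p * p / U0\<^sup>2)
     + (p / U0) * SS x x x - dd (grd u x) psi x / U0 * (R * R) / 2 - SS x x x * SS x x x
     + R * (R * SS x (grd psi x) x + R * SS x (grd psi x) x) / 2 - q\<^sup>2 * (R * R) / 4"
    unfolding ric_eq[OF assms] dd_SS[OF assms] dd_quot[OF assms]
    by (simp add: ld_def px R_def[symmetric] p_def[symmetric] h_def[symmetric] n_def[symmetric] U0_def[symmetric])
  have L: "lapS u x = R * k - (h + p) - (n - 2) * p"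
  proof -
    have "ld id (ld id u) x = h + p"
      unfolding ld_def[of id "ld id u"] by (simp add: dd_ld[OF openU su assms] h_def p_def)
    then show ?thesis by (simp add: lapS_def R_def k_def n_def p_def ld_def)
  qed
  have ne: "U0 \<noteq> 0" "R \<noteq> 0" using xu xR by (simp_all add: U0_def R_def)
  have q: "q = 2 * (U0 * p - U0\<^sup>2 + 1) / R" unfolding q_def P_def using ne by (simp add: field_simps)
  show ?thesis
    unfolding E G S cE oE gg gu lp pxx L oU c n_def[symmetric] p_def[symmetric] U0_def[symmetric] unfolding q P_def
    using ne by (simp add: field_simps power2_eq_square)
qed

end

section \<open>The static vacuum equations\<close>

locale sqs = qsm U u for U :: "(real^'n::finite) set" and u +
  fixes V :: "real^'n::finite \<Rightarrow> real" and n :: real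
  assumes nC [simp]: "real CARD('n) = n" and sV: "smooth_on V U"
    and static0: "\<And>x i j. x \<in> U \<Longrightarrow> hessian (warped_metric u) V i j x = V x * ricci (warped_metric u) i j x"
    and harm0: "\<And>x. x \<in> U \<Longrightarrow> laplacian (warped_metric u) V x = 0"
begin

definition hs where "hs X Y x = (\<Sum>i\<in>UNIV. \<Sum>j\<in>UNIV. X $ i * Y $ j * hessian (warped_metric u) V i j x)"

section \<open>Radial, mixed and tangential components of the static equation\<close>

lemma hessian_eq: assumes "x \<in> U"
  shows "hessian (warped_metric u) V i j x = pd i (pd j V) x - Ss i j x * ld id V x + dd (grd psi x) V x * (x $ i * x $ j) / 2"
proof -
  have "(\<Sum>k\<in>UNIV. christoffel (warped_metric u) k i j x * pd k V x)
     = Ss i j x * (\<Sum>k\<in>UNIV. x $ k * pd k V x) - x $ i * x $ j / 2 * (\<Sum>k\<in>UNIV. grd psi x $ k * pd k V x)"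
    by (simp only: christoffel_eq[OF assms] sum_distrib_left flip: sum_subtractf)
      (rule sum.cong, simp_all add: grd_def field_simps)
  then show ?thesis
    by (simp add: hessian_def sum_x_pd diffble_U[OF sV assms] dd_sum_pd[OF diffble_U[OF sV assms], of "grd psi x"] field_simps)
qed

lemma hs_eq: assumes "x \<in> U"
  shows "hs X Y x = dd X (dd Y V) x - SS X Y x * ld id V x + dd (grd psi x) V x * ((x \<bullet> X) * (x \<bullet> Y)) / 2"
proof -
  have "hs X Y x = (\<Sum>i\<in>UNIV. \<Sum>j\<in>UNIV. X $ i * Y $ j * pd i (pd j V) x)
     - ld id V x * (\<Sum>i\<in>UNIV. \<Sum>j\<in>UNIV. X $ i * Y $ j * Ss i j x)
     + dd (grd psi x) V x / 2 * ((\<Sum>i\<in>UNIV. X $ i * x $ i) * (\<Sum>j\<in>UNIV. Y $ j * x $ j))"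
    unfolding sum_product unfolding sum_distrib_left unfolding hs_def hessian_eq[OF assms]
    unfolding sum.distrib[symmetric] sum_subtractf[symmetric]
    by (intro sum.cong refl) (simp add: field_simps)
  moreover have "x \<bullet> X = (\<Sum>i\<in>UNIV. X $ i * x $ i)" for X by (simp add: inner_sum mult.commute)
  ultimately show ?thesis
    unfolding dd2_sum_pd[OF openU sV assms] SS_sum(1)[OF assms] by simp
qed

lemma hs_ric: "x \<in> U \<Longrightarrow> hs X Y x = V x * ric X Y x"
  by (simp add: hs_def ric_def static0 sum_distrib_left mult_ac)

text \<open>Contraction with \<open>x\<close> and a tangential \<open>Y\<close>. The mixed second
  derivative of V is absorbed into the derivative of \<open>ld id V\<close>, so the equation
  compares derivatives within one sphere.\<close>

lemma static_mixed: assumes "x \<in> U" "x \<bullet> Y = 0"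
  shows "dd Y (ld id V) x = dd Y V x + dd Y u x / u x * (ld id V x + (n - 2) * V x)"
proof -
  have "dd x (dd Y V) x - dd Y u x / u x * ld id V x = V x * ((n - 2) * (dd Y u x / u x))"
    using hs_eq[OF assms(1), of x Y] hs_ric[OF assms(1), of x Y] ric_xt[OF assms] SS_tx(2)[OF assms] assms(2) by simp
  moreover have "dd Y (ld id V) x = dd x (dd Y V) x + dd Y V x"
    using dd_ld[OF openU sV assms(1) linear_id', of Y] dd_commute[OF openU sV assms(1), of Y x] by simp
  ultimately show ?thesis using u_nonzero[OF assms(1)] by (simp add: field_simps)
qed

text \<open>The factor of the pure trace right hand side in \<open>static_tangential\<close>;
  \<open>BB_eq\<close> removes the derivative of \<open>chi\<close> from it.\<close>

definition BB where "BB x = u x * (chi x * ld id V x + V x * (n * chi x + dd x chi x + chi x * (ld id u x / u x)))"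

lemma static_tangential: assumes "x \<in> U" "x \<bullet> X = 0" "x \<bullet> Y = 0"
  shows "u x * dd X (dd Y V) x + V x * dd X (dd Y u) x = BB x * (X \<bullet> Y)"
proof -
  have "dd X (dd Y V) x - chi x * (X \<bullet> Y) * ld id V x
     = V x * ((n * chi x + dd x chi x + chi x * (ld id u x / u x)) * (X \<bullet> Y) - dd X (dd Y u) x / u x)"
    using hs_eq[OF assms(1), of X Y] hs_ric[OF assms(1), of X Y] ric_tt[OF assms] assms(2,3)
      dd_commute[OF openU su assms(1), of X Y] by (simp add: SS_def)
  then have "dd X (dd Y V) x = chi x * (X \<bullet> Y) * ld id V x
     + V x * ((n * chi x + dd x chi x + chi x * (ld id u x / u x)) * (X \<bullet> Y) - dd X (dd Y u) x / u x)"
    by simp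
  then show ?thesis unfolding BB_def using u_nonzero[OF assms(1)] by (simp only:) (simp add: field_simps)
qed

lemma BB_eq: assumes "x \<in> U"
  shows "(x \<bullet> x) * BB x = u x * ((1 - om x) * ld id V x + V x * ((n - 2) * (1 - om x) + (1 + om x) * (ld id u x / u x)))"
proof -
  have c: "(x \<bullet> x) * chi x = 1 - om x" using rel(3)[OF assms] by (simp add: algebra_simps)
  have d: "(x \<bullet> x) * dd x chi x = 2 * om x * (ld id u x / u x) - 2 * ((x \<bullet> x) * chi x)"
    using dd_chi[OF assms, of x] by (simp add: ld_def)
  have "(x \<bullet> x) * BB x = u x * (((x \<bullet> x) * chi x) * ld id V x + V x * (n * ((x \<bullet> x) * chi x) + (x \<bullet> x) * dd x chi x + ((x \<bullet> x) * chi x) * (ld id u x / u x)))"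
    by (simp add: BB_def algebra_simps)
  then have E: "(x \<bullet> x) * BB x = u x * ((1 - om x) * ld id V x + V x * (n * (1 - om x) + (2 * om x * (ld id u x / u x) - 2 * (1 - om x)) + (1 - om x) * (ld id u x / u x)))"
    unfolding d c .
  define M where "M = ld id u x / u x"
  show ?thesis unfolding E M_def[symmetric] by (simp add: algebra_simps)
qed

lemma ldid2: "smooth_on f U \<Longrightarrow> x \<in> U \<Longrightarrow> ld id (ld id f) x = dd x (dd x f) x + ld id f x"
  by (simp add: ld_def[of id "ld id f"] dd_ld[OF openU]) (simp add: ld_def)

lemma lapl_axis: "lapl f x = (\<Sum>i\<in>UNIV. dd (axis i 1) (dd (axis i 1) f) x)"
proof -
  have "pd i f = dd (axis i 1) f" for i by (simp add: pd_eq_dd fun_eq_iff)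
  then show ?thesis by (simp add: lapl_def pd_eq_dd)
qed

text \<open>The projections of the coordinate vectors onto the tangent space form a Parseval frame,
  so a sum over them is the tangential trace without any choice of basis.\<close>

lemma tan_trace: assumes "x \<in> U" "smooth_on f U"
  shows "(\<Sum>i\<in>UNIV. (let e = axis i 1 - (x $ i / (x \<bullet> x)) *\<^sub>R x in (x \<bullet> x) * dd e (dd e f) x))
    = lapS f x + (n - 1) * ld id f x"
proof -
  have d: "(dd v f) differentiable (at x)" for v by (rule diffble_U[OF smooth_dd[OF openU assms(2)] assms(1)])
  have df: "f differentiable (at y)" if "y \<in> U" for y by (rule diffble_U[OF assms(2) that])
  have lin2: "dd v (dd (a - c *\<^sub>R b) f) x = dd v (dd a f) x - c * dd v (dd b f) x" for v a b c
  proof -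
    have "dd v (dd (a - c *\<^sub>R b) f) x = dd v (\<lambda>y. dd a f y - c * dd b f y) x"
      by (rule dd_cong_open[OF openU assms(1)]) (simp add: dd_lin[OF df])
    also have "\<dots> = dd v (dd a f) x - c * dd v (dd b f) x"
      by (subst dd_simps | (intro diffble_U[OF _ assms(1)] smooth_mult smooth_const smooth_dd openU assms(2)))+ simp
    finally show ?thesis .
  qed
  have e: "(let e = axis i 1 - (x $ i / (x \<bullet> x)) *\<^sub>R x in (x \<bullet> x) * dd e (dd e f) x)
     = (x \<bullet> x) * dd (axis i 1) (dd (axis i 1) f) x - 2 * (x $ i * pd i (dd x f) x)
       + (x $ i * x $ i) * (dd x (dd x f) x / (x \<bullet> x))" for i
  proof -
    have "dd x (dd (axis i 1) f) x = pd i (dd x f) x"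
      using dd_commute[OF openU assms(2,1)] by (simp add: pd_eq_dd)
    then show ?thesis
      using R0[OF assms(1)] by (simp add: Let_def lin2 dd_lin[OF d] pd_eq_dd field_simps)
  qed
  have "(\<Sum>i\<in>UNIV. (let e = axis i 1 - (x $ i / (x \<bullet> x)) *\<^sub>R x in (x \<bullet> x) * dd e (dd e f) x))
     = (x \<bullet> x) * lapl f x - 2 * (\<Sum>i\<in>UNIV. x $ i * pd i (dd x f) x) + (\<Sum>i\<in>UNIV. x $ i * x $ i) * (dd x (dd x f) x / (x \<bullet> x))"
    unfolding e lapl_axis by (simp only: sum.distrib sum_subtractf sum_distrib_left sum_distrib_right)
  also have "\<dots> = (x \<bullet> x) * lapl f x - 2 * dd x (dd x f) x + dd x (dd x f) x"
    using R0[OF assms(1)] by (simp add: dd_sum_pd[OF d, symmetric] inner_sum[symmetric])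
  finally show ?thesis by (simp add: lapS_def ldid2[OF assms(2,1)] algebra_simps)
qed

lemma tan_trace_eq: assumes "x \<in> U"
  shows "u x * lapS V x + V x * lapS u x = (n - 1) * u x * (- om x * ld id V x + V x * ((n - 2) * (1 - om x) + om x * (ld id u x / u x)))"
proof -
  let ?e = "\<lambda>i. axis i 1 - (x $ i / (x \<bullet> x)) *\<^sub>R x"
  have perp: "x \<bullet> ?e i = 0" for i using R0[OF assms] by (simp add: inner_diff_right inner_axis)
  have ee: "?e i \<bullet> ?e i = 1 - x $ i * x $ i / (x \<bullet> x)" for i
    using R0[OF assms] by (simp add: inner_diff_right inner_diff_left inner_axis inner_axis' field_simps)
  have "u x * (lapS V x + (n - 1) * ld id V x) + V x * (lapS u x + (n - 1) * ld id u x)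
     = (\<Sum>i\<in>UNIV. (x \<bullet> x) * (u x * dd (?e i) (dd (?e i) V) x + V x * dd (?e i) (dd (?e i) u) x))"
    unfolding tan_trace[OF assms sV, symmetric] tan_trace[OF assms su, symmetric] Let_def
    by (simp only: sum.distrib[symmetric] sum_distrib_left) (rule sum.cong, simp_all add: algebra_simps)
  also have "\<dots> = (\<Sum>i\<in>UNIV. (x \<bullet> x) * (BB x * (1 - x $ i * x $ i / (x \<bullet> x))))"
    by (simp only: static_tangential[OF assms perp perp] ee)
  also have "\<dots> = (x \<bullet> x) * BB x * (\<Sum>i\<in>(UNIV::'n set). 1) - BB x * (\<Sum>i\<in>UNIV. x $ i * x $ i)"
    by (simp only: sum_distrib_left flip: sum_subtractf)
      (rule sum.cong, use R0[OF assms] in \<open>simp_all add: field_simps\<close>)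
  also have "\<dots> = (n - 1) * ((x \<bullet> x) * BB x)" by (simp add: inner_sum[symmetric] algebra_simps)
  finally show ?thesis unfolding BB_eq[OF assms] using u_nonzero[OF assms] by (simp add: field_simps)
qed

text \<open>Harmonicity trades the radial component of the Hessian for the tangential trace, and the
  static equation replaces that component by the radial Ricci curvature.\<close>

lemma rad_eq: assumes "x \<in> U"
  shows "lapS V x + (n - 1) * om x * ld id V x = - V x * ((n - 1) * om x * (ld id u x / u x) - lapS u x / u x)"
proof -
  have "0 = laplacian (warped_metric u) V x" using harm0[OF assms] by simp
  also have "\<dots> = (\<Sum>i\<in>UNIV. hessian (warped_metric u) V i i x) - chi x * hs x x x"
  proof -
    have "laplacian (warped_metric u) V x = (\<Sum>i\<in>UNIV. (\<Sum>j\<in>UNIV. kd i j * hessian (warped_metric u) V i j x)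
        - (\<Sum>j\<in>UNIV. chi x * (x $ i * x $ j * hessian (warped_metric u) V i j x)))"
      unfolding laplacian_def ginv_eq[OF assms] by (simp only: left_diff_distrib sum_subtractf mult.assoc)
    then show ?thesis by (simp only: kd_sums sum_subtractf hs_def sum_distrib_left)
  qed
  also have "(\<Sum>i\<in>UNIV. hessian (warped_metric u) V i i x) = lapl V x - (om x * ld id psi x + n * chi x + chi x * ld id psi x * (x \<bullet> x) / 2) * ld id V x
      + dd (grd psi x) V x * (x \<bullet> x) / 2"
  proof -
    have "(\<Sum>i\<in>UNIV. Ss i i x) = om x * (\<Sum>i\<in>UNIV. x $ i * pd i psi x) + (\<Sum>i\<in>(UNIV::'n set). chi x) + chi x * ld id psi x / 2 * (\<Sum>i\<in>UNIV. x $ i * x $ i)"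
      by (simp only: sum_distrib_left flip: sum.distrib) (rule sum.cong, simp_all add: Ss_def field_simps)
    then have t: "(\<Sum>i\<in>UNIV. Ss i i x) = om x * ld id psi x + n * chi x + chi x * ld id psi x * (x \<bullet> x) / 2"
      by (simp add: sum_x_pd[OF diffble_U[OF smooth_coefficients(1) assms]] inner_sum)
    have "(\<Sum>i\<in>UNIV. hessian (warped_metric u) V i i x) = lapl V x - ld id V x * (\<Sum>i\<in>UNIV. Ss i i x) + dd (grd psi x) V x / 2 * (\<Sum>i\<in>UNIV. x $ i * x $ i)"
      unfolding hessian_eq[OF assms] lapl_def
      by (simp only: sum_distrib_left flip: sum.distrib sum_subtractf) (rule sum.cong, simp_all add: field_simps)
    then show ?thesis unfolding t by (simp add: inner_sum)
  qed
  finally have 0: "lapl V x - (om x * ld id psi x + n * chi x + chi x * ld id psi x * (x \<bullet> x) / 2) * ld id V x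
      + dd (grd psi x) V x * (x \<bullet> x) / 2 = chi x * hs x x x" by simp
  have h: "hs x x x = dd x (dd x V) x - (om x * ld id psi x * (x \<bullet> x) + chi x * (x \<bullet> x) + chi x * ld id psi x * (x \<bullet> x) * (x \<bullet> x) / 2) * ld id V x
     + dd (grd psi x) V x * ((x \<bullet> x) * (x \<bullet> x)) / 2"
    unfolding hs_eq[OF assms] by (simp add: SS_def ld_def field_simps)
  have c: "(x \<bullet> x) * chi x = 1 - om x" using rel(3)[OF assms] by (simp add: algebra_simps)
  have "(x \<bullet> x) * (chi x * hs x x x) - hs x x x = (x \<bullet> x) * lapl V x - dd x (dd x V) x - (n - 1) * ((x \<bullet> x) * chi x) * ld id V x"
    unfolding 0[symmetric] by (subst h) (simp add: field_simps)
  moreover have "(x \<bullet> x) * (chi x * hs x x x) - hs x x x = - om x * hs x x x"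
    unfolding mult.assoc[symmetric] c by (simp add: algebra_simps)
  ultimately have "- om x * hs x x x = lapS V x + (n - 1) * om x * ld id V x"
    unfolding c lapS_def ldid2[OF sV assms] by (simp add: algebra_simps)
  moreover have "om x * hs x x x = V x * (om x * ric x x x)" by (simp add: hs_ric[OF assms])
  ultimately show ?thesis unfolding ric_xx[OF assms] by (simp add: ld_def algebra_simps)
qed

text \<open>\<open>tan_trace_eq\<close> and \<open>rad_eq\<close> are two linear equations for
  \<open>lapS V\<close> and \<open>V * lapS u / u\<close>; their sum and difference are the two
  conclusions. The second is V times the scalar curvature, up to a factor, so V cannot be cancelled
  yet.\<close>

lemma static_trace: assumes "x \<in> U"
  shows "lapS V x + (n - 1) * om x * ld id V x = (n - 1) * (n - 2) / 2 * (1 - om x) * V x"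
    "V x * (lapS u x / u x - (n - 1) * om x * (ld id u x / u x) - (n - 1) * (n - 2) / 2 * (1 - om x)) = 0"
proof -
  define L where "L = lapS u x / u x"
  define M where "M = ld id u x / u x"
  have "u x * (lapS V x + V x * L) = u x * ((n - 1) * (- om x * ld id V x + V x * ((n - 2) * (1 - om x) + om x * M)))"
    using tan_trace_eq[OF assms] u_nonzero[OF assms] by (simp add: L_def M_def algebra_simps)
  then have 1: "lapS V x + V x * L = (n - 1) * (- om x * ld id V x + V x * ((n - 2) * (1 - om x) + om x * M))"
    using u_nonzero[OF assms] by simp
  have 2: "lapS V x + (n - 1) * om x * ld id V x = - V x * ((n - 1) * om x * M - L)"
    using rad_eq[OF assms] by (simp add: L_def M_def)
  have "2 * (lapS V x + (n - 1) * om x * ld id V x) = (n - 1) * (n - 2) * (1 - om x) * V x"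
    using 1 2 by (simp add: algebra_simps)
  then show "lapS V x + (n - 1) * om x * ld id V x = (n - 1) * (n - 2) / 2 * (1 - om x) * V x" by simp
  have "V x * (2 * L - 2 * ((n - 1) * om x * M) - (n - 1) * (n - 2) * (1 - om x)) = 0"
    using 1 2 by (simp add: algebra_simps)
  moreover have "2 * (L - (n - 1) * om x * M - (n - 1) * (n - 2) / 2 * (1 - om x))
      = 2 * L - 2 * ((n - 1) * om x * M) - (n - 1) * (n - 2) * (1 - om x)"
    by (simp add: field_simps)
  ultimately have "V x * (2 * (L - (n - 1) * om x * M - (n - 1) * (n - 2) / 2 * (1 - om x))) = 0" by (simp only:)
  then show "V x * (lapS u x / u x - (n - 1) * om x * (ld id u x / u x) - (n - 1) * (n - 2) / 2 * (1 - om x)) = 0"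
    unfolding L_def[symmetric] M_def[symmetric] by (metis mult_eq_0_iff zero_neq_numeral)
qed

section \<open>Unique continuation for the potential\<close>

lemma smooth_ricci: "smooth_on (ricci (warped_metric u) i j) U"
  unfolding ricci_def
  by (intro smooth_sum smooth_add smooth_diff smooth_mult smooth_pd smooth_christoffel openU)

definition jet2 where "jet2 x = (V x)\<^sup>2 + (\<Sum>j\<in>UNIV. (pd j V x)\<^sup>2)"

lemma jet_ineq: fixes a b m K :: real
  assumes "\<bar>a\<bar> \<le> m" "\<bar>b\<bar> \<le> K * m" "0 \<le> m" shows "2 * a * b \<le> 2 * K * m\<^sup>2"
proof -
  have "a * b \<le> \<bar>a\<bar> * \<bar>b\<bar>" by (metis abs_ge_self abs_mult)
  also have "\<dots> \<le> m * (K * m)" using assms by (intro mult_mono) auto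
  finally show ?thesis by (simp add: power2_eq_square mult_ac)
qed

text \<open>Along a segment the 1-jet of \<open>V\<close> solves a linear ordinary differential equation, because
  \<open>Hess V = V Ric\<close>.\<close>

lemma jet_zero_near: assumes "x \<in> U" "jet2 x = 0" "cball x e \<subseteq> U" "e > 0" "y \<in> cball x e"
  shows "jet2 y = 0"
proof -
  define v where "v = y - x"
  have seg: "x + t *\<^sub>R v \<in> cball x e" if "0 \<le> t" "t \<le> 1" for t
  proof -
    have "norm (t *\<^sub>R v) \<le> 1 * norm v" using that by (simp add: mult_left_le_one_le)
    also have "\<dots> \<le> e" using assms(5) by (simp add: v_def dist_norm norm_minus_commute)
    finally show ?thesis by (simp add: dist_norm)
  qed
  have segU: "x + t *\<^sub>R v \<in> U" if "0 \<le> t" "t \<le> 1" for t using seg[OF that] assms(3) by blast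
  have "\<exists>K. \<forall>z\<in>cball x e. \<bar>f z\<bar> \<le> K" if "smooth_on f U" for f
  proof -
    have "bounded (f ` cball x e)"
      by (intro compact_imp_bounded compact_continuous_image continuous_on_subset[OF smooth_continuous[OF that] assms(3)] compact_cball)
    then show ?thesis unfolding bounded_iff by auto
  qed
  then have bd: "\<forall>f\<in>F. smooth_on f U \<longrightarrow> (\<exists>K. \<forall>z\<in>cball x e. \<bar>f z\<bar> \<le> K)" for F by blast
  define KC where "KC k i j = (SOME K. \<forall>z\<in>cball x e. \<bar>christoffel (warped_metric u) k i j z\<bar> \<le> K)" for k i j
  define KR where "KR i j = (SOME K. \<forall>z\<in>cball x e. \<bar>ricci (warped_metric u) i j z\<bar> \<le> K)" for i j
  have KC: "\<bar>christoffel (warped_metric u) k i j z\<bar> \<le> KC k i j" if "z \<in> cball x e" for k i j z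
    using someI_ex[of "\<lambda>K. \<forall>z\<in>cball x e. \<bar>christoffel (warped_metric u) k i j z\<bar> \<le> K"] bd[of "{christoffel (warped_metric u) k i j}"]
      smooth_christoffel[of k i j] that unfolding KC_def by auto
  have KR: "\<bar>ricci (warped_metric u) i j z\<bar> \<le> KR i j" if "z \<in> cball x e" for i j z
    using someI_ex[of "\<lambda>K. \<forall>z\<in>cball x e. \<bar>ricci (warped_metric u) i j z\<bar> \<le> K"] bd[of "{ricci (warped_metric u) i j}"]
      smooth_ricci[of i j] that unfolding KR_def by auto
  define m where "m z = sqrt (jet2 z)" for z
  have j0: "jet2 z \<ge> 0" for z unfolding jet2_def by (intro add_nonneg_nonneg sum_nonneg) auto
  have m0: "m z \<ge> 0" "(m z)\<^sup>2 = jet2 z" for z using j0 by (simp_all add: m_def)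
  have mV: "\<bar>V z\<bar> \<le> m z" for z
    unfolding m_def using real_sqrt_le_mono[of "(V z)\<^sup>2" "jet2 z"] by (simp add: jet2_def sum_nonneg)
  have mp: "\<bar>pd j V z\<bar> \<le> m z" for z j
  proof -
    have "(pd j V z)\<^sup>2 \<le> (\<Sum>j\<in>UNIV. (pd j V z)\<^sup>2)" by (rule member_le_sum) auto
    also have "\<dots> \<le> jet2 z" by (simp add: jet2_def)
    finally show ?thesis unfolding m_def using real_sqrt_le_mono by fastforce
  qed
  define K1 where "K1 = (\<Sum>i\<in>UNIV. \<bar>v $ i\<bar>)"
  define K2 where "K2 j = (\<Sum>i\<in>UNIV. \<bar>v $ i\<bar> * ((\<Sum>k\<in>UNIV. KC k i j) + KR i j))" for j
  have dV: "\<bar>dd v V z\<bar> \<le> K1 * m z" if "z \<in> cball x e" for z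
  proof -
    have "dd v V z = (\<Sum>i\<in>UNIV. v $ i * pd i V z)" using diffble_U[OF sV] that assms(3) by (blast intro: dd_sum_pd)
    also have "\<bar>\<dots>\<bar> \<le> (\<Sum>i\<in>UNIV. \<bar>v $ i * pd i V z\<bar>)" by (rule sum_abs)
    also have "\<dots> \<le> (\<Sum>i\<in>UNIV. \<bar>v $ i\<bar> * m z)" by (intro sum_mono) (auto simp: abs_mult intro!: mult_left_mono mp)
    finally show ?thesis by (simp add: K1_def sum_distrib_right)
  qed
  have dp: "\<bar>dd v (pd j V) z\<bar> \<le> K2 j * m z" if "z \<in> cball x e" for z j
  proof -
    have zU: "z \<in> U" using that assms(3) by blast
    have h: "\<bar>pd i (pd j V) z\<bar> \<le> ((\<Sum>k\<in>UNIV. KC k i j) + KR i j) * m z" for i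
    proof -
      have "pd i (pd j V) z = (\<Sum>k\<in>UNIV. christoffel (warped_metric u) k i j z * pd k V z) + V z * ricci (warped_metric u) i j z"
        using static0[OF zU, of i j] by (simp add: hessian_def)
      also have "\<bar>\<dots>\<bar> \<le> (\<Sum>k\<in>UNIV. \<bar>christoffel (warped_metric u) k i j z * pd k V z\<bar>) + \<bar>V z * ricci (warped_metric u) i j z\<bar>"
        by (rule order_trans[OF abs_triangle_ineq add_right_mono[OF sum_abs]])
      also have "\<dots> \<le> (\<Sum>k\<in>UNIV. KC k i j * m z) + m z * KR i j"
        unfolding abs_mult using KC[OF that] KR[OF that] mp mV m0(1) abs_ge_zero
        by (intro add_mono sum_mono mult_mono) (auto intro: order_trans[OF abs_ge_zero])
      finally show ?thesis by (simp add: sum_distrib_left algebra_simps)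
    qed
    have "dd v (pd j V) z = (\<Sum>i\<in>UNIV. v $ i * pd i (pd j V) z)" by (rule dd_sum_pd[OF diffble_U[OF smooth_pd[OF sV] zU]])
    also have "\<bar>\<dots>\<bar> \<le> (\<Sum>i\<in>UNIV. \<bar>v $ i * pd i (pd j V) z\<bar>)" by (rule sum_abs)
    also have "\<dots> \<le> (\<Sum>i\<in>UNIV. \<bar>v $ i\<bar> * (((\<Sum>k\<in>UNIV. KC k i j) + KR i j) * m z))"
      by (intro sum_mono) (auto simp: abs_mult intro!: mult_left_mono h)
    finally show ?thesis by (simp add: K2_def sum_distrib_right mult.assoc)
  qed
  define C where "C = 2 * K1 + (\<Sum>j\<in>UNIV. 2 * K2 j)"
  define g where "g t = jet2 (x + t *\<^sub>R v)" for t
  define g' where "g' t = (let z = x + t *\<^sub>R v in 2 * V z * dd v V z + (\<Sum>j\<in>UNIV. 2 * pd j V z * dd v (pd j V) z))" for t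
  have gd: "(g has_real_derivative g' t) (at t)" if "0 \<le> t" "t \<le> 1" for t
    unfolding g_def jet2_def g'_def Let_def
    using has_real_derivative_line[OF diffble_U[OF sV segU[OF that]]] has_real_derivative_line[OF diffble_U[OF smooth_pd[OF sV] segU[OF that]]]
    by (auto intro!: derivative_eq_intros simp: mult_ac)
  have g'le: "g' t \<le> C * g t" if "0 \<le> t" "t \<le> 1" for t
  proof -
    let ?z = "x + t *\<^sub>R v"
    have "g' t \<le> 2 * K1 * (m ?z)\<^sup>2 + (\<Sum>j\<in>UNIV. 2 * K2 j * (m ?z)\<^sup>2)"
      unfolding g'_def Let_def
      by (intro add_mono sum_mono jet_ineq mV mp m0(1) dV dp seg that)
    then show ?thesis by (simp add: C_def g_def m0 algebra_simps sum_distrib_left)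
  qed
  \<comment> \<open>Gronwall: \<open>g' \<le> C g\<close> makes this product nonincreasing, and it
    starts at 0.\<close>
  define w where "w t = g t * exp (- C * t)" for t
  have "w 1 \<le> w 0"
  proof (rule DERIV_nonpos_imp_nonincreasing[of 0 1 w])
    fix t :: real assume t: "0 \<le> t" "t \<le> 1"
    have "(w has_real_derivative (g' t - C * g t) * exp (- C * t)) (at t)"
      unfolding w_def using gd[OF t] by (auto intro!: derivative_eq_intros simp: algebra_simps)
    then show "\<exists>y. DERIV w t :> y \<and> y \<le> 0" using g'le[OF t] by (intro exI conjI) (auto simp: mult_le_0_iff)
  qed simp
  then have "g 1 * exp (- C) \<le> 0" using assms(2) by (simp add: w_def g_def)
  then have "g 1 \<le> 0" by (simp add: mult_le_0_iff)
  then show ?thesis using j0[of y] by (simp add: g_def v_def)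
qed

text \<open>The zero set of the 1-jet is open by \<open>jet_zero_near\<close> and closed by
  continuity; it contains \<open>W\<close>, where V vanishes together with its derivatives.\<close>

lemma unique_continuation:
  assumes "connected U" "open W" "W \<subseteq> U" "W \<noteq> {}" "\<And>x. x \<in> W \<Longrightarrow> V x = 0" "y \<in> U"
  shows "V y = 0"
proof -
  define A where "A = {x \<in> U. jet2 x = 0}"
  have "openin (top_of_set U) A"
  proof (subst openin_open_eq[OF openU], intro conjI)
    show "open A" unfolding open_contains_cball
    proof
      fix x assume x: "x \<in> A"
      then obtain e where e: "e > 0" "cball x e \<subseteq> U" using openU open_contains_cball unfolding A_def by blast
      then show "\<exists>e>0. cball x e \<subseteq> A" using jet_zero_near[of x e] x unfolding A_def by blast
    qed
  qed (auto simp: A_def)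
  moreover have "closedin (top_of_set U) A"
  proof -
    have "smooth_on jet2 U" unfolding jet2_def by (intro smooth_add smooth_sum smooth_power smooth_pd sV openU)
    then have "continuous_on U jet2" by (rule smooth_continuous)
    then show ?thesis unfolding A_def by (rule continuous_closedin_preimage_constant)
  qed
  moreover have "A \<noteq> {}"
  proof -
    obtain x where x: "x \<in> W" using assms(4) by blast
    have "pd j V x = 0" for j
      using pd_cong_open[OF assms(2) x, of V "\<lambda>x. 0" j] assms(5) by (simp add: pd_eq_dd)
    then have "x \<in> A" using x assms by (auto simp: A_def jet2_def)
    then show ?thesis by blast
  qed
  ultimately have "A = U" using assms(1) connected_clopen by blast
  then have "jet2 y = 0" using assms(6) by (auto simp: A_def)
  moreover have "jet2 y \<ge> (V y)\<^sup>2" by (simp add: jet2_def sum_nonneg)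
  ultimately show ?thesis by simp
qed

text \<open>This is the vanishing of the scalar curvature. On the open set where it failed V would
  be 0, hence everywhere.\<close>

lemma scal_eq: assumes "connected U" "\<exists>y\<in>U. V y \<noteq> 0" "x \<in> U"
  shows "lapS u x / u x - (n - 1) * om x * (ld id u x / u x) = (n - 1) * (n - 2) / 2 * (1 - om x)"
proof (rule ccontr)
  define F where "F x = lapS u x / u x - (n - 1) * om x * (ld id u x / u x) - (n - 1) * (n - 2) / 2 * (1 - om x)" for x
  assume "\<not> ?thesis"
  then have F0: "F x \<noteq> 0" by (simp add: F_def)
  have "smooth_on (lapS u) U" unfolding lapS_def lapl_def
    by (intro smooth_diff smooth_mult smooth_sum smooth_pd smooth_ld smooth_norm2 smooth_const openU su linear_id')
  then have "smooth_on F U" unfolding F_def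
    by (intro smooth_diff smooth_mult smooth_divide smooth_const smooth_coefficients openU su smooth_ld linear_id') (use u_nonzero in auto)
  then have "continuous_on U F" by (rule smooth_continuous)
  then have o: "open {y \<in> U. F y \<noteq> 0}"
    using continuous_open_preimage[OF _ openU, of F "- {0}"] by (simp add: vimage_def Int_def open_Compl)
  have "V y = 0" if "y \<in> {y \<in> U. F y \<noteq> 0}" for y
    using static_trace(2)[of y] that by (auto simp: F_def)
  then have "V y = 0" if "y \<in> U" for y
    using unique_continuation[OF assms(1) o _ _ _ that] F0 assms(3) by blast
  then show False using assms(2) by blast
qed

end

section \<open>Parallel tangential gradients and plane slices\<close>

definition rot :: "real^'n \<Rightarrow> real^'n \<Rightarrow> real^'n \<Rightarrow> real^'n" where
  "rot a b x = (x \<bullet> a) *\<^sub>R b - (x \<bullet> b) *\<^sub>R a"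

lemma linear_rot [simp]: "linear (rot a b)"
  by (rule linearI) (simp_all add: rot_def inner_add_left algebra_simps scaleR_add_left)

lemma rot_perp: "x \<bullet> rot a b x = 0"
  by (simp add: rot_def inner_diff_right inner_commute mult.commute)

lemma ld_simps:
  assumes "f differentiable (at x)" "g differentiable (at x)"
  shows "ld A (\<lambda>y. f y + g y) x = ld A f x + ld A g x"
    "ld A (\<lambda>y. f y - g y) x = ld A f x - ld A g x"
    "ld A (\<lambda>y. f y * g y) x = f x * ld A g x + ld A f x * g x"
  using dd_simps[OF assms] by (simp_all add: ld_def)

lemma dd_divide:
  assumes "f differentiable (at x)" "g differentiable (at x)" "g x \<noteq> 0"
  shows "dd v (\<lambda>y. f y / g y) x = dd v f x / g x - f x * dd v g x / (g x)\<^sup>2"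
proof -
  have "((\<lambda>y. f y / g y) has_derivative (\<lambda>v. dd v f x / g x - f x * dd v g x / (g x)\<^sup>2)) (at x)"
    using has_derivative_dd[OF assms(1)] has_derivative_dd[OF assms(2)] assms(3)
    by (auto intro!: derivative_eq_intros simp: field_simps power2_eq_square)
  then show ?thesis by (rule dd_unique)
qed

lemma ld_id_commute:
  assumes "open U" "smooth_on f U" "x \<in> U" "linear A"
  shows "ld id (ld A f) x = ld A (ld id f) x"
  using ld_commutator[OF assms(1-3) linear_id' assms(4)] dd_lin(5)[OF smooth_diffble[OF assms(1-3)]] by simp

text \<open>Gronwall for the square of the solution, so that an upper bound of the coefficient is
  enough.\<close>

lemma linear_ode_zero:
  fixes \<phi> :: "real \<Rightarrow> real"
  assumes "\<phi> 0 = 0" "\<And>t. 0 \<le> t \<Longrightarrow> t \<le> 1 \<Longrightarrow> (\<phi> has_real_derivative k t * \<phi> t) (at t)"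
    and "\<And>t. 0 \<le> t \<Longrightarrow> t \<le> 1 \<Longrightarrow> k t \<le> K"
  shows "\<phi> 1 = 0"
proof -
  define w where "w t = (\<phi> t)\<^sup>2 * exp (- 2 * K * t)" for t
  have "w 1 \<le> w 0"
  proof (rule DERIV_nonpos_imp_nonincreasing[of 0 1 w])
    fix t :: real assume t: "0 \<le> t" "t \<le> 1"
    have "(w has_real_derivative 2 * (k t - K) * (\<phi> t)\<^sup>2 * exp (- 2 * K * t)) (at t)"
      unfolding w_def using assms(2)[OF t] by (auto intro!: derivative_eq_intros simp: algebra_simps power2_eq_square)
    then show "\<exists>y. DERIV w t :> y \<and> y \<le> 0"
      using assms(3)[OF t] by (intro exI conjI) (auto simp: mult_le_0_iff)
  qed simp
  then have "(\<phi> 1)\<^sup>2 * exp (- 2 * K) \<le> 0" using assms(1) by (simp add: w_def)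
  then show ?thesis by (simp add: mult_le_0_iff)
qed

section \<open>Commutators of rotations applied to the mixed equation\<close>

context sqs begin

abbreviation EV where "EV \<equiv> ld id V"
abbreviation Eu where "Eu \<equiv> ld id u"
text \<open>The factor of the logarithmic derivative of u in the mixed equation. Where it vanishes
  this equation says nothing about u, so its zeros have to be avoided later.\<close>

definition QQ where "QQ x = EV x + (n - 2) * V x"

lemma smooth_EV [smooth_intros]: "smooth_on EV U" "smooth_on Eu U" "smooth_on QQ U"
  unfolding QQ_def by (intro smooth_ld smooth_add smooth_mult smooth_const openU linear_id' sV su)+

lemma ld_EV: assumes "x \<in> U" "x \<bullet> A x = 0"
  shows "u x * ld A EV x = u x * ld A V x + ld A u x * QQ x"
  using static_mixed[OF assms] u_nonzero[OF assms(1)] by (simp add: ld_def[of A] QQ_def field_simps)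

text \<open>Apply \<open>B\<close> to the mixed equation for \<open>A\<close> and antisymmetrise.
  The commutator \<open>C\<close> is tangential too, so the mixed equation for \<open>C\<close>
  removes all second derivatives. What is left is \<open>2 * W1 + (n - 3) * W = 0\<close>, where
  \<open>W = 0\<close> is the claim and \<open>W1\<close> has \<open>EV\<close> in place of V. The
  mixed equation itself gives \<open>W1 = W\<close>, hence \<open>(n - 1) * W = 0\<close>.\<close>

lemma wedge: assumes "x \<in> U" "linear A" "linear B" "\<And>y. y \<bullet> A y = 0" "\<And>y. y \<bullet> B y = 0" "n > 1"
  shows "ld A u x * ld B V x = ld B u x * ld A V x"
proof -
  note sl = smooth_ld[OF openU]
  have d: "u differentiable (at x)" "V differentiable (at x)" "EV differentiable (at x)" "QQ differentiable (at x)"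
    by (intro diffble_U[OF _ assms(1)] su sV smooth_EV)+
  have dl: "ld C u differentiable (at x)" "ld C V differentiable (at x)" "ld C EV differentiable (at x)" if "linear C" for C
    by (intro diffble_U[OF _ assms(1)] sl that su sV smooth_EV)+
  have e: "ld B u x * ld A EV x + u x * ld B (ld A EV) x = ld B u x * ld A V x + u x * ld B (ld A V) x
      + ld B (ld A u) x * QQ x + ld A u x * (ld B EV x + (n - 2) * ld B V x)"
    if "linear A" "linear B" "\<And>y. y \<bullet> A y = 0" for A B
  proof -
    have Q: "ld B QQ x = ld B EV x + (n - 2) * ld B V x"
      unfolding QQ_def by (subst ld_simps | (intro diffble_U[OF _ assms(1)] smooth_mult smooth_const sV smooth_EV openU))+ (simp add: ld_def)
    have "ld B (\<lambda>y. u y * ld A EV y) x = ld B (\<lambda>y. u y * ld A V y + ld A u y * QQ y) x"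
      by (rule ld_cong_open[OF openU assms(1)]) (rule ld_EV, simp, rule that(3))
    then show ?thesis
      by (simp add: ld_simps d dl that diffble_U[OF smooth_mult[OF openU su sl[OF that(1) sV]] assms(1)]
          diffble_U[OF smooth_mult[OF openU sl[OF that(1) su] smooth_EV(3)] assms(1)] Q algebra_simps)
  qed
  define C where "C y = A (B y) - B (A y)" for y
  have Cp: "y \<bullet> C y = 0" for y
  proof -
    \<comment> \<open>Polarisation: a linear field tangential to all spheres is skew. The commutator
      of two skew maps is skew, hence tangential.\<close>
    have skew: "y \<bullet> D z = - (D y \<bullet> z)" if "linear D" "\<And>y. y \<bullet> D y = 0" for D y z
    proof -
      have "(y + z) \<bullet> D (y + z) = 0" using that(2) by blast
      then show ?thesis using that(2)[of y] that(2)[of z]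
        by (simp add: linear_add[OF that(1)] inner_add_left inner_add_right inner_commute)
    qed
    show ?thesis unfolding C_def
      using skew[OF assms(2,4), of y "B y"] skew[OF assms(3,5), of y "A y"] by (simp add: inner_diff_right inner_commute)
  qed
  have c: "ld B (ld A f) x - ld A (ld B f) x = dd (C x) f x" if "smooth_on f U" for f
    using ld_commutator[OF openU that assms(1) assms(3,2)] by (simp add: C_def)
  have g: "u x * dd (C x) EV x = u x * dd (C x) V x + dd (C x) u x * QQ x"
    using ld_EV[OF assms(1), of C] Cp by (simp add: ld_def[of C])
  define W where "W = ld A u x * ld B V x - ld B u x * ld A V x"
  define W1 where "W1 = ld A u x * ld B EV x - ld B u x * ld A EV x"
  have "u x * (ld B (ld A EV) x - ld A (ld B EV) x) = u x * (ld B (ld A V) x - ld A (ld B V) x)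
     + (ld B (ld A u) x - ld A (ld B u) x) * QQ x - W + W1 + (n - 2) * W + W1"
    using e[OF assms(2,3,4)] e[OF assms(3,2,5)] by (simp add: W_def W1_def algebra_simps)
  then have 1: "2 * W1 + (n - 3) * W = 0"
    unfolding c[OF su] c[OF sV] c[OF smooth_EV(1)] using g by (simp add: algebra_simps)
  have "u x * W1 = ld A u x * (u x * ld B EV x) - ld B u x * (u x * ld A EV x)" by (simp add: W1_def algebra_simps)
  also have "\<dots> = u x * W"
    unfolding ld_EV[OF assms(1), of B, OF assms(5)] ld_EV[OF assms(1), of A, OF assms(4)] by (simp add: W_def algebra_simps)
  finally have "W1 = W" using u_nonzero[OF assms(1)] by simp
  then have "(n - 1) * W = 0" using 1 by (simp add: algebra_simps)
  then show ?thesis using assms(6) by (simp add: W_def)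
qed

text \<open>\<open>E\<close> commutes with rotations and may be applied to \<open>wedge\<close>; the
  terms with \<open>EV\<close> cancel by the mixed equation and \<open>wedge\<close>.\<close>

lemma wedgeE: assumes "x \<in> U" "linear A" "linear B" "\<And>y. y \<bullet> A y = 0" "\<And>y. y \<bullet> B y = 0" "n > 1"
  shows "ld A Eu x * ld B V x = ld B Eu x * ld A V x"
proof -
  note sl = smooth_ld[OF openU]
  have dl: "ld C u differentiable (at x)" "ld C V differentiable (at x)" if "linear C" for C
    by (intro diffble_U[OF _ assms(1)] sl that su sV)+
  have "ld id (\<lambda>y. ld A u y * ld B V y) x = ld id (\<lambda>y. ld B u y * ld A V y) x"
    by (rule ld_cong_open[OF openU assms(1)]) (rule wedge[OF _ assms(2-6)])
  then have 1: "ld A u x * ld B EV x + ld A Eu x * ld B V x = ld B u x * ld A EV x + ld B Eu x * ld A V x"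
    by (simp add: ld_simps dl assms(2,3) ld_id_commute[OF openU _ assms(1)] su sV)
  have "u x * (ld A u x * ld B EV x) = u x * (ld B u x * ld A EV x)"
  proof -
    have "u x * (ld A u x * ld B EV x) - u x * (ld B u x * ld A EV x) = u x * (ld A u x * ld B V x - ld B u x * ld A V x)"
      using ld_EV[OF assms(1), of B, OF assms(5)] ld_EV[OF assms(1), of A, OF assms(4)] by algebra
    then show ?thesis using wedge[OF assms] by simp
  qed
  then show ?thesis using 1 u_nonzero[OF assms(1)] by simp
qed

text \<open>If one of the two derivatives of V is nonzero, the previous two relations combine. If
  both vanish, \<open>wedgeE\<close> is differentiated by \<open>E\<close> once more: then
  \<open>u * ld A EV = ld A u * QQ\<close>, and likewise for \<open>B\<close>, so the nonzero
  \<open>QQ\<close> can be cancelled.\<close>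

lemma wedgeEu: assumes "x \<in> U" "linear A" "linear B" "\<And>y. y \<bullet> A y = 0" "\<And>y. y \<bullet> B y = 0" "n > 1" "QQ x \<noteq> 0"
  shows "ld A Eu x * ld B u x = ld B Eu x * ld A u x"
proof -
  note w = wedge[OF assms(1-6)] and w' = wedgeE[OF assms(1-6)]
  consider "ld A V x \<noteq> 0" | "ld B V x \<noteq> 0" | "ld A V x = 0" "ld B V x = 0" by blast
  then show ?thesis
  proof cases
    case 1
    have "(ld A Eu x * ld B u x - ld B Eu x * ld A u x) * ld A V x = 0" using w w' by algebra
    then show ?thesis using 1 by simp
  next
    case 2
    have "(ld A Eu x * ld B u x - ld B Eu x * ld A u x) * ld B V x = 0" using w w' by algebra
    then show ?thesis using 2 by simp
  next
    case 3
    note sl = smooth_ld[OF openU]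
    have dl: "ld C Eu differentiable (at x)" "ld C V differentiable (at x)" if "linear C" for C
      by (intro diffble_U[OF _ assms(1)] sl that smooth_EV sV)+
    have "ld id (\<lambda>y. ld A Eu y * ld B V y) x = ld id (\<lambda>y. ld B Eu y * ld A V y) x"
      by (rule ld_cong_open[OF openU assms(1)]) (rule wedgeE[OF _ assms(2-6)])
    then have "ld A Eu x * ld B EV x = ld B Eu x * ld A EV x"
      using 3 by (simp add: ld_simps dl assms(2,3) ld_id_commute[OF openU sV assms(1)])
    then have "(ld A Eu x * ld B u x - ld B Eu x * ld A u x) * QQ x = 0"
      using ld_EV[OF assms(1), of B, OF assms(5)] ld_EV[OF assms(1), of A, OF assms(4)] 3 by algebra
    then show ?thesis using assms(7) by simp
  qed
qed

end

text \<open>By \<open>pplane\<close> and \<open>dup\<close> the plane spanned by \<open>a\<close>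
  and \<open>b\<close> contains \<open>p\<close> and the gradient of u at \<open>p\<close>;
  \<open>e0\<close> is one unit normal of the plane. On the convex set \<open>B\<close> every later
  divisor is nonzero: V, the \<open>S\<close>-derivatives of u and of u V, and
  \<open>QQ\<close>.\<close>

locale slice = sqs U u V n for U :: "(real^'n::finite) set" and u V n +
  fixes B :: "(real^'n) set" and a b e0 p :: "real^'n"
  assumes openB: "open B" and convB: "convex B" and BU: "B \<subseteq> U" and pB: "p \<in> B" and n1: "n > 1"
    and ab: "a \<bullet> a = 1" "b \<bullet> b = 1" "a \<bullet> b = 0" and e0: "e0 \<bullet> e0 = 1" "e0 \<bullet> a = 0" "e0 \<bullet> b = 0"
    and pplane: "\<And>e. e \<bullet> a = 0 \<Longrightarrow> e \<bullet> b = 0 \<Longrightarrow> p \<bullet> e = 0"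
    and dup: "\<And>e. e \<bullet> a = 0 \<Longrightarrow> e \<bullet> b = 0 \<Longrightarrow> dd e u p = 0"
    and V0: "\<And>x. x \<in> B \<Longrightarrow> V x \<noteq> 0" and Su0: "\<And>x. x \<in> B \<Longrightarrow> ld (rot a b) u x \<noteq> 0"
    and Sh0: "\<And>x. x \<in> B \<Longrightarrow> u x * ld (rot a b) V x + V x * ld (rot a b) u x \<noteq> 0"
    and Q0: "\<And>x. x \<in> B \<Longrightarrow> QQ x \<noteq> 0"
begin

abbreviation S where "S \<equiv> ld (rot a b)"
abbreviation A where "A \<equiv> rot a b"
definition Pl where "Pl = {x. \<forall>e. e \<bullet> a = 0 \<longrightarrow> e \<bullet> b = 0 \<longrightarrow> x \<bullet> e = 0}"
definition PP where "PP = B \<inter> Pl"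

lemma xU: "x \<in> PP \<Longrightarrow> x \<in> U" "x \<in> B \<Longrightarrow> x \<in> U" using BU by (auto simp: PP_def)

lemma smooth_B [smooth_intros]: "smooth_on u B" "smooth_on V B" "smooth_on EV B" "smooth_on Eu B" "smooth_on om B"
  by (intro smooth_on_subset[OF _ BU openB openU] su sV smooth_EV smooth_coefficients)+

lemmas diffble_B = smooth_diffble[OF openB]

lemma ba: "b \<bullet> a = 0" "a \<bullet> e0 = 0" "b \<bullet> e0 = 0" using ab e0 by (simp_all add: inner_commute)

section \<open>The plane and differentiation along it\<close>

lemma Pl_eq: "x \<in> Pl \<longleftrightarrow> x = (x \<bullet> a) *\<^sub>R a + (x \<bullet> b) *\<^sub>R b"
proof
  assume x: "x \<in> Pl"
  define r where "r = x - ((x \<bullet> a) *\<^sub>R a + (x \<bullet> b) *\<^sub>R b)"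
  have r: "r \<bullet> a = 0" "r \<bullet> b = 0" using ab ba by (simp_all add: r_def inner_diff_left inner_add_left)
  then have "x \<bullet> r = 0" using x by (simp add: Pl_def)
  then have "r \<bullet> r = 0" using r by (subst r_def) (simp add: inner_diff_left inner_add_left inner_commute[of a r] inner_commute[of b r])
  then show "x = (x \<bullet> a) *\<^sub>R a + (x \<bullet> b) *\<^sub>R b" by (simp add: r_def)
next
  assume x: "x = (x \<bullet> a) *\<^sub>R a + (x \<bullet> b) *\<^sub>R b"
  have "x \<bullet> e = 0" if "e \<bullet> a = 0" "e \<bullet> b = 0" for e
  proof -
    have "x \<bullet> e = ((x \<bullet> a) *\<^sub>R a + (x \<bullet> b) *\<^sub>R b) \<bullet> e" by (rule arg_cong[OF x, of "\<lambda>v. v \<bullet> e"])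
    also have "\<dots> = 0" using that by (simp add: inner_add_left inner_commute[of a e] inner_commute[of b e])
    finally show ?thesis .
  qed
  then show "x \<in> Pl" by (simp add: Pl_def)
qed

lemma Pl_sub: "x \<in> Pl \<Longrightarrow> y \<in> Pl \<Longrightarrow> x + t *\<^sub>R y \<in> Pl"
  by (simp add: Pl_def inner_add_left)

lemma A_Pl: "A x \<in> Pl"
  by (auto simp: Pl_def rot_def inner_diff_left inner_commute[of a] inner_commute[of b])

lemma plane_line: assumes "x \<in> PP" "v \<in> Pl"
  shows "\<forall>\<^sub>F t in nhds 0. x + t *\<^sub>R v \<in> PP"
proof -
  have "((\<lambda>t. x + t *\<^sub>R v) \<longlongrightarrow> x + 0 *\<^sub>R v) (nhds 0)" by (intro tendsto_intros filterlim_ident)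
  then have "\<forall>\<^sub>F t in nhds 0. x + t *\<^sub>R v \<in> B"
    using topological_tendstoD[OF _ openB, of "\<lambda>t. x + t *\<^sub>R v"] assms by (simp add: PP_def)
  then show ?thesis using assms Pl_sub by (auto simp: PP_def elim!: eventually_mono)
qed

text \<open>Many identities below hold only on the slice; this allows them to be differentiated in
  the directions of the plane.\<close>

lemma plane_DERIV: assumes "x \<in> PP" "v \<in> Pl" "f differentiable (at x)"
    and "\<And>z. z \<in> PP \<Longrightarrow> f z = g z" "((\<lambda>t. g (x + t *\<^sub>R v)) has_real_derivative D) (at 0)"
  shows "dd v f x = D"
proof (rule dd_line_eq[OF assms(3)])
  have "\<forall>\<^sub>F t in nhds 0. g (x + t *\<^sub>R v) = f (x + t *\<^sub>R v)"
    using plane_line[OF assms(1,2)] by (rule eventually_mono) (use assms(4) in auto)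
  then show "((\<lambda>t. f (x + t *\<^sub>R v)) has_real_derivative D) (at 0)"
    using DERIV_cong_ev[OF refl _ refl, of "\<lambda>t. g (x + t *\<^sub>R v)" "\<lambda>t. f (x + t *\<^sub>R v)" 0 D] assms(5) by simp
qed

lemma plane_dd: assumes "x \<in> PP" "v \<in> Pl" "f differentiable (at x)" "g differentiable (at x)"
    and "\<And>z. z \<in> PP \<Longrightarrow> f z = g z"
  shows "dd v f x = dd v g x"
  using plane_DERIV[OF assms(1-3,5)] has_real_derivative_line[of g x 0 v] assms(4) by simp

definition perp where "perp e \<longleftrightarrow> e \<bullet> a = 0 \<and> e \<bullet> b = 0"

lemma perp_x: "x \<in> PP \<Longrightarrow> perp e \<Longrightarrow> x \<bullet> e = 0" by (auto simp: PP_def Pl_def perp_def)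

lemma rot_rot: "x \<in> Pl \<Longrightarrow> A (A x) = - x"
proof -
  assume "x \<in> Pl"
  then have x: "(x \<bullet> a) *\<^sub>R a + (x \<bullet> b) *\<^sub>R b = x" using Pl_eq by metis
  have "A (A x) = - ((x \<bullet> a) *\<^sub>R a + (x \<bullet> b) *\<^sub>R b)"
    using ab ba by (simp add: rot_def inner_diff_left)
  then show ?thesis unfolding x .
qed

lemma rot_norm: "x \<in> Pl \<Longrightarrow> A x \<bullet> A x = x \<bullet> x"
proof -
  assume "x \<in> Pl"
  then have "x \<bullet> x = ((x \<bullet> a) *\<^sub>R a + (x \<bullet> b) *\<^sub>R b) \<bullet> x" using Pl_eq by metis
  also have "\<dots> = (x \<bullet> a) * (x \<bullet> a) + (x \<bullet> b) * (x \<bullet> b)"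
    by (simp only: inner_add_left inner_scaleR_left inner_commute[of a x] inner_commute[of b x])
  finally show ?thesis using ab ba by (simp add: rot_def inner_diff_left inner_diff_right)
qed

lemma plane_split: assumes "x \<in> PP" "v \<in> Pl"
  shows "v = ((v \<bullet> x) / (x \<bullet> x)) *\<^sub>R x + ((v \<bullet> A x) / (x \<bullet> x)) *\<^sub>R A x"
proof -
  define \<alpha> \<beta> s t where d: "\<alpha> = x \<bullet> a" "\<beta> = x \<bullet> b" "s = v \<bullet> a" "t = v \<bullet> b"
  have x: "x = \<alpha> *\<^sub>R a + \<beta> *\<^sub>R b" and v: "v = s *\<^sub>R a + t *\<^sub>R b"
    using assms Pl_eq[of x] Pl_eq[of v] unfolding PP_def d by blast+
  have Ax: "A x = \<alpha> *\<^sub>R b - \<beta> *\<^sub>R a" by (simp add: rot_def d)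
  have R: "x \<bullet> x = \<alpha>\<^sup>2 + \<beta>\<^sup>2" unfolding x using ab by (simp add: inner_add_left inner_add_right inner_commute power2_eq_square)
  have R0': "\<alpha>\<^sup>2 + \<beta>\<^sup>2 \<noteq> 0" using R0[OF xU(1)[OF assms(1)]] R by simp
  have vx: "v \<bullet> x = s * \<alpha> + t * \<beta>" "v \<bullet> A x = t * \<alpha> - s * \<beta>"
    unfolding Ax using ab by (simp_all add: v x inner_add_left inner_add_right inner_diff_right inner_commute)
  have "(x \<bullet> x) *\<^sub>R v = (v \<bullet> x) *\<^sub>R x + (v \<bullet> A x) *\<^sub>R A x"
    unfolding vx R Ax by (subst v, subst x) (simp add: algebra_simps power2_eq_square d(3,4)[symmetric])
  then have "(1 / (x \<bullet> x)) *\<^sub>R ((x \<bullet> x) *\<^sub>R v) = (1 / (x \<bullet> x)) *\<^sub>R ((v \<bullet> x) *\<^sub>R x + (v \<bullet> A x) *\<^sub>R A x)" by simp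
  then show ?thesis using R0[OF xU(1)[OF assms(1)]] by (simp add: scaleR_add_right)
qed

text \<open>At a point \<open>x\<close>, the field \<open>rot x X\<close> is a multiple of a given tangent vector \<open>X\<close>.\<close>

lemma wedge_dd: assumes "x \<in> U" "x \<bullet> X = 0" "x \<bullet> Y = 0" shows "dd X u x * dd Y V x = dd Y u x * dd X V x"
proof -
  have l: "ld (rot x X) f x = (x \<bullet> x) * dd X f x" if "x \<bullet> X = 0" "f differentiable (at x)" for X f
    using that by (simp add: ld_def rot_def dd_lin)
  have "(x \<bullet> x) * dd X u x * ((x \<bullet> x) * dd Y V x) = (x \<bullet> x) * dd Y u x * ((x \<bullet> x) * dd X V x)"
    using wedge[OF assms(1) linear_rot linear_rot rot_perp rot_perp n1, of x X x Y] l[OF assms(2)] l[OF assms(3)] diffble_U[OF su assms(1)] diffble_U[OF sV assms(1)] by simp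
  then show ?thesis using R0[OF assms(1)] by simp
qed

lemma wedgeEu_dd: assumes "x \<in> B" "x \<bullet> X = 0" "x \<bullet> Y = 0" shows "dd X Eu x * dd Y u x = dd Y Eu x * dd X u x"
proof -
  have xU': "x \<in> U" using assms BU by blast
  have l: "ld (rot x X) f x = (x \<bullet> x) * dd X f x" if "x \<bullet> X = 0" "f differentiable (at x)" for X f
    using that by (simp add: ld_def rot_def dd_lin)
  have "(x \<bullet> x) * dd X Eu x * ((x \<bullet> x) * dd Y u x) = (x \<bullet> x) * dd Y Eu x * ((x \<bullet> x) * dd X u x)"
    using wedgeEu[OF xU' linear_rot linear_rot rot_perp rot_perp n1 Q0[OF assms(1)], of x X x Y] l[OF assms(2)] l[OF assms(3)] diffble_U[OF su xU'] diffble_U[OF smooth_EV(2) xU'] by simp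
  then show ?thesis using R0[OF xU'] by simp
qed

text \<open>\<open>GG\<close> is the factor of proportionality between the tangential gradients of V
  and u; \<open>k1\<close> and \<open>k2\<close> are the coefficients of linear equations for the
  normal derivatives of u along \<open>E\<close> and \<open>S\<close>.\<close>

definition GG where "GG x = S V x / S u x"
definition k1 where "k1 x = S Eu x / S u x - 1"
definition k2 where "k2 x = - (u x * S GG x / (u x * GG x + V x))"

lemma GG_h: "x \<in> B \<Longrightarrow> u x * GG x + V x \<noteq> 0"
  using Sh0[of x] Su0[of x] by (simp add: GG_def field_simps)

lemma smooth_slice_aux [smooth_intros]: "smooth_on (S u) B" "smooth_on (S V) B" "smooth_on GG B" "smooth_on k1 B" "smooth_on k2 B"
proof -
  show 1: "smooth_on (S u) B" "smooth_on (S V) B" by (intro smooth_ld openB linear_rot smooth_B)+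
  show 2: "smooth_on GG B" unfolding GG_def by (intro smooth_divide openB 1 Su0)
  show "smooth_on k1 B" unfolding k1_def by (intro smooth_divide smooth_diff smooth_const smooth_ld openB linear_rot 1 Su0 smooth_B)
  show "smooth_on k2 B" unfolding k2_def
    by (intro smooth_minus smooth_divide smooth_mult smooth_add smooth_ld linear_rot openB smooth_B 2 GG_h)
qed

section \<open>Vanishing of the normal derivatives on the slice\<close>

lemma ddV_GG: "x \<in> PP \<Longrightarrow> perp e \<Longrightarrow> dd e V x = GG x * dd e u x"
  using wedge_dd[OF xU(1) perp_x rot_perp, of x e a b] Su0[of x] by (simp add: GG_def ld_def PP_def field_simps)

lemma dd_e_x: assumes "x \<in> U" "smooth_on f U" shows "dd e (ld id f) x = dd x (dd e f) x + dd e f x"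
  using dd_ld[OF openU assms(2,1) linear_id', of e] dd_commute[OF openU assms(2,1), of e x] by simp

text \<open>The tangential gradients of \<open>Eu\<close> and u are parallel, so their normal
  components are in the ratio of their \<open>S\<close>-derivatives.\<close>

lemma y_ode1: assumes "x \<in> PP" "perp e" shows "dd x (dd e u) x = k1 x * dd e u x"
proof -
  have "dd e Eu x * S u x = S Eu x * dd e u x"
    using wedgeEu_dd[OF _ perp_x rot_perp, of x e a b] assms by (simp add: ld_def PP_def)
  then show ?thesis using dd_e_x[OF xU(1)[OF assms(1)] su, of e] Su0[of x] assms(1) by (simp add: k1_def PP_def field_simps)
qed

text \<open>\<open>A x\<close> and \<open>e\<close> are orthogonal, so the tangential static
  equation for this pair has right hand side 0. Inserting \<open>dd e V = GG * dd e u\<close>,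
  differentiated along the slice, leaves a linear homogeneous equation for
  \<open>dd e u\<close>.\<close>

lemma y_ode2: assumes "x \<in> PP" "perp e" shows "dd (A x) (dd e u) x = k2 x * dd e u x"
proof -
  have xB: "x \<in> B" using assms by (simp add: PP_def)
  have d: "dd e u differentiable (at x)" "dd e V differentiable (at x)" "GG differentiable (at x)"
    by (intro diffble_B[OF _ xB] smooth_dd smooth_slice_aux smooth_B openB)+
  have "dd (A x) (dd e V) x = dd (A x) (\<lambda>z. GG z * dd e u z) x"
    by (rule plane_dd[OF assms(1) A_Pl d(2)]) (auto intro!: diffble_B[OF _ xB] smooth_mult smooth_dd smooth_slice_aux smooth_B openB ddV_GG assms(2))
  also have "\<dots> = GG x * dd (A x) (dd e u) x + S GG x * dd e u x"
    by (subst dd_simps[OF d(3,1)]) (simp add: ld_def)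
  finally have 1: "dd (A x) (dd e V) x = GG x * dd (A x) (dd e u) x + S GG x * dd e u x" .
  have "A x \<bullet> e = 0" using assms(2)
    by (simp add: rot_def perp_def inner_diff_left inner_commute[of a e] inner_commute[of b e])
  then have "u x * dd (A x) (dd e V) x + V x * dd (A x) (dd e u) x = 0"
    using static_tangential[OF xU(1)[OF assms(1)] rot_perp perp_x[OF assms]] by simp
  then have "(u x * GG x + V x) * dd (A x) (dd e u) x = - (u x * S GG x * dd e u x)" unfolding 1 by (simp add: algebra_simps)
  then show ?thesis using GG_h[OF xB] by (simp add: k2_def field_simps)
qed

text \<open>Along the segment from \<open>p\<close> to \<open>x\<close> the normal derivative solves
  a linear homogeneous equation, by \<open>y_ode1\<close> and \<open>y_ode2\<close>, and it vanishes
  at \<open>p\<close>. So the gradient of u lies in the plane on the whole slice.\<close>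

lemma dd_perp_u: assumes "x \<in> PP" "perp e" shows "dd e u x = 0"
proof -
  define v where "v = x - p"
  have pPl: "p \<in> Pl" using pplane by (simp add: Pl_def)
  have vPl: "v \<in> Pl" using assms pPl by (simp add: v_def Pl_def PP_def inner_diff_left)
  have seg: "p + t *\<^sub>R v \<in> PP" if "0 \<le> t" "t \<le> 1" for t
  proof -
    have "p + t *\<^sub>R v = (1 - t) *\<^sub>R p + t *\<^sub>R x" by (simp add: v_def algebra_simps)
    then have "p + t *\<^sub>R v \<in> B" using convB pB assms(1) that by (simp add: PP_def convex_alt)
    then show ?thesis using Pl_sub[OF pPl vPl] by (simp add: PP_def)
  qed
  define k where "k z = (z \<bullet> v) / (z \<bullet> z) * k1 z + ((z \<bullet> a) * (b \<bullet> v) - (z \<bullet> b) * (a \<bullet> v)) / (z \<bullet> z) * k2 z" for z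
  have "smooth_on k B" unfolding k_def
    by (intro smooth_add smooth_mult smooth_divide smooth_diff smooth_const smooth_inner smooth_norm2 smooth_slice_aux openB R0 xU)
  then have cB: "continuous_on B k" by (rule smooth_continuous)
  have "continuous_on {0..1} (\<lambda>t. k (p + t *\<^sub>R v))"
    by (rule continuous_on_compose2[OF cB]) (use seg in \<open>auto intro!: continuous_intros simp: PP_def\<close>)
  then have "bounded ((\<lambda>t. k (p + t *\<^sub>R v)) ` {0..1})" by (intro compact_imp_bounded compact_continuous_image compact_Icc)
  then obtain K where "\<forall>y\<in>(\<lambda>t. k (p + t *\<^sub>R v)) ` {0..1}. norm y \<le> K" unfolding bounded_iff by blast
  then have K: "\<bar>k (p + t *\<^sub>R v)\<bar> \<le> K" if "0 \<le> t" "t \<le> 1" for t using that by simp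
  have "dd e u (p + 1 *\<^sub>R v) = 0"
  proof (rule linear_ode_zero[where \<phi>="\<lambda>t. dd e u (p + t *\<^sub>R v)" and k="\<lambda>t. k (p + t *\<^sub>R v)" and K=K])
    show "dd e u (p + 0 *\<^sub>R v) = 0" using dup assms(2) by (simp add: perp_def)
    fix t :: real assume t: "0 \<le> t" "t \<le> 1"
    define z where "z = p + t *\<^sub>R v"
    have z: "z \<in> PP" using seg[OF t] by (simp add: z_def)
    have d: "dd e u differentiable (at z)" using z by (intro diffble_B smooth_dd openB smooth_B) (simp add: PP_def)
    have "dd v (dd e u) z = dd (((v \<bullet> z) / (z \<bullet> z)) *\<^sub>R z + ((v \<bullet> A z) / (z \<bullet> z)) *\<^sub>R A z) (dd e u) z"
      using plane_split[OF z vPl] by simp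
    also have "\<dots> = k z * dd e u z"
      unfolding dd_lin[OF d] y_ode1[OF z assms(2)] y_ode2[OF z assms(2)]
      by (simp add: k_def rot_def inner_diff_right inner_commute algebra_simps)
    finally show "((\<lambda>t. dd e u (p + t *\<^sub>R v)) has_real_derivative k (p + t *\<^sub>R v) * dd e u (p + t *\<^sub>R v)) (at t)"
      using has_real_derivative_line[of "dd e u" p t v] d by (simp add: z_def)
    show "k (p + t *\<^sub>R v) \<le> K" using K[OF t] by simp
  qed
  then show ?thesis by (simp add: v_def)
qed

lemma dd_perp_V: "x \<in> PP \<Longrightarrow> perp e \<Longrightarrow> dd e V x = 0" using ddV_GG dd_perp_u by simp

lemma dd_perp_Eu: assumes "x \<in> PP" "perp e" shows "dd e Eu x = 0"
  using wedgeEu_dd[OF _ perp_x[OF assms] rot_perp, of a b] dd_perp_u[OF assms] Su0[of x] assms(1) by (simp add: ld_def PP_def)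

text \<open>For tangential \<open>e\<close> this is the Hessian on the unit sphere, evaluated on
  \<open>e\<close>; the radial term is due to the curvature of the sphere in R^n. It commutes with
  \<open>E\<close> and, for normal \<open>e\<close>, with \<open>S\<close>.\<close>

definition tau where "tau e f x = (x \<bullet> x) * dd e (dd e f) x - (e \<bullet> e) * ld id f x"

lemma sm_tau [smooth_intros]: "smooth_on f U \<Longrightarrow> smooth_on (tau e f) U"
  unfolding tau_def by (intro smooth_diff smooth_mult smooth_norm2 smooth_dd smooth_const smooth_ld linear_id' openU)

lemma dd_S: assumes "x \<in> U" "smooth_on f U" "perp e" shows "dd e (S f) x = S (dd e f) x"
proof -
  have "A e = 0" using assms(3) by (simp add: rot_def perp_def)
  then show ?thesis using dd_ld[OF openU assms(2,1) linear_rot, of e a b] dd_commute[OF openU assms(2,1), of e "A x"]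
    dd_lin(5)[OF diffble_U[OF assms(2,1)]] by (simp add: ld_def[of A "dd e f"])
qed

lemma tau_S: assumes "x \<in> U" "smooth_on f U" "perp e" shows "tau e (S f) x = S (tau e f) x"
proof -
  have sf: "smooth_on (S f) U" by (intro smooth_ld openU linear_rot assms)
  have "dd e (dd e (S f)) x = dd e (S (dd e f)) x"
    by (rule dd_cong_open[OF openU assms(1)]) (rule dd_S[OF _ assms(2,3)])
  also have "\<dots> = S (dd e (dd e f)) x" by (rule dd_S[OF assms(1) smooth_dd[OF openU assms(2)] assms(3)])
  finally have 1: "dd e (dd e (S f)) x = S (dd e (dd e f)) x" .
  have "S (tau e f) x = (x \<bullet> x) * S (dd e (dd e f)) x - (e \<bullet> e) * S (ld id f) x"
    unfolding tau_def
    by (subst ld_simps | (intro diffble_U[OF _ assms(1)] smooth_mult smooth_norm2 smooth_dd smooth_const smooth_ld linear_id' openU assms))+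
      (simp add: ld_def[of A "\<lambda>y. y \<bullet> y"] ld_def[of A "\<lambda>y. e \<bullet> e"] rot_perp)
  then show ?thesis unfolding tau_def[of e "S f"] 1 ld_id_commute[OF openU assms(2,1) linear_rot] by simp
qed

lemma tau_E: assumes "x \<in> U" "smooth_on f U" shows "tau e (ld id f) x = ld id (tau e f) x"
proof -
  have "dd e (dd e (ld id f)) x = dd e (\<lambda>y. ld id (dd e f) y + dd e f y) x"
    by (rule dd_cong_open[OF openU assms(1)]) (simp add: dd_e_x[OF _ assms(2)] ld_def)
  also have "\<dots> = dd e (ld id (dd e f)) x + dd e (dd e f) x"
    by (subst dd_simps | (intro diffble_U[OF _ assms(1)] smooth_dd smooth_ld linear_id' openU assms))+ simp
  also have "dd e (ld id (dd e f)) x = dd x (dd e (dd e f)) x + dd e (dd e f) x"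
    by (rule dd_e_x[OF assms(1) smooth_dd[OF openU assms(2)]])
  finally have 1: "dd e (dd e (ld id f)) x = dd x (dd e (dd e f)) x + 2 * dd e (dd e f) x" by linarith
  have "ld id (tau e f) x = (x \<bullet> x) * dd x (dd e (dd e f)) x + 2 * (x \<bullet> x) * dd e (dd e f) x - (e \<bullet> e) * ld id (ld id f) x"
    unfolding tau_def
    by (subst ld_simps | (intro diffble_U[OF _ assms(1)] smooth_mult smooth_norm2 smooth_dd smooth_const smooth_ld linear_id' openU assms))+
      (simp add: ld_def)
  then show ?thesis unfolding tau_def[of e "ld id f"] 1 by (simp add: algebra_simps)
qed

text \<open>Rotations between the plane and \<open>e\<close> turn a second derivative along
  \<open>e\<close> into the \<open>e\<close>-derivative of a first order operator. Relations known
  for all rotations on an open set can thus be differentiated once to reach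
  \<open>tau\<close>.\<close>

lemma mixed: assumes "x \<in> PP" "perp e" "smooth_on T U"
  shows "(x \<bullet> a) * dd e (ld (rot a e) T) x + (x \<bullet> b) * dd e (ld (rot b e) T) x = tau e T x"
    "ld (rot a e) T x = (x \<bullet> a) * dd e T x" "ld (rot b e) T x = (x \<bullet> b) * dd e T x"
proof -
  note xU' = xU(1)[OF assms(1)]
  have d: "T differentiable (at x)" "dd e T differentiable (at x)" by (intro diffble_U[OF _ xU'] smooth_dd openU assms)+
  have r: "rot c e x = (x \<bullet> c) *\<^sub>R e" for c using perp_x[OF assms(1,2)] by (simp add: rot_def)
  have re: "rot a e e = - ((e \<bullet> e) *\<^sub>R a)" "rot b e e = - ((e \<bullet> e) *\<^sub>R b)" using assms(2) by (simp_all add: rot_def perp_def)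
  have sc: "dd e (dd (c *\<^sub>R e) T) x = c * dd e (dd e T) x" for c
    using dd_commute[OF openU assms(3) xU', of e "c *\<^sub>R e"] dd_lin(3)[OF d(2), of c e] by simp
  have x0: "x = (x \<bullet> a) *\<^sub>R a + (x \<bullet> b) *\<^sub>R b" using assms(1) Pl_eq[of x] unfolding PP_def by blast
  have x: "dd x T x = (x \<bullet> a) * dd a T x + (x \<bullet> b) * dd b T x" "x \<bullet> x = (x \<bullet> a) * (x \<bullet> a) + (x \<bullet> b) * (x \<bullet> b)"
    using arg_cong[OF x0, of "\<lambda>v. dd v T x"] arg_cong[OF x0, of "\<lambda>v. x \<bullet> v"]
    by (simp_all only: dd_lin[OF d(1)] inner_add_right inner_scaleR_right)
  show "(x \<bullet> a) * dd e (ld (rot a e) T) x + (x \<bullet> b) * dd e (ld (rot b e) T) x = tau e T x"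
    unfolding dd_ld[OF openU assms(3) xU' linear_rot] r re sc tau_def dd_lin[OF d(1)]
    by (simp add: ld_def x algebra_simps)
  show "ld (rot a e) T x = (x \<bullet> a) * dd e T x" "ld (rot b e) T x = (x \<bullet> b) * dd e T x"
    by (simp_all add: ld_def r dd_lin[OF d(1)])
qed

text \<open>Differentiating a parallelism relation along \<open>e\<close>, at a point where both
  \<open>e\<close>-derivatives vanish, leaves only second derivatives; the combination with weights
  \<open>x \<bullet> a\<close> and \<open>x \<bullet> b\<close> is \<open>tau\<close>.\<close>

lemma wedge_tau: assumes "x \<in> PP" "perp e" "W \<subseteq> U" "open W" "x \<in> W" "smooth_on f U" "smooth_on g U" "smooth_on f1 U" "smooth_on g1 U"
    and w: "\<And>c y. y \<in> W \<Longrightarrow> ld (rot c e) f y * g1 y = ld (rot c e) g y * f1 y"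
    and z: "dd e f x = 0" "dd e g x = 0"
  shows "tau e f x * g1 x = tau e g x * f1 x"
proof -
  note xU' = xU(1)[OF assms(1)]
  have *: "dd e (ld (rot c e) f) x * g1 x = dd e (ld (rot c e) g) x * f1 x" if "c = a \<or> c = b" for c
  proof -
    have "dd e (\<lambda>y. ld (rot c e) f y * g1 y) x = dd e (\<lambda>y. ld (rot c e) g y * f1 y) x"
      by (rule dd_cong_open[OF assms(4,5)]) (rule w)
    moreover have "ld (rot c e) f x = 0" "ld (rot c e) g x = 0"
      using that mixed(2,3)[OF assms(1,2,6)] mixed(2,3)[OF assms(1,2,7)] z by auto
    moreover have "dd e (\<lambda>y. ld (rot c e) f y * g1 y) x = ld (rot c e) f x * dd e g1 x + dd e (ld (rot c e) f) x * g1 x"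
      by (rule dd_simps) (intro diffble_U[OF _ xU'] smooth_ld openU linear_rot assms)+
    moreover have "dd e (\<lambda>y. ld (rot c e) g y * f1 y) x = ld (rot c e) g x * dd e f1 x + dd e (ld (rot c e) g) x * f1 x"
      by (rule dd_simps) (intro diffble_U[OF _ xU'] smooth_ld openU linear_rot assms)+
    ultimately show ?thesis by simp
  qed
  have "tau e f x * g1 x = (x \<bullet> a) * (dd e (ld (rot a e) f) x * g1 x) + (x \<bullet> b) * (dd e (ld (rot b e) f) x * g1 x)"
    unfolding mixed(1)[OF assms(1,2,6), symmetric] by (simp add: algebra_simps)
  also have "\<dots> = tau e g x * f1 x"
    unfolding mixed(1)[OF assms(1,2,7), symmetric] *[of a, simplified] *[of b, simplified] by (simp add: algebra_simps)
  finally show ?thesis .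
qed

lemma tau_V: assumes "x \<in> PP" "perp e" shows "tau e V x * S u x = tau e u x * S V x"
proof (rule wedge_tau[OF assms order_refl openU xU(1)[OF assms(1)] sV su])
  show "ld (rot c e) V y * S u y = ld (rot c e) u y * S V y" if "y \<in> U" for c y
    using wedge[OF that linear_rot linear_rot rot_perp rot_perp n1, of a b c e] by (simp add: mult.commute)
qed (intro smooth_ld openU linear_rot su sV dd_perp_V dd_perp_u assms)+

lemma tau_Eu: assumes "x \<in> PP" "perp e" shows "tau e Eu x * S u x = tau e u x * S Eu x"
proof (rule wedge_tau[OF assms BU openB _ smooth_EV(2) su])
  show "ld (rot c e) Eu y * S u y = ld (rot c e) u y * S Eu y" if "y \<in> B" for c y
    using wedgeEu[OF xU(2)[OF that] linear_rot linear_rot rot_perp rot_perp n1 Q0[OF that], of c e a b] by (simp add: mult.commute)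
  show "x \<in> B" using assms by (simp add: PP_def)
qed (intro smooth_ld openU linear_rot su smooth_EV dd_perp_Eu dd_perp_u assms)+

end

section \<open>Polynomial relations on a slice\<close>

text \<open>On a slice, with \<open>N = n - 1\<close>, \<open>X = Y + Z\<close> and \<open>d = Z - Y\<close>, the functions \<open>sX\<close>, \<open>sd\<close>, \<open>sw\<close>, \<open>sl\<close> are the
  \<open>S\<close>-derivatives of \<open>X\<close>, \<open>d\<close>, \<open>\<omega>\<close> and of an auxiliary unknown \<open>l\<close>, while \<open>pAX\<close>, \<open>pAd\<close>, \<open>pEl\<close> are \<open>\<omega>\<close> times
  the \<open>E\<close>-derivatives of \<open>X\<close>, \<open>d\<close>, \<open>l\<close>; a prime marks an \<open>S\<close>-derivative. The relation \<open>pPhi = 0\<close> is the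
  identity \<open>[E, S] X = 0\<close>, and \<open>pF2\<close>, \<open>pF3\<close> are \<open>S pPhi\<close> and \<open>\<omega> E pPhi\<close>.\<close>

definition pS3 :: "real \<Rightarrow> real \<Rightarrow> real" where "pS3 X d = X^3 + 3*X\<^sup>2*d + X*d\<^sup>2 - d^3"

definition pPhi :: "real \<Rightarrow> real \<Rightarrow> real \<Rightarrow> real \<Rightarrow> real \<Rightarrow> real \<Rightarrow> real" where
  "pPhi N X d w c l = N*l*(w-l) - l*d\<^sup>2 + w*((N/2+1)*d\<^sup>2 - N*X*d - N/2*X\<^sup>2)
     + ((3*N+1)/2*X\<^sup>2 + 3*N*X*d + (N-3)/2*d\<^sup>2) + c/2*pS3 X d"

definition pPhi' :: "real \<Rightarrow> real \<Rightarrow> real \<Rightarrow> real \<Rightarrow> real \<Rightarrow> real \<Rightarrow> real \<Rightarrow> real \<Rightarrow> real \<Rightarrow> real \<Rightarrow> real \<Rightarrow> real" where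
  "pPhi' N X d w c l X' d' w' c' l' = N*l'*(w-l) + N*l*(w'-l') - l'*d\<^sup>2 - 2*l*d*d'
     + w'*((N/2+1)*d\<^sup>2 - N*X*d - N/2*X\<^sup>2) + w*((N+2)*d*d' - N*(X'*d + X*d') - N*X*X')
     + ((3*N+1)*X*X' + 3*N*(X'*d + X*d') + (N-3)*d*d') + c'/2*pS3 X d
     + c/2*(3*X\<^sup>2*X' + 6*X*X'*d + 3*X\<^sup>2*d' + X'*d\<^sup>2 + 2*X*d*d' - 3*d\<^sup>2*d')"

definition "sX X d c = - (X\<^sup>2 + d\<^sup>2)/2 - c*(X::real)"
definition "sd N X d c l = N*l - (X+c)*(d::real)"
definition "sw X d w = - w*(X+(d::real))"
definition "sl N X d w c l = (w-1)*(N*X-d) - l*X + c*N*l + c*(d\<^sup>2-X\<^sup>2)/(2::real)"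
definition "pAX N X d w c l = (w-1)*(N*X-d) + l*d - d - c*(X\<^sup>2+d\<^sup>2)/(2::real)"
definition "pAd N X d c = - N*X - (N-1)*d - c*X\<^sup>2/2 - c*X*d + c*d\<^sup>2/(2::real)"
definition "pAX' N X d w c l = (let X' = sX X d c; d' = sd N X d c l; w' = sw X d w; c' = 1 + c\<^sup>2; l' = sl N X d w c l in
   w'*(N*X-d) + (w-1)*(N*X'-d') + l'*d + l*d' - d' - c'*(X\<^sup>2+d\<^sup>2)/2 - c*(X*X'+d*d'))"
definition "pAd' N X d c l = (let X' = sX X d c; d' = sd N X d c l; c' = 1 + c\<^sup>2 in
   - N*X' - (N-1)*d' - c'*X\<^sup>2/2 - c*X*X' - c'*X*d - c*X'*d - c*X*d' + c'*d\<^sup>2/2 + c*d*d')"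
definition "pF2 N X d w c l = pPhi' N X d w c l (sX X d c) (sd N X d c l) (sw X d w) (1 + c\<^sup>2) (sl N X d w c l)"
definition "pEl N X d w c l = (pAd' N X d c l + (X+d)*pAd N X d c + (X+c)*pAd N X d c + d*pAX N X d w c l)/(N::real)"
definition "pF3 N X d w c l = pPhi' N X d w c l (pAX N X d w c l) (pAd N X d c)
   (- w*(l - c*d + (N-1)*(w-1) - c*X)) 0 (pEl N X d w c l)"

lemma pPhi_DERIV:
  assumes "(X has_real_derivative X') (at t)" "(d has_real_derivative d') (at t)" "(w has_real_derivative w') (at t)"
    "(c has_real_derivative c') (at t)" "(l has_real_derivative l') (at t)"
  shows "((\<lambda>t. pPhi N (X t) (d t) (w t) (c t) (l t)) has_real_derivative
    pPhi' N (X t) (d t) (w t) (c t) (l t) X' d' w' c' l') (at t)"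
  unfolding pPhi_def pPhi'_def pS3_def using assms
  by (auto intro!: derivative_eq_intros simp: field_simps power2_eq_square power3_eq_cube)

context slice begin

section \<open>The first order system on a slice\<close>

lemma smooth_BB [smooth_intros]: "smooth_on BB U"
proof -
  have "smooth_on (ld id chi) U" by (intro smooth_ld openU linear_id' smooth_coefficients)
  moreover have "ld id chi = (\<lambda>x. dd x chi x)" by (simp add: ld_def fun_eq_iff)
  ultimately have "smooth_on (\<lambda>x. dd x chi x) U" by simp
  then show ?thesis unfolding BB_def
    by (intro smooth_mult smooth_add smooth_divide smooth_const openU su sV smooth_coefficients smooth_EV) (use u_nonzero in auto)
qed

lemma static_tangential_field: assumes "y \<in> U"
  shows "u y * (ld (rot c e) (S V) y - dd (A (rot c e y)) V y) + V y * (ld (rot c e) (S u) y - dd (A (rot c e y)) u y)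
    = BB y * (rot c e y \<bullet> A y)"
proof -
  have "ld (rot c e) (S f) y - dd (A (rot c e y)) f y = dd (rot c e y) (dd (A y) f) y" if "smooth_on f U" for f
    unfolding ld_def[of "rot c e"] dd_ld[OF openU that assms linear_rot] by simp
  then show ?thesis using static_tangential[OF assms rot_perp rot_perp] su sV by simp
qed

text \<open>The tangential equation for the pair of a mixed rotation and \<open>S\<close>,
  differentiated along \<open>e\<close>. The right hand sides for \<open>rot a e\<close> and
  \<open>rot b e\<close> cancel in the combination of \<open>mixed\<close>, so \<open>BB\<close>
  drops out.\<close>

lemma star: assumes "x \<in> PP" "perp e"
  shows "u x * (tau e (S V) x + (e \<bullet> e) * S V x) + V x * (tau e (S u) x + (e \<bullet> e) * S u x) = 0"
proof -
  note xU' = xU(1)[OF assms(1)]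
  have xe: "x \<bullet> e = 0" by (rule perp_x[OF assms])
  have pe: "e \<bullet> a = 0" "e \<bullet> b = 0" using assms(2) by (auto simp: perp_def)
  have df: "f differentiable (at y)" if "y \<in> U" "smooth_on f U" for f y using diffble_U that by blast
  have sS: "smooth_on (S u) U" "smooth_on (S V) U" by (intro smooth_ld openU linear_rot su sV)+
  have Ra: "A (rot a e y) = (- (y \<bullet> e)) *\<^sub>R b" "A (rot b e y) = (y \<bullet> e) *\<^sub>R a"
     "rot a e y \<bullet> A y = (y \<bullet> e) * (y \<bullet> b)" "rot b e y \<bullet> A y = - (y \<bullet> e) * (y \<bullet> a)" for y
    using pe ab ba by (simp_all add: rot_def inner_diff_left inner_diff_right)
  have gen: "u x * (dd e (ld (rot c e) (S V)) x + (e \<bullet> e) * s * dd g V x) + V x * (dd e (ld (rot c e) (S u)) x + (e \<bullet> e) * s * dd g u x)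
      = BB x * ((e \<bullet> e) * t * (x \<bullet> h))"
    if "\<And>y. y \<in> U \<Longrightarrow> u y * (ld (rot c e) (S V) y + (y \<bullet> e) * (s * dd g V y)) + V y * (ld (rot c e) (S u) y + (y \<bullet> e) * (s * dd g u y))
       = BB y * ((y \<bullet> e) * (t * (y \<bullet> h)))" for c g h s t
  proof -
    have "dd e (\<lambda>y. u y * (ld (rot c e) (S V) y + (y \<bullet> e) * (s * dd g V y)) + V y * (ld (rot c e) (S u) y + (y \<bullet> e) * (s * dd g u y))) x
       = dd e (\<lambda>y. BB y * ((y \<bullet> e) * (t * (y \<bullet> h)))) x"
      by (rule dd_cong_open[OF openU xU']) (rule that)
    moreover have "dd e (\<lambda>y. u y * (ld (rot c e) (S V) y + (y \<bullet> e) * (s * dd g V y)) + V y * (ld (rot c e) (S u) y + (y \<bullet> e) * (s * dd g u y))) x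
      = u x * (dd e (ld (rot c e) (S V)) x + (e \<bullet> e) * s * dd g V x) + V x * (dd e (ld (rot c e) (S u)) x + (e \<bullet> e) * s * dd g u x)"
      by (subst dd_simps dd_inner dd_const | (intro df[OF xU'] smooth_add smooth_mult smooth_inner smooth_const smooth_dd smooth_ld linear_rot sS su sV openU))+
        (simp add: xe dd_perp_u[OF assms] dd_perp_V[OF assms] algebra_simps)
    moreover have "dd e (\<lambda>y. BB y * ((y \<bullet> e) * (t * (y \<bullet> h)))) x = BB x * ((e \<bullet> e) * t * (x \<bullet> h))"
      by (subst dd_simps dd_inner dd_const | (intro df[OF xU'] smooth_add smooth_mult smooth_inner smooth_const smooth_BB openU))+
        (simp add: xe algebra_simps)
    ultimately show ?thesis by simp
  qed
  have 1: "u x * (dd e (ld (rot a e) (S V)) x + (e \<bullet> e) * 1 * dd b V x) + V x * (dd e (ld (rot a e) (S u)) x + (e \<bullet> e) * 1 * dd b u x)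
      = BB x * ((e \<bullet> e) * 1 * (x \<bullet> b))"
    by (rule gen) (use static_tangential_field[of _ a e] in \<open>simp add: Ra dd_lin[OF df[OF _ su]] dd_lin[OF df[OF _ sV]]\<close>)
  have 2: "u x * (dd e (ld (rot b e) (S V)) x + (e \<bullet> e) * (-1) * dd a V x) + V x * (dd e (ld (rot b e) (S u)) x + (e \<bullet> e) * (-1) * dd a u x)
      = BB x * ((e \<bullet> e) * (-1) * (x \<bullet> a))"
    by (rule gen) (use static_tangential_field[of _ b e] in \<open>simp add: Ra dd_lin[OF df[OF _ su]] dd_lin[OF df[OF _ sV]]\<close>)
  have Sf: "S f x = (x \<bullet> a) * dd b f x - (x \<bullet> b) * dd a f x" if "smooth_on f U" for f
    using df[OF xU' that] by (simp add: ld_def rot_def dd_lin)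
  have "u x * ((x \<bullet> a) * dd e (ld (rot a e) (S V)) x + (x \<bullet> b) * dd e (ld (rot b e) (S V)) x + (e \<bullet> e) * S V x)
     + V x * ((x \<bullet> a) * dd e (ld (rot a e) (S u)) x + (x \<bullet> b) * dd e (ld (rot b e) (S u)) x + (e \<bullet> e) * S u x)
     = (x \<bullet> a) * (BB x * ((e \<bullet> e) * 1 * (x \<bullet> b))) + (x \<bullet> b) * (BB x * ((e \<bullet> e) * (-1) * (x \<bullet> a)))"
    unfolding 1[symmetric] 2[symmetric] Sf[OF su] Sf[OF sV] by (simp add: algebra_simps)
  then show ?thesis unfolding mixed(1)[OF assms sS(1)] mixed(1)[OF assms sS(2)] by simp
qed

text \<open>In terms of Hessians on the unit sphere, u Hess V + V Hess u is \<open>Lam\<close> times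
  the round metric: see \<open>tauI\<close> for normal directions and \<open>SSI\<close> for the
  direction of \<open>S\<close>.\<close>

definition Lam where "Lam x = (x \<bullet> x) * BB x - u x * EV x - V x * Eu x"

lemma tauI: assumes "x \<in> PP" "perp e" shows "u x * tau e V x + V x * tau e u x = (e \<bullet> e) * Lam x"
proof -
  have "u x * tau e V x + V x * tau e u x = (x \<bullet> x) * (u x * dd e (dd e V) x + V x * dd e (dd e u) x) - (e \<bullet> e) * (u x * EV x + V x * Eu x)"
    by (simp add: tau_def algebra_simps)
  then show ?thesis unfolding static_tangential[OF xU(1)[OF assms(1)] perp_x[OF assms] perp_x[OF assms]] by (simp add: Lam_def algebra_simps)
qed

text \<open>The second term is the acceleration of the rotation orbit. On the slice the orbits are
  great circles about the origin, so it points to the centre.\<close>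

lemma SS2: assumes "x \<in> PP" "smooth_on f U" shows "dd (A x) (dd (A x) f) x = S (S f) x + ld id f x"
proof -
  have "A (A x) = - x" using rot_rot assms(1) by (simp add: PP_def)
  then show ?thesis unfolding ld_def[of A "S f"] dd_ld[OF openU assms(2) xU(1)[OF assms(1)] linear_rot]
    using dd_lin(4)[OF diffble_U[OF assms(2) xU(1)[OF assms(1)]], of x] by (simp add: ld_def)
qed

lemma SSI: assumes "x \<in> PP" shows "u x * S (S V) x + V x * S (S u) x = Lam x"
proof -
  have "u x * (S (S V) x + EV x) + V x * (S (S u) x + Eu x) = BB x * (x \<bullet> x)"
    using static_tangential[OF xU(1)[OF assms] rot_perp rot_perp, of a b a b] rot_norm[of x] assms
    unfolding SS2[OF assms sV] SS2[OF assms su] by (simp add: PP_def)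
  then show ?thesis by (simp add: Lam_def algebra_simps)
qed

lemma Lam_eq: assumes "x \<in> B"
  shows "Lam x = u x * V x * ((n - 2) * (1 - om x) + om x * (Eu x / u x - EV x / V x))"
proof -
  define M where "M = Eu x / u x"
  define W where "W = EV x / V x"
  have M: "Eu x = u x * M" "EV x = V x * W" using u_nonzero[OF xU(2)[OF assms]] V0[OF assms] by (simp_all add: M_def W_def)
  have "Lam x = u x * ((1 - om x) * EV x + V x * ((n - 2) * (1 - om x) + (1 + om x) * M)) - u x * EV x - V x * Eu x"
    unfolding Lam_def BB_eq[OF xU(2)[OF assms]] by (simp add: M_def)
  then show ?thesis unfolding M_def[symmetric] W_def[symmetric] M
    using u_nonzero[OF xU(2)[OF assms]] V0[OF assms] by (simp add: algebra_simps)
qed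

text \<open>Up to sign a principal curvature, within the unit sphere, of the level set of u.
  \<open>tau_c\<close> makes it the same in all normal directions, and \<open>S_c\<close> is the
  Riccati equation in curvature 1.\<close>

definition cc where "cc x = - (tau e0 u x / S u x)"

lemma perp0: "perp e0" using e0 by (simp add: perp_def)

text \<open>\<open>tauI\<close> and \<open>tau_V\<close> are two linear equations for
  \<open>tau e u\<close> and \<open>tau e V\<close> whose determinant is, up to sign, the nonzero
  \<open>S\<close>-derivative of u V. Hence \<open>tau\<close> depends on \<open>e\<close> only
  through \<open>e \<bullet> e\<close>.\<close>

lemma tau_c: assumes "x \<in> PP" "perp e"
  shows "tau e u x = - ((e \<bullet> e) * cc x * S u x)" "tau e V x = - ((e \<bullet> e) * cc x * S V x)"
proof -
  have xB: "x \<in> B" using assms by (simp add: PP_def)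
  have *: "(u x * S V x + V x * S u x) * tau e u x = (e \<bullet> e) * (Lam x * S u x)" if "perp e" for e
    using tauI[OF assms(1) that] tau_V[OF assms(1) that] by algebra
  have "(u x * S V x + V x * S u x) * (tau e u x - (e \<bullet> e) * tau e0 u x) = 0"
    using *[OF assms(2)] *[OF perp0] e0(1) by algebra
  then have t: "tau e u x = (e \<bullet> e) * tau e0 u x" using Sh0[OF xB] by simp
  show 1: "tau e u x = - ((e \<bullet> e) * cc x * S u x)" using t Su0[OF xB] by (simp add: cc_def)
  have "(tau e V x + (e \<bullet> e) * cc x * S V x) * S u x = 0" using tau_V[OF assms] 1 by algebra
  then show "tau e V x = - ((e \<bullet> e) * cc x * S V x)" using Su0[OF xB] by (simp add: eq_neg_iff_add_eq_0)
qed

lemma cI: assumes "x \<in> PP" shows "Lam x = - cc x * (u x * S V x + V x * S u x)"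
  using tauI[OF assms perp0] tau_c[OF assms perp0] e0(1) by (simp add: algebra_simps)

lemma smooth_cc [smooth_intros]: "smooth_on cc B" unfolding cc_def
  by (intro smooth_minus smooth_divide openB smooth_slice_aux Su0 smooth_on_subset[OF sm_tau[OF su] BU openB openU])

text \<open>\<open>tau\<close> commutes with \<open>E\<close>, and by \<open>tau_Eu\<close> the
  parallelism of \<open>Eu\<close> and u persists in second derivatives; so the quotient defining
  \<open>cc\<close> has radial derivative 0.\<close>

lemma E_c: assumes "x \<in> PP" shows "ld id cc x = 0"
proof -
  have xB: "x \<in> B" using assms by (simp add: PP_def)
  have 1: "ld id cc x = - (ld id (tau e0 u) x / S u x - tau e0 u x * ld id (S u) x / (S u x)\<^sup>2)"
  proof -
    have s: "smooth_on (tau e0 u) B" by (rule smooth_on_subset[OF sm_tau[OF su] BU openB openU])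
    have "smooth_on (\<lambda>x. tau e0 u x / S u x) B" by (intro smooth_divide openB smooth_slice_aux Su0 s)
    then have "dd x cc x = - dd x (\<lambda>x. tau e0 u x / S u x) x"
      unfolding cc_def by (rule dd_minus[OF diffble_B[OF _ xB]])
    also have "\<dots> = - (dd x (tau e0 u) x / S u x - tau e0 u x * dd x (S u) x / (S u x)\<^sup>2)"
      by (subst dd_divide[OF diffble_B[OF s xB] diffble_B[OF smooth_slice_aux(1) xB] Su0[OF xB]]) simp
    finally show ?thesis by (simp add: ld_def[of id])
  qed
  have "ld id (tau e0 u) x * S u x = tau e0 u x * ld id (S u) x"
    using tau_Eu[OF assms perp0] tau_E[OF xU(1)[OF assms] su, of e0] ld_id_commute[OF openU su xU(1)[OF assms] linear_rot, of a b] by simp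
  then have 2: "ld id (tau e0 u) x / S u x - tau e0 u x * ld id (S u) x / (S u x)\<^sup>2 = 0"
    using Su0[OF xB] by (simp add: field_simps power2_eq_square)
  show ?thesis unfolding 1 2 by simp
qed

text \<open>Insert \<open>tau e0 f = - cc * S f\<close> into \<open>star\<close>. The second
  derivatives combine to \<open>Lam\<close>, which by \<open>cI\<close> is \<open>- cc\<close> times
  the \<open>S\<close>-derivative of u V; this derivative is then cancelled.\<close>

lemma S_c: assumes "x \<in> PP" shows "S cc x = 1 + (cc x)\<^sup>2"
proof -
  have xB: "x \<in> B" using assms by (simp add: PP_def)
  have d: "cc differentiable (at x)" "S u differentiable (at x)" "S V differentiable (at x)" by (intro diffble_B[OF _ xB] smooth_cc smooth_slice_aux)+
  have P: "S (tau e0 f) x = - (cc x * S (S f) x + S cc x * S f x)" if "smooth_on f U" "\<And>y. y \<in> PP \<Longrightarrow> tau e0 f y = - (cc y * S f y)" for f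
  proof -
    have s: "smooth_on (tau e0 f) B" by (rule smooth_on_subset[OF sm_tau[OF that(1)] BU openB openU])
    have s': "smooth_on (S f) B" by (intro smooth_ld openB linear_rot smooth_on_subset[OF that(1) BU openB openU])
    have m: "(\<lambda>y. cc y * S f y) differentiable (at x)" by (intro diffble_B[OF _ xB] smooth_mult openB smooth_cc s')
    have "S (tau e0 f) x = dd (A x) (\<lambda>y. - (cc y * S f y)) x" unfolding ld_def[of A "tau e0 f"]
      by (rule plane_dd[OF assms A_Pl diffble_B[OF s xB] diffble_B[OF _ xB] that(2)]) (intro smooth_minus smooth_mult openB smooth_cc s')
    also have "\<dots> = - (cc x * S (S f) x + S cc x * S f x)"
      unfolding dd_minus[OF m] dd_simps(3)[OF d(1) diffble_B[OF s' xB]] by (simp add: ld_def)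
    finally show ?thesis .
  qed
  have "u x * (S (tau e0 V) x + S V x) + V x * (S (tau e0 u) x + S u x) = 0"
    using star[OF assms perp0] tau_S[OF xU(1)[OF assms] sV perp0] tau_S[OF xU(1)[OF assms] su perp0] e0(1) by simp
  then have "u x * (- (cc x * S (S V) x + S cc x * S V x) + S V x) + V x * (- (cc x * S (S u) x + S cc x * S u x) + S u x) = 0"
    using P[OF sV] P[OF su] tau_c[OF _ perp0] e0(1) by simp
  then have "(u x * S V x + V x * S u x) * (1 - S cc x) = cc x * (u x * S (S V) x + V x * S (S u) x)" by algebra
  also have "\<dots> = - (cc x)\<^sup>2 * (u x * S V x + V x * S u x)" unfolding SSI[OF assms] cI[OF assms] by (simp add: power2_eq_square)
  finally have "(u x * S V x + V x * S u x) * (1 - S cc x + (cc x)\<^sup>2) = 0" by (simp add: algebra_simps)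
  then show ?thesis using Sh0[OF xB] by simp
qed

text \<open>The direction of \<open>S\<close> contributes \<open>S (S V)\<close>, and each of the
  \<open>n - 2\<close> normal directions contributes \<open>- cc * S V\<close>. The projections
  \<open>\<epsilon> i\<close> form a Parseval frame of the normal space.\<close>

lemma lapS_slice: assumes "x \<in> PP" shows "lapS V x = S (S V) x - (n - 2) * cc x * S V x"
proof -
  note xU' = xU(1)[OF assms]
  define H where "H v w = dd v (dd w V) x" for v w
  have dv: "dd w V differentiable (at x)" for w by (rule diffble_U[OF smooth_dd[OF openU sV] xU'])
  have sym: "H v w = H w v" for v w unfolding H_def by (rule dd_commute[OF openU sV xU'])
  have l1: "H (v + v') w = H v w + H v' w" "H (t *\<^sub>R v) w = t * H v w" for v v' w t unfolding H_def by (simp_all add: dd_lin[OF dv])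
  have l2: "H w (v + v') = H w v + H w v'" "H w (t *\<^sub>R v) = t * H w v" for v v' w t using l1 sym by metis+
  have aP: "a \<in> Pl" "b \<in> Pl" "x \<in> Pl" using assms by (auto simp: Pl_def PP_def inner_commute)
  have z: "H v e = 0" if "v \<in> Pl" "perp e" for v e
    unfolding H_def using plane_dd[OF assms that(1) dv, of "\<lambda>_. 0" e] dd_perp_V that(2) by simp
  have Hee: "(x \<bullet> x) * H e e = (e \<bullet> e) * (EV x - cc x * S V x)" if "perp e" for e
    using tau_c(2)[OF assms that] by (simp add: tau_def H_def algebra_simps)
  define \<epsilon> where "\<epsilon> i = axis i 1 - (a $ i *\<^sub>R a + b $ i *\<^sub>R b)" for i
  have pe: "perp (\<epsilon> i)" for i using ab ba by (simp add: perp_def \<epsilon>_def inner_diff_left inner_add_left inner_axis')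
  have ax: "axis i 1 = (a $ i *\<^sub>R a + b $ i *\<^sub>R b) + \<epsilon> i" for i by (simp add: \<epsilon>_def)
  have Hi: "H (axis i 1) (axis i 1) = (a $ i * a $ i) * H a a + 2 * (a $ i * b $ i) * H a b + (b $ i * b $ i) * H b b + H (\<epsilon> i) (\<epsilon> i)" for i
    unfolding ax l1 l2 using z[OF aP(1) pe] z[OF aP(2) pe] sym[of "\<epsilon> i" a] sym[of "\<epsilon> i" b] sym[of b a] by (simp add: algebra_simps)
  have ei: "\<epsilon> i \<bullet> \<epsilon> i = 1 - a $ i * a $ i - b $ i * b $ i" for i
    using ab ba by (simp add: \<epsilon>_def inner_diff_left inner_diff_right inner_add_left inner_add_right inner_axis inner_axis')
  have s1: "(\<Sum>i\<in>UNIV. a $ i * a $ i) = 1" "(\<Sum>i\<in>UNIV. b $ i * b $ i) = 1" "(\<Sum>i\<in>UNIV. a $ i * b $ i) = 0"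
    using ab by (simp_all add: inner_sum)
  have "(x \<bullet> x) * lapl V x = (\<Sum>i\<in>UNIV. (x \<bullet> x) * H (axis i 1) (axis i 1))"
    unfolding lapl_axis H_def by (simp add: sum_distrib_left)
  also have "\<dots> = (\<Sum>i\<in>UNIV. (a $ i * a $ i) * ((x \<bullet> x) * H a a) + (a $ i * b $ i) * (2 * (x \<bullet> x) * H a b) + (b $ i * b $ i) * ((x \<bullet> x) * H b b)
      + (1 - a $ i * a $ i - b $ i * b $ i) * (EV x - cc x * S V x))"
  proof (rule sum.cong)
    fix i
    show "(x \<bullet> x) * H (axis i 1) (axis i 1) = (a $ i * a $ i) * ((x \<bullet> x) * H a a) + (a $ i * b $ i) * (2 * (x \<bullet> x) * H a b) + (b $ i * b $ i) * ((x \<bullet> x) * H b b)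
      + (1 - a $ i * a $ i - b $ i * b $ i) * (EV x - cc x * S V x)"
      using Hee[OF pe[of i]] unfolding ei Hi by (simp add: algebra_simps)
  qed simp
  also have "\<dots> = (x \<bullet> x) * (H a a + H b b) + (n - 2) * (EV x - cc x * S V x)"
    unfolding sum.distrib sum_distrib_right[symmetric] sum_subtractf s1 by (simp add: algebra_simps)
  also have "(x \<bullet> x) * (H a a + H b b) = H x x + H (A x) (A x)"
  proof -
    define \<alpha> \<beta> where d: "\<alpha> = x \<bullet> a" "\<beta> = x \<bullet> b"
    have x: "x = \<alpha> *\<^sub>R a + \<beta> *\<^sub>R b" using aP(3) Pl_eq[of x] unfolding d by blast
    have Ax: "A x = \<alpha> *\<^sub>R b + (- \<beta>) *\<^sub>R a" by (simp add: rot_def d)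
    have R: "x \<bullet> x = \<alpha> * \<alpha> + \<beta> * \<beta>" using arg_cong[OF x, of "\<lambda>v. x \<bullet> v"] by (simp add: inner_add_right d)
    have xx: "H x x = \<alpha> * \<alpha> * H a a + 2 * \<alpha> * \<beta> * H a b + \<beta> * \<beta> * H b b"
    proof -
      have "H x x = H (\<alpha> *\<^sub>R a + \<beta> *\<^sub>R b) (\<alpha> *\<^sub>R a + \<beta> *\<^sub>R b)" using x by simp
      then show ?thesis unfolding l1 l2 sym[of b a] by (simp add: algebra_simps)
    qed
    show ?thesis unfolding xx Ax R l1 l2 sym[of b a] by (simp add: algebra_simps)
  qed
  also have "H (A x) (A x) = S (S V) x + EV x" unfolding H_def by (rule SS2[OF assms sV])
  finally have F: "(x \<bullet> x) * lapl V x = H x x + (S (S V) x + EV x) + (n - 2) * (EV x - cc x * S V x)" .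
  define ev where "ev = EV x"
  have "lapS V x = (x \<bullet> x) * lapl V x - (H x x + ev) - (n - 2) * ev"
    unfolding lapS_def nC ldid2[OF sV xU'] ev_def H_def by simp
  then show ?thesis unfolding F ev_def[symmetric] by (simp add: algebra_simps)
qed

text \<open>Logarithmic derivatives of u and V along \<open>S\<close> (\<open>Zf\<close>,
  \<open>Yf\<close>) and along \<open>E\<close> (\<open>Mf\<close>, \<open>Wf\<close>);
  \<open>Xf\<close> and \<open>df\<close> belong to the product u V and the quotient u / V.
  \<open>lf\<close> stands for \<open>S df\<close>, which is not yet expressed by the other
  quantities; its normalisation gives \<open>M_W\<close>.\<close>

definition Zf where "Zf x = S u x / u x"
definition Yf where "Yf x = S V x / V x"
definition Mf where "Mf x = Eu x / u x"
definition Wf where "Wf x = EV x / V x"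
definition Xf where "Xf x = Yf x + Zf x"
definition df where "df x = Zf x - Yf x"
definition lf where "lf x = (S df x + (Xf x + cc x) * df x) / (n - 1)"

lemma smooth_slice_functions [smooth_intros]: "smooth_on Zf B" "smooth_on Yf B" "smooth_on Mf B" "smooth_on Wf B" "smooth_on Xf B" "smooth_on df B" "smooth_on lf B"
proof -
  show 1: "smooth_on Zf B" "smooth_on Yf B" "smooth_on Mf B" "smooth_on Wf B"
    unfolding Zf_def Yf_def Mf_def Wf_def
    by (rule smooth_divide[OF openB]; use V0 u_nonzero xU(2) smooth_B smooth_slice_aux in \<open>auto\<close>)+
  show 2: "smooth_on Xf B" "smooth_on df B" unfolding Xf_def df_def by (intro smooth_add smooth_diff openB 1)+
  show "smooth_on lf B" unfolding lf_def
    by (intro smooth_divide smooth_add smooth_mult smooth_const smooth_ld linear_rot openB 2 smooth_cc) (use n1 in auto)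
qed

lemma dd_quotients: assumes "x \<in> B"
  shows "dd v Zf x = dd v (S u) x / u x - Zf x * (dd v u x / u x)" "dd v Yf x = dd v (S V) x / V x - Yf x * (dd v V x / V x)"
    "dd v Mf x = dd v Eu x / u x - Mf x * (dd v u x / u x)" "dd v Wf x = dd v EV x / V x - Wf x * (dd v V x / V x)"
  unfolding Zf_def Yf_def Mf_def Wf_def using u_nonzero[OF xU(2)[OF assms]] V0[OF assms]
  by (subst dd_divide, (intro diffble_B[OF _ assms] smooth_B smooth_slice_aux)+, simp, simp add: field_simps power2_eq_square)+

lemma slice_Lam: assumes "x \<in> PP" shows "cc x * Xf x = (n - 2) * (om x - 1) - om x * (Mf x - Wf x)"
proof -
  have xB: "x \<in> B" using assms by (simp add: PP_def)
  have nz: "u x \<noteq> 0" "V x \<noteq> 0" using u_nonzero[OF xU(2)[OF xB]] V0[OF xB] by auto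
  have "u x * S V x + V x * S u x = u x * V x * Xf x" using nz by (simp add: Xf_def Yf_def Zf_def field_simps)
  then have "u x * V x * ((n - 2) * (1 - om x) + om x * (Mf x - Wf x)) = u x * V x * (- cc x * Xf x)"
    using cI[OF assms] Lam_eq[OF xB] by (simp add: Mf_def Wf_def)
  moreover have "u x * V x \<noteq> 0" using nz by simp
  ultimately have "(n - 2) * (1 - om x) + om x * (Mf x - Wf x) = - cc x * Xf x" using mult_left_cancel by blast
  then show ?thesis by (simp add: algebra_simps)
qed

text \<open>The second derivatives of u and V occur in the combination \<open>Lam / (u V)\<close>,
  which \<open>cI\<close> evaluates as \<open>- cc * Xf\<close>.\<close>

lemma S_X: assumes "x \<in> PP" shows "S Xf x = - ((Xf x)\<^sup>2 + (df x)\<^sup>2) / 2 - cc x * Xf x"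
proof -
  have xB: "x \<in> B" using assms by (simp add: PP_def)
  have nz: "u x \<noteq> 0" "V x \<noteq> 0" using u_nonzero[OF xU(2)[OF xB]] V0[OF xB] by auto
  have "S Xf x = S Yf x + S Zf x" unfolding Xf_def by (rule ld_simps) (intro diffble_B[OF _ xB] smooth_slice_functions)+
  also have "\<dots> = S (S V) x / V x + S (S u) x / u x - (Yf x)\<^sup>2 - (Zf x)\<^sup>2"
    unfolding ld_def[of A Yf] ld_def[of A Zf] dd_quotients[OF xB]
    by (simp add: ld_def[of A V] ld_def[of A u] ld_def[of A "S V"] ld_def[of A "S u"] Yf_def Zf_def power2_eq_square)
  also have "S (S V) x / V x + S (S u) x / u x = Lam x / (u x * V x)" unfolding SSI[OF assms, symmetric] using nz by (simp add: field_simps)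
  also have "\<dots> = - cc x * Xf x" unfolding cI[OF assms] using nz by (simp add: Xf_def Yf_def Zf_def field_simps)
  finally have F: "S Xf x = - cc x * Xf x - (Yf x)\<^sup>2 - (Zf x)\<^sup>2" .
  have "(Xf x)\<^sup>2 + (df x)\<^sup>2 = 2 * ((Yf x)\<^sup>2 + (Zf x)\<^sup>2)" by (simp add: Xf_def df_def power2_eq_square algebra_simps)
  then show ?thesis unfolding F by simp
qed

lemma S_W: assumes "x \<in> PP" shows "S Wf x = - (1 - Wf x) * df x + (n - 1) * Zf x"
proof -
  have xB: "x \<in> B" using assms by (simp add: PP_def)
  have nz: "u x \<noteq> 0" "V x \<noteq> 0" using u_nonzero[OF xU(2)[OF xB]] V0[OF xB] by auto
  have g: "S EV x = S V x + Zf x * (EV x + (n - 2) * V x)"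
    using static_mixed[OF xU(2)[OF xB] rot_perp, of a b] by (simp add: ld_def[of A] Zf_def)
  have "S Wf x = S EV x / V x - Wf x * Yf x"
    unfolding ld_def[of A Wf] dd_quotients[OF xB] by (simp add: ld_def[of A] Yf_def)
  also have "\<dots> = Yf x + Zf x * (Wf x + (n - 2)) - Wf x * Yf x"
    unfolding g Yf_def Wf_def using nz by (simp add: field_simps)
  finally show ?thesis by (simp add: df_def algebra_simps)
qed

lemma S_Y: assumes "x \<in> PP" shows "S Yf x = - (Yf x)\<^sup>2 + (n - 2) * cc x * Yf x + (n - 1) * (n - 2) / 2 * (1 - om x) - (n - 1) * om x * Wf x"
proof -
  have xB: "x \<in> B" using assms by (simp add: PP_def)
  have nz: "u x \<noteq> 0" "V x \<noteq> 0" using u_nonzero[OF xU(2)[OF xB]] V0[OF xB] by auto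
  have "S (S V) x = (n - 2) * cc x * S V x - (n - 1) * om x * EV x + (n - 1) * (n - 2) / 2 * (1 - om x) * V x"
    using static_trace(1)[OF xU(2)[OF xB]] lapS_slice[OF assms] by simp
  moreover have "S Yf x = S (S V) x / V x - (Yf x)\<^sup>2"
    unfolding ld_def[of A Yf] dd_quotients[OF xB] by (simp add: ld_def[of A] Yf_def power2_eq_square)
  ultimately have "S Yf x = ((n - 2) * cc x * S V x - (n - 1) * om x * EV x + (n - 1) * (n - 2) / 2 * (1 - om x) * V x) / V x - (Yf x)\<^sup>2" by simp
  also have "\<dots> = (n - 2) * cc x * Yf x - (n - 1) * om x * Wf x + (n - 1) * (n - 2) / 2 * (1 - om x) - (Yf x)\<^sup>2"
    unfolding Yf_def Wf_def using nz by (simp add: add_divide_distrib diff_divide_distrib)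
  finally show ?thesis by simp
qed

lemma S_d: "x \<in> B \<Longrightarrow> S df x = sd (n - 1) (Xf x) (df x) (cc x) (lf x)"
  using n1 by (simp add: sd_def lf_def field_simps)

text \<open>Computing \<open>S df\<close> from \<open>S_X\<close> and \<open>S_Y\<close> expresses
  \<open>lf\<close> by first order quantities. It can therefore be differentiated along
  \<open>S\<close> in turn, and the system closes.\<close>

lemma l_W: assumes "x \<in> PP" shows "lf x = - 2 * cc x * Yf x - (n - 2) * (1 - om x) + 2 * om x * Wf x"
proof -
  have xB: "x \<in> B" using assms by (simp add: PP_def)
  have "S df x = S Zf x - S Yf x" unfolding df_def by (rule ld_simps) (intro diffble_B[OF _ xB] smooth_slice_functions)+
  moreover have "S Xf x = S Yf x + S Zf x" unfolding Xf_def by (rule ld_simps) (intro diffble_B[OF _ xB] smooth_slice_functions)+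
  ultimately have 1: "S df x = S Xf x - 2 * S Yf x" by simp
  have "(n - 1) * lf x = S df x + (Xf x + cc x) * df x" using n1 by (simp add: lf_def)
  also have "\<dots> = (n - 1) * (- 2 * cc x * Yf x - (n - 2) * (1 - om x) + 2 * om x * Wf x)"
    unfolding 1 S_X[OF assms] S_Y[OF assms] unfolding Xf_def df_def by (simp add: power2_eq_square field_simps)
  finally have "(n - 1) * lf x = (n - 1) * (- 2 * cc x * Yf x - (n - 2) * (1 - om x) + 2 * om x * Wf x)" .
  then show ?thesis using n1 by simp
qed

lemma M_W: assumes "x \<in> PP"
  shows "om x * (Mf x + Wf x) = lf x - cc x * df x" "om x * (Mf x - Wf x) = (n - 2) * (om x - 1) - cc x * Xf x"
  using slice_Lam[OF assms] l_W[OF assms] by (simp_all add: Xf_def df_def algebra_simps)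

lemma plane_ray_DERIV: assumes "x \<in> PP" "v \<in> Pl" "smooth_on f B"
  shows "((\<lambda>t. f (x + t *\<^sub>R v)) has_real_derivative dd v f x) (at 0)"
  using has_real_derivative_line[of f x 0 v] diffble_B[OF assms(3)] assms(1) by (simp add: PP_def)

lemma S_om: "x \<in> B \<Longrightarrow> S om x = sw (Xf x) (df x) (om x)"
  using dd_om[OF xU(2), of x "A x"] by (simp add: ld_def sw_def Xf_def df_def Zf_def)

lemma Yeq: "Yf x = (Xf x - df x) / 2" "Zf x = (Xf x + df x) / 2" by (simp_all add: Xf_def df_def)

lemma S_l: assumes "x \<in> PP" shows "S lf x = sl (n - 1) (Xf x) (df x) (om x) (cc x) (lf x)"
proof -
  have xB: "x \<in> B" using assms by (simp add: PP_def)
  let ?v = "A x"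
  have "dd ?v lf x = - 2 * (S cc x * Yf x + cc x * S Yf x) + (n - 2) * S om x + 2 * (S om x * Wf x + om x * S Wf x)"
  proof (rule plane_DERIV[OF assms A_Pl diffble_B[OF smooth_slice_functions(7) xB], where g="\<lambda>z. - 2 * cc z * Yf z - (n - 2) * (1 - om z) + 2 * om z * Wf z"])
    show "((\<lambda>t. - 2 * cc (x + t *\<^sub>R ?v) * Yf (x + t *\<^sub>R ?v) - (n - 2) * (1 - om (x + t *\<^sub>R ?v)) + 2 * om (x + t *\<^sub>R ?v) * Wf (x + t *\<^sub>R ?v))
      has_real_derivative - 2 * (S cc x * Yf x + cc x * S Yf x) + (n - 2) * S om x + 2 * (S om x * Wf x + om x * S Wf x)) (at 0)"
      using plane_ray_DERIV[OF assms A_Pl smooth_cc] plane_ray_DERIV[OF assms A_Pl smooth_slice_functions(2)] plane_ray_DERIV[OF assms A_Pl smooth_B(5)] plane_ray_DERIV[OF assms A_Pl smooth_slice_functions(4)]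
      by (auto intro!: derivative_eq_intros simp: ld_def algebra_simps)
  qed (rule l_W)
  then have E: "S lf x = - 2 * (S cc x * Yf x + cc x * S Yf x) + (n - 2) * S om x + 2 * (S om x * Wf x + om x * S Wf x)" by (simp add: ld_def)
  have W: "2 * om x * Wf x = lf x + 2 * cc x * Yf x + (n - 2) * (1 - om x)" using l_W[OF assms] by simp
  have SY: "S Yf x = (S Xf x - S df x) / 2"
  proof -
    have "S df x = S Zf x - S Yf x" unfolding df_def by (rule ld_simps) (intro diffble_B[OF _ xB] smooth_slice_functions)+
    moreover have "S Xf x = S Yf x + S Zf x" unfolding Xf_def by (rule ld_simps) (intro diffble_B[OF _ xB] smooth_slice_functions)+
    ultimately show ?thesis by simp
  qed
  have "2 * (S om x * Wf x + om x * S Wf x) = - (Xf x + df x) * (2 * om x * Wf x) + 2 * om x * (- df x + (n - 1) * Zf x) + (2 * om x * Wf x) * df x"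
    unfolding S_W[OF assms] S_om[OF xB] sw_def by (simp add: algebra_simps)
  then show ?thesis unfolding E W SY S_c[OF assms] S_X[OF assms] S_d[OF xB] S_om[OF xB] sw_def sd_def sl_def unfolding Yeq
    by (simp add: field_simps power2_eq_square)
qed

text \<open>For logarithmic derivatives the commuting of \<open>E\<close> and \<open>S\<close> reads
  \<open>E Z = S M\<close> and \<open>E Y = S W\<close>. So \<open>E X\<close> and
  \<open>E d\<close> are the \<open>S\<close>-derivatives of \<open>M + W\<close> and
  \<open>M - W\<close>, which \<open>M_W\<close> expresses by the unknowns.\<close>

lemma E_X_d: assumes "x \<in> PP" shows "ld id Xf x = pAX (n - 1) (Xf x) (df x) (om x) (cc x) (lf x) / om x"
    "ld id df x = pAd (n - 1) (Xf x) (df x) (cc x) / om x"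
proof -
  have xB: "x \<in> B" using assms by (simp add: PP_def)
  have w0: "om z \<noteq> 0" if "z \<in> B" for z using u_nonzero[OF xU(2)[OF that]] by (simp add: om_def)
  let ?v = "A x"
  have cm: "ld id (S u) x = S Eu x" "ld id (S V) x = S EV x"
    using ld_id_commute[OF openU _ xU(2)[OF xB] linear_rot] su sV by auto
  have EZ: "ld id Zf x = S Mf x" "ld id Yf x = S Wf x"
    unfolding ld_def[of id Zf] ld_def[of id Yf] ld_def[of A Mf] ld_def[of A Wf] dd_quotients[OF xB]
    using cm by (simp_all add: ld_def[of id] ld_def[of A Eu] ld_def[of A EV] ld_def[of A u] ld_def[of A V] Mf_def Wf_def Zf_def Yf_def)
  have dd4: "Zf differentiable (at x)" "Yf differentiable (at x)" "Mf differentiable (at x)" "Wf differentiable (at x)"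
    by (intro diffble_B[OF _ xB] smooth_slice_functions)+
  have l: "ld id Xf x = ld id Yf x + ld id Zf x" "ld id df x = ld id Zf x - ld id Yf x"
    unfolding Xf_def df_def by (rule ld_simps; intro dd4)+
  have m: "S (\<lambda>z. Mf z + Wf z) x = S Mf x + S Wf x" "S (\<lambda>z. Mf z - Wf z) x = S Mf x - S Wf x"
    by (rule ld_simps; intro dd4)+
  have 1: "dd ?v (\<lambda>z. Mf z + Wf z) x = ((S lf x - (S cc x * df x + cc x * S df x)) * om x - (lf x - cc x * df x) * S om x) / (om x * om x)"
  proof (rule plane_DERIV[OF assms A_Pl diffble_B[OF _ xB], where g="\<lambda>z. (lf z - cc z * df z) / om z"])
    show "smooth_on (\<lambda>z. Mf z + Wf z) B" by (intro smooth_add openB smooth_slice_functions)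
    show "Mf z + Wf z = (lf z - cc z * df z) / om z" if "z \<in> PP" for z
      using M_W(1)[OF that] w0[of z] that by (simp add: PP_def field_simps)
    show "((\<lambda>t. (lf (x + t *\<^sub>R ?v) - cc (x + t *\<^sub>R ?v) * df (x + t *\<^sub>R ?v)) / om (x + t *\<^sub>R ?v)) has_real_derivative
      ((S lf x - (S cc x * df x + cc x * S df x)) * om x - (lf x - cc x * df x) * S om x) / (om x * om x)) (at 0)"
      using plane_ray_DERIV[OF assms A_Pl smooth_cc] plane_ray_DERIV[OF assms A_Pl smooth_slice_functions(6)] plane_ray_DERIV[OF assms A_Pl smooth_B(5)] plane_ray_DERIV[OF assms A_Pl smooth_slice_functions(7)] w0[OF xB]
      by (auto intro!: derivative_eq_intros simp: ld_def algebra_simps)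
  qed
  have 2: "dd ?v (\<lambda>z. Mf z - Wf z) x = (((n - 2) * S om x - (S cc x * Xf x + cc x * S Xf x)) * om x - ((n - 2) * (om x - 1) - cc x * Xf x) * S om x) / (om x * om x)"
  proof (rule plane_DERIV[OF assms A_Pl diffble_B[OF _ xB], where g="\<lambda>z. ((n - 2) * (om z - 1) - cc z * Xf z) / om z"])
    show "smooth_on (\<lambda>z. Mf z - Wf z) B" by (intro smooth_diff openB smooth_slice_functions)
    show "Mf z - Wf z = ((n - 2) * (om z - 1) - cc z * Xf z) / om z" if "z \<in> PP" for z
      using M_W(2)[OF that] w0[of z] that by (simp add: PP_def field_simps)
    show "((\<lambda>t. ((n - 2) * (om (x + t *\<^sub>R ?v) - 1) - cc (x + t *\<^sub>R ?v) * Xf (x + t *\<^sub>R ?v)) / om (x + t *\<^sub>R ?v)) has_real_derivative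
      (((n - 2) * S om x - (S cc x * Xf x + cc x * S Xf x)) * om x - ((n - 2) * (om x - 1) - cc x * Xf x) * S om x) / (om x * om x)) (at 0)"
      using plane_ray_DERIV[OF assms A_Pl smooth_cc] plane_ray_DERIV[OF assms A_Pl smooth_slice_functions(5)] plane_ray_DERIV[OF assms A_Pl smooth_B(5)] w0[OF xB]
      by (auto intro!: derivative_eq_intros simp: ld_def algebra_simps)
  qed
  have h: "(P * w - Q * (- w * s)) / (w * w) = (P + Q * s) / w" if "w \<noteq> 0" for P Q s w :: real
    using that by (simp add: field_simps)
  have h2: "((k * - (w * s) - P) * w - (k * (w - 1) - Q) * - (w * s)) / (w * w) = (- k * s - P - Q * s) / w" if "w \<noteq> 0" for P Q k s w :: real
    using that by (simp add: field_simps)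
  have "ld id Xf x = dd ?v (\<lambda>z. Mf z + Wf z) x" using l(1) m(1) EZ by (simp add: ld_def[of A])
  then show "ld id Xf x = pAX (n - 1) (Xf x) (df x) (om x) (cc x) (lf x) / om x"
    unfolding 1 S_om[OF xB] sw_def h[OF w0[OF xB]] unfolding S_l[OF assms] S_c[OF assms] S_d[OF xB] sl_def sd_def pAX_def
    by (simp add: field_simps power2_eq_square)
  have "ld id df x = dd ?v (\<lambda>z. Mf z - Wf z) x" using l(2) m(2) EZ by (simp add: ld_def[of A])
  then show "ld id df x = pAd (n - 1) (Xf x) (df x) (cc x) / om x"
    unfolding 2 S_om[OF xB] sw_def mult_minus_left h2[OF w0[OF xB]] unfolding S_X[OF assms] S_c[OF assms] pAd_def
    by (simp add: field_simps power2_eq_square)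
qed

section \<open>Integrability conditions of the slice system\<close>

lemma om0: "x \<in> B \<Longrightarrow> om x \<noteq> 0" using u_nonzero[OF xU(2)] by (simp add: om_def)

lemma quot_S: "w \<noteq> 0 \<Longrightarrow> (P * w - Q * sw X d w) / (w * w) = (P + Q * (X + d)) / (w::real)"
  by (simp add: sw_def field_simps)

lemma S_E_X: assumes "x \<in> PP"
  shows "S (ld id Xf) x = (pAX' (n - 1) (Xf x) (df x) (om x) (cc x) (lf x) + pAX (n - 1) (Xf x) (df x) (om x) (cc x) (lf x) * (Xf x + df x)) / om x"
proof -
  have xB: "x \<in> B" using assms by (simp add: PP_def)
  let ?v = "A x"
  let ?z = "\<lambda>t. x + t *\<^sub>R A x"
  have "dd ?v (ld id Xf) x = (pAX' (n - 1) (Xf x) (df x) (om x) (cc x) (lf x) * om x - pAX (n - 1) (Xf x) (df x) (om x) (cc x) (lf x) * sw (Xf x) (df x) (om x)) / (om x * om x)"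
  proof (rule plane_DERIV[OF assms A_Pl diffble_B[OF smooth_ld[OF openB linear_id' smooth_slice_functions(5)] xB]])
    show "ld id Xf z = pAX (n - 1) (Xf z) (df z) (om z) (cc z) (lf z) / om z" if "z \<in> PP" for z by (rule E_X_d(1)[OF that])
    have D: "((\<lambda>t. pAX (n - 1) (Xf (?z t)) (df (?z t)) (om (?z t)) (cc (?z t)) (lf (?z t))) has_real_derivative pAX' (n - 1) (Xf x) (df x) (om x) (cc x) (lf x)) (at 0)"
      unfolding pAX_def pAX'_def Let_def sX_def unfolding S_X[OF assms,symmetric] S_d[OF xB,symmetric] S_om[OF xB,symmetric] S_c[OF assms,symmetric] S_l[OF assms,symmetric]
      using plane_ray_DERIV[OF assms A_Pl smooth_cc] plane_ray_DERIV[OF assms A_Pl smooth_slice_functions(5)] plane_ray_DERIV[OF assms A_Pl smooth_B(5)] plane_ray_DERIV[OF assms A_Pl smooth_slice_functions(6)] plane_ray_DERIV[OF assms A_Pl smooth_slice_functions(7)]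
      by (auto intro!: derivative_eq_intros simp: ld_def field_simps power2_eq_square)
    have D2: "((\<lambda>t. om (?z t)) has_real_derivative sw (Xf x) (df x) (om x)) (at 0)"
      using plane_ray_DERIV[OF assms A_Pl[of x] smooth_B(5)] S_om[OF xB] by (simp add: ld_def)
    show "((\<lambda>t. pAX (n - 1) (Xf (?z t)) (df (?z t)) (om (?z t)) (cc (?z t)) (lf (?z t)) / om (?z t)) has_real_derivative
     (pAX' (n - 1) (Xf x) (df x) (om x) (cc x) (lf x) * om x - pAX (n - 1) (Xf x) (df x) (om x) (cc x) (lf x) * sw (Xf x) (df x) (om x)) / (om x * om x)) (at 0)"
      using DERIV_divide[OF D D2] om0[OF xB] by simp
  qed
  then show ?thesis unfolding ld_def[of A "ld id Xf"] quot_S[OF om0[OF xB]] by simp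
qed

lemma S_E_d: assumes "x \<in> PP"
  shows "S (ld id df) x = (pAd' (n - 1) (Xf x) (df x) (cc x) (lf x) + pAd (n - 1) (Xf x) (df x) (cc x) * (Xf x + df x)) / om x"
proof -
  have xB: "x \<in> B" using assms by (simp add: PP_def)
  let ?v = "A x"
  let ?z = "\<lambda>t. x + t *\<^sub>R A x"
  have "dd ?v (ld id df) x = (pAd' (n - 1) (Xf x) (df x) (cc x) (lf x) * om x - pAd (n - 1) (Xf x) (df x) (cc x) * sw (Xf x) (df x) (om x)) / (om x * om x)"
  proof (rule plane_DERIV[OF assms A_Pl diffble_B[OF smooth_ld[OF openB linear_id' smooth_slice_functions(6)] xB]])
    show "ld id df z = pAd (n - 1) (Xf z) (df z) (cc z) / om z" if "z \<in> PP" for z by (rule E_X_d(2)[OF that])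
    have D: "((\<lambda>t. pAd (n - 1) (Xf (?z t)) (df (?z t)) (cc (?z t))) has_real_derivative pAd' (n - 1) (Xf x) (df x) (cc x) (lf x)) (at 0)"
      unfolding pAd_def pAd'_def Let_def sX_def unfolding S_X[OF assms,symmetric] S_d[OF xB,symmetric] S_c[OF assms,symmetric]
      using plane_ray_DERIV[OF assms A_Pl smooth_cc] plane_ray_DERIV[OF assms A_Pl smooth_slice_functions(5)] plane_ray_DERIV[OF assms A_Pl smooth_slice_functions(6)]
      by (auto intro!: derivative_eq_intros simp: ld_def field_simps power2_eq_square)
    have D2: "((\<lambda>t. om (?z t)) has_real_derivative sw (Xf x) (df x) (om x)) (at 0)"
      using plane_ray_DERIV[OF assms A_Pl[of x] smooth_B(5)] S_om[OF xB] by (simp add: ld_def)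
    show "((\<lambda>t. pAd (n - 1) (Xf (?z t)) (df (?z t)) (cc (?z t)) / om (?z t)) has_real_derivative
     (pAd' (n - 1) (Xf x) (df x) (cc x) (lf x) * om x - pAd (n - 1) (Xf x) (df x) (cc x) * sw (Xf x) (df x) (om x)) / (om x * om x)) (at 0)"
      using DERIV_divide[OF D D2] om0[OF xB] by simp
  qed
  then show ?thesis unfolding ld_def[of A "ld id df"] quot_S[OF om0[OF xB]] by simp
qed

lemma pPhi_zero: assumes "x \<in> PP" shows "pPhi (n - 1) (Xf x) (df x) (om x) (cc x) (lf x) = 0"
proof -
  have xB: "x \<in> B" and xP: "x \<in> Pl" using assms by (simp_all add: PP_def)
  have "dd x (S Xf) x = - (Xf x * ld id Xf x + df x * ld id df x) - cc x * ld id Xf x"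
  proof (rule plane_DERIV[OF assms xP diffble_B[OF smooth_ld[OF openB linear_rot smooth_slice_functions(5)] xB] S_X])
    show "((\<lambda>t. - ((Xf (x + t *\<^sub>R x))\<^sup>2 + (df (x + t *\<^sub>R x))\<^sup>2) / 2 - cc (x + t *\<^sub>R x) * Xf (x + t *\<^sub>R x)) has_real_derivative
      - (Xf x * ld id Xf x + df x * ld id df x) - cc x * ld id Xf x) (at 0)"
      using plane_ray_DERIV[OF assms xP smooth_cc] plane_ray_DERIV[OF assms xP smooth_slice_functions(5)] plane_ray_DERIV[OF assms xP smooth_slice_functions(6)] E_c[OF assms]
      by (auto intro!: derivative_eq_intros simp: ld_def field_simps power2_eq_square)
  qed
  then have "S (ld id Xf) x = - (Xf x * ld id Xf x + df x * ld id df x) - cc x * ld id Xf x"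
    using ld_id_commute[OF openB smooth_slice_functions(5) xB linear_rot, of a b] by (simp add: ld_def[of id])
  then have "pAX' (n - 1) (Xf x) (df x) (om x) (cc x) (lf x) + pAX (n - 1) (Xf x) (df x) (om x) (cc x) (lf x) * (Xf x + df x)
      = - (Xf x * pAX (n - 1) (Xf x) (df x) (om x) (cc x) (lf x) + df x * pAd (n - 1) (Xf x) (df x) (cc x)) - cc x * pAX (n - 1) (Xf x) (df x) (om x) (cc x) (lf x)"
    unfolding S_E_X[OF assms] E_X_d[OF assms] using om0[OF xB]
    by (simp only: times_divide_eq_right add_divide_distrib[symmetric] minus_divide_left diff_divide_distrib[symmetric] divide_cancel_right simp_thms)
  \<comment> \<open>The polynomial is \<open>om\<close> times E S X - S E X, with both orders
    expanded by the system.\<close>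
  moreover have "pPhi N X d w c l = - (pAX' N X d w c l + pAX N X d w c l * (X + d)) - (X * pAX N X d w c l + d * pAd N X d c) - c * pAX N X d w c l" for N X d w c l
    unfolding pPhi_def pS3_def pAX'_def Let_def sX_def sd_def sw_def sl_def pAX_def pAd_def
    by (simp add: field_simps power2_eq_square power3_eq_cube)
  ultimately show ?thesis by simp
qed

lemma pF2_zero: assumes "x \<in> PP" shows "pF2 (n - 1) (Xf x) (df x) (om x) (cc x) (lf x) = 0"
proof -
  have xB: "x \<in> B" using assms by (simp add: PP_def)
  let ?z = "\<lambda>t. x + t *\<^sub>R A x"
  have D: "((\<lambda>t. pPhi (n - 1) (Xf (?z t)) (df (?z t)) (om (?z t)) (cc (?z t)) (lf (?z t))) has_real_derivative pF2 (n - 1) (Xf x) (df x) (om x) (cc x) (lf x)) (at 0)"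
    unfolding pF2_def sX_def S_X[OF assms,symmetric] S_d[OF xB,symmetric] S_om[OF xB,symmetric] S_c[OF assms,symmetric] S_l[OF assms,symmetric]
    using pPhi_DERIV[OF plane_ray_DERIV[OF assms A_Pl smooth_slice_functions(5)] plane_ray_DERIV[OF assms A_Pl smooth_slice_functions(6)] plane_ray_DERIV[OF assms A_Pl smooth_B(5)] plane_ray_DERIV[OF assms A_Pl smooth_cc] plane_ray_DERIV[OF assms A_Pl smooth_slice_functions(7)], of "n - 1"]
    by (simp add: ld_def)
  have "dd (A x) (\<lambda>_. 0) x = pF2 (n - 1) (Xf x) (df x) (om x) (cc x) (lf x)"
    by (rule plane_DERIV[OF assms A_Pl _ _ D]) (simp_all add: pPhi_zero)
  then show ?thesis by simp
qed

text \<open>\<open>E\<close> applied to the definition of \<open>lf\<close>, with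
  \<open>E (S df) = S (E df)\<close>; no new unknown appears.\<close>

lemma E_l: assumes "x \<in> PP" shows "ld id lf x = pEl (n - 1) (Xf x) (df x) (om x) (cc x) (lf x) / om x"
proof -
  have xB: "x \<in> B" and xP: "x \<in> Pl" using assms by (simp_all add: PP_def)
  have c: "dd x (S df) x = S (ld id df) x"
    using ld_id_commute[OF openB smooth_slice_functions(6) xB linear_rot, of a b] by (simp add: ld_def[of id])
  have F: "dd x lf x = (S (ld id df) x + (Xf x + cc x) * ld id df x + ld id Xf x * df x) / (n - 1)"
  proof (rule plane_DERIV[OF assms xP diffble_B[OF smooth_slice_functions(7) xB] lf_def])
    show "((\<lambda>t. (S df (x + t *\<^sub>R x) + (Xf (x + t *\<^sub>R x) + cc (x + t *\<^sub>R x)) * df (x + t *\<^sub>R x)) / (n - 1)) has_real_derivative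
      (S (ld id df) x + (Xf x + cc x) * ld id df x + ld id Xf x * df x) / (n - 1)) (at 0)"
      using plane_ray_DERIV[OF assms xP smooth_cc] plane_ray_DERIV[OF assms xP smooth_slice_functions(5)] plane_ray_DERIV[OF assms xP smooth_slice_functions(6)] E_c[OF assms] plane_ray_DERIV[OF assms xP smooth_ld[OF openB linear_rot[of a b] smooth_slice_functions(6)]] unfolding c
      by (intro DERIV_cdivide) (auto intro!: derivative_eq_intros simp: ld_def[of id] algebra_simps)
  qed
  have L: "ld id lf x = dd x lf x" by (simp add: ld_def)
  have G: "(P / w + k * (Q / w) + T / w * d) / m = (P + k * Q + d * T) / m / w" for P Q T k d m w :: real
    by (simp add: add_divide_distrib mult.commute)
  have "ld id lf x = (pAd' (n - 1) (Xf x) (df x) (cc x) (lf x) + pAd (n - 1) (Xf x) (df x) (cc x) * (Xf x + df x)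
     + (Xf x + cc x) * pAd (n - 1) (Xf x) (df x) (cc x) + df x * pAX (n - 1) (Xf x) (df x) (om x) (cc x) (lf x)) / (n - 1) / om x"
    unfolding L F S_E_d[OF assms] E_X_d[OF assms] by (rule G)
  then show ?thesis unfolding pEl_def by (simp only: mult.commute)
qed

lemma E_om: assumes "x \<in> PP" shows "ld id om x = - om x * (lf x - cc x * df x + (n - 1 - 1) * (om x - 1) - cc x * Xf x) / om x"
proof -
  have xB: "x \<in> B" using assms by (simp_all add: PP_def)
  have "ld id om x = - 2 * (om x * Mf x)"
    using dd_om[OF xU(2), of x x] xB by (simp add: ld_def Mf_def)
  moreover have "2 * (om x * Mf x) = lf x - cc x * df x + (n - 2) * (om x - 1) - cc x * Xf x" using M_W[OF assms] by (simp add: algebra_simps)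
  moreover have "- w * k / w = - k" if "w \<noteq> 0" for w k :: real using that by simp
  ultimately show ?thesis using om0[OF xB] by (simp only: ) simp
qed

text \<open>Linearity in the primed arguments lets the common denominator \<open>om\<close> of the
  \<open>E\<close>-derivatives come out. The argument \<open>c'\<close> is 0 because
  \<open>cc\<close> has no radial derivative.\<close>

lemma pPhi'_scale: "pPhi' N X d w c l (X'/k) (d'/k) (w'/k) 0 (l'/k) = pPhi' N X d w c l X' d' w' 0 l' / k"
  by (cases "k = 0") (simp_all add: pPhi'_def field_simps)

lemma pF3_zero: assumes "x \<in> PP" shows "pF3 (n - 1) (Xf x) (df x) (om x) (cc x) (lf x) = 0"
proof -
  have xB: "x \<in> B" and xP: "x \<in> Pl" using assms by (simp_all add: PP_def)
  let ?z = "\<lambda>t. x + t *\<^sub>R x"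
  have D: "((\<lambda>t. pPhi (n - 1) (Xf (?z t)) (df (?z t)) (om (?z t)) (cc (?z t)) (lf (?z t))) has_real_derivative 
       pPhi' (n - 1) (Xf x) (df x) (om x) (cc x) (lf x) (ld id Xf x) (ld id df x) (ld id om x) (ld id cc x) (ld id lf x)) (at 0)"
    using pPhi_DERIV[OF plane_ray_DERIV[OF assms xP smooth_slice_functions(5)] plane_ray_DERIV[OF assms xP smooth_slice_functions(6)] plane_ray_DERIV[OF assms xP smooth_B(5)] plane_ray_DERIV[OF assms xP smooth_cc] plane_ray_DERIV[OF assms xP smooth_slice_functions(7)], of "n - 1"]
    by (simp add: ld_def)
  have "dd x (\<lambda>_. 0) x = pPhi' (n - 1) (Xf x) (df x) (om x) (cc x) (lf x) (ld id Xf x) (ld id df x) (ld id om x) (ld id cc x) (ld id lf x)"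
    by (rule plane_DERIV[OF assms xP _ _ D]) (simp_all add: pPhi_zero)
  then show ?thesis unfolding E_X_d[OF assms] E_c[OF assms] E_l[OF assms] E_om[OF assms] pPhi'_scale using om0[OF xB] by (simp add: pF3_def)
qed

text \<open>Where \<open>S Zf = 0\<close>, in particular at a maximum, this determines
  \<open>lf\<close> from \<open>cc\<close> and \<open>Zf\<close>.\<close>

lemma SZ: assumes "x \<in> PP" shows "(n - 1) * lf x = 2 * S Zf x + 2 * (Zf x)\<^sup>2 + 2 * cc x * Zf x"
proof -
  have xB: "x \<in> B" using assms by (simp add: PP_def)
  have "S df x = S Zf x - S Yf x" unfolding df_def by (rule ld_simps) (intro diffble_B[OF _ xB] smooth_slice_functions)+
  moreover have "S Xf x = S Yf x + S Zf x" unfolding Xf_def by (rule ld_simps) (intro diffble_B[OF _ xB] smooth_slice_functions)+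
  ultimately have "2 * S Zf x = S df x + S Xf x" by simp
  then show ?thesis unfolding S_X[OF assms] S_d[OF xB] sd_def unfolding Yeq by (simp add: power2_eq_square field_simps)
qed

end

lemma (in sqs) slice_identities:
  assumes n3: "n \<ge> 3" and p: "p \<in> U"
    and ab: "a \<bullet> a = 1" "b \<bullet> b = 1" "a \<bullet> b = 0" and pa: "p = norm p *\<^sub>R a"
    and du: "\<And>e. e \<bullet> a = 0 \<Longrightarrow> e \<bullet> b = 0 \<Longrightarrow> dd e u p = 0"
    and nz: "V p \<noteq> 0" "Z \<noteq> 0" "Y + Z \<noteq> 0" "QQ p \<noteq> 0"
    and Z: "Z = ld (rot a b) u p / u p" and Y: "Y = ld (rot a b) V p / V p"
  obtains c l where "pPhi (n - 1) (Y + Z) (Z - Y) (om p) c l = 0" "pF2 (n - 1) (Y + Z) (Z - Y) (om p) c l = 0"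
    "pF3 (n - 1) (Y + Z) (Z - Y) (om p) c l = 0"
    "(n - 1) * l = 2 * ld (rot a b) (\<lambda>x. ld (rot a b) u x / u x) p + 2 * Z\<^sup>2 + 2 * c * Z"
proof -
  define h where "h x = u x * ld (rot a b) V x + V x * ld (rot a b) u x" for x
  have hh: "h p = u p * V p * (Y + Z)" using nz(1) u_nonzero[OF p] by (simp add: h_def Y Z field_simps)
  \<comment> \<open>The open set on which all divisors of the slice computation are nonzero; a ball
    around \<open>p\<close> inside it serves as the slice neighbourhood.\<close>
  define T where "T = {x \<in> U. V x \<noteq> 0 \<and> ld (rot a b) u x \<noteq> 0 \<and> h x \<noteq> 0 \<and> QQ x \<noteq> 0}"
  define k where "k x = V x * ld (rot a b) u x * (h x * QQ x)" for x
  have "continuous_on U k" unfolding h_def k_def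
    by (intro smooth_continuous[where U=U] smooth_mult smooth_add smooth_ld openU linear_rot su sV smooth_EV)
  then have "open (U \<inter> k -` (- {0}))" by (rule continuous_open_preimage[OF _ openU]) (rule open_Compl[OF closed_singleton])
  moreover have "T = U \<inter> k -` (- {0})" by (auto simp: T_def k_def)
  ultimately have "open T" by simp
  moreover have "p \<in> T" using p nz u_nonzero[OF p] hh by (auto simp: T_def Z)
  ultimately obtain \<epsilon> where \<epsilon>: "\<epsilon> > 0" "ball p \<epsilon> \<subseteq> T" using open_contains_ball by blast
  have "real CARD('n) \<ge> 3" using n3 nC by linarith
  then have c3: "CARD('n) \<ge> 3" by linarith
  have "dim {a, b} \<le> card {a, b}" by (rule dim_le_card') simp
  also have "card {a, b} \<le> 2" by (simp add: card_insert_le_m1)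
  \<comment> \<open>Here the dimension must be at least 3: a normal of the plane is needed.\<close>
  also have "2 < DIM(real^'n)" using c3 by simp
  finally obtain e where e: "e \<noteq> 0" "\<And>y. y \<in> span {a, b} \<Longrightarrow> orthogonal e y"
    using orthogonal_to_subspace_exists by blast
  have ea: "e \<bullet> a = 0" "e \<bullet> b = 0" using e(2)[of a] e(2)[of b] by (auto simp: orthogonal_def span_base)
  interpret slice U u V n "ball p \<epsilon>" a b "sgn e" p
  proof
    show "p \<bullet> e' = 0" if "e' \<bullet> a = 0" for e' using that by (subst pa) (simp add: inner_commute)
    show "sgn e \<bullet> sgn e = 1" using e(1) by (simp add: dot_square_norm norm_sgn)
    show "sgn e \<bullet> a = 0" "sgn e \<bullet> b = 0" using ea by (simp_all add: sgn_div_norm)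
    show "ball p \<epsilon> \<subseteq> U" using \<epsilon> by (auto simp: T_def)
    show "V x \<noteq> 0" "ld (rot a b) u x \<noteq> 0" "u x * ld (rot a b) V x + V x * ld (rot a b) u x \<noteq> 0" "QQ x \<noteq> 0" if "x \<in> ball p \<epsilon>" for x
      using \<epsilon> that by (auto simp: T_def h_def)
  qed (use n3 ab du \<epsilon> in auto)
  have pP: "p \<in> PP" using pB pplane by (simp add: PP_def Pl_def)
  have eq: "Xf p = Y + Z" "df p = Z - Y" "Zf p = Z" "Zf = (\<lambda>x. ld (rot a b) u x / u x)"
    by (simp_all add: Xf_def df_def Zf_def Yf_def Y Z fun_eq_iff)
  show ?thesis using pPhi_zero[OF pP] pF2_zero[OF pP] pF3_zero[OF pP] SZ[OF pP] unfolding eq(1-3) unfolding eq(4) by (rule that)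
qed

section \<open>Small solutions of the polynomial relations\<close>

text \<open>Remainders of the three relations after the substitution \<open>X = xZ\<close>, \<open>d = (2 - x)Z\<close>, with \<open>J = 1/N\<close>. In the
  first two \<open>G = cZ\<close>; in the others \<open>G = c/Z\<close>.\<close>

definition rPhi :: "real \<Rightarrow> real \<Rightarrow> real \<Rightarrow> real \<Rightarrow> real \<Rightarrow> real \<Rightarrow> real" where
  "rPhi N J G Z x w = (-2)*G*x^2 + (-2)*G*x^2*J + 8*G*x + 8*G*x*J + (-4)*G + (-16)*G*J + (-2)*Z^2*x^2*J + 8*Z^2*x*J + (-12)*Z^2*J + x^2*w*N + x^2*w + (-1)*x^2*N + (-1)*x^2 + (-4)*x*w*N + (-4)*x*w + 4*x*N + 6*x + 2*w*N + 6*w + 2*N + (-6)"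

definition rF2 :: "real \<Rightarrow> real \<Rightarrow> real \<Rightarrow> real \<Rightarrow> real \<Rightarrow> real \<Rightarrow> real" where
  "rF2 N J G Z x w = 4*G^2*x^2*J + 16*G^2*x + (-36)*G^2 + 6*G*Z^2*x^3 + 6*G*Z^2*x^3*J + (-28)*G*Z^2*x^2 + (-20)*G*Z^2*x^2*J + 56*G*Z^2*x + 40*G*Z^2*x*J + (-48)*G*Z^2 + (-16)*G*Z^2*J + (-2)*G*x^2*w*N + (-2)*G*x^2*w + 2*G*x^2*N + 2*G*x^2 + (-2)*G*x*w*N + (-2)*G*x*w + (-2)*G*x + 4*G*w*N + 4*G*w + (-8)*G + 6*Z^4*x^3*J + (-24)*Z^4*x^2*J + 40*Z^4*x*J + (-16)*Z^4*J + (-3)*Z^2*x^3*w*N + (-3)*Z^2*x^3*w + 3*Z^2*x^3*N + 3*Z^2*x^3 + 10*Z^2*x^2*w*N + 12*Z^2*x^2*w + (-12)*Z^2*x^2*N + (-18)*Z^2*x^2 + (-12)*Z^2*x*w*N + (-22)*Z^2*x*w + 20*Z^2*x*N + 40*Z^2*x + 4*Z^2*w*N + 12*Z^2*w + (-8)*Z^2*N + (-32)*Z^2 + x*w^2*N^2 + x*w^2*N + (-1)*x*w*N^2 + (-1)*x*w*N + (-2)*w^2*N + 2*w*N"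

definition rF22 :: "real \<Rightarrow> real \<Rightarrow> real \<Rightarrow> real \<Rightarrow> real \<Rightarrow> real \<Rightarrow> real" where
  "rF22 N J G Z x w = (-8)*G^3*Z^2 + 4*G^2*Z^2*x^2*J + 16*G^2*Z^2*x + (-36)*G^2*Z^2 + 2*G^2*w*N + 6*G*Z^2*x^3 + 6*G*Z^2*x^3*J + (-28)*G*Z^2*x^2 + (-20)*G*Z^2*x^2*J + 56*G*Z^2*x + 40*G*Z^2*x*J + (-48)*G*Z^2 + (-16)*G*Z^2*J + (-2)*G*x^2*w*N + (-2)*G*x^2*w + 2*G*x^2*N + 2*G*x^2 + (-2)*G*x*w*N + (-2)*G*x*w + (-2)*G*x + 4*G*w*N + 4*G*w + (-8)*G + 6*Z^2*x^3*J + (-24)*Z^2*x^2*J + 40*Z^2*x*J + (-16)*Z^2*J + (-3)*x^3*w*N + (-3)*x^3*w + 3*x^3*N + 3*x^3 + 10*x^2*w*N + 12*x^2*w + (-12)*x^2*N + (-18)*x^2 + (-12)*x*w*N + (-22)*x*w + 20*x*N + 40*x + 4*w*N + 12*w + (-8)*N + (-32)"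

definition rF3 :: "real \<Rightarrow> real \<Rightarrow> real \<Rightarrow> real \<Rightarrow> real \<Rightarrow> real \<Rightarrow> real" where
  "rF3 N J G Z x w = 16*G^3*Z^2*x*J + (-16)*G^3*Z^2*J + 6*G^2*Z^2*x^3 + 10*G^2*Z^2*x^3*J + (-32)*G^2*Z^2*x^2 + (-64)*G^2*Z^2*x^2*J + (-8)*G^2*Z^2*x^2*J*J + 36*G^2*Z^2*x + 148*G^2*Z^2*x*J + 32*G^2*Z^2*x*J*J + (-16)*G^2*Z^2 + (-72)*G^2*Z^2*J + (-32)*G^2*Z^2*J*J + (-4)*G^2*x*w + 8*G^2*w + (-4)*G^2*w*J + 8*G^2 + (-8)*G^2*J + (-2)*G*Z^2*x^4*J + (-2)*G*Z^2*x^4*J*J + 26*G*Z^2*x^3*J + 16*G*Z^2*x^3*J*J + (-108)*G*Z^2*x^2*J + (-64)*G*Z^2*x^2*J*J + 180*G*Z^2*x*J + 128*G*Z^2*x*J*J + (-72)*G*Z^2*J + (-96)*G*Z^2*J*J + (-3)*G*x^3*w*N + (-3)*G*x^3*w + 3*G*x^3*N + 3*G*x^3 + 18*G*x^2*w*N + 24*G*x^2*w + 4*G*x^2*w*J + (-14)*G*x^2*N + (-28)*G*x^2 + (-12)*G*x^2*J + (-22)*G*x*w*N + (-42)*G*x*w + (-16)*G*x*w*J + (-10)*G*x*N + 38*G*x + 52*G*x*J + 12*G*w*N + 12*G*w + 8*G*w*J + 4*G*N + 48*G + (-64)*G*J + (-2)*Z^2*x^4*J*J + 16*Z^2*x^3*J*J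 + (-56)*Z^2*x^2*J*J + 96*Z^2*x*J*J + (-64)*Z^2*J*J + x^4*w + x^4*w*J + (-1)*x^4 + (-1)*x^4*J + (-6)*x^3*w + (-8)*x^3*w*J + 8*x^3 + 10*x^3*J + 14*x^2*w + 28*x^2*w*J + (-20)*x^2 + (-46)*x^2*J + (-4)*x*w + (-48)*x*w*J + (-4)*x + 100*x*J + (-12)*w + 28*w*J + 72 + (-80)*J"

lemma power_expand:
  fixes x :: real
  shows "x^2 = x*x" "x^3 = x*(x*x)" "x^4 = x*(x*(x*x))" "x^5 = x*(x*(x*(x*x)))" "x^6 = x*(x*(x*(x*(x*x))))"
  by (simp_all add: numeral_eq_Suc)

context
  fixes N J :: real
  assumes NJ: "N * J = 1"
begin

lemma JN: "J * N = 1" "J * (N * t) = t" "t / N = t * J" "N * J = 1" "N * (J * t) = t"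
proof -
  have "N \<noteq> 0" using NJ by auto
  then have "J = 1 / N" using NJ by (simp add: field_simps)
  then show "J * N = 1" "J * (N * t) = t" "t / N = t * J" "N * J = 1" "N * (J * t) = t" using \<open>N \<noteq> 0\<close> by simp_all
qed

text \<open>The last argument is the value of \<open>l\<close> given by \<open>SZ\<close> where
  \<open>S Z = 0\<close>, with \<open>G = c Z\<close>. While \<open>G\<close> stays bounded, the
  terms without the factor \<open>Z^2\<close> decide in the limit.\<close>

lemma scaled_large:
  assumes "Z \<noteq> 0"
  shows "pPhi N (x*Z) ((2-x)*Z) w (G/Z) ((2*Z^2+2*G)*J) = - 4*J*G^2 + 2*w*G + Z^2 * rPhi N J G Z x w"
    "Z * pF2 N (x*Z) ((2-x)*Z) w (G/Z) ((2*Z^2+2*G)*J) = 2*N*G^2*w - 8*G^3 + Z^2 * rF2 N J G Z x w"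
proof -
  define c where "c = G/Z"
  have G: "G = c * Z" using assms by (simp add: c_def)
  show "pPhi N (x*Z) ((2-x)*Z) w (G/Z) ((2*Z^2+2*G)*J) = - 4*J*G^2 + 2*w*G + Z^2 * rPhi N J G Z x w"
    unfolding c_def[symmetric] G unfolding pPhi_def pS3_def rPhi_def by (simp add: field_simps power_expand JN)
  show "Z * pF2 N (x*Z) ((2-x)*Z) w (G/Z) ((2*Z^2+2*G)*J) = 2*N*G^2*w - 8*G^3 + Z^2 * rF2 N J G Z x w"
    unfolding c_def[symmetric] G unfolding pF2_def pPhi'_def pS3_def rF2_def sX_def sd_def sw_def sl_def by (simp add: field_simps power_expand JN)
qed

text \<open>The scaling for \<open>c\<close> of the order of \<open>Z\<close>. The leading term of
  \<open>pF2\<close> carries the factor \<open>w - 1\<close>; where this is 0, the leading term of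
  \<open>pF3\<close> has to decide.\<close>

lemma scaled_small:
  shows "pF2 N (x*Z) ((2-x)*Z) w (G*Z) ((2+2*G)*Z^2*J) = Z * (N*w*(w-1)*(x*(N+1) - 2) + Z^2 * rF22 N J G Z x w)"
    "pF3 N (x*Z) ((2-x)*Z) w (G*Z) ((2+2*G)*Z^2*J) = Z^2 * ((-2)*G*w^2*N + 2*G*w^2 + (-1)*x^2*w^2*N^2 + (-1)*x^2*w^2*N + x^2*w*N^2 + 4*x^2*w*N + 3*x^2*w + (-3)*x^2*N + (-3)*x^2 + 2*x*w^2*N^2 + 8*x*w*N^2 + (-12)*x*w + (-10)*x*N^2 + (-4)*x*N + 12*x + (-2)*w^2*N^2 + 2*w^2 + (-2)*w*N^2 + (-16)*w*N + 10*w + (-4)*N^2 + 16*N + (-12) + Z^2 * rF3 N J G Z x w)"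
proof -
  show "pF2 N (x*Z) ((2-x)*Z) w (G*Z) ((2+2*G)*Z^2*J) = Z * (N*w*(w-1)*(x*(N+1) - 2) + Z^2 * rF22 N J G Z x w)"
    unfolding pF2_def pPhi'_def pS3_def rF22_def sX_def sd_def sw_def sl_def by (simp add: field_simps power_expand JN)
  have aX: "pAX N (x*Z) ((2-x)*Z) w (G*Z) ((2+2*G)*Z^2*J) = (-1)*G*Z^3*x^2 + 2*G*Z^3*x + (-2)*G*Z^3*x*J + (-2)*G*Z^3 + 4*G*Z^3*J + (-2)*Z^3*x*J + 4*Z^3*J + Z*x*w*N + Z*x*w + (-1)*Z*x*N + (-2)*Z*w"
    unfolding pAX_def by (simp add: field_simps power_expand JN)
  have ad: "pAd N (x*Z) ((2-x)*Z) (G*Z) = G*Z^3*x^2 + (-4)*G*Z^3*x + 2*G*Z^3 + (-1)*Z*x + (-2)*Z*N + 2*Z"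
    unfolding pAd_def by (simp add: field_simps power_expand JN)
  have el: "pEl N (x*Z) ((2-x)*Z) w (G*Z) ((2+2*G)*Z^2*J) = (-4)*G^2*Z^4*x*J + 4*G^2*Z^4*J + 2*G*Z^4*x^2*J + 2*G*Z^4*x^2*J*J + (-12)*G*Z^4*x*J + (-8)*G*Z^4*x*J*J + 8*G*Z^4*J + 8*G*Z^4*J*J + (-2)*G*Z^2 + 2*G*Z^2*J + 2*Z^4*x^2*J*J + (-8)*Z^4*x*J*J + 8*Z^4*J*J + (-1)*Z^2*x^2*w + (-1)*Z^2*x^2*w*J + Z^2*x^2 + Z^2*x^2*J + 2*Z^2*x*w + 4*Z^2*x*w*J + (-4)*Z^2*x + (-6)*Z^2*x*J + (-4)*Z^2*w*J + (-4)*Z^2 + 8*Z^2*J"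
    unfolding pEl_def aX ad unfolding pAd'_def Let_def sX_def sd_def by (simp add: field_simps power_expand JN)
  show "pF3 N (x*Z) ((2-x)*Z) w (G*Z) ((2+2*G)*Z^2*J) = Z^2 * ((-2)*G*w^2*N + 2*G*w^2 + (-1)*x^2*w^2*N^2 + (-1)*x^2*w^2*N + x^2*w*N^2 + 4*x^2*w*N + 3*x^2*w + (-3)*x^2*N + (-3)*x^2 + 2*x*w^2*N^2 + 8*x*w*N^2 + (-12)*x*w + (-10)*x*N^2 + (-4)*x*N + 12*x + (-2)*w^2*N^2 + 2*w^2 + (-2)*w*N^2 + (-16)*w*N + 10*w + (-4)*N^2 + 16*N + (-12) + Z^2 * rF3 N J G Z x w)"
    unfolding pF3_def aX ad el unfolding pPhi'_def pS3_def rF3_def by (simp add: field_simps power_expand JN)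
qed

end

text \<open>The relation \<open>pPhi = 0\<close> is quadratic in \<open>C = cZ\<close>, so \<open>C\<close> is bounded and accumulates only at \<open>0\<close> and
  \<open>N\<omega>/2\<close>; the leading part of \<open>Z pF2\<close> excludes the latter.\<close>

lemma scaled_limit:
  fixes Z x w C :: "nat \<Rightarrow> real"
  assumes N: "N > 0" and lim: "Z \<longlonglongrightarrow> 0" "x \<longlonglongrightarrow> x'" "w \<longlonglongrightarrow> w'" and w': "w' > 0" and Z: "\<And>k. Z k \<noteq> 0"
    and z: "\<And>k. pPhi N (x k * Z k) ((2 - x k) * Z k) (w k) (C k / Z k) ((2*(Z k)^2 + 2*C k)*(1/N)) = 0"
      "\<And>k. pF2 N (x k * Z k) ((2 - x k) * Z k) (w k) (C k / Z k) ((2*(Z k)^2 + 2*C k)*(1/N)) = 0"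
  obtains r where "strict_mono r" "(\<lambda>k. C (r k) / (Z (r k))^2) \<longlonglongrightarrow> - (x'^2*((N+1)*w' - (N+1)) + x'*(4*N+6 - (4*N+4)*w') + ((2*N+6)*w' + 2*N - 6)) / (2*w')"
proof -
  define J where "J = 1/N"
  have J: "N * J = 1" "J > 0" using N by (auto simp: J_def)
  \<comment> \<open>\<open>rPhi\<close> is affine in \<open>G\<close>. Its slope and its intercept
    turn \<open>pPhi = 0\<close> into the quadratic equation \<open>eq\<close> for
    \<open>C\<close>.\<close>
  define P where "P k = 2 * w k + (Z k)^2 * (rPhi N J 1 (Z k) (x k) (w k) - rPhi N J 0 (Z k) (x k) (w k))" for k
  define Q where "Q k = rPhi N J 0 (Z k) (x k) (w k)" for k
  have Pl: "P \<longlonglongrightarrow> 2 * w' + 0^2 * (rPhi N J 1 0 x' w' - rPhi N J 0 0 x' w')"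
    unfolding P_def rPhi_def by (intro tendsto_intros lim)
  have Ql: "Q \<longlonglongrightarrow> rPhi N J 0 0 x' w'" unfolding Q_def rPhi_def by (intro tendsto_intros lim)
  have eq: "4*J*(C k)^2 = P k * C k + (Z k)^2 * Q k" for k
  proof -
    have "rPhi N J (C k) (Z k) (x k) (w k) = C k * (rPhi N J 1 (Z k) (x k) (w k) - rPhi N J 0 (Z k) (x k) (w k)) + rPhi N J 0 (Z k) (x k) (w k)"
      unfolding rPhi_def by (simp add: algebra_simps)
    then have R: "(Z k)^2 * rPhi N J (C k) (Z k) (x k) (w k) = (P k - 2 * w k) * C k + (Z k)^2 * Q k"
      unfolding P_def Q_def by algebra
    have "- 4*J*(C k)^2 + 2*w k*C k + (Z k)^2 * rPhi N J (C k) (Z k) (x k) (w k) = 0"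
      using z(1)[of k] scaled_large(1)[OF J(1) Z[of k], of "x k" "w k" "C k"] by (simp add: J_def[symmetric])
    then show ?thesis unfolding R by (simp add: algebra_simps)
  qed
  have ZQ: "(\<lambda>k. (Z k)^2 * Q k) \<longlonglongrightarrow> 0^2 * rPhi N J 0 0 x' w'" by (intro tendsto_intros lim Ql)
  obtain p where p: "\<And>k. \<bar>P k\<bar> \<le> p" using convergent_imp_Bseq[OF convergentI[OF Pl]] unfolding Bseq_def by auto
  obtain q where q: "\<And>k. \<bar>(Z k)^2 * Q k\<bar> \<le> q" using convergent_imp_Bseq[OF convergentI[OF ZQ]] unfolding Bseq_def by auto
  have "\<bar>C k\<bar> \<le> max 1 ((p + q) / (4*J))" for k
  proof (cases "\<bar>C k\<bar> \<le> 1")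
    case False
    then have c1: "\<bar>C k\<bar> > 1" by simp
    have "4*J*\<bar>C k\<bar>*\<bar>C k\<bar> = P k * C k + (Z k)^2 * Q k" using eq[of k] by (simp add: power2_eq_square abs_mult_self_eq mult.assoc)
    also have "\<dots> \<le> \<bar>P k\<bar> * \<bar>C k\<bar> + \<bar>(Z k)^2 * Q k\<bar>" by (metis abs_ge_self abs_mult add_mono)
    also have "\<dots> \<le> p * \<bar>C k\<bar> + q * \<bar>C k\<bar>"
    proof (rule add_mono)
      show "\<bar>P k\<bar> * \<bar>C k\<bar> \<le> p * \<bar>C k\<bar>" using p[of k] by (intro mult_right_mono) auto
      have "q * 1 \<le> q * \<bar>C k\<bar>" using c1 q[of k] by (intro mult_left_mono) auto
      then show "\<bar>(Z k)^2 * Q k\<bar> \<le> q * \<bar>C k\<bar>" using q[of k] by linarith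
    qed
    finally have "(4*J*\<bar>C k\<bar>) * \<bar>C k\<bar> \<le> (p + q) * \<bar>C k\<bar>" by (simp add: algebra_simps)
    then have "4*J*\<bar>C k\<bar> \<le> p + q" by (rule mult_right_le_imp_le) (use c1 in simp)
    then have "\<bar>C k\<bar> \<le> (p + q) / (4*J)" using J(2) by (simp add: field_simps)
    then show ?thesis by simp
  qed simp
  then have "bounded (range C)" unfolding bounded_iff by auto
  then obtain c r where r: "strict_mono r" "(C \<circ> r) \<longlonglongrightarrow> c" using bounded_imp_convergent_subsequence by blast
  have Cr: "(\<lambda>k. C (r k)) \<longlonglongrightarrow> c" using r(2) by (simp add: o_def)
  have lr: "(\<lambda>k. Z (r k)) \<longlonglongrightarrow> 0" "(\<lambda>k. x (r k)) \<longlonglongrightarrow> x'" "(\<lambda>k. w (r k)) \<longlonglongrightarrow> w'"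
    "(\<lambda>k. P (r k)) \<longlonglongrightarrow> 2 * w'" "(\<lambda>k. Q (r k)) \<longlonglongrightarrow> rPhi N J 0 0 x' w'" "(\<lambda>k. (Z (r k))^2 * Q (r k)) \<longlonglongrightarrow> 0"
    using lim Pl Ql ZQ r(1) by (auto dest: LIMSEQ_subseq_LIMSEQ[where f=r] simp: o_def)
  have "(\<lambda>k. 4*J*(C (r k))^2) \<longlonglongrightarrow> 4*J*c^2" by (intro tendsto_intros Cr)
  moreover have "(\<lambda>k. P (r k) * C (r k) + (Z (r k))^2 * Q (r k)) \<longlonglongrightarrow> 2 * w' * c + 0" by (intro tendsto_intros Cr lr)
  ultimately have 1: "4*J*c^2 = 2*w'*c" unfolding eq using LIMSEQ_unique by fastforce
  have "(\<lambda>k. 2*N*(C (r k))^2*w (r k) - 8*(C (r k))^3 + (Z (r k))^2 * rF2 N J (C (r k)) (Z (r k)) (x (r k)) (w (r k)))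
     \<longlonglongrightarrow> 2*N*c^2*w' - 8*c^3 + 0^2 * rF2 N J c 0 x' w'"
    unfolding rF2_def by (intro tendsto_intros lr Cr)
  moreover have "2*N*(C k)^2*w k - 8*(C k)^3 + (Z k)^2 * rF2 N J (C k) (Z k) (x k) (w k) = 0" for k
    using scaled_large(2)[OF J(1) Z[of k], of "x k" "w k" "C k"] z(2)[of k] by (simp add: J_def[symmetric])
  ultimately have 2: "2*N*c^2*w' - 8*c^3 = 0" using LIMSEQ_unique[OF tendsto_const] by fastforce
  \<comment> \<open>For \<open>c \<noteq> 0\<close> the quadratic equation gives
    \<open>w' = 2 J c\<close>, while the leading part of \<open>Z pF2\<close> gives
    \<open>N w' = 4 c\<close>; together 2 c = 4 c.\<close>
  have "c = 0"
  proof (rule ccontr)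
    assume c: "c \<noteq> 0"
    have a: "2*J*c = w'" using 1 c by (simp add: power2_eq_square)
    have "N*w' = 4*c" using 2 c by (simp add: power2_eq_square power3_eq_cube)
    then have "N * (2*J*c) = 4*c" using a by simp
    then have "2*(N*J)*c = 4*c" by (simp add: algebra_simps)
    then show False using J(1) c by simp
  qed
  then have den: "(\<lambda>k. 4*J*C (r k) - P (r k)) \<longlonglongrightarrow> 4*J*0 - 2*w'" using Cr by (intro tendsto_intros lr) simp
  \<comment> \<open>The quadratic equation reads \<open>C (4 J C - P) = Z^2 Q\<close>, and the
    bracket tends to \<open>- 2 w'\<close>, which is not 0.\<close>
  have "(\<lambda>k. Q (r k) / (4*J*C (r k) - P (r k))) \<longlonglongrightarrow> rPhi N J 0 0 x' w' / (4*J*0 - 2*w')"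
    using w' by (intro tendsto_divide lr den) simp
  moreover have "\<forall>\<^sub>F k in sequentially. 4*J*C (r k) - P (r k) \<noteq> 0" using w' by (intro tendsto_imp_eventually_ne[OF den]) simp
  then have "\<forall>\<^sub>F k in sequentially. Q (r k) / (4*J*C (r k) - P (r k)) = C (r k) / (Z (r k))^2"
  proof (rule eventually_mono)
    fix k assume "4*J*C (r k) - P (r k) \<noteq> 0"
    then show "Q (r k) / (4*J*C (r k) - P (r k)) = C (r k) / (Z (r k))^2"
      using eq[of "r k"] Z[of "r k"] by (simp add: field_simps power2_eq_square)
  qed
  ultimately have "(\<lambda>k. C (r k) / (Z (r k))^2) \<longlonglongrightarrow> rPhi N J 0 0 x' w' / (4*J*0 - 2*w')"
    using filterlim_cong[OF refl refl] by fast
  also have "rPhi N J 0 0 x' w' / (4*J*0 - 2*w') = - (x'^2*((N+1)*w' - (N+1)) + x'*(4*N+6 - (4*N+4)*w') + ((2*N+6)*w' + 2*N - 6)) / (2*w')"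
    unfolding rPhi_def using w' by (simp add: field_simps)
  finally show ?thesis using that r(1) by blast
qed

text \<open>Compactness: along counterexamples with \<open>Z\<close> tending to 0,
  \<open>x = 1 + Y / Z\<close> stays in [0, 2] and \<open>scaled_limit\<close> yields the limit of
  \<open>c / Z\<close>. If \<open>w0 \<noteq> 1\<close>, then \<open>x\<close> tends to 1 and the
  factor \<open>x (N + 1) - 2\<close> in \<open>pF2\<close> tends to \<open>N - 1 > 0\<close>, a
  contradiction. If \<open>w0 = 1\<close>, this term is void, but \<open>pF3\<close> only needs
  \<open>x \<ge> 0\<close>. Hence the case distinction in the bound on \<open>Y\<close>.\<close>

lemma no_small_solution:
  assumes N: "N > 1" and w0: "w0 > 0"
  shows "\<exists>\<epsilon>>0. \<forall>Y Z w c l. Z \<noteq> 0 \<longrightarrow> \<bar>Z\<bar> < \<epsilon> \<longrightarrow> \<bar>w - w0\<bar> < \<epsilon> \<longrightarrow> \<bar>Y\<bar> \<le> (if w0 = 1 then 1 else \<epsilon>) * \<bar>Z\<bar> \<longrightarrow>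
    N * l = 2 * Z\<^sup>2 + 2 * c * Z \<longrightarrow> pPhi N (Y + Z) (Z - Y) w c l = 0 \<longrightarrow> pF2 N (Y + Z) (Z - Y) w c l = 0 \<longrightarrow>
    pF3 N (Y + Z) (Z - Y) w c l \<noteq> 0"
proof (rule ccontr)
  assume neg: "\<not> ?thesis"
  define e where "e k = 1 / real (Suc k)" for k
  have e0: "e k > 0" for k by (simp add: e_def)
  have el: "e \<longlonglongrightarrow> 0" unfolding e_def by (rule LIMSEQ_Suc[OF lim_1_over_n])
  have "\<exists>Y Z w c l. Z \<noteq> 0 \<and> \<bar>Z\<bar> < e k \<and> \<bar>w - w0\<bar> < e k \<and> \<bar>Y\<bar> \<le> (if w0 = 1 then 1 else e k) * \<bar>Z\<bar> \<and>
    N * l = 2 * Z\<^sup>2 + 2 * c * Z \<and> pPhi N (Y + Z) (Z - Y) w c l = 0 \<and> pF2 N (Y + Z) (Z - Y) w c l = 0 \<and>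
    pF3 N (Y + Z) (Z - Y) w c l = 0" for k using neg e0[of k] by blast
  then obtain Y Z w c l where s: "\<And>k. Z k \<noteq> 0" "\<And>k. \<bar>Z k\<bar> < e k" "\<And>k. \<bar>w k - w0\<bar> < e k" "\<And>k. \<bar>Y k\<bar> \<le> (if w0 = 1 then 1 else e k) * \<bar>Z k\<bar>"
    and l: "\<And>k. N * l k = 2 * (Z k)\<^sup>2 + 2 * c k * Z k" and z: "\<And>k. pPhi N (Y k + Z k) (Z k - Y k) (w k) (c k) (l k) = 0"
    "\<And>k. pF2 N (Y k + Z k) (Z k - Y k) (w k) (c k) (l k) = 0" "\<And>k. pF3 N (Y k + Z k) (Z k - Y k) (w k) (c k) (l k) = 0"
    by metis
  define J where "J = 1/N"
  have J: "N * J = 1" using N by (simp add: J_def)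
  define x where "x k = 1 + Y k / Z k" for k
  have x1: "\<bar>x k - 1\<bar> \<le> (if w0 = 1 then 1 else e k)" for k using s(4)[of k] s(1)[of k] by (simp add: x_def abs_divide divide_le_eq)
  have e1: "e k \<le> 1" for k by (simp add: e_def)
  have "\<bar>x k\<bar> \<le> 2" for k using x1[of k] e1[of k] by (auto split: if_splits)
  then have "bounded (range x)" unfolding bounded_iff by auto
  then obtain x' r where r: "strict_mono r" "(x \<circ> r) \<longlonglongrightarrow> x'" using bounded_imp_convergent_subsequence by blast
  have xl: "(\<lambda>k. x (r k)) \<longlonglongrightarrow> x'" using r(2) by (simp add: o_def)
  have "Z \<longlonglongrightarrow> 0" by (rule Lim_null_comparison[OF _ el]) (use s(2) less_imp_le in \<open>auto intro!: always_eventually\<close>)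
  then have Zl: "(\<lambda>k. Z (r k)) \<longlonglongrightarrow> 0" using LIMSEQ_subseq_LIMSEQ[OF _ r(1)] by (simp add: o_def)
  have "(\<lambda>k. w k - w0) \<longlonglongrightarrow> 0" by (rule Lim_null_comparison[OF _ el]) (use s(3) less_imp_le in \<open>auto intro!: always_eventually\<close>)
  then have "w \<longlonglongrightarrow> w0" by (simp add: LIM_zero_iff)
  then have wl: "(\<lambda>k. w (r k)) \<longlonglongrightarrow> w0" using LIMSEQ_subseq_LIMSEQ[OF _ r(1)] by (simp add: o_def)
  have "x k \<ge> 0" for k using x1[of k] e1[of k] by (auto split: if_splits)
  then have x'0: "x' \<ge> 0" by (intro LIMSEQ_le_const[OF xl]) auto
  have x'1: "x' = 1" if "w0 \<noteq> 1"
  proof -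
    have "(\<lambda>k. x k - 1) \<longlonglongrightarrow> 0" by (rule Lim_null_comparison[OF _ el]) (use x1 that in \<open>auto intro!: always_eventually\<close>)
    then have "x \<longlonglongrightarrow> 1" by (simp add: LIM_zero_iff)
    then show ?thesis using xl LIMSEQ_subseq_LIMSEQ[OF _ r(1)] LIMSEQ_unique by (force simp: o_def)
  qed
  have XY: "x k * Z k = Y k + Z k" "(2 - x k) * Z k = Z k - Y k" for k using s(1)[of k] by (simp_all add: x_def field_simps)
  have l': "l k = (2*(Z k)^2 + 2*(c k * Z k))*(1/N)" for k using l[of k] N by (simp add: field_simps)
  have c': "c k = (c k * Z k) / Z k" for k using s(1)[of k] by simp
  have N0: "N > 0" using N by simp
  obtain r' where r': "strict_mono r'" "(\<lambda>k. (c (r (r' k)) * Z (r (r' k))) / (Z (r (r' k)))^2) \<longlonglongrightarrow>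
     - (x'^2*((N+1)*w0 - (N+1)) + x'*(4*N+6 - (4*N+4)*w0) + ((2*N+6)*w0 + 2*N - 6)) / (2*w0)"
    using scaled_limit[OF N0 Zl xl wl w0 s(1), of "\<lambda>k. c (r k) * Z (r k)"] z(1,2) unfolding XY l'[symmetric] c'[symmetric] by blast
  define g where "g = - (x'^2*((N+1)*w0 - (N+1)) + x'*(4*N+6 - (4*N+4)*w0) + ((2*N+6)*w0 + 2*N - 6)) / (2*w0)"
  define G where "G k = c (r (r' k)) / Z (r (r' k))" for k
  define Z1 x1 w1 where d: "Z1 k = Z (r (r' k))" "x1 k = x (r (r' k))" "w1 k = w (r (r' k))" for k
  have Gl: "G \<longlonglongrightarrow> g" using r'(2) s(1) unfolding G_def g_def by (simp add: power2_eq_square)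
  have ll: "Z1 \<longlonglongrightarrow> 0" "x1 \<longlonglongrightarrow> x'" "w1 \<longlonglongrightarrow> w0" unfolding d
    using LIMSEQ_subseq_LIMSEQ[OF Zl r'(1)] LIMSEQ_subseq_LIMSEQ[OF xl r'(1)] LIMSEQ_subseq_LIMSEQ[OF wl r'(1)] by (simp_all add: o_def)
  have Z10: "Z1 k \<noteq> 0" for k using s(1) by (simp add: d)
  have sub: "c (r (r' k)) = G k * Z1 k" "l (r (r' k)) = (2 + 2*G k)*(Z1 k)^2*J" for k
  proof -
    show c: "c (r (r' k)) = G k * Z1 k" using s(1)[of "r (r' k)"] by (simp add: G_def d)
    show "l (r (r' k)) = (2 + 2*G k)*(Z1 k)^2*J" unfolding l' c by (simp add: d J_def algebra_simps power2_eq_square)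
  qed
  have F2: "pF2 N (x1 k * Z1 k) ((2 - x1 k) * Z1 k) (w1 k) (G k * Z1 k) ((2 + 2*G k)*(Z1 k)^2*J) = 0"
    and F3: "pF3 N (x1 k * Z1 k) ((2 - x1 k) * Z1 k) (w1 k) (G k * Z1 k) ((2 + 2*G k)*(Z1 k)^2*J) = 0" for k
    using z(2,3)[of "r (r' k)"] unfolding sub unfolding d XY by simp_all
  have F2': "N*w1 k*(w1 k-1)*(x1 k*(N+1) - 2) + (Z1 k)^2 * rF22 N J (G k) (Z1 k) (x1 k) (w1 k) = 0" for k
    using F2[of k] unfolding scaled_small(1)[OF J] using Z10[of k] by simp
  have "(\<lambda>k. N*w1 k*(w1 k-1)*(x1 k*(N+1) - 2) + (Z1 k)^2 * rF22 N J (G k) (Z1 k) (x1 k) (w1 k))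
     \<longlonglongrightarrow> N*w0*(w0-1)*(x'*(N+1) - 2) + 0^2 * rF22 N J g 0 x' w0"
    unfolding rF22_def by (intro tendsto_intros ll Gl)
  then have 2: "N*w0*(w0-1)*(x'*(N+1) - 2) = 0" unfolding F2' using LIMSEQ_unique[OF tendsto_const] by fastforce
  have w1: "w0 = 1"
  proof (rule ccontr)
    assume "w0 \<noteq> 1"
    then show False using 2 x'1 N w0 by simp
  qed
  define L where "L G x w = (-2)*G*w^2*N + 2*G*w^2 + (-1)*x^2*w^2*N^2 + (-1)*x^2*w^2*N + x^2*w*N^2 + 4*x^2*w*N + 3*x^2*w + (-3)*x^2*N + (-3)*x^2 + 2*x*w^2*N^2 + 8*x*w*N^2 + (-12)*x*w + (-10)*x*N^2 + (-4)*x*N + 12*x + (-2)*w^2*N^2 + 2*w^2 + (-2)*w*N^2 + (-16)*w*N + 10*w + (-4)*N^2 + 16*N + (-12)" for G x w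
  have F3': "L (G k) (x1 k) (w1 k) + (Z1 k)^2 * rF3 N J (G k) (Z1 k) (x1 k) (w1 k) = 0" for k
    using F3[of k] unfolding scaled_small(2)[OF J] using Z10[of k] by (simp add: L_def)
  have "(\<lambda>k. L (G k) (x1 k) (w1 k) + (Z1 k)^2 * rF3 N J (G k) (Z1 k) (x1 k) (w1 k)) \<longlonglongrightarrow> L g x' w0 + 0^2 * rF3 N J g 0 x' w0"
    unfolding rF3_def L_def by (intro tendsto_intros ll Gl)
  then have "L g x' 1 = 0" unfolding F3' w1 using LIMSEQ_unique[OF tendsto_const] by fastforce
  \<comment> \<open>At \<open>w0 = 1\<close> the limit of \<open>c / Z\<close> simplifies, and the
    leading term of \<open>pF3\<close> becomes a negative multiple of the positive number
    \<open>x' + 2 N\<close>.\<close>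
  moreover have g: "g = - (x' + 2*N)" by (simp add: g_def w1 field_simps power2_eq_square)
  moreover have "L g x' 1 = - 2*(N+1)*(x' + 2*N)" unfolding g L_def by (simp add: algebra_simps power2_eq_square)
  moreover have "(N+1)*(x' + 2*N) > 0" using N x'0 by (intro mult_pos_pos) auto
  ultimately show False by linarith
qed

section \<open>Rotations, the spherical Laplacian and maximum principles\<close>

abbreviation Lo :: "'n \<Rightarrow> 'n \<Rightarrow> (real^'n::finite \<Rightarrow> real) \<Rightarrow> real^'n \<Rightarrow> real" where
  "Lo i j \<equiv> ld (rot (axis i 1) (axis j 1))"

lemma ld_ld_rot:
  assumes "open U" "smooth_on f U" "x \<in> U" "linear A"
  shows "ld A (ld A f) x = dd (A x) (dd (A x) f) x + dd (A (A x)) f x"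
  using dd_ld[OF assms, of "A x"] by (simp add: ld_def[of A "ld A f"])

text \<open>The Casimir operator of the rotation group. Ordered pairs count each coordinate plane
  twice, whence the factor 1/2; pairs with \<open>i = j\<close> give 0.\<close>

lemma lapS_rot:
  fixes f :: "real^'n::finite \<Rightarrow> real"
  assumes "open U" "smooth_on f U" "x \<in> U"
  shows "lapS f x = (1/2) * (\<Sum>i\<in>UNIV. \<Sum>j\<in>UNIV. Lo i j (Lo i j f) x)"
proof -
  define e :: "'n \<Rightarrow> real^'n" where "e i = axis i 1" for i
  define H where "H v w = dd v (dd w f) x" for v w
  have df: "f differentiable (at x)" by (rule smooth_diffble[OF assms])
  have dv: "dd w f differentiable (at x)" for w by (rule smooth_diffble[OF assms(1) smooth_dd[OF assms(1,2)] assms(3)])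
  have sym: "H v w = H w v" for v w unfolding H_def by (rule dd_commute[OF assms])
  have l1: "H (v - v') w = H v w - H v' w" "H (t *\<^sub>R v) w = t * H v w" for v v' w t unfolding H_def by (simp_all add: dd_lin[OF dv])
  have l2: "H w (v - v') = H w v - H w v'" "H w (t *\<^sub>R v) = t * H w v" for v v' w t using l1 sym by metis+
  have xx: "x \<bullet> x = (\<Sum>i\<in>UNIV. x $ i * x $ i)" by (simp add: inner_sum)
  have s1: "(\<Sum>i\<in>UNIV. \<Sum>j\<in>UNIV. x $ i * x $ i * H (e j) (e j)) = (x \<bullet> x) * lapl f x"
  proof -
    have lp: "lapl f x = (\<Sum>j\<in>UNIV. H (e j) (e j))"
    proof -
      have "pd i f = dd (axis i 1) f" for i by (simp add: pd_eq_dd fun_eq_iff)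
      then show ?thesis by (simp add: lapl_def pd_eq_dd H_def e_def)
    qed
    show ?thesis unfolding xx lp sum_product by (rule refl)
  qed
  have s2: "(\<Sum>i\<in>UNIV. \<Sum>j\<in>UNIV. x $ j * x $ j * H (e i) (e i)) = (x \<bullet> x) * lapl f x"
    using s1 by (subst sum.swap) simp
  have s3: "(\<Sum>i\<in>UNIV. \<Sum>j\<in>UNIV. x $ i * (x $ j * H (e i) (e j))) = H x x"
  proof -
    have h1: "H v x = (\<Sum>j\<in>UNIV. x $ j * H v (e j))" for v
      unfolding sym[of v] unfolding H_def e_def by (subst dd_sum_pd[OF dv]) (simp add: pd_eq_dd)
    have h2: "H x v = (\<Sum>j\<in>UNIV. x $ j * H (e j) v)" for v
      unfolding H_def e_def by (subst dd_sum_pd[OF dv]) (simp add: pd_eq_dd)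
    have "H x x = (\<Sum>i\<in>UNIV. x $ i * (\<Sum>j\<in>UNIV. x $ j * H (e i) (e j)))"
      using h2[of x] by (simp only: h1[of "e i" for i])
    then show ?thesis by (simp add: sum_distrib_left)
  qed
  have s4: "(\<Sum>i\<in>UNIV. \<Sum>j\<in>UNIV. x $ i * (x $ j * H (e j) (e i))) = H x x"
    using s3 sym by simp
  have q: "H (rot (e i) (e j) x) (rot (e i) (e j) x) = x $ i * x $ i * H (e j) (e j) - x $ i * (x $ j * H (e i) (e j))
     - x $ i * (x $ j * H (e j) (e i)) + x $ j * x $ j * H (e i) (e i)" for i j
  proof -
    have r: "rot (e i) (e j) x = x $ i *\<^sub>R e j - x $ j *\<^sub>R e i" by (simp add: rot_def e_def inner_axis)
    show ?thesis unfolding r l1 l2 by (simp add: algebra_simps)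
  qed
  have "(\<Sum>i\<in>UNIV. \<Sum>j\<in>UNIV. H (rot (e i) (e j) x) (rot (e i) (e j) x)) = 2 * ((x \<bullet> x) * lapl f x) - 2 * H x x"
    unfolding q by (simp add: sum.distrib sum_subtractf s1 s2 s3 s4)
  moreover have "(\<Sum>i\<in>UNIV. \<Sum>j\<in>UNIV. dd (rot (e i) (e j) (rot (e i) (e j) x)) f x) = - 2 * (real CARD('n) - 1) * ld id f x"
  proof -
    have r: "dd (rot (e i) (e j) (rot (e i) (e j) x)) f x = x $ i * kd i j * dd (e j) f x - x $ j * dd (e j) f x
       - x $ i * dd (e i) f x + x $ j * kd i j * dd (e i) f x" for i j
    proof -
      have ee: "e i \<bullet> e i = 1" "e j \<bullet> e j = 1" "e j \<bullet> e i = kd i j" "e i \<bullet> e j = kd i j" "x \<bullet> e i = x $ i" "x \<bullet> e j = x $ j"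
        by (auto simp: e_def inner_axis kd_axis kd_def)
      show ?thesis by (simp add: rot_def dd_lin[OF df] inner_diff_left ee algebra_simps)
    qed
    have E: "ld id f x = (\<Sum>i\<in>UNIV. x $ i * dd (e i) f x)" using dd_sum_pd[OF df, of x] by (simp add: ld_def pd_eq_dd e_def)
    have k1: "(\<Sum>i\<in>UNIV. \<Sum>j\<in>UNIV. x $ i * kd i j * dd (e j) f x) = ld id f x"
      unfolding E by (simp add: mult.assoc sum_distrib_left[symmetric])
    have k2: "(\<Sum>i\<in>UNIV. \<Sum>j\<in>UNIV. x $ j * kd i j * dd (e i) f x) = ld id f x"
      unfolding E by (subst sum.swap) (simp add: mult.assoc sum_distrib_left[symmetric])
    have k3: "(\<Sum>i\<in>(UNIV::'n set). \<Sum>j\<in>UNIV. x $ j * dd (e j) f x) = real CARD('n) * ld id f x" unfolding E by simp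
    have k4: "(\<Sum>i\<in>UNIV. \<Sum>j\<in>(UNIV::'n set). x $ i * dd (e i) f x) = real CARD('n) * ld id f x"
      unfolding E sum_distrib_left by simp
    show ?thesis unfolding r sum.distrib sum_subtractf k1 k2 k3 k4 by (simp add: algebra_simps)
  qed
  moreover have "H x x = ld id (ld id f) x - ld id f x"
    using ld_ld_rot[OF assms linear_id'] by (simp add: H_def ld_def[of id f])
  ultimately show ?thesis unfolding ld_ld_rot[OF assms linear_rot] lapS_def
    by (simp add: sum.distrib H_def e_def algebra_simps)
qed

lemma dd_ld':
  assumes "open U" "smooth_on f U" "x \<in> U" "linear A"
  shows "dd e (ld A f) x = ld A (dd e f) x + dd (A e) f x"
  using dd_ld[OF assms, of e] dd_commute[OF assms(1-3), of e "A x"] by (simp add: ld_def)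

text \<open>Only cross terms of the form D_(A e_i) D_(e_i) f could obstruct. Their sum pairs the
  skew map with the symmetric Hessian and vanishes.\<close>

lemma lapl_rot_commute:
  assumes "open U" "smooth_on f U" "x \<in> U"
  shows "lapl (ld (rot a b) f) x = ld (rot a b) (lapl f) x"
proof -
  let ?A = "rot a b"
  have pdd: "pd i g = dd (axis i 1) g" for i and g :: "real^'a \<Rightarrow> real" by (simp add: pd_eq_dd fun_eq_iff)
  have sd: "smooth_on (dd e f) U" for e by (rule smooth_dd[OF assms(1,2)])
  have 1: "dd e (dd e (ld ?A f)) x = ld ?A (dd e (dd e f)) x + 2 * dd (?A e) (dd e f) x" for e
  proof -
    have "dd e (dd e (ld ?A f)) x = dd e (\<lambda>y. ld ?A (dd e f) y + dd (?A e) f y) x"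
      by (rule dd_cong_open[OF assms(1,3)]) (rule dd_ld'[OF assms(1,2) _ linear_rot])
    also have "\<dots> = dd e (ld ?A (dd e f)) x + dd e (dd (?A e) f) x"
      by (rule dd_simps) (intro smooth_diffble[OF assms(1) _ assms(3)] smooth_ld assms(1) linear_rot sd)+
    finally show ?thesis using dd_ld'[OF assms(1) sd assms(3) linear_rot, of e a b e] dd_commute[OF assms, of e "?A e"] by simp
  qed
  have "(\<Sum>i\<in>UNIV. dd (?A (axis i 1)) (dd (axis i 1) f) x) = (\<Sum>i\<in>UNIV. a $ i * pd i (dd b f) x) - (\<Sum>i\<in>UNIV. b $ i * pd i (dd a f) x)"
  proof -
    have d: "dd w f differentiable (at x)" for w by (rule smooth_diffble[OF assms(1) sd assms(3)])
    have "dd (?A (axis i 1)) (dd (axis i 1) f) x = a $ i * pd i (dd b f) x - b $ i * pd i (dd a f) x" for i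
      using dd_commute[OF assms, of "axis i 1"] by (simp add: rot_def dd_lin[OF d] inner_axis' pd_eq_dd)
    then show ?thesis by (simp add: sum_subtractf)
  qed
  also have "\<dots> = 0"
    using dd_commute[OF assms, of a b] unfolding dd_sum_pd[OF smooth_diffble[OF assms(1) sd assms(3)]] by simp
  finally have 2: "(\<Sum>i\<in>UNIV. dd (?A (axis i 1)) (dd (axis i 1) f) x) = 0" .
  have "ld ?A (lapl f) x = (\<Sum>i\<in>UNIV. ld ?A (dd (axis i 1) (dd (axis i 1) f)) x)"
  proof -
    have "lapl f = (\<lambda>y. \<Sum>i\<in>UNIV. dd (axis i 1) (dd (axis i 1) f) y)" by (simp add: fun_eq_iff lapl_def pdd)
    then show ?thesis unfolding ld_def
      by (simp only:) (rule dd_sum_fun, intro smooth_diffble[OF assms(1) _ assms(3)] smooth_dd assms(1) sd)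
  qed
  then show ?thesis unfolding lapl_def pdd 1 by (simp add: sum.distrib sum_distrib_left[symmetric] 2)
qed

lemma smooth_lapl [smooth_intros]: "open U \<Longrightarrow> smooth_on f U \<Longrightarrow> smooth_on (lapl f) U"
  unfolding lapl_def by (intro smooth_sum smooth_pd)

lemma smooth_lapS [smooth_intros]: "open U \<Longrightarrow> smooth_on f U \<Longrightarrow> smooth_on (lapS f) U"
  unfolding lapS_def by (intro smooth_diff smooth_mult smooth_norm2 smooth_const smooth_ld linear_id' smooth_lapl)

lemma lapS_rot_commute:
  assumes "open U" "smooth_on f U" "x \<in> U"
  shows "lapS (ld (rot a b) f) x = ld (rot a b) (lapS f) x"
proof -
  let ?A = "rot a b"
  have sl: "smooth_on (ld A f) U" if "linear A" for A by (rule smooth_ld[OF assms(1) that assms(2)])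
  note sl2 = smooth_ld[OF assms(1) linear_id' sl[OF linear_id']]
  have R: "ld ?A (\<lambda>x. x \<bullet> x) x = 0"
  proof -
    have "((\<lambda>x. x \<bullet> x) has_derivative (\<lambda>v. x \<bullet> v + v \<bullet> x)) (at x)" by (auto intro!: derivative_eq_intros)
    then show ?thesis using rot_perp[of x a b] by (simp add: ld_def dd_unique inner_commute)
  qed
  have d: "(\<lambda>x. x \<bullet> x) differentiable (at x)" "lapl f differentiable (at x)" "ld id (ld id f) differentiable (at x)" "ld id f differentiable (at x)"
    by (intro smooth_diffble[OF assms(1) _ assms(3)] smooth_norm2 smooth_lapl assms sl2 sl linear_id')+
  have "ld ?A (lapS f) x = ld ?A (\<lambda>x. (x \<bullet> x) * lapl f x - ld id (ld id f) x - (real CARD('a) - 2) * ld id f x) x"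
    by (simp add: lapS_def[abs_def])
  also have "\<dots> = (x \<bullet> x) * ld ?A (lapl f) x - ld ?A (ld id (ld id f)) x - (real CARD('a) - 2) * ld ?A (ld id f) x"
    by (subst ld_simps | (intro differentiable_diff differentiable_mult differentiable_const d))+ (simp add: R, simp add: ld_def)
  also have "\<dots> = lapS (ld ?A f) x"
  proof -
    have "ld id (ld id (ld ?A f)) x = ld id (ld ?A (ld id f)) x"
      by (rule ld_cong_open[OF assms(1,3)]) (rule ld_id_commute[OF assms(1,2) _ linear_rot])
    then show ?thesis unfolding lapS_def lapl_rot_commute[OF assms] ld_id_commute[OF assms linear_rot] 
      ld_id_commute[OF assms(1) sl[OF linear_id'] assms(3) linear_rot] by simp
  qed
  finally show ?thesis by simp
qed

text \<open>For orthonormal \<open>a\<close>, \<open>b\<close> this is the flow of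
  \<open>rot a b\<close>: rotation by the angle \<open>t\<close> in their plane, fixing the
  orthogonal complement.\<close>

definition cv :: "real^'n \<Rightarrow> real^'n \<Rightarrow> real^'n \<Rightarrow> real \<Rightarrow> real^'n" where
  "cv a b x t = x + (cos t - 1) *\<^sub>R ((x \<bullet> a) *\<^sub>R a + (x \<bullet> b) *\<^sub>R b) + sin t *\<^sub>R rot a b x"

definition "orth2 a b \<longleftrightarrow> a \<bullet> a = 1 \<and> b \<bullet> b = 1 \<and> a \<bullet> (b :: real^'n) = 0"

lemma cv_0 [simp]: "cv a b x 0 = x" by (simp add: cv_def)

lemma cv_deriv: assumes "orth2 a b" shows "(cv a b x has_vector_derivative rot a b (cv a b x t)) (at t)"
proof -
  have "((\<lambda>t. x + (cos t - 1) *\<^sub>R ((x \<bullet> a) *\<^sub>R a + (x \<bullet> b) *\<^sub>R b) + sin t *\<^sub>R rot a b x) has_vector_derivative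
     (- sin t) *\<^sub>R ((x \<bullet> a) *\<^sub>R a + (x \<bullet> b) *\<^sub>R b) + cos t *\<^sub>R rot a b x) (at t)"
    by (auto intro!: derivative_eq_intros simp: has_vector_derivative_def scaleR_add_left algebra_simps)
  moreover have "rot a b (cv a b x t) = (- sin t) *\<^sub>R ((x \<bullet> a) *\<^sub>R a + (x \<bullet> b) *\<^sub>R b) + cos t *\<^sub>R rot a b x"
  proof -
    have c: "cv a b x t \<bullet> a = cos t * (x \<bullet> a) - sin t * (x \<bullet> b)" "cv a b x t \<bullet> b = cos t * (x \<bullet> b) + sin t * (x \<bullet> a)"
      using assms by (simp_all add: orth2_def cv_def rot_def inner_add_left inner_diff_left inner_commute[of b a] algebra_simps)
    show ?thesis unfolding rot_def[of a b "cv a b x t"] c by (simp add: rot_def algebra_simps)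
  qed
  ultimately show ?thesis by (simp add: cv_def[abs_def])
qed

lemma norm_cv: assumes "orth2 a b" shows "norm (cv a b x t) = norm x"
proof -
  define \<alpha> \<beta> where d: "\<alpha> = x \<bullet> a" "\<beta> = x \<bullet> b"
  define v where "v = (cos t - 1) *\<^sub>R (\<alpha> *\<^sub>R a + \<beta> *\<^sub>R b) + sin t *\<^sub>R (\<alpha> *\<^sub>R b - \<beta> *\<^sub>R a)"
  have o: "a \<bullet> a = 1" "b \<bullet> b = 1" "a \<bullet> b = 0" "b \<bullet> a = 0" using assms by (auto simp: orth2_def inner_commute)
  have 1: "cv a b x t = x + v" by (simp add: cv_def v_def d rot_def)
  have "v \<bullet> v = ((cos t - 1)\<^sup>2 + (sin t)\<^sup>2) * (\<alpha>\<^sup>2 + \<beta>\<^sup>2)"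
    unfolding v_def by (simp add: inner_add_left inner_add_right inner_diff_left inner_diff_right o power2_eq_square algebra_simps) (use sin_cos_squared_add[of t] in algebra)
  also have "(cos t - 1)\<^sup>2 + (sin t)\<^sup>2 = 2 - 2 * cos t" using sin_cos_squared_add[of t] by (simp add: power2_eq_square algebra_simps)
  finally have 2: "v \<bullet> v = (2 - 2 * cos t) * (\<alpha>\<^sup>2 + \<beta>\<^sup>2)" .
  have 3: "x \<bullet> v = (cos t - 1) * (\<alpha>\<^sup>2 + \<beta>\<^sup>2)"
    unfolding v_def by (simp add: inner_add_right inner_diff_right d[symmetric] power2_eq_square algebra_simps)
  have "(x + v) \<bullet> (x + v) = x \<bullet> x + 2 * (x \<bullet> v) + v \<bullet> v" by (simp add: inner_add_left inner_add_right inner_commute)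
  also have "\<dots> = x \<bullet> x" unfolding 2 3 by (simp add: algebra_simps)
  finally show ?thesis unfolding 1 by (simp add: norm_eq_sqrt_inner)
qed

lemma cv_DERIV: assumes "orth2 a b" "f differentiable (at (cv a b x t))"
  shows "((\<lambda>t. f (cv a b x t)) has_real_derivative ld (rot a b) f (cv a b x t)) (at t)"
  using has_real_derivative_curve[OF assms(2) cv_deriv[OF assms(1)]] by (simp add: ld_def)

section \<open>Maxima and oscillation on spheres\<close>

lemma max_second_derivative:
  fixes g :: "real \<Rightarrow> real"
  assumes "\<And>t. (g has_real_derivative g' t) (at t)" "(g' has_real_derivative D) (at 0)" "\<And>t. g t \<le> g 0"
  shows "g' 0 = 0" "D \<le> 0"
proof -
  show z: "g' 0 = 0" using DERIV_local_max[OF assms(1)[of 0], of 1] assms(3) by simp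
  show "D \<le> 0"
  proof (rule ccontr)
    assume "\<not> D \<le> 0"
    then obtain d where d: "d > 0" "\<And>h. h > 0 \<Longrightarrow> h < d \<Longrightarrow> g' 0 < g' (0 + h)" using DERIV_pos_inc_right[OF assms(2)] by auto
    have "\<exists>z>0. z < d/2 \<and> g (d/2) - g 0 = (d/2 - 0) * g' z" by (rule MVT2) (use d assms(1) in auto)
    then obtain z where z': "0 < z" "z < d/2" "g (d/2) - g 0 = d/2 * g' z" by auto
    have "g' z > 0" using d(2)[of z] z' z by simp
    then have "g (d/2) - g 0 > 0" unfolding z'(3) using d by simp
    then show False using assms(3)[of "d/2"] by simp
  qed
qed

text \<open>Restricted to the orbit \<open>cv a b x\<close>, which stays on the sphere,
  \<open>f\<close> is a function of one variable with a maximum at 0.\<close>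

lemma spatial_max_rot:
  assumes "open U" "smooth_on f U" "\<And>y. norm y = norm x \<Longrightarrow> y \<in> U" "\<And>y. norm y = norm x \<Longrightarrow> f y \<le> f x" "orth2 a b"
  shows "ld (rot a b) f x = 0" "ld (rot a b) (ld (rot a b) f) x \<le> 0"
proof -
  have c: "cv a b x t \<in> U" for t using assms(3) norm_cv[OF assms(5)] by blast
  have D1: "((\<lambda>t. f (cv a b x t)) has_real_derivative ld (rot a b) f (cv a b x t)) (at t)" for t
    by (rule cv_DERIV[OF assms(5) smooth_diffble[OF assms(1,2) c]])
  have D2: "((\<lambda>t. ld (rot a b) f (cv a b x t)) has_real_derivative ld (rot a b) (ld (rot a b) f) (cv a b x 0)) (at 0)"
    by (rule cv_DERIV[OF assms(5) smooth_diffble[OF assms(1) smooth_ld[OF assms(1) linear_rot assms(2)] c]])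
  have m: "f (cv a b x t) \<le> f (cv a b x 0)" for t using assms(4) norm_cv[OF assms(5)] by simp
  show "ld (rot a b) f x = 0" "ld (rot a b) (ld (rot a b) f) x \<le> 0"
    using max_second_derivative[OF D1 D2 m] by simp_all
qed

lemma orth2_axis: "i \<noteq> j \<Longrightarrow> orth2 (axis i 1) (axis j 1 :: real^'n::finite)"
  by (simp add: orth2_def inner_axis_axis)

lemma Lo_self: "f differentiable (at x) \<Longrightarrow> Lo i i f x = 0"
  by (simp add: ld_def rot_def dd_lin)

lemma spatial_max_lapS:
  assumes "open U" "smooth_on f U" "\<And>y. norm y = norm x \<Longrightarrow> y \<in> U" "\<And>y. norm y = norm x \<Longrightarrow> f y \<le> f x"
  shows "lapS f x \<le> 0" "Lo i j f x = 0"
proof -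
  have d: "f differentiable (at x)" "Lo i j f differentiable (at x)" for i j
    by (intro smooth_diffble[OF assms(1)] smooth_ld assms linear_rot refl)+
  show L: "Lo i j f x = 0" for i j
    by (cases "i = j") (simp_all add: Lo_self d spatial_max_rot[OF assms orth2_axis])
  have "Lo i j (Lo i j f) x \<le> 0" for i j
    by (cases "i = j") (simp_all add: Lo_self d spatial_max_rot[OF assms orth2_axis])
  then show "lapS f x \<le> 0" unfolding lapS_rot[OF assms(1,2) assms(3)[OF refl]] by (auto intro!: sum_nonpos)
qed

lemma exists_unit_orth:
  fixes a :: "real^'n::finite" assumes "CARD('n) \<ge> 2" obtains b where "b \<bullet> b = 1" "b \<bullet> a = 0"
proof -
  have "dim {a} \<le> card {a}" by (rule dim_le_card') simp
  also have "\<dots> < DIM(real^'n)" using assms by simp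
  finally obtain e where e: "e \<noteq> 0" "\<And>y. y \<in> span {a} \<Longrightarrow> orthogonal e y"
    using orthogonal_to_subspace_exists by blast
  have "e \<bullet> a = 0" using e(2)[of a] by (auto simp: orthogonal_def span_base)
  then show ?thesis using e(1) by (intro that[of "sgn e"]) (simp_all add: dot_square_norm norm_sgn sgn_div_norm)
qed

text \<open>The two points lie in a plane through the origin, and \<open>arccos\<close> of their
  normalised product is the angle. If \<open>y\<close> is a multiple of \<open>x\<close>, any unit
  vector \<open>b\<close> orthogonal to \<open>x\<close> will do.\<close>

lemma sphere_rotation:
  fixes x y :: "real^'n::finite"
  assumes "CARD('n) \<ge> 2" "norm y = norm x" "x \<noteq> 0"
  obtains a b t where "orth2 a b" "0 \<le> t" "t \<le> pi" "cv a b x t = y"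
proof -
  define r where "r = norm x"
  have r: "r > 0" using assms(3) by (simp add: r_def)
  define a where "a = (1/r) *\<^sub>R x"
  have xa: "x = r *\<^sub>R a" using r by (simp add: a_def)
  have aa: "a \<bullet> a = 1" using r by (simp add: a_def r_def dot_square_norm power2_eq_square)
  define z where "z = y - (y \<bullet> a) *\<^sub>R a"
  have za: "z \<bullet> a = 0" by (simp add: z_def inner_diff_left aa)
  obtain b where b: "b \<bullet> b = 1" "b \<bullet> a = 0" "z = norm z *\<^sub>R b"
  proof (cases "z = 0")
    case True
    then show ?thesis using exists_unit_orth[OF assms(1), of a] that by auto
  next
    case False
    then show ?thesis using za by (intro that[of "sgn z"]) (simp_all add: dot_square_norm norm_sgn sgn_div_norm)
  qed
  have y: "y = (y \<bullet> a) *\<^sub>R a + norm z *\<^sub>R b" using b(3) by (simp add: z_def)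
  have "y \<bullet> y = (y \<bullet> a)\<^sup>2 + (norm z)\<^sup>2"
    by (subst (1 2) y) (simp add: inner_add_left inner_add_right aa b(1,2) inner_commute[of a b] power2_eq_square)
  then have "(y \<bullet> a)\<^sup>2 + (norm z)\<^sup>2 = r\<^sup>2" using assms(2) by (simp add: r_def dot_square_norm)
  moreover have "((y \<bullet> a) / r)\<^sup>2 + (norm z / r)\<^sup>2 = ((y \<bullet> a)\<^sup>2 + (norm z)\<^sup>2) / r\<^sup>2"
    by (simp only: power_divide add_divide_distrib)
  ultimately have n: "((y \<bullet> a) / r)\<^sup>2 + (norm z / r)\<^sup>2 = 1" using r by simp
  define c where "c = (y \<bullet> a) / r"
  have c1: "c\<^sup>2 \<le> 1" using n by (simp add: c_def) (smt (verit) zero_le_power2)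
  then have c2: "-1 \<le> c" "c \<le> 1" by (simp_all add: abs_square_le_1 abs_le_iff)
  have s: "sin (arccos c) = norm z / r"
  proof -
    have "sin (arccos c) = sqrt ((norm z / r)\<^sup>2)" unfolding sin_arccos[OF c2] using n by (intro arg_cong[where f=sqrt]) (simp add: c_def eq_diff_eq add.commute)
    then show ?thesis using r by simp
  qed
  have x1: "x \<bullet> a = r" "x \<bullet> b = 0" using aa b(2) by (simp_all add: xa inner_commute[of a b])
  have "cv a b x (arccos c) = r *\<^sub>R a + (cos (arccos c) - 1) *\<^sub>R (r *\<^sub>R a) + sin (arccos c) *\<^sub>R (r *\<^sub>R b)"
    unfolding cv_def rot_def x1 by (simp add: xa[symmetric])
  also have "\<dots> = (r * c) *\<^sub>R a + norm z *\<^sub>R b" unfolding s cos_arccos[OF c2] using r by (simp add: algebra_simps)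
  also have "\<dots> = y" using y r by (simp add: c_def)
  finally show ?thesis using that[of a b "arccos c"] aa b arccos_bounded[OF c2] by (simp add: orth2_def inner_commute)
qed

text \<open>The points are joined by a rotation orbit of parameter length at most
  \<open>pi\<close>.\<close>

lemma sphere_osc:
  fixes f :: "real^'n::finite \<Rightarrow> real"
  assumes "CARD('n) \<ge> 2" "norm y = norm x" "x \<noteq> 0" "\<And>z. norm z = norm x \<Longrightarrow> f differentiable (at z)"
    and B: "\<And>a b z. orth2 a b \<Longrightarrow> norm z = norm x \<Longrightarrow> \<bar>ld (rot a b) f z\<bar> \<le> B"
  shows "\<bar>f y - f x\<bar> \<le> pi * B"
proof -
  obtain a b t where c: "orth2 a b" "0 \<le> t" "t \<le> pi" "cv a b x t = y" using sphere_rotation[OF assms(1-3)] .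
  have D: "((\<lambda>t. f (cv a b x t)) has_real_derivative ld (rot a b) f (cv a b x t)) (at t)" for t
    by (rule cv_DERIV[OF c(1) assms(4)[OF norm_cv[OF c(1)]]])
  have B0: "0 \<le> B" using B[OF c(1), of x] by simp
  have "norm (f (cv a b x t) - f (cv a b x 0)) \<le> B * norm (t - 0)"
  proof (rule field_differentiable_bound[of UNIV])
    show "((\<lambda>t. f (cv a b x t)) has_field_derivative ld (rot a b) f (cv a b x s)) (at s within UNIV)" for s using D by simp
    show "norm (ld (rot a b) f (cv a b x s)) \<le> B" for s using B[OF c(1) norm_cv[OF c(1)]] by simp
  qed auto
  also have "\<dots> \<le> B * pi" using c B0 by (intro mult_left_mono) auto
  finally show ?thesis using c(4) by (simp add: mult.commute)
qed

text \<open>The squared gradient on the unit sphere, that is r^2 times the squared tangential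
  gradient in R^n. It is written with rotations because these commute with \<open>lapS\<close> and
  \<open>E\<close>.\<close>

definition Qd :: "(real^'n::finite \<Rightarrow> real) \<Rightarrow> real^'n \<Rightarrow> real" where
  "Qd f x = (1/2) * (\<Sum>i\<in>UNIV. \<Sum>j\<in>UNIV. (Lo i j f x)\<^sup>2)"

lemma Qd_nonneg: "Qd f x \<ge> 0" by (simp add: Qd_def sum_nonneg)

text \<open>Lagrange's identity for \<open>x\<close> and the gradient.\<close>

lemma Qd_eq: assumes "f differentiable (at x)"
  shows "Qd f x = (x \<bullet> x) * (grd f x \<bullet> grd f x) - (x \<bullet> grd f x)\<^sup>2"
proof -
  define g where "g = grd f x"
  have L: "Lo i j f x = x $ i * g $ j - x $ j * g $ i" for i j
  proof -
    have "Lo i j f x = rot (axis i 1) (axis j 1) x \<bullet> g" by (simp add: ld_def g_def grd_inner[OF assms])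
    then show ?thesis by (simp add: rot_def inner_diff_left inner_axis inner_axis')
  qed
  have "(Lo i j f x)\<^sup>2 = (x $ i * x $ i) * (g $ j * g $ j) - 2 * ((x $ i * g $ i) * (x $ j * g $ j)) + (g $ i * g $ i) * (x $ j * x $ j)" for i j
    unfolding L by (simp add: power2_eq_square algebra_simps)
  then have "(\<Sum>i\<in>UNIV. \<Sum>j\<in>UNIV. (Lo i j f x)\<^sup>2) = (x \<bullet> x) * (g \<bullet> g) - 2 * ((x \<bullet> g) * (x \<bullet> g)) + (g \<bullet> g) * (x \<bullet> x)"
    unfolding inner_sum sum_product by (simp add: sum.distrib sum_subtractf sum_distrib_left)
  then show ?thesis by (simp add: Qd_def g_def power2_eq_square)
qed

lemma Qd_dd: assumes "f differentiable (at x)" "x \<bullet> v = 0" shows "(dd v f x)\<^sup>2 * (x \<bullet> x) \<le> (v \<bullet> v) * Qd f x"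
proof (cases "x = 0")
  case False
  define g where "g = grd f x"
  define h where "h = g - ((x \<bullet> g) / (x \<bullet> x)) *\<^sub>R x"
  have R: "x \<bullet> x \<noteq> 0" using False by simp
  have "dd v f x = v \<bullet> h" using assms(2) by (simp add: h_def inner_diff_right g_def grd_inner[OF assms(1)] inner_commute[of v x])
  then have "(dd v f x)\<^sup>2 \<le> (v \<bullet> v) * (h \<bullet> h)" using Cauchy_Schwarz_ineq[of v h] by simp
  then have "(dd v f x)\<^sup>2 * (x \<bullet> x) \<le> (v \<bullet> v) * (h \<bullet> h) * (x \<bullet> x)" by (rule mult_right_mono) simp
  moreover have "(h \<bullet> h) * (x \<bullet> x) = Qd f x" unfolding Qd_eq[OF assms(1)] g_def[symmetric] h_def
    using R by (simp add: inner_diff_left inner_diff_right inner_commute[of g x] field_simps power2_eq_square)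
  ultimately show ?thesis by (simp add: mult.assoc)
qed (simp add: Qd_nonneg)

text \<open>By Bessel's inequality for \<open>a\<close> and \<open>b\<close>, the vector
  \<open>rot a b x\<close> is not longer than \<open>x\<close>.\<close>

lemma Qd_rot: assumes "f differentiable (at x)" "orth2 a b" "x \<noteq> 0" shows "(ld (rot a b) f x)\<^sup>2 \<le> Qd f x"
proof -
  define \<alpha> \<beta> where d: "\<alpha> = x \<bullet> a" "\<beta> = x \<bullet> b"
  have o: "a \<bullet> a = 1" "b \<bullet> b = 1" "a \<bullet> b = 0" "b \<bullet> a = 0" using assms(2) by (auto simp: orth2_def inner_commute)
  have v: "rot a b x \<bullet> rot a b x = \<alpha>\<^sup>2 + \<beta>\<^sup>2" by (simp add: rot_def d inner_diff_left inner_diff_right o power2_eq_square)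
  have "0 \<le> (x - \<alpha> *\<^sub>R a - \<beta> *\<^sub>R b) \<bullet> (x - \<alpha> *\<^sub>R a - \<beta> *\<^sub>R b)" by simp
  also have "\<dots> = x \<bullet> x - \<alpha>\<^sup>2 - \<beta>\<^sup>2"
    by (simp add: inner_diff_left inner_diff_right o inner_commute[of a x] inner_commute[of b x] d[symmetric] power2_eq_square)
  finally have "rot a b x \<bullet> rot a b x \<le> x \<bullet> x" using v by simp
  then have "(rot a b x \<bullet> rot a b x) * Qd f x \<le> (x \<bullet> x) * Qd f x" by (rule mult_right_mono[OF _ Qd_nonneg])
  then have "(ld (rot a b) f x)\<^sup>2 * (x \<bullet> x) \<le> Qd f x * (x \<bullet> x)"
    using Qd_dd[OF assms(1) rot_perp, of a b] by (simp add: ld_def mult.commute)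
  then show ?thesis using assms(3) by simp
qed

text \<open>With \<open>a\<close> radial and \<open>b\<close> along the tangential part
  \<open>h\<close> of the gradient, the rotation \<open>rot a b\<close> sees the whole spherical
  gradient. This selects the plane of a slice.\<close>

lemma Qd_frame: assumes "f differentiable (at x)" "Qd f x > 0" "x \<noteq> 0"
  obtains a b where "orth2 a b" "x = norm x *\<^sub>R a" "\<And>e. e \<bullet> a = 0 \<Longrightarrow> e \<bullet> b = 0 \<Longrightarrow> dd e f x = 0"
    "ld (rot a b) f x = sqrt (Qd f x)"
proof -
  define g where "g = grd f x"
  define h where "h = g - ((x \<bullet> g) / (x \<bullet> x)) *\<^sub>R x"
  have R: "x \<bullet> x \<noteq> 0" using assms(3) by simp
  have hx: "h \<bullet> x = 0" using R by (simp add: h_def inner_diff_left inner_commute[of g x])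
  have hQ: "(h \<bullet> h) * (x \<bullet> x) = Qd f x" unfolding Qd_eq[OF assms(1)] g_def[symmetric] h_def
    using R by (simp add: inner_diff_left inner_diff_right inner_commute[of g x] field_simps power2_eq_square)
  then have h0: "h \<noteq> 0" using assms(2) by auto
  have g: "g = h + ((x \<bullet> g) / (x \<bullet> x)) *\<^sub>R x" by (simp add: h_def)
  show ?thesis
  proof (rule that[of "sgn x" "sgn h"])
    show "orth2 (sgn x) (sgn h)" using h0 assms(3) hx
      by (simp add: orth2_def dot_square_norm norm_sgn) (simp add: sgn_div_norm inner_commute)
    show "x = norm x *\<^sub>R sgn x" using assms(3) by (simp add: sgn_div_norm)
    show "dd e f x = 0" if "e \<bullet> sgn x = 0" "e \<bullet> sgn h = 0" for e
    proof -
      have "e \<bullet> x = 0" "e \<bullet> h = 0" using that assms(3) h0 by (simp_all add: sgn_div_norm)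
      then have "e \<bullet> g = 0" by (subst g) (simp add: inner_add_right)
      then show ?thesis by (simp add: g_def grd_inner[OF assms(1)])
    qed
    have "rot (sgn x) (sgn h) x = norm x *\<^sub>R sgn h"
      using hx assms(3) by (simp add: rot_def sgn_div_norm inner_commute[of x h] dot_square_norm power2_eq_square)
    then have "ld (rot (sgn x) (sgn h)) f x = norm x * (sgn h \<bullet> g)" by (simp add: ld_def dd_lin[OF assms(1)] g_def grd_inner[OF assms(1)])
    also have "sgn h \<bullet> g = norm h" using hx h0 by (subst g) (simp add: inner_add_right sgn_div_norm dot_square_norm power2_eq_square)
    also have "norm x * norm h = sqrt (Qd f x)" unfolding hQ[symmetric] by (simp add: norm_eq_sqrt_inner real_sqrt_mult mult.commute)
    finally show "ld (rot (sgn x) (sgn h)) f x = sqrt (Qd f x)" .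
  qed
qed

section \<open>Maximum principles in the radial direction\<close>

lemma DERIV_radial:
  assumes "f differentiable (at (t *\<^sub>R x))" "t \<noteq> 0"
  shows "((\<lambda>t. f (t *\<^sub>R x)) has_real_derivative ld id f (t *\<^sub>R x) / t) (at t)"
proof -
  have "((\<lambda>t. f (0 + t *\<^sub>R x)) has_real_derivative dd x f (0 + t *\<^sub>R x)) (at t)"
    by (rule has_real_derivative_line) (use assms in simp)
  moreover have "dd x f (t *\<^sub>R x) = ld id f (t *\<^sub>R x) / t" using assms by (simp add: ld_def dd_lin)
  ultimately show ?thesis by simp
qed

lemma compact_annulus: "compact {x::real^'n::finite. r1 \<le> norm x \<and> norm x \<le> r2}"
proof -
  have "{x::real^'n. r1 \<le> norm x \<and> norm x \<le> r2} = cball 0 r2 - ball 0 r1" by auto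
  then show ?thesis by (simp add: compact_diff)
qed

text \<open>Parabolic maximum principle with log r as time. Subtracting \<epsilon> log r makes the
  radial derivative negative at a maximum \<open>z\<close> over the annulus, so values slightly
  inside \<open>z\<close> are larger. Only the inward side is inspected, hence no condition on the
  outer boundary.\<close>

lemma radial_max_bound:
  fixes H :: "real^'n::finite \<Rightarrow> real"
  assumes r1: "r1 > 0" and K: "\<And>x. norm x = r1 \<Longrightarrow> H x \<le> K"
    and H: "\<And>x. norm x \<ge> r1 \<Longrightarrow> H differentiable (at x)"
    and E: "\<And>x. norm x > r1 \<Longrightarrow> H x > K \<Longrightarrow> (\<And>y. norm y = norm x \<Longrightarrow> H y \<le> H x) \<Longrightarrow> ld id H x \<le> 0"
    and y: "norm y \<ge> r1"
  shows "H y \<le> K"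
proof (rule ccontr)
  assume "\<not> H y \<le> K"
  then have Hy: "H y > K" by simp
  define r2 where "r2 = norm y"
  have r2: "r2 > r1" using y K[of y] Hy by (cases "norm y = r1") (auto simp: r2_def)
  define l where "l = ln r2 - ln r1"
  have l: "l > 0" using r1 r2 by (simp add: l_def)
  \<comment> \<open>Half of what would bring the value at \<open>y\<close> down to \<open>K\<close>,
    so that \<open>y\<close> still violates the bound after the perturbation.\<close>
  define \<epsilon> where "\<epsilon> = (H y - K) / (2 * l)"
  have \<epsilon>: "\<epsilon> > 0" "H y - \<epsilon> * l > K" using Hy l by (simp_all add: \<epsilon>_def field_simps)
  define F where "F x = H x - \<epsilon> * (ln (norm x) - ln r1)" for x
  let ?A = "{x::real^'n. r1 \<le> norm x \<and> norm x \<le> r2}"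
  have "continuous_on ?A H" using H by (intro differentiable_imp_continuous_on) (auto simp: differentiable_on_def intro: differentiable_at_withinI)
  then have "continuous_on ?A F" unfolding F_def using r1 by (intro continuous_intros) auto
  moreover have "y \<in> ?A" using r2 by (simp add: r2_def)
  ultimately obtain z where z: "z \<in> ?A" "\<And>x. x \<in> ?A \<Longrightarrow> F x \<le> F z"
    using continuous_attains_sup[OF compact_annulus[of r1 r2], of F] by blast
  have "F z > K" using z(2)[OF \<open>y \<in> ?A\<close>] \<epsilon>(2) by (simp add: F_def l_def r2_def)
  then have z1: "norm z > r1" using K[of z] z(1) by (cases "norm z = r1") (auto simp: F_def)
  have "ln (norm z) - ln r1 \<ge> 0" using z1 r1 ln_less_cancel_iff[of r1 "norm z"] by linarith
  then have "\<epsilon> * (ln (norm z) - ln r1) \<ge> 0" using \<epsilon>(1) by simp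
  then have Hz: "H z > K" using \<open>F z > K\<close> unfolding F_def by linarith
  have m: "H x \<le> H z" if "norm x = norm z" for x using z(2)[of x] z(1) that by (simp add: F_def)
  have Ez: "ld id H z \<le> 0" by (rule E[OF z1 Hz m])
  define f where "f t = H (t *\<^sub>R z) - \<epsilon> * (ln t + ln (norm z) - ln r1)" for t
  have "(f has_real_derivative ld id H (1 *\<^sub>R z) / 1 - \<epsilon> * (1 / 1)) (at 1)" unfolding f_def
    by (rule DERIV_diff[OF DERIV_radial]) (use H z(1) in \<open>auto intro!: derivative_eq_intros\<close>)
  then have "(f has_real_derivative ld id H z - \<epsilon>) (at 1)" by simp
  moreover have "ld id H z - \<epsilon> < 0" using Ez \<epsilon>(1) by simp
  ultimately obtain d where d: "d > 0" "\<And>h. h > 0 \<Longrightarrow> h < d \<Longrightarrow> f 1 < f (1 - h)" using DERIV_neg_dec_left by blast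
  define h where "h = min (d/2) (1 - r1 / norm z)"
  have z0: "norm z > 0" using z1 r1 by linarith
  have "r1 / norm z < 1" using z1 z0 by (simp add: divide_less_eq)
  then have h: "h > 0" "h < d" "h \<le> 1 - r1 / norm z" using d(1) by (auto simp: h_def)
  have h1: "1 - h > 0" "(1 - h) * norm z \<ge> r1" "(1 - h) * norm z \<le> norm z"
  proof -
    have q: "r1 / norm z > 0" using r1 z0 by simp
    then show "1 - h > 0" using h by linarith
    have "r1 / norm z \<le> 1 - h" using h by linarith
    then show "(1 - h) * norm z \<ge> r1" using z0 by (simp add: divide_le_eq)
    show "(1 - h) * norm z \<le> norm z" using h(1) z0 by (simp add: algebra_simps)
  qed
  have "F ((1 - h) *\<^sub>R z) \<le> F z" using z(1) h1 by (intro z(2)) auto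
  moreover have "F ((1 - h) *\<^sub>R z) = f (1 - h)" "F z = f 1" using h1(1) z0 by (simp_all add: F_def f_def ln_mult)
  ultimately show False using d(2)[OF h(1,2)] by simp
qed

text \<open>The same argument with time reversed: the perturbation is added, and the contradiction
  comes from points slightly outside the maximum.\<close>

lemma radial_max_increasing:
  fixes H :: "real^'n::finite \<Rightarrow> real"
  assumes r: "0 < r1" "r1 < r2" and H: "\<And>x. norm x \<ge> r1 \<Longrightarrow> H differentiable (at x)"
    and E: "\<And>x. norm x \<ge> r1 \<Longrightarrow> (\<And>y. norm y = norm x \<Longrightarrow> H y \<le> H x) \<Longrightarrow> ld id H x \<ge> 0"
    and y: "norm y = r1" and K: "\<And>x. norm x = r2 \<Longrightarrow> H x \<le> K"
  shows "H y \<le> K"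
proof (rule ccontr)
  assume "\<not> H y \<le> K"
  then have Hy: "H y > K" by simp
  define l where "l = ln r2 - ln r1"
  have l: "l > 0" using r by (simp add: l_def)
  define \<epsilon> where "\<epsilon> = (H y - K) / (2 * l)"
  have \<epsilon>: "\<epsilon> > 0" "H y - \<epsilon> * l > K" using Hy l by (simp_all add: \<epsilon>_def field_simps)
  define F where "F x = H x + \<epsilon> * (ln (norm x) - ln r2)" for x
  let ?A = "{x::real^'n. r1 \<le> norm x \<and> norm x \<le> r2}"
  have "continuous_on ?A H" using H by (intro differentiable_imp_continuous_on) (auto simp: differentiable_on_def intro: differentiable_at_withinI)
  then have "continuous_on ?A F" unfolding F_def using r by (intro continuous_intros) auto
  moreover have yA: "y \<in> ?A" using r y by simp
  ultimately obtain z where z: "z \<in> ?A" "\<And>x. x \<in> ?A \<Longrightarrow> F x \<le> F z"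
    using continuous_attains_sup[OF compact_annulus[of r1 r2], of F] by blast
  have "F y = H y - \<epsilon> * l" using y by (simp add: F_def l_def algebra_simps)
  then have "F z > K" using z(2)[OF yA] \<epsilon>(2) by linarith
  then have z1: "norm z < r2" using K[of z] z(1) by (cases "norm z = r2") (auto simp: F_def)
  have m: "H x \<le> H z" if "norm x = norm z" for x using z(2)[of x] z(1) that by (simp add: F_def)
  have Ez: "ld id H z \<ge> 0" by (rule E[OF _ m]) (use z in auto)
  have z0: "norm z > 0" using z(1) r by auto
  define f where "f t = H (t *\<^sub>R z) + \<epsilon> * (ln t + ln (norm z) - ln r2)" for t
  have "(f has_real_derivative ld id H (1 *\<^sub>R z) / 1 + \<epsilon> * (1 / 1)) (at 1)" unfolding f_def
    by (rule DERIV_add[OF DERIV_radial]) (use H z(1) in \<open>auto intro!: derivative_eq_intros\<close>)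
  then have "(f has_real_derivative ld id H z + \<epsilon>) (at 1)" by simp
  moreover have "ld id H z + \<epsilon> > 0" using Ez \<epsilon>(1) by simp
  ultimately obtain d where d: "d > 0" "\<And>h. h > 0 \<Longrightarrow> h < d \<Longrightarrow> f 1 < f (1 + h)" using DERIV_pos_inc_right by blast
  define h where "h = min (d/2) (r2 / norm z - 1)"
  have h: "h > 0" "h < d" "h \<le> r2 / norm z - 1" using d(1) z1 z0 by (auto simp: h_def field_simps)
  have h1: "(1 + h) * norm z \<le> r2" "(1 + h) * norm z \<ge> norm z"
  proof -
    have "1 + h \<le> r2 / norm z" using h by linarith
    then show "(1 + h) * norm z \<le> r2" using z0 by (simp add: le_divide_eq)
    show "(1 + h) * norm z \<ge> norm z" using h(1) z0 by (simp add: algebra_simps)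
  qed
  have "F ((1 + h) *\<^sub>R z) \<le> F z" using z(1) h1 h(1) by (intro z(2)) auto
  moreover have "F ((1 + h) *\<^sub>R z) = f (1 + h)" "F z = f 1" using h(1) z0 by (simp_all add: F_def f_def ln_mult)
  ultimately show False using d(2)[OF h(1,2)] by simp
qed

section \<open>Decay of the metric coefficient\<close>

lemma radial_derivative:
  fixes x :: "real^'n::finite"
  assumes "x \<noteq> 0" "(\<phi> has_real_derivative D) (at (norm x))"
  shows "((\<lambda>y. \<phi> (norm y)) has_derivative (\<lambda>v. (v \<bullet> sgn x) * D)) (at x)"
  by (rule DERIV_compose_FDERIV[OF assms(2) has_derivative_norm[OF assms(1)]])

lemma radial_diff:
  fixes x :: "real^'n::finite"
  assumes "x \<noteq> 0" "(\<phi> has_real_derivative D) (at (norm x))"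
  shows "(\<lambda>y. \<phi> (norm y)) differentiable (at x)" "ld id (\<lambda>y. \<phi> (norm y)) x = norm x * D"
proof -
  show "(\<lambda>y. \<phi> (norm y)) differentiable (at x)" using radial_derivative[OF assms] by (auto simp: differentiable_def)
  show "ld id (\<lambda>y. \<phi> (norm y)) x = norm x * D"
    unfolding ld_def using assms(1) dd_unique[OF radial_derivative[OF assms], of x] by (simp add: sgn_div_norm dot_square_norm power2_eq_square)
qed

lemma norm_powr_diff:
  fixes x :: "real^'n::finite" assumes "x \<noteq> 0"
  shows "(\<lambda>y. norm y powr k) differentiable (at x)" "ld id (\<lambda>y. norm y powr k) x = k * norm x powr k"
proof -
  have p: "norm x > 0" using assms by simp
  have "((\<lambda>z. z powr k) has_real_derivative k * norm x powr (k - 1)) (at (norm x))"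
    by (rule has_real_derivative_powr[OF p])
  note r = radial_diff[OF assms this]
  show "(\<lambda>y. norm y powr k) differentiable (at x)" by (rule r(1))
  show "ld id (\<lambda>y. norm y powr k) x = k * norm x powr k" using r(2) p by (simp add: powr_diff)
qed

abbreviation Lp :: "'n \<times> 'n \<Rightarrow> (real^'n::finite \<Rightarrow> real) \<Rightarrow> real^'n \<Rightarrow> real" where
  "Lp p \<equiv> Lo (fst p) (snd p)"

lemma sum_pairs: "(\<Sum>i\<in>UNIV. \<Sum>j\<in>UNIV. f i j) = (\<Sum>p\<in>UNIV. f (fst p) (snd p))"
  for f :: "'n::finite \<Rightarrow> 'n \<Rightarrow> real"
  by (simp add: sum.cartesian_product case_prod_beta)

lemma ld_const [simp]: "ld A (\<lambda>_. c) x = 0" by (simp add: ld_def)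

context
  fixes U :: "(real^'n::finite) set" assumes oU: "open U"
begin

lemma lapS_Lp: "smooth_on f U \<Longrightarrow> x \<in> U \<Longrightarrow> lapS f x = (1/2) * (\<Sum>p\<in>UNIV. Lp p (Lp p f) x)"
  using lapS_rot[OF oU] by (simp add: sum_pairs)

lemma lapS_add: assumes "smooth_on f U" "smooth_on g U" "x \<in> U" shows "lapS (\<lambda>y. f y + g y) x = lapS f x + lapS g x"
proof -
  have d: "h differentiable (at y)" if "smooth_on h U" "y \<in> U" for h y by (rule smooth_diffble[OF oU that])
  note sl = smooth_ld[OF oU linear_rot]
  have "Lp p (Lp p (\<lambda>y. f y + g y)) x = Lp p (Lp p f) x + Lp p (Lp p g) x" for p
  proof -
    have "Lp p (Lp p (\<lambda>y. f y + g y)) x = Lp p (\<lambda>y. Lp p f y + Lp p g y) x"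
      by (rule ld_cong_open[OF oU assms(3)]) (intro ld_simps d assms)
    then show ?thesis by (simp add: ld_simps d sl assms)
  qed
  then show ?thesis by (simp add: lapS_Lp smooth_add oU assms sum.distrib)
qed

lemma lapS_mult: assumes "smooth_on f U" "smooth_on g U" "x \<in> U"
  shows "lapS (\<lambda>y. f y * g y) x = f x * lapS g x + g x * lapS f x + (\<Sum>p\<in>UNIV. Lp p f x * Lp p g x)"
proof -
  have d: "h differentiable (at y)" if "smooth_on h U" "y \<in> U" for h y by (rule smooth_diffble[OF oU that])
  note sl = smooth_ld[OF oU linear_rot]
  have "Lp p (Lp p (\<lambda>y. f y * g y)) x = f x * Lp p (Lp p g) x + g x * Lp p (Lp p f) x + 2 * (Lp p f x * Lp p g x)" for p
  proof -
    have "Lp p (Lp p (\<lambda>y. f y * g y)) x = Lp p (\<lambda>y. f y * Lp p g y + Lp p f y * g y) x"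
      by (rule ld_cong_open[OF oU assms(3)]) (intro ld_simps d assms)
    also have "\<dots> = Lp p (\<lambda>y. f y * Lp p g y) x + Lp p (\<lambda>y. Lp p f y * g y) x"
      by (intro ld_simps d assms smooth_mult oU sl)
    also have "\<dots> = (f x * Lp p (Lp p g) x + Lp p f x * Lp p g x) + (Lp p f x * Lp p g x + Lp p (Lp p f) x * g x)"
      by (simp add: ld_simps d sl assms)
    finally show ?thesis by simp
  qed
  then show ?thesis by (simp add: lapS_Lp smooth_mult oU assms sum.distrib sum_distrib_left algebra_simps)
qed

lemma lapS_const [simp]: "x \<in> U \<Longrightarrow> lapS (\<lambda>_. c) x = 0"
proof -
  assume x: "x \<in> U"
  have z: "ld A (\<lambda>_. c) = (\<lambda>_. 0)" for A by (simp add: fun_eq_iff)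
  show ?thesis by (simp add: lapS_Lp[OF smooth_const x] z)
qed

lemma lapS_cmult: "smooth_on f U \<Longrightarrow> x \<in> U \<Longrightarrow> lapS (\<lambda>y. c * f y) x = c * lapS f x"
  using lapS_mult[OF smooth_const] by simp

lemma lapS_sum: assumes "finite I" "\<And>i. i \<in> I \<Longrightarrow> smooth_on (f i) U" "x \<in> U"
  shows "lapS (\<lambda>y. \<Sum>i\<in>I. f i y) x = (\<Sum>i\<in>I. lapS (f i) x)"
  using assms by (induction I rule: finite_induct) (simp_all add: lapS_add smooth_sum oU)

lemma smooth_Qd: "smooth_on f U \<Longrightarrow> smooth_on (Qd f) U"
  unfolding Qd_def by (intro smooth_mult smooth_const smooth_sum smooth_power smooth_ld linear_rot oU)

lemma Qd_Lp: "Qd f x = (1/2) * (\<Sum>p\<in>UNIV. Lp p f x * Lp p f x)"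
  by (simp add: Qd_def sum_pairs power2_eq_square)

text \<open>Bochner's identity. Rotations commute with \<open>lapS\<close>, so no curvature term
  shows; it is hidden in the second derivatives by rotations, which are not symmetric in
  \<open>p\<close> and \<open>q\<close>.\<close>

lemma lapS_Qd: assumes "smooth_on f U" "x \<in> U"
  shows "lapS (Qd f) x = (\<Sum>p\<in>UNIV. Lp p f x * lapS (Lp p f) x) + (1/2) * (\<Sum>p\<in>UNIV. \<Sum>q\<in>UNIV. (Lp q (Lp p f) x)\<^sup>2)"
proof -
  note sl = smooth_ld[OF oU linear_rot assms(1)]
  have "Qd f = (\<lambda>x. (1/2) * (\<Sum>p\<in>UNIV. Lp p f x * Lp p f x))" by (simp add: Qd_Lp fun_eq_iff)
  then have "lapS (Qd f) x = lapS (\<lambda>x. (1/2) * (\<Sum>p\<in>UNIV. Lp p f x * Lp p f x)) x" by simp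
  also have "\<dots> = (1/2) * (\<Sum>p\<in>UNIV. lapS (\<lambda>x. Lp p f x * Lp p f x) x)"
    by (subst lapS_cmult lapS_sum | (intro smooth_sum smooth_mult oU sl assms finite))+ simp
  also have "\<dots> = (1/2) * (\<Sum>p\<in>UNIV. 2 * (Lp p f x * lapS (Lp p f) x) + (\<Sum>q\<in>UNIV. (Lp q (Lp p f) x)\<^sup>2))"
    unfolding lapS_mult[OF sl sl assms(2)] by (simp add: power2_eq_square)
  finally show ?thesis by (simp add: sum.distrib sum_distrib_left[symmetric])
qed

lemma ld_Qd: assumes "smooth_on f U" "x \<in> U" "linear A"
  shows "ld A (Qd f) x = (\<Sum>p\<in>UNIV. Lp p f x * ld A (Lp p f) x)"
proof -
  note sl = smooth_ld[OF oU linear_rot assms(1)]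
  have d: "h differentiable (at x)" if "smooth_on h U" for h by (rule smooth_diffble[OF oU that assms(2)])
  have Q: "Qd f = (\<lambda>x. (1/2) * (\<Sum>p\<in>UNIV. Lp p f x * Lp p f x))" by (simp add: Qd_Lp fun_eq_iff)
  have "ld A (Qd f) x = (1/2) * ld A (\<lambda>x. \<Sum>p\<in>UNIV. Lp p f x * Lp p f x) x"
    unfolding Q by (subst ld_simps(3) | (intro d smooth_const smooth_sum smooth_mult oU sl))+ simp
  also have "\<dots> = (1/2) * (\<Sum>p\<in>UNIV. ld A (\<lambda>x. Lp p f x * Lp p f x) x)"
    unfolding ld_def[of A] by (subst dd_sum_fun | (intro d smooth_mult oU sl))+ simp
  also have "\<dots> = (\<Sum>p\<in>UNIV. Lp p f x * ld A (Lp p f) x)"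
    by (simp add: ld_simps d sl sum_distrib_left algebra_simps)
  finally show ?thesis .
qed

text \<open>Cauchy-Schwarz over the n^2 ordered pairs; of the squared second derivatives only those
  with \<open>q = p\<close> are needed.\<close>

lemma lapS_square_le: assumes "smooth_on f U" "x \<in> U"
  shows "(lapS f x)\<^sup>2 \<le> (real CARD('n))\<^sup>2 / 4 * (\<Sum>p\<in>UNIV. \<Sum>q\<in>UNIV. (Lp q (Lp p f) x)\<^sup>2)"
proof -
  have "(\<Sum>p\<in>UNIV. Lp p (Lp p f) x)\<^sup>2 \<le> real (card (UNIV :: ('n \<times> 'n) set)) * (\<Sum>p\<in>UNIV. (Lp p (Lp p f) x)\<^sup>2)"
    using sum_squared_le_sum_of_squares[of "\<lambda>p. Lp p (Lp p f) x" UNIV] by (simp add: mult.commute)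
  also have "\<dots> \<le> real (card (UNIV :: ('n \<times> 'n) set)) * (\<Sum>p\<in>UNIV. \<Sum>q\<in>UNIV. (Lp q (Lp p f) x)\<^sup>2)"
    by (intro mult_left_mono sum_mono member_le_sum) auto
  finally show ?thesis unfolding lapS_Lp[OF assms] by (simp add: power2_eq_square field_simps)
qed

end

section \<open>The exterior region and the decay of 1 - \<omega>\<close>

locale ext = sqs U u V n for U :: "(real^'n::finite) set" and u V n +
  fixes r0 :: real
  assumes Ueq: "U = ext_region r0" and r0: "r0 > 0" and n3: "n \<ge> 3"
    and Vb: "bounded (V ` U)" and Vnz: "\<exists>x\<in>U. V x \<noteq> 0"
begin

lemma mem_U_iff: "x \<in> U \<longleftrightarrow> norm x > r0" by (simp add: Ueq ext_region_def)

lemma U0: "x \<in> U \<Longrightarrow> x \<noteq> 0" using r0 by (auto simp: mem_U_iff)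

lemma card3: "CARD('n) \<ge> 3" using n3 nC by linarith

lemma connected_U: "connected U"
proof -
  have "U = - cball 0 r0" by (auto simp: mem_U_iff)
  moreover have "connected (- cball 0 r0 :: (real^'n) set)"
    by (rule connected_complement_bounded_convex) (use card3 in auto)
  ultimately show ?thesis by simp
qed

text \<open>The scalar equation solved for \<open>Eu\<close>: a quasilinear parabolic equation in
  the time log r with diffusion coefficient u^2 / (n - 1).\<close>

lemma Eu_eq: assumes "x \<in> U"
  shows "(n - 1) * Eu x = (u x)\<^sup>2 * lapS u x - (n - 1) * (n - 2) / 2 * ((u x)^3 - u x)"
proof -
  define a M k where d: "a = lapS u x / u x" "M = Eu x / u x" "k = (n - 1) * (n - 2) / 2"
  have 1: "lapS u x = u x * a" "Eu x = u x * M" "om x * (u x)\<^sup>2 = 1" using u_nonzero[OF assms] by (simp_all add: d om_def)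
  have "a - (n - 1) * om x * M = k * (1 - om x)" unfolding d by (rule scal_eq[OF connected_U Vnz assms])
  then have "(n - 1) * (u x * M) = (u x)\<^sup>2 * (u x * a) - k * ((u x)^3 - u x)" using 1(3) by algebra
  then show ?thesis unfolding 1(1,2) d(3)[symmetric] .
qed

lemma sphere_bound: assumes "continuous_on U f" "r > r0"
  obtains K where "\<And>x. norm x = r \<Longrightarrow> \<bar>f x\<bar> \<le> (K::real)"
proof -
  have "{x. norm x = r} = {x::real^'n. r \<le> norm x \<and> norm x \<le> r}" by auto
  then have "compact {x::real^'n. norm x = r}" using compact_annulus[of r r] by simp
  moreover have "continuous_on {x. norm x = r} f" by (rule continuous_on_subset[OF assms(1)]) (use assms(2) in \<open>auto simp: mem_U_iff\<close>)
  ultimately have "bounded (f ` {x. norm x = r})" by (intro compact_imp_bounded compact_continuous_image)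
  then show ?thesis using that unfolding bounded_iff by auto
qed

lemma spatial_max:
  assumes "x \<in> U" "smooth_on f U" "\<And>y. norm y = norm x \<Longrightarrow> f y \<le> f x"
  shows "lapS f x \<le> 0" "Lo i j f x = 0"
  using spatial_max_lapS[OF openU assms(2) _ assms(3)] assms(1) by (auto simp: mem_U_iff)

lemma spatial_min:
  assumes "x \<in> U" "smooth_on f U" "\<And>y. norm y = norm x \<Longrightarrow> f y \<ge> f x"
  shows "lapS f x \<ge> 0"
proof -
  have "lapS (\<lambda>y. -1 * f y) x \<le> 0" by (rule spatial_max[OF assms(1)]) (use assms in \<open>auto intro!: smooth_minus openU\<close>)
  then show ?thesis using lapS_cmult[OF openU assms(2,1), of "-1"] by simp
qed

text \<open>Twice the mass as seen at \<open>x\<close>, constant on Schwarzschild space. The power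
  of r absorbs the zero order term of the scalar equation, so the radial derivative of
  \<open>Hm\<close> is a positive multiple of \<open>lapS u\<close>.\<close>

definition Hm where "Hm x = (1 - om x) * norm x powr (n - 2)"

lemma smom: "smooth_on om U" by (rule smooth_coefficients)

lemma Hm_diff: assumes "x \<in> U"
  shows "Hm differentiable (at x)" "ld id Hm x = norm x powr (n - 2) * (2 / (n - 1) * (lapS u x / u x))"
proof -
  have d: "(\<lambda>y. 1 - om y) differentiable (at x)" by (intro diffble_U[OF _ assms] smooth_diff smooth_const smom openU)
  note p = norm_powr_diff[OF U0[OF assms], of "n - 2"]
  show "Hm differentiable (at x)" unfolding Hm_def by (intro differentiable_mult d p)
  have "ld id (\<lambda>y. 1 - om y) x = - ld id om x" by (subst ld_simps(2)) (auto intro: diffble_U[OF smom assms] simp: ld_const)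
  also have "\<dots> = 2 * om x * (Eu x / u x)" using dd_om[OF assms, of x] by (simp add: ld_def)
  finally have 1: "ld id (\<lambda>y. 1 - om y) x = 2 * om x * (Eu x / u x)" .
  have "ld id Hm x = norm x powr (n - 2) * ((n - 2) * (1 - om x) + 2 * om x * (Eu x / u x))"
    unfolding Hm_def ld_simps(3)[OF d p(1)] p(2) 1 by (simp add: algebra_simps)
  moreover have "(n - 2) * (1 - om x) + 2 * om x * (Eu x / u x) = 2 / (n - 1) * (lapS u x / u x)"
  proof -
    define A where "A = lapS u x / u x"
    define M where "M = Eu x / u x"
    have "A - (n - 1) * om x * M = (n - 1) * (n - 2) / 2 * (1 - om x)" unfolding A_def M_def by (rule scal_eq[OF connected_U Vnz assms])
    then show ?thesis unfolding A_def[symmetric] M_def[symmetric] using n3 by (simp add: field_simps)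
  qed
  ultimately show "ld id Hm x = norm x powr (n - 2) * (2 / (n - 1) * (lapS u x / u x))" by simp
qed

lemma om_mono: assumes "x \<in> U" "y \<in> U" "om y \<le> om x" shows "u x \<le> u y"
proof -
  have "1 / (u y)\<^sup>2 \<le> 1 / (u x)\<^sup>2" using assms(3) by (simp add: om_def)
  then have "(u x)\<^sup>2 \<le> (u y)\<^sup>2" using u0[OF assms(1)] u0[OF assms(2)] by (simp add: field_simps)
  then show ?thesis using u0[OF assms(2)] power2_le_imp_le by fastforce
qed

text \<open>On each sphere \<open>Hm\<close> is an increasing function of u, so it is extremal where
  u is, and there \<open>lapS u\<close> has a sign. The maximum principle applies to
  \<open>Hm\<close> and to \<open>- Hm\<close>.\<close>

lemma om_asym: assumes "r > r0" obtains C where "C > 0" "\<And>x. norm x \<ge> r \<Longrightarrow> \<bar>1 - om x\<bar> \<le> C * norm x powr (2 - n)"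
proof -
  have inU: "x \<in> U" if "norm x \<ge> r" for x using that assms by (simp add: mem_U_iff)
  have r': "r > 0" using assms r0 by simp
  have cH: "continuous_on U Hm"
    by (intro differentiable_imp_continuous_on) (auto simp: differentiable_on_def intro: differentiable_at_withinI Hm_diff)
  obtain K where K: "\<And>x. norm x = r \<Longrightarrow> \<bar>Hm x\<bar> \<le> K" using sphere_bound[OF cH assms] by blast
  have comp: "(Hm y \<le> Hm x) = (om x \<le> om y)" if "norm y = norm x" "x \<in> U" for x y
    using U0[OF that(2)] by (simp add: Hm_def that(1))
  have up: "Hm y \<le> K" if "norm y \<ge> r" for y
  proof (rule radial_max_bound[OF r' _ _ _ that])
    show "Hm x \<le> K" if "norm x = r" for x using K[OF that] by simp
    show "Hm differentiable (at x)" if "norm x \<ge> r" for x by (rule Hm_diff(1)[OF inU[OF that]])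
    show "ld id Hm x \<le> 0" if "norm x > r" and m: "\<And>y. norm y = norm x \<Longrightarrow> Hm y \<le> Hm x" for x :: "real^'n"
    proof -
      have x: "x \<in> U" using inU that by simp
      have "u y \<le> u x" if y: "norm y = norm x" for y
      proof -
        have yU: "y \<in> U" using x y by (simp add: mem_U_iff)
        show ?thesis by (rule om_mono[OF yU x]) (use m[OF y] comp[OF y x] in simp)
      qed
      then have "lapS u x \<le> 0" by (rule spatial_max[OF x su])
      then show ?thesis unfolding Hm_diff(2)[OF x] using u0[OF x] n3 by (simp add: mult_le_0_iff divide_le_0_iff)
    qed
  qed
  have lo: "- Hm y \<le> K" if "norm y \<ge> r" for y
  proof (rule radial_max_bound[OF r' _ _ _ that])
    show "- Hm x \<le> K" if "norm x = r" for x using K[OF that] by simp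
    show "(\<lambda>x. - Hm x) differentiable (at x)" if "norm x \<ge> r" for x using Hm_diff(1)[OF inU[OF that]] by simp
    show "ld id (\<lambda>x. - Hm x) x \<le> 0" if "norm x > r" and m: "\<And>y. norm y = norm x \<Longrightarrow> - Hm y \<le> - Hm x" for x :: "real^'n"
    proof -
      have x: "x \<in> U" using inU that by simp
      have "u x \<le> u y" if y: "norm y = norm x" for y
      proof -
        have yU: "y \<in> U" using x y by (simp add: mem_U_iff)
        show ?thesis by (rule om_mono[OF x yU]) (use m[OF y] comp[of x y] y yU in simp)
      qed
      then have "lapS u x \<ge> 0" by (rule spatial_min[OF x su])
      then have "ld id Hm x \<ge> 0" unfolding Hm_diff(2)[OF x] using u0[OF x] n3 by simp
      then show ?thesis using dd_minus[OF Hm_diff(1)[OF x], of x] by (simp add: ld_def)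
    qed
  qed
  show ?thesis
  proof (rule that[of "max K 1"])
    fix x :: "real^'n" assume x: "norm x \<ge> r"
    have p: "norm x > 0" using x r' by linarith
    have "\<bar>Hm x\<bar> \<le> max K 1" using up[OF x] lo[OF x] by linarith
    then have "\<bar>1 - om x\<bar> * norm x powr (n - 2) \<le> max K 1" by (simp add: Hm_def abs_mult)
    then have "\<bar>1 - om x\<bar> * norm x powr (n - 2) * norm x powr (2 - n) \<le> max K 1 * norm x powr (2 - n)"
      by (rule mult_right_mono) simp
    moreover have "norm x powr (n - 2) * norm x powr (2 - n) = 1" using p by (simp add: powr_add[symmetric])
    ultimately show "\<bar>1 - om x\<bar> \<le> max K 1 * norm x powr (2 - n)" by (simp add: mult.assoc)
  qed simp
qed

lemma u_asym: obtains C r where "C > 0" "r > r0" "r \<ge> 1" "\<And>x. norm x \<ge> r \<Longrightarrow> \<bar>1 - om x\<bar> \<le> C / norm x"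
   "\<And>x. norm x \<ge> r \<Longrightarrow> \<bar>(u x)\<^sup>2 - 1\<bar> \<le> C / norm x" "\<And>x. norm x \<ge> r \<Longrightarrow> \<bar>u x - 1\<bar> \<le> C / norm x"
proof -
  obtain C where C: "C > 0" "\<And>x. norm x \<ge> r0 + 1 \<Longrightarrow> \<bar>1 - om x\<bar> \<le> C * norm x powr (2 - n)" using om_asym[of "r0 + 1"] by auto
  \<comment> \<open>The entry \<open>2 * C\<close> ensures \<open>om \<ge> 1/2\<close>, so that
    bounds for \<open>om\<close> pass to u; the entry 1 allows the exponent \<open>2 - n\<close> to
    be weakened to -1.\<close>
  define r where "r = max (r0 + 1) (max 1 (2 * C))"
  have rr: "r \<ge> r0 + 1" "r \<ge> 1" "r \<ge> 2 * C" by (simp_all add: r_def)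
  have om: "\<bar>1 - om x\<bar> \<le> C / norm x" if "norm x \<ge> r" for x
  proof -
    have x1: "norm x \<ge> 1" using that rr by linarith
    have "norm x powr (2 - n) \<le> norm x powr (-1)" using x1 n3 by (intro powr_mono) auto
    also have "\<dots> = 1 / norm x" using x1 by (simp add: powr_minus_divide)
    finally have "C * norm x powr (2 - n) \<le> C * (1 / norm x)" using C(1) by (intro mult_left_mono) auto
    then show ?thesis using C(2)[of x] that rr by simp
  qed
  have u2: "\<bar>(u x)\<^sup>2 - 1\<bar> \<le> 2 * C / norm x" if "norm x \<ge> r" for x
  proof -
    have x0: "norm x > 0" "x \<in> U" using that rr r0 by (auto simp: mem_U_iff)
    have "C / norm x \<le> 1/2" using that rr x0 C(1) by (simp add: field_simps)
    then have o: "om x \<ge> 1/2" using om[OF that] by linarith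
    have ou: "om x * (u x)\<^sup>2 = 1" using u_nonzero[OF x0(2)] by (simp add: om_def)
    then have uu: "(u x)\<^sup>2 \<le> 2" using o mult_right_mono[OF o, of "(u x)\<^sup>2"] by simp
    have "(u x)\<^sup>2 - 1 = (1 - om x) * (u x)\<^sup>2" using ou by (simp add: algebra_simps)
    then have "\<bar>(u x)\<^sup>2 - 1\<bar> = \<bar>1 - om x\<bar> * (u x)\<^sup>2" by (simp add: abs_mult)
    also have "\<dots> \<le> C / norm x * 2" using om[OF that] uu by (intro mult_mono) auto
    finally show ?thesis by (simp add: mult.commute)
  qed
  have u3: "\<bar>u x - 1\<bar> \<le> 2 * C / norm x" if "norm x \<ge> r" for x
  proof -
    have x0: "x \<in> U" using that rr r0 by (auto simp: mem_U_iff)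
    have "\<bar>u x - 1\<bar> * 1 \<le> \<bar>u x - 1\<bar> * (u x + 1)" using u0[OF x0] by (intro mult_left_mono) auto
    also have "\<dots> = \<bar>(u x - 1) * (u x + 1)\<bar>" using u0[OF x0] by (simp add: abs_mult)
    also have "(u x - 1) * (u x + 1) = (u x)\<^sup>2 - 1" by (simp add: power2_eq_square algebra_simps)
    finally show ?thesis using u2[OF that] by simp
  qed
  show ?thesis
  proof (rule that[of "2 * C" r])
    show "\<bar>1 - om x\<bar> \<le> 2 * C / norm x" if "norm x \<ge> r" for x
    proof -
      have "C / norm x \<le> 2 * C / norm x" using C(1) by (intro divide_right_mono) auto
      then show ?thesis using om[OF that] by linarith
    qed
    show "2 * C > 0" "r > r0" "r \<ge> 1" using C rr by auto
  qed (rule u2 u3, assumption)+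
qed

text \<open>Apply each rotation to \<open>Eu_eq\<close>, multiply by \<open>Lp p u\<close> and sum.
  The term \<open>4 * u x * lapS u x * Qd u x\<close> contains uncontrolled second derivatives;
  Young's inequality moves them into the squared second derivatives of \<open>lapS_Qd\<close>, at
  the price of a term quadratic in \<open>Qd u\<close>.\<close>

lemma bochner: assumes "x \<in> U"
  shows "(n - 1) * ld id (Qd u) x \<le> (u x)\<^sup>2 * lapS (Qd u) x + 2 * n\<^sup>2 * (Qd u x)\<^sup>2 - (n - 1) * (n - 2) * (3 * (u x)\<^sup>2 - 1) * Qd u x"
proof -
  define k where "k = (n - 1) * (n - 2) / 2"
  define T where "T = (\<Sum>p\<in>UNIV. \<Sum>q\<in>UNIV. (Lp q (Lp p u) x)\<^sup>2)"
  note sl = smooth_ld[OF openU linear_rot su]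
  have d: "h differentiable (at x)" if "smooth_on h U" for h by (rule diffble_U[OF that assms])
  have sL: "smooth_on (lapS u) U" by (rule smooth_lapS[OF openU su])
  have E: "(n - 1) * ld id (Lp p u) x = 2 * u x * Lp p u x * lapS u x + (u x)\<^sup>2 * lapS (Lp p u) x - k * (3 * (u x)\<^sup>2 - 1) * Lp p u x" for p
  proof -
    have "Lp p (\<lambda>y. (n - 1) * Eu y) x = Lp p (\<lambda>y. u y * u y * lapS u y - k * (u y * u y * u y - u y)) x"
      by (rule ld_cong_open[OF openU assms]) (use Eu_eq in \<open>simp add: k_def power2_eq_square power3_eq_cube mult.assoc\<close>)
    moreover have "Lp p (\<lambda>y. (n - 1) * Eu y) x = (n - 1) * ld id (Lp p u) x"
      by (subst ld_simps(3)) (auto intro!: d smooth_const smooth_EV simp: ld_id_commute[OF openU su assms linear_rot])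
    moreover have "Lp p (\<lambda>y. u y * u y * lapS u y - k * (u y * u y * u y - u y)) x
       = u x * u x * Lp p (lapS u) x + 2 * u x * Lp p u x * lapS u x - k * (3 * (u x * u x) * Lp p u x - Lp p u x)"
      by (subst ld_simps | (intro d smooth_diff smooth_mult smooth_const openU su sL))+ (simp add: algebra_simps)
    ultimately show ?thesis unfolding lapS_rot_commute[OF openU su assms] by (simp add: power2_eq_square algebra_simps)
  qed
  have Q: "Qd u x = (1/2) * (\<Sum>p\<in>UNIV. Lp p u x * Lp p u x)" by (rule Qd_Lp[OF openU])
  have "(n - 1) * ld id (Qd u) x = (\<Sum>p\<in>UNIV. Lp p u x * ((n - 1) * ld id (Lp p u) x))"
    unfolding ld_Qd[OF openU su assms linear_id'] by (simp add: sum_distrib_left algebra_simps)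
  also have "\<dots> = (\<Sum>p\<in>UNIV. (2 * u x * lapS u x - k * (3 * (u x)\<^sup>2 - 1)) * (Lp p u x * Lp p u x) + (u x)\<^sup>2 * (Lp p u x * lapS (Lp p u) x))"
    unfolding E by (simp add: algebra_simps)
  also have "\<dots> = (2 * u x * lapS u x - k * (3 * (u x)\<^sup>2 - 1)) * (2 * Qd u x) + (u x)\<^sup>2 * (lapS (Qd u) x - (1/2) * T)"
    unfolding Q lapS_Qd[OF openU su assms] T_def by (simp only: sum.distrib sum_distrib_left[symmetric]) simp
  finally have eq: "(n - 1) * ld id (Qd u) x = (2 * u x * lapS u x - k * (3 * (u x)\<^sup>2 - 1)) * (2 * Qd u x) + (u x)\<^sup>2 * (lapS (Qd u) x - (1/2) * T)" .
  have T: "(lapS u x)\<^sup>2 \<le> n\<^sup>2 / 4 * T" using lapS_square_le[OF openU su assms] by (simp add: T_def)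
  have n0: "n > 0" using n3 by simp
  \<comment> \<open>The weight \<open>n\<close> is chosen so that, after
    \<open>lapS_square_le\<close>, the first square is exactly absorbed by the available half of
    \<open>T\<close>.\<close>
  have "2 * (u x * lapS u x / n) * (n * Qd u x) \<le> (u x * lapS u x / n)\<^sup>2 + (n * Qd u x)\<^sup>2"
    by (rule sum_squares_bound)
  then have a: "4 * u x * lapS u x * Qd u x \<le> 2 * (u x)\<^sup>2 * ((lapS u x)\<^sup>2 / n\<^sup>2) + 2 * n\<^sup>2 * (Qd u x)\<^sup>2"
    using n0 by (simp add: power_mult_distrib power_divide)
  have "(lapS u x)\<^sup>2 / n\<^sup>2 \<le> T / 4" using T n0 by (simp add: field_simps)
  then have "2 * (u x)\<^sup>2 * ((lapS u x)\<^sup>2 / n\<^sup>2) \<le> 2 * (u x)\<^sup>2 * (T / 4)" by (intro mult_left_mono) auto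
  then have b: "4 * u x * lapS u x * Qd u x \<le> (u x)\<^sup>2 * ((1/2) * T) + 2 * n\<^sup>2 * (Qd u x)\<^sup>2" using a by argo
  have "(n - 1) * ld id (Qd u) x = 4 * u x * lapS u x * Qd u x - (u x)\<^sup>2 * ((1/2) * T) + (u x)\<^sup>2 * lapS (Qd u) x - 2 * k * (3 * (u x)\<^sup>2 - 1) * Qd u x"
    unfolding eq by (simp add: algebra_simps)
  moreover have "2 * k * (3 * (u x)\<^sup>2 - 1) * Qd u x = (n - 1) * (n - 2) * (3 * (u x)\<^sup>2 - 1) * Qd u x" by (simp add: k_def)
  ultimately show ?thesis using b by linarith
qed

text \<open>The weight of Bernstein's trick: dividing the squared gradient by \<open>eta\<close> absorbs the quadratic term of the
  Bochner inequality.\<close>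

definition eta where "eta x = 1 - 2 * n\<^sup>2 * ((u x - 1) * (u x - 1))"

lemma eta_facts: assumes "x \<in> U"
  shows "lapS eta x = - 4 * n\<^sup>2 * (u x - 1) * lapS u x - 4 * n\<^sup>2 * Qd u x" "ld id eta x = - 4 * n\<^sup>2 * (u x - 1) * Eu x"
    "smooth_on eta U"
proof -
  have su1: "smooth_on (\<lambda>y. u y - 1) U" by (intro smooth_diff smooth_const openU su)
  have sq: "smooth_on (\<lambda>y. (u y - 1) * (u y - 1)) U" by (intro smooth_mult openU su1)
  have d: "h differentiable (at x)" if "smooth_on h U" for h by (rule diffble_U[OF that assms])
  have L: "ld A (\<lambda>y. u y - 1) x = ld A u x" for A by (subst ld_simps(2)) (auto intro: d su)
  have lap1: "lapS (\<lambda>y. u y - 1) x = lapS u x"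
    using lapS_add[OF openU su smooth_const assms, of "-1"] lapS_const[OF openU assms, of "-1"] by simp
  have e: "eta = (\<lambda>x. 1 + (- 2 * n\<^sup>2) * ((u x - 1) * (u x - 1)))" by (simp add: eta_def fun_eq_iff)
  have s2: "smooth_on (\<lambda>x. (- 2 * n\<^sup>2) * ((u x - 1) * (u x - 1))) U" by (intro smooth_mult smooth_const openU su1)
  have "lapS eta x = (- 2 * n\<^sup>2) * lapS (\<lambda>x. (u x - 1) * (u x - 1)) x"
    unfolding e lapS_add[OF openU smooth_const s2 assms] lapS_cmult[OF openU sq assms] using lapS_const[OF openU assms] by simp
  also have "lapS (\<lambda>x. (u x - 1) * (u x - 1)) x = 2 * (u x - 1) * lapS u x + 2 * Qd u x"
    unfolding lapS_mult[OF openU su1 su1 assms] L lap1 Qd_Lp[OF openU] by simp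
  finally show "lapS eta x = - 4 * n\<^sup>2 * (u x - 1) * lapS u x - 4 * n\<^sup>2 * Qd u x" by (simp add: algebra_simps)
  show "ld id eta x = - 4 * n\<^sup>2 * (u x - 1) * Eu x" unfolding e
    by (subst ld_simps L | (intro d smooth_const s2 sq su1))+ (simp add: algebra_simps)
  show "smooth_on eta U" unfolding e by (intro smooth_add smooth_const s2 openU)
qed

text \<open>The threshold \<open>1 / (24 * n)\<close> keeps \<open>eta\<close> away from 0 and
  limits the loss in the decay exponent of \<open>gradient_decay\<close> to 1/4.\<close>

lemma eta_range: assumes "\<bar>u y - 1\<bar> \<le> 1 / (24 * n)"
  shows "1/2 \<le> eta y" "eta y \<le> 1" "(u y)\<^sup>2 \<ge> 1 - 1 / (12 * n)"
proof -
  have n0: "n > 0" using n3 by simp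
    have "\<bar>u y - 1\<bar> * \<bar>u y - 1\<bar> \<le> (1 / (24 * n)) * (1 / (24 * n))" using assms n0 by (intro mult_mono) auto
    then have "(u y - 1) * (u y - 1) \<le> 1 / (576 * n\<^sup>2)" by (simp add: power2_eq_square)
    then have "2 * n\<^sup>2 * ((u y - 1) * (u y - 1)) \<le> 2 * n\<^sup>2 * (1 / (576 * n\<^sup>2))" by (intro mult_left_mono) auto
    also have "\<dots> \<le> 1/2" using n0 by simp
    finally show "1/2 \<le> eta y" by (simp add: eta_def)
    show "eta y \<le> 1" by (simp add: eta_def)
    have "0 \<le> (u y - 1)\<^sup>2" by simp
    then have "(u y)\<^sup>2 \<ge> 1 + 2 * (u y - 1)" by (simp add: power2_eq_square algebra_simps)
    moreover define e where "e = 1 / (24 * n)"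
    moreover have "u y - 1 \<ge> - e" using assms unfolding e_def by linarith
    moreover have "1 / (12 * n) = 2 * e" by (simp add: e_def)
    ultimately show "(u y)\<^sup>2 \<ge> 1 - 1 / (12 * n)" by argo
qed

text \<open>At a maximum of \<open>G = Qd u / eta\<close> over the sphere its gradient vanishes and
  \<open>lapS G \<le> 0\<close>, so the Bochner inequality becomes one for the radial derivative of
  \<open>G\<close>. The terms with \<open>lapS u\<close> cancel because \<open>eta\<close> is a
  function of u and u solves the parabolic equation. The term \<open>- 4 * n\<^sup>2 * Qd u\<close>
  of \<open>lapS eta\<close> outweighs the quadratic term.\<close>

lemma gradient_decay:
  assumes r: "r > r0" and small: "\<And>x. norm x > r \<Longrightarrow> \<bar>u x - 1\<bar> \<le> 1 / (24 * n)"
    and x: "norm x > r" and m: "\<And>y. norm y = norm x \<Longrightarrow> Qd u y / eta y \<le> Qd u x / eta x"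
  shows "ld id (\<lambda>y. Qd u y / eta y) x \<le> - (2 * (n - 2) - 1/4) * (Qd u x / eta x)"
proof -
  define W where "W = {y::real^'n. norm y > r}"
  have oW: "open W" unfolding W_def by (intro open_Collect_less continuous_intros)
  have WU: "W \<subseteq> U" using r by (auto simp: W_def mem_U_iff)
  have xW: "x \<in> W" and xU: "x \<in> U" using x r by (auto simp: W_def mem_U_iff)
  have n0: "n > 0" using n3 by simp
  note et = eta_range[OF small]
  have ex: "1/2 \<le> eta x" "eta x \<le> 1" using et[OF x] by auto
  define G where "G y = Qd u y / eta y" for y
  have sQ: "smooth_on (Qd u) U" by (rule smooth_Qd[OF openU su])
  have sW: "smooth_on (Qd u) W" "smooth_on eta W" by (intro smooth_on_subset[OF _ WU oW openU] sQ eta_facts(3)[OF xU])+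
  have sG: "smooth_on G W" unfolding G_def by (rule smooth_divide[OF oW _ sW]) (use et(1) in \<open>force simp: W_def\<close>)
  have QG: "Qd u y = G y * eta y" if "y \<in> W" for y using et(1)[of y] that by (simp add: G_def W_def)
  have mG: "lapS G x \<le> 0" "Lo i j G x = 0" for i j
    by (rule spatial_max_lapS[OF oW sG]; use x m in \<open>auto simp: W_def G_def\<close>)+
  have Q2: "ld A (Qd u) y = ld A (\<lambda>z. G z * eta z) y" if "y \<in> W" for A y by (rule ld_cong_open[OF oW that QG])
  have "lapS (Qd u) x = lapS (\<lambda>z. G z * eta z) x"
  proof -
    have "Lp p (Lp p (Qd u)) x = Lp p (Lp p (\<lambda>z. G z * eta z)) x" for p by (rule ld_cong_open[OF oW xW Q2])
    then show ?thesis unfolding lapS_Lp[OF oW sW(1) xW] lapS_Lp[OF oW smooth_mult[OF oW sG sW(2)] xW] by simp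
  qed
  also have "\<dots> = G x * lapS eta x + eta x * lapS G x" unfolding lapS_mult[OF oW sG sW(2) xW] mG(2) by simp
  finally have lQ: "lapS (Qd u) x \<le> G x * lapS eta x" using mult_left_mono[OF mG(1), of "eta x"] ex by simp
  have EQ: "ld id (Qd u) x = G x * ld id eta x + ld id G x * eta x"
    unfolding Q2[OF xW] by (rule ld_simps) (intro smooth_diffble[OF oW _ xW] sG sW)+
  define q g a e where d: "q = Qd u x" "g = G x" "a = lapS u x" "e = eta x"
  define U where "U = u x"
  have qg: "q = g * e" using QG[OF xW] by (simp add: d)
  have g0: "g \<ge> 0" using ex(1) Qd_nonneg[of u x] by (simp add: d G_def)
  have q0: "q \<ge> 0" by (simp add: d Qd_nonneg)
  have A: "(n - 1) * (g * (- 4 * n\<^sup>2 * (U - 1) * Eu x) + ld id G x * e) \<le> U\<^sup>2 * (g * (- 4 * n\<^sup>2 * (U - 1) * a - 4 * n\<^sup>2 * q)) + 2 * n\<^sup>2 * q\<^sup>2 - (n - 1) * (n - 2) * (3 * U\<^sup>2 - 1) * q"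
  proof -
    have "U\<^sup>2 * lapS (Qd u) x \<le> U\<^sup>2 * (G x * lapS eta x)" using lQ by (intro mult_left_mono) auto
    then show ?thesis using bochner[OF xU] unfolding EQ eta_facts[OF xU] d U_def by simp
  qed
  have "(n - 1) * Eu x = U\<^sup>2 * a - (n - 1) * (n - 2) / 2 * (U^3 - U)" using Eu_eq[OF xU] by (simp add: U_def d)
  then have B: "(n - 1) * (g * (- 4 * n\<^sup>2 * (U - 1) * Eu x) + ld id G x * e) = (n - 1) * (ld id G x * e) - 4 * n\<^sup>2 * g * (U - 1) * (U\<^sup>2 * a - (n - 1) * (n - 2) / 2 * (U^3 - U))"
    by algebra
  have I: "U\<^sup>2 * (g * (- 4 * n\<^sup>2 * (U - 1) * a - 4 * n\<^sup>2 * q)) + 4 * n\<^sup>2 * g * (U - 1) * (U\<^sup>2 * a - (n - 1) * (n - 2) / 2 * (U^3 - U))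
     = - 4 * n\<^sup>2 * U\<^sup>2 * g * q - 2 * n\<^sup>2 * g * ((n - 1) * (n - 2)) * ((U - 1) * (U^3 - U))" by (simp add: field_simps)
  have "(n - 1) * (ld id G x * e) \<le> - 4 * n\<^sup>2 * U\<^sup>2 * g * q + 2 * n\<^sup>2 * q\<^sup>2 - (n - 1) * (n - 2) * (3 * U\<^sup>2 - 1) * q - 2 * n\<^sup>2 * g * ((n - 1) * (n - 2)) * ((U - 1) * (U^3 - U))"
    using A unfolding B using I by argo
  moreover have "2 * n\<^sup>2 * q\<^sup>2 \<le> 4 * n\<^sup>2 * U\<^sup>2 * g * q"
  proof -
    have "12 * n > 0" "1 / (12 * n) \<le> 1/2" using n3 by (auto simp: field_simps)
    then have U2: "U\<^sup>2 \<ge> 1/2" using et(3)[OF x] unfolding U_def by linarith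
    have "q \<le> g" using ex(2) g0 unfolding qg d(4)[symmetric] by (simp add: mult_left_le)
    then have "q * q \<le> g * q" using q0 by (rule mult_right_mono)
    also have "\<dots> \<le> (2 * U\<^sup>2) * (g * q)" using U2 g0 q0 mult_right_mono[of 1 "2 * U\<^sup>2" "g * q"] by simp
    finally have "2 * n\<^sup>2 * (q * q) \<le> 2 * n\<^sup>2 * ((2 * U\<^sup>2) * (g * q))" by (intro mult_left_mono) auto
    then show ?thesis by (simp add: power2_eq_square algebra_simps)
  qed
  moreover have "2 * n\<^sup>2 * g * ((n - 1) * (n - 2)) * ((U - 1) * (U^3 - U)) \<ge> 0"
  proof -
    have "(U - 1) * (U^3 - U) = (U - 1)\<^sup>2 * (U * (U + 1))" by (simp add: power2_eq_square power3_eq_cube algebra_simps)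
    then have "(U - 1) * (U^3 - U) \<ge> 0" using u0[OF xU] by (simp add: U_def)
    then show ?thesis using g0 n3 by simp
  qed
  ultimately have "(n - 1) * (ld id G x * e) \<le> - (n - 1) * (n - 2) * (3 * U\<^sup>2 - 1) * q" by linarith
  then have "(n - 1) * (ld id G x * e) \<le> (n - 1) * (- (n - 2) * (3 * U\<^sup>2 - 1) * q)" by (simp add: algebra_simps)
  then have "ld id G x * e \<le> - (n - 2) * (3 * U\<^sup>2 - 1) * q" using n3 by simp
  then have "ld id G x * e \<le> (- (n - 2) * (3 * U\<^sup>2 - 1) * g) * e" unfolding qg by (simp add: algebra_simps)
  then have "ld id G x \<le> - (n - 2) * (3 * U\<^sup>2 - 1) * g" by (rule mult_right_le_imp_le) (use ex d in auto)
  also have "\<dots> \<le> - (2 * (n - 2) - 1/4) * g"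
  proof (rule mult_right_mono[OF _ g0])
    \<comment> \<open>The deviation of u^2 from 1 costs at most 1/12 here, and u^2 enters with the
      factor 3.\<close>
    have "(n - 2) * U\<^sup>2 \<ge> (n - 2) * (1 - 1 / (12 * n))" using et(3)[OF x] n3 by (intro mult_left_mono) (auto simp: U_def)
    moreover have "(n - 2) * (1 / (12 * n)) \<le> 1/12" using n3 by (simp add: field_simps)
    moreover have "(n - 2) * (1 - 1 / (12 * n)) = (n - 2) - (n - 2) * (1 / (12 * n))" by (simp add: algebra_simps)
    ultimately have "(n - 2) * U\<^sup>2 \<ge> (n - 2) - 1/12" by linarith
    then show "- (n - 2) * (3 * U\<^sup>2 - 1) \<le> - (2 * (n - 2) - 1/4)" by (simp add: algebra_simps)
  qed
  finally show "ld id (\<lambda>y. Qd u y / eta y) x \<le> - (2 * (n - 2) - 1/4) * (Qd u x / eta x)" by (simp add: d G_def[abs_def])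
qed

end

section \<open>Decay of the potential and symmetry near infinity\<close>

text \<open>Instead of integrating, the comparison function \<open>A / j * z powr (- j)\<close> is
  added to and subtracted from \<open>g\<close>; both results are monotone. With
  \<open>A = 0\<close> it says that \<open>g\<close> is constant.\<close>

lemma decay_integral:
  fixes g :: "real \<Rightarrow> real"
  assumes "0 < s" "s \<le> t" "j > 0" "\<And>z. s \<le> z \<Longrightarrow> z \<le> t \<Longrightarrow> (g has_real_derivative g' z) (at z)"
    and "\<And>z. s \<le> z \<Longrightarrow> z \<le> t \<Longrightarrow> \<bar>g' z\<bar> \<le> A * z powr (- j - 1)"
  shows "\<bar>g t - g s\<bar> \<le> A / j * s powr (- j)"
proof -
  have A: "0 \<le> A" using assms(5)[of s] assms(1,2) by (simp add: zero_le_mult_iff) (smt (verit) powr_gt_zero zero_le_mult_iff)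
  have D: "((\<lambda>z. A / j * z powr (- j)) has_real_derivative - (A * z powr (- j - 1))) (at z)" if "s \<le> z" for z
    using that assms(1,3) by (auto intro!: derivative_eq_intros simp: field_simps)
  have 1: "g t + A / j * t powr (- j) \<le> g s + A / j * s powr (- j)"
  proof (rule DERIV_nonpos_imp_nonincreasing[of s t "\<lambda>z. g z + A / j * z powr (- j)", OF assms(2)])
    fix z assume z: "s \<le> z" "z \<le> t"
    show "\<exists>y. ((\<lambda>z. g z + A / j * z powr (- j)) has_real_derivative y) (at z) \<and> y \<le> 0"
      using DERIV_add[OF assms(4)[OF z] D[OF z(1)]] assms(5)[OF z] by (intro exI conjI) auto
  qed
  have 2: "g s - A / j * s powr (- j) \<le> g t - A / j * t powr (- j)"
  proof (rule DERIV_nonneg_imp_nondecreasing[of s t "\<lambda>z. g z - A / j * z powr (- j)", OF assms(2)])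
    fix z assume z: "s \<le> z" "z \<le> t"
    show "\<exists>y. ((\<lambda>z. g z - A / j * z powr (- j)) has_real_derivative y) (at z) \<and> 0 \<le> y"
      using DERIV_diff[OF assms(4)[OF z] D[OF z(1)]] assms(5)[OF z] by (intro exI conjI) auto
  qed
  have "A / j * t powr (- j) \<ge> 0" using A assms(3) by simp
  then show ?thesis using 1 2 by linarith
qed

lemma rot_scale: "cv a b (s *\<^sub>R x) t = s *\<^sub>R cv a b x t"
  by (simp add: cv_def rot_def scaleR_add_right scaleR_diff_right algebra_simps)

lemma (in ext) V_bound: obtains Vm where "Vm > 0" "\<And>x. x \<in> U \<Longrightarrow> \<bar>V x\<bar> \<le> Vm"
proof -
  obtain B where "\<And>x. x \<in> U \<Longrightarrow> \<bar>V x\<bar> \<le> B" using Vb unfolding bounded_iff by auto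
  then show ?thesis using that[of "max B 1"] by fastforce
qed

text \<open>The estimates near infinity with one common constant \<open>C\<close>. The summand 1/4
  in the exponent of \<open>Qa\<close> is the loss in \<open>gradient_decay\<close>;
  \<open>uh\<close> keeps u and \<open>om\<close> between fixed positive bounds.\<close>

locale asy = ext U u V n r0 for U :: "(real^'n::finite) set" and u V n r0 +
  fixes C r1 Vm :: real
  assumes C: "C > 0" and r1: "r1 > r0" "r1 \<ge> 1"
    and Qa: "\<And>x. norm x \<ge> r1 \<Longrightarrow> Qd u x \<le> C\<^sup>2 * norm x powr (1/4 - 2 * (n - 2))"
    and oma: "\<And>x. norm x \<ge> r1 \<Longrightarrow> \<bar>1 - om x\<bar> \<le> C / norm x"
    and ua: "\<And>x. norm x \<ge> r1 \<Longrightarrow> \<bar>u x - 1\<bar> \<le> C / norm x" and uh: "\<And>x. norm x \<ge> r1 \<Longrightarrow> \<bar>u x - 1\<bar> \<le> 1/4"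
    and Vm: "Vm > 0" "\<And>x. x \<in> U \<Longrightarrow> \<bar>V x\<bar> \<le> Vm"

text \<open>The maximum principle is applied to \<open>Qd u / eta\<close> times r^k, where
  \<open>k\<close> is the rate of \<open>gradient_decay\<close>. Since \<open>eta\<close> lies
  between 1/2 and 1, the bound passes to \<open>Qd u\<close>.\<close>

lemma (in ext) asy_ex: obtains C r1 Vm where "asy U u V n r0 C r1 Vm"
proof -
  obtain Vm where Vm: "Vm > 0" "\<And>x. x \<in> U \<Longrightarrow> \<bar>V x\<bar> \<le> Vm" using V_bound by blast
  obtain C r where C: "C > 0" "r > r0" "r \<ge> 1" "\<And>x. norm x \<ge> r \<Longrightarrow> \<bar>1 - om x\<bar> \<le> C / norm x"
    "\<And>x. norm x \<ge> r \<Longrightarrow> \<bar>u x - 1\<bar> \<le> C / norm x" using u_asym by metis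
  have n0: "n > 0" using n3 by simp
  define r2 where "r2 = max r (24 * n * C)"
  have small: "\<bar>u x - 1\<bar> \<le> 1 / (24 * n)" if "norm x \<ge> r2" for x
  proof -
    have x: "norm x \<ge> r" "norm x \<ge> 24 * n * C" "norm x > 0" using that C(3) by (auto simp: r2_def)
    then have "C / norm x \<le> 1 / (24 * n)" using n0 by (simp add: field_simps)
    then show ?thesis using C(5)[OF x(1)] by linarith
  qed
  define r3 where "r3 = r2 + 1"
  have r3: "r3 > r2" "r3 > r0" "r3 \<ge> 1" "r3 \<ge> r" "r2 > r0" using C by (auto simp: r3_def r2_def)
  define k where "k = 2 * (n - 2) - 1/4"
  obtain K where K: "\<And>x. norm x = r3 \<Longrightarrow> \<bar>Qd u x\<bar> \<le> K" using sphere_bound[OF smooth_continuous[OF smooth_Qd[OF openU su]] r3(2)] by blast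
  define H where "H x = (Qd u x / eta x) * norm x powr k" for x
  have et: "1/2 \<le> eta x" "eta x \<le> 1" if "norm x \<ge> r2" for x using eta_range[OF small[OF that]] by auto
  have inU: "x \<in> U" if "norm x \<ge> r2" for x using that r3 by (simp add: mem_U_iff)
  have dG: "(\<lambda>y. Qd u y / eta y) differentiable (at x)" if "norm x \<ge> r2" for x
    using et(1)[OF that] by (intro differentiable_divide diffble_U[OF _ inU[OF that]] smooth_Qd openU su eta_facts(3)[OF inU[OF that]]) auto
  have Hb: "H y \<le> 2 * K * r3 powr k" if "norm y \<ge> r3" for y
  proof (rule radial_max_bound[OF _ _ _ _ that])
    show "r3 > 0" using r3 by simp
    show "H x \<le> 2 * K * r3 powr k" if x: "norm x = r3" for x
    proof -
      have "Qd u x / eta x \<le> K / (1/2)" using K[OF x] et(1)[of x] Qd_nonneg[of u x] x r3 by (intro frac_le) auto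
      then have "H x \<le> K / (1/2) * r3 powr k" unfolding H_def x by (rule mult_right_mono) simp
      then show ?thesis by (simp add: mult.commute)
    qed
    show "H differentiable (at x)" if x: "norm x \<ge> r3" for x
      unfolding H_def using x r3 U0[OF inU] by (intro differentiable_mult dG norm_powr_diff) auto
    show "ld id H x \<le> 0" if x: "norm x > r3" and m: "\<And>y. norm y = norm x \<Longrightarrow> H y \<le> H x" for x :: "real^'n"
    proof -
      have x2: "norm x > r2" "norm x \<ge> r2" using x r3 by auto
      have x0: "x \<noteq> 0" "norm x powr k > 0" using U0[OF inU[OF x2(2)]] by auto
      have "Qd u y / eta y \<le> Qd u x / eta x" if "norm y = norm x" for y
      proof -
        have "(Qd u y / eta y) * norm x powr k \<le> (Qd u x / eta x) * norm x powr k" using m[OF that] by (simp only: H_def that)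
        then show ?thesis using x0(2) by (rule mult_right_le_imp_le)
      qed
      then have "ld id (\<lambda>y. Qd u y / eta y) x \<le> - k * (Qd u x / eta x)"
        using gradient_decay[OF r3(5) small x2(1)] by (simp add: k_def)
      moreover have "ld id H x = norm x powr k * (k * (Qd u x / eta x) + ld id (\<lambda>y. Qd u y / eta y) x)"
        unfolding H_def ld_simps(3)[OF dG[OF x2(2)] norm_powr_diff(1)[OF x0(1)]] norm_powr_diff(2)[OF x0(1)] by (simp add: algebra_simps)
      ultimately show ?thesis using x0(2) by (simp add: mult_le_0_iff)
    qed
  qed
  have K0: "K \<ge> 0"
  proof -
    obtain z :: "real^'n" where "norm z = r3" using vector_choose_size[of r3] r3 by auto
    then show ?thesis using K by fastforce
  qed
  define D where "D = sqrt (2 * K * r3 powr k)"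
  have Qb: "Qd u x \<le> D\<^sup>2 * norm x powr (1/4 - 2 * (n - 2))" if x: "norm x \<ge> r3" for x
  proof -
    have x2: "norm x \<ge> r2" "norm x > 0" using x r3 by auto
    have "Qd u x / 1 \<le> Qd u x / eta x" using et[OF x2(1)] Qd_nonneg[of u x] by (intro divide_left_mono) auto
    then have "Qd u x * norm x powr k \<le> H x" unfolding H_def by (intro mult_right_mono) auto
    also have "\<dots> \<le> D\<^sup>2" using Hb[OF x] K0 by (simp add: D_def)
    finally have "Qd u x * norm x powr k * norm x powr (- k) \<le> D\<^sup>2 * norm x powr (- k)" by (rule mult_right_mono) simp
    moreover have "norm x powr k * norm x powr (- k) = 1" using x2(2) by (simp add: powr_add[symmetric])
    moreover have "- k = 1/4 - 2 * (n - 2)" by (simp add: k_def)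
    ultimately show ?thesis by (simp add: mult.assoc)
  qed
  define C' where "C' = max C D"
  have CC: "C / t \<le> C' / t" if "t \<ge> 0" for t using that by (intro divide_right_mono) (auto simp: C'_def)
  have "asy U u V n r0 C' r3 Vm"
  proof
    show "C' > 0" using C by (simp add: C'_def)
    show "r3 > r0" "r3 \<ge> 1" by (fact r3)+
    show "Qd u x \<le> C'\<^sup>2 * norm x powr (1/4 - 2 * (n - 2))" if "norm x \<ge> r3" for x
    proof -
      have "D \<ge> 0" using K0 by (simp add: D_def)
      then have "D\<^sup>2 \<le> C'\<^sup>2" by (intro power_mono) (auto simp: C'_def)
      then show ?thesis using Qb[OF that] mult_right_mono[of "D\<^sup>2" "C'\<^sup>2" "norm x powr (1/4 - 2 * (n - 2))"] by fastforce
    qed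
    show "\<bar>1 - om x\<bar> \<le> C' / norm x" if "norm x \<ge> r3" for x using C(4)[of x] CC[of "norm x"] that r3 by fastforce
    show "\<bar>u x - 1\<bar> \<le> C' / norm x" if "norm x \<ge> r3" for x using C(5)[of x] CC[of "norm x"] that r3 by fastforce
    have "1 / (24 * n) \<le> 1/4" using n3 by (simp add: field_simps)
    then show "\<bar>u x - 1\<bar> \<le> 1/4" if "norm x \<ge> r3" for x using small[of x] that r3 by fastforce
  qed (fact Vm)+
  then show ?thesis by (rule that)
qed

context ext begin

text \<open>The mixed equation is E (SV) = SV + (Su / u) QQ. Dividing by the radius removes the
  first term, so along a ray the quotient changes only through \<open>Su\<close>.\<close>

lemma SV_ray:
  assumes "s > 0" "s *\<^sub>R x \<in> U"
  shows "((\<lambda>s. ld (rot a b) V (s *\<^sub>R x) / s) has_real_derivative (ld (rot a b) u (s *\<^sub>R x) / u (s *\<^sub>R x)) * QQ (s *\<^sub>R x) / s\<^sup>2) (at s)"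
proof -
  let ?S = "ld (rot a b)" and ?y = "s *\<^sub>R x"
  have "((\<lambda>s. ?S V (s *\<^sub>R x)) has_real_derivative ld id (?S V) ?y / s) (at s)"
    by (rule DERIV_radial) (use assms in \<open>auto intro!: diffble_U smooth_ld openU linear_rot sV\<close>)
  then have "((\<lambda>s. ?S V (s *\<^sub>R x) / s) has_real_derivative (ld id (?S V) ?y / s * s - ?S V ?y * 1) / (s * s)) (at s)"
    using assms(1) by (intro DERIV_divide DERIV_ident) auto
  moreover have "ld id (?S V) ?y - ?S V ?y = (?S u ?y / u ?y) * QQ ?y"
    using ld_EV[where A="rot a b", OF assms(2) rot_perp] ld_id_commute[OF openU sV assms(2) linear_rot, of a b] u_nonzero[OF assms(2)] by (simp add: field_simps)
  ultimately show ?thesis using assms(1) by (simp add: power2_eq_square)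
qed

lemma sphere_argmax: fixes x :: "real^'n" assumes "continuous_on U f" "norm x > r0"
  obtains z where "norm z = norm x" "\<And>y. norm y = norm x \<Longrightarrow> f y \<le> (f z :: real)"
proof -
  let ?S = "{y::real^'n. norm x \<le> norm y \<and> norm y \<le> norm x}"
  have "continuous_on ?S f" by (rule continuous_on_subset[OF assms(1)]) (use assms(2) in \<open>auto simp: mem_U_iff\<close>)
  moreover have "x \<in> ?S" by simp
  ultimately obtain z where "z \<in> ?S" "\<And>y. y \<in> ?S \<Longrightarrow> f y \<le> f z" using continuous_attains_sup[OF compact_annulus[of "norm x" "norm x"], of f] by blast
  then show ?thesis using that[of z] by auto
qed

end

section \<open>Decay of the derivatives of V and a lower bound for |V|\<close>

context asy begin

lemma inU: "norm x \<ge> r1 \<Longrightarrow> x \<in> U" using r1 by (simp add: mem_U_iff)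

lemma u_half: "norm x \<ge> r1 \<Longrightarrow> 1/2 \<le> u x" "norm x \<ge> r1 \<Longrightarrow> u x \<le> 2" using uh[of x] by linarith+

lemma om_half: assumes "norm x \<ge> r1" shows "1/2 \<le> om x" "om x \<le> 2"
proof -
  have "(u x)\<^sup>2 \<le> (5/4)\<^sup>2" "(3/4)\<^sup>2 \<le> (u x)\<^sup>2" using uh[OF assms] by (intro power_mono; linarith)+
  then have "(u x)\<^sup>2 \<le> 2" "1/2 \<le> (u x)\<^sup>2" "(u x)\<^sup>2 > 0" by (auto simp: power2_eq_square)
  then show "1/2 \<le> om x" "om x \<le> 2" by (auto simp: om_def field_simps)
qed

lemma Su_bound: assumes "norm x \<ge> r1" "orth2 a b" shows "\<bar>ld (rot a b) u x\<bar> \<le> C * norm x powr (-1/2)"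
proof -
  have x1: "norm x \<ge> 1" "x \<in> U" using assms r1 inU by auto
  have "(ld (rot a b) u x)\<^sup>2 \<le> Qd u x" by (rule Qd_rot[OF diffble_U[OF su x1(2)] assms(2) U0[OF x1(2)]])
  also have "\<dots> \<le> C\<^sup>2 * norm x powr (1/4 - 2 * (n - 2))" by (rule Qa[OF assms(1)])
  also have "\<dots> \<le> C\<^sup>2 * norm x powr (-1)" using x1 n3 by (intro mult_left_mono powr_mono) auto
  also have "\<dots> = (C * norm x powr (-1/2))\<^sup>2"
  proof -
    have "(norm x powr (-1/2))\<^sup>2 = norm x powr (-1/2 + -1/2)" unfolding powr_add by (simp add: power2_eq_square)
    then show ?thesis by (simp add: power_mult_distrib)
  qed
  finally have "\<bar>ld (rot a b) u x\<bar> \<le> \<bar>C * norm x powr (-1/2)\<bar>" by (simp add: abs_le_square_iff)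
  then show ?thesis using C by (simp add: abs_mult)
qed

text \<open>Division by u removes \<open>EV\<close> from the rotational derivative, which is (n - 1)
  \<omega> V Su. With V bounded and Su small, \<open>Kf\<close> is nearly constant on spheres before
  anything is known about \<open>EV\<close>.\<close>

definition Kf where "Kf x = (EV x - V x) / u x"

lemma Kf_facts: assumes "x \<in> U"
  shows "Kf differentiable (at x)" "ld (rot a b) Kf x = (n - 1) * V x * ld (rot a b) u x * om x" "EV x = u x * Kf x + V x"
proof -
  have d: "(\<lambda>y. EV y - V y) differentiable (at x)" "u differentiable (at x)" "EV differentiable (at x)" "V differentiable (at x)"
    by (intro diffble_U[OF _ assms] smooth_diff smooth_EV su sV openU)+
  show "Kf differentiable (at x)" unfolding Kf_def using u_nonzero[OF assms] d by (intro differentiable_divide) auto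
  have "ld (rot a b) Kf x = (ld (rot a b) EV x - ld (rot a b) V x) / u x - (EV x - V x) * ld (rot a b) u x / (u x)\<^sup>2"
    unfolding Kf_def ld_def[of "rot a b"] dd_divide[OF d(1,2) u_nonzero[OF assms]] dd_simps(2)[OF d(3,4)] ..
  moreover have "ld (rot a b) EV x - ld (rot a b) V x = ld (rot a b) u x * QQ x / u x"
    using ld_EV[where A="rot a b", OF assms rot_perp] u_nonzero[OF assms] by (simp add: field_simps)
  ultimately have "ld (rot a b) Kf x = ld (rot a b) u x * (QQ x - (EV x - V x)) / (u x)\<^sup>2"
    by (simp add: power2_eq_square right_diff_distrib diff_divide_distrib mult.commute)
  moreover have "QQ x - (EV x - V x) = (n - 1) * V x" by (simp add: QQ_def algebra_simps)
  ultimately show "ld (rot a b) Kf x = (n - 1) * V x * ld (rot a b) u x * om x" by (simp add: om_def)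
  show "EV x = u x * Kf x + V x" using u_nonzero[OF assms] by (simp add: Kf_def)
qed

lemma half: "norm x \<ge> r1 \<Longrightarrow> 0 < norm x powr (-1/2)" "norm x \<ge> r1 \<Longrightarrow> norm x powr (-1/2) \<le> 1" "norm x \<ge> r1 \<Longrightarrow> 1 / norm x \<le> norm x powr (-1/2)"
proof -
  assume x: "norm x \<ge> r1"
  then have x1: "norm x \<ge> 1" using r1 by simp
  have "norm x > 0" using x1 by linarith
  then show "0 < norm x powr (-1/2)" by simp
  have "norm x powr (-1/2) \<le> norm x powr 0" using x1 by (intro powr_mono) auto
  then show "norm x powr (-1/2) \<le> 1" using \<open>norm x > 0\<close> by simp
  have "norm x powr (-1) \<le> norm x powr (-1/2)" using x1 by (intro powr_mono) auto
  then show "1 / norm x \<le> norm x powr (-1/2)" using x1 by (simp add: powr_minus_divide)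
qed

lemma Kf_osc: assumes "norm x \<ge> r1" "norm y = norm x"
  shows "\<bar>Kf y - Kf x\<bar> \<le> pi * ((n - 1) * Vm * C * 2) * norm x powr (-1/2)"
proof -
  have "\<bar>Kf y - Kf x\<bar> \<le> pi * ((n - 1) * Vm * (C * norm x powr (-1/2)) * 2)"
  proof (rule sphere_osc[OF _ assms(2)])
    show "CARD('n) \<ge> 2" using card3 by simp
    show "x \<noteq> 0" by (rule U0[OF inU[OF assms(1)]])
    show "Kf differentiable (at z)" if "norm z = norm x" for z by (rule Kf_facts[OF inU]) (use that assms in simp)
    show "\<bar>ld (rot a b) Kf z\<bar> \<le> (n - 1) * Vm * (C * norm x powr (-1/2)) * 2" if ab: "orth2 a b" and z: "norm z = norm x" for a b z
    proof -
      have zr: "norm z \<ge> r1" using z assms by simp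
      have "\<bar>ld (rot a b) Kf z\<bar> = (n - 1) * \<bar>V z\<bar> * \<bar>ld (rot a b) u z\<bar> * om z"
        unfolding Kf_facts(2)[OF inU[OF zr]] using n3 om_half[OF zr] by (simp add: abs_mult)
      also have "\<dots> \<le> (n - 1) * Vm * (C * norm x powr (-1/2)) * 2"
        using Vm(2)[OF inU[OF zr]] Su_bound[OF zr ab] om_half[OF zr] n3 Vm(1) C z by (intro mult_mono) auto
      finally show ?thesis .
    qed
  qed
  then show ?thesis by (simp only: mult_ac)
qed

definition m2 where "m2 = (n - 2) * C * Vm"

lemma m2_pos: "m2 > 0" using n3 C Vm by (simp add: m2_def)

lemma EV_extr_aux: assumes "norm p \<ge> r1"
  shows "\<bar>(n - 2) / 2 * (1 - om p) * V p\<bar> \<le> m2 / 2 * (1 / norm p)"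
proof -
  have "\<bar>(n - 2) / 2 * (1 - om p) * V p\<bar> = (n - 2) / 2 * (\<bar>1 - om p\<bar> * \<bar>V p\<bar>)" using n3 by (simp add: abs_mult)
  also have "\<dots> \<le> (n - 2) / 2 * ((C / norm p) * Vm)"
    using oma[OF assms] Vm inU[OF assms] C n3 by (intro mult_left_mono mult_mono) auto
  finally show ?thesis by (simp add: m2_def)
qed

lemma om_EV: assumes "norm p \<ge> r1" shows "lapS V p = (n - 1) * ((n - 2) / 2 * (1 - om p) * V p - om p * EV p)"
  using static_trace(1)[OF inU[OF assms]] by (simp add: field_simps)

text \<open>At a maximum of V on a sphere \<open>lapS V \<le> 0\<close>, and \<open>om_EV\<close>
  then bounds \<open>om * EV\<close> from below by the small term with
  \<open>1 - om\<close>.\<close>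

lemma EV_max: assumes "norm p \<ge> r1" "\<And>y. norm y = norm p \<Longrightarrow> V y \<le> V p" shows "EV p \<ge> - (m2 / norm p)"
proof -
  have "lapS V p \<le> 0" by (rule spatial_max[OF inU[OF assms(1)] sV assms(2)])
  then have "(n - 2) / 2 * (1 - om p) * V p - om p * EV p \<le> 0" unfolding om_EV[OF assms(1)] using n3 by (simp add: mult_le_0_iff)
  then have 1: "om p * EV p \<ge> - (m2 / 2 * (1 / norm p))" using EV_extr_aux[OF assms(1)] by linarith
  show ?thesis
  proof (cases "EV p \<ge> 0")
    case True then show ?thesis using m2_pos by (smt (verit) divide_nonneg_nonneg norm_ge_zero)
  next
    case False
    have "om p * EV p \<le> 1/2 * EV p" using om_half[OF assms(1)] False by (intro mult_right_mono_neg) auto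
    then show ?thesis using 1 by simp
  qed
qed

lemma EV_min: assumes "norm p \<ge> r1" "\<And>y. norm y = norm p \<Longrightarrow> V p \<le> V y" shows "EV p \<le> m2 / norm p"
proof -
  have "lapS V p \<ge> 0" by (rule spatial_min[OF inU[OF assms(1)] sV assms(2)])
  then have "(n - 2) / 2 * (1 - om p) * V p - om p * EV p \<ge> 0" unfolding om_EV[OF assms(1)] using n3 by (simp add: zero_le_mult_iff)
  then have 1: "om p * EV p \<le> m2 / 2 * (1 / norm p)" using EV_extr_aux[OF assms(1)] by linarith
  show ?thesis
  proof (cases "EV p \<le> 0")
    case True then show ?thesis using m2_pos by (smt (verit) divide_nonneg_nonneg norm_ge_zero)
  next
    case False
    have "om p * EV p \<ge> 1/2 * EV p" using om_half[OF assms(1)] False by (intro mult_right_mono) auto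
    then show ?thesis using 1 by simp
  qed
qed

lemma extremal_points: fixes x :: "real^'n" assumes "norm x \<ge> r1"
  obtains p p' where "norm p = norm x" "norm p' = norm x" "EV p \<ge> - (m2 / norm x)" "EV p' \<le> m2 / norm x"
proof -
  have x: "norm x > r0" using assms r1 by simp
  have cV: "continuous_on U V" "continuous_on U (\<lambda>y. - V y)" using smooth_continuous[OF sV] by (auto intro: continuous_intros)
  obtain p where p: "norm p = norm x" "\<And>y. norm y = norm x \<Longrightarrow> V y \<le> V p" using sphere_argmax[OF cV(1) x] by blast
  obtain p' where p': "norm p' = norm x" "\<And>y. norm y = norm x \<Longrightarrow> - V y \<le> - V p'" using sphere_argmax[OF cV(2) x] by blast
  show ?thesis using that[OF p(1) p'(1)] EV_max[of p] EV_min[of p'] p p' assms by simp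
qed

text \<open>The maximum and the minimum of V on a sphere supply one one-sided bound for
  \<open>EV\<close> each; the bounded oscillation of \<open>Kf\<close> spreads both over the
  sphere.\<close>

lemma EV_bounded: obtains B where "B > 0" "\<And>x. norm x \<ge> r1 \<Longrightarrow> \<bar>EV x\<bar> \<le> B"
proof -
  define D1 where "D1 = pi * ((n - 1) * Vm * C * 2)"
  have D1: "D1 \<ge> 0" using n3 Vm C by (simp add: D1_def)
  define k0 where "k0 = 2 * (m2 + Vm) + D1"
  have k0: "k0 \<ge> 0" using m2_pos Vm D1 by (simp add: k0_def)
  have "\<bar>EV x\<bar> \<le> 2 * k0 + Vm + 1" if x: "norm x \<ge> r1" for x
  proof -
    have x1: "norm x \<ge> 1" using x r1 by simp
    obtain p p' where p: "norm p = norm x" "norm p' = norm x" "EV p \<ge> - (m2 / norm x)" "EV p' \<le> m2 / norm x" using extremal_points[OF x] .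
    have pr: "norm p \<ge> r1" "norm p' \<ge> r1" using p x by auto
    have mx: "m2 / norm x \<le> m2" using x1 m2_pos by (simp add: divide_le_eq)
    have osc: "\<bar>Kf y - Kf x\<bar> \<le> D1" if "norm y = norm x" for y
      using Kf_osc[OF x that] half(2)[OF x] D1 mult_left_mono[OF half(2)[OF x] D1] unfolding D1_def by linarith
    have "Kf p' \<le> (m2 + Vm) / u p'" unfolding Kf_def
      using p(4) mx Vm(2)[OF inU[OF pr(2)]] u_half(1)[OF pr(2)] by (intro divide_right_mono) auto
    also have "\<dots> \<le> (m2 + Vm) / (1/2)" using u_half(1)[OF pr(2)] m2_pos Vm by (intro divide_left_mono) auto
    finally have 1: "Kf x \<le> k0" using osc[OF p(2)] by (simp add: k0_def)
    have "- Kf p = (V p - EV p) / u p" by (simp add: Kf_def minus_divide_left)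
    also have "\<dots> \<le> (m2 + Vm) / u p"
      using p(3) mx Vm(2)[OF inU[OF pr(1)]] u_half(1)[OF pr(1)] by (intro divide_right_mono) auto
    also have "\<dots> \<le> (m2 + Vm) / (1/2)" using u_half(1)[OF pr(1)] m2_pos Vm by (intro divide_left_mono) auto
    finally have 2: "- Kf x \<le> k0" using osc[OF p(1)] by (simp add: k0_def)
    have "\<bar>u x * Kf x\<bar> \<le> 2 * k0" using u_half[OF x] 1 2 k0 by (simp add: abs_mult) (intro mult_mono, auto)
    then show ?thesis using Kf_facts(3)[OF inU[OF x]] Vm(2)[OF inU[OF x]] by linarith
  qed
  then show ?thesis using that[of "2 * k0 + Vm + 1"] k0 Vm by simp
qed

lemma ray: assumes "norm x \<ge> r1" "s \<ge> 1" shows "norm (s *\<^sub>R x) \<ge> r1" "s *\<^sub>R x \<in> U" "norm (s *\<^sub>R x) powr k = s powr k * norm x powr k"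
proof -
  have "1 * norm x \<le> s * norm x" using assms by (intro mult_right_mono) auto
  then show 1: "norm (s *\<^sub>R x) \<ge> r1" using assms by simp
  then show "s *\<^sub>R x \<in> U" by (rule inU)
  show "norm (s *\<^sub>R x) powr k = s powr k * norm x powr k" using assms by (simp add: powr_mult)
qed

text \<open>If \<open>SV/r\<close> had a nonzero limit along a ray, \<open>V\<close> would be unbounded along rotation orbits.\<close>

lemma SV_decay: obtains D where "D > 0" "\<And>x a b. norm x \<ge> r1 \<Longrightarrow> orth2 a b \<Longrightarrow> \<bar>ld (rot a b) V x\<bar> \<le> D * norm x powr (-1/2)"
proof -
  obtain B where B: "B > 0" "\<And>x. norm x \<ge> r1 \<Longrightarrow> \<bar>EV x\<bar> \<le> B" using EV_bounded by blast
  define Qb where "Qb = B + (n - 2) * Vm"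
  have Qb0: "Qb > 0" using B Vm n3 by (simp add: Qb_def add_pos_nonneg)
  have Qb: "\<bar>QQ x\<bar> \<le> Qb" if "norm x \<ge> r1" for x
  proof -
    have "\<bar>QQ x\<bar> \<le> \<bar>EV x\<bar> + (n - 2) * \<bar>V x\<bar>" using n3 abs_triangle_ineq[of "EV x" "(n - 2) * V x"] by (simp add: QQ_def abs_mult)
    also have "\<dots> \<le> Qb" unfolding Qb_def using B(2)[OF that] Vm(2)[OF inU[OF that]] n3 by (intro add_mono mult_left_mono) auto
    finally show ?thesis .
  qed
  define A where "A = 2 * C * Qb"
  have A0: "A > 0" using C Qb0 by (simp add: A_def)
  \<comment> \<open>By \<open>SV_ray\<close> the derivative is of order z^(-5/2) in the ray
    parameter, hence integrable: the quotient varies by at most a multiple of r^(-1/2) along the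
    whole ray.\<close>
  have var: "\<bar>ld (rot a b) V (s *\<^sub>R x) / s - ld (rot a b) V x\<bar> \<le> A * norm x powr (-1/2)"
    if x: "norm x \<ge> r1" and ab: "orth2 a b" and s: "s \<ge> 1" for x a b s
  proof -
    have "\<bar>ld (rot a b) V (s *\<^sub>R x) / s - ld (rot a b) V (1 *\<^sub>R x) / 1\<bar> \<le> (A * norm x powr (-1/2)) / (3/2) * 1 powr (- (3/2))"
    proof (rule decay_integral[OF _ s])
      fix z :: real assume z: "1 \<le> z" "z \<le> s"
      note rz = ray[OF x z(1)]
      show "((\<lambda>s. ld (rot a b) V (s *\<^sub>R x) / s) has_real_derivative (ld (rot a b) u (z *\<^sub>R x) / u (z *\<^sub>R x)) * QQ (z *\<^sub>R x) / z\<^sup>2) (at z)"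
        by (rule SV_ray) (use z rz in auto)
      have "\<bar>ld (rot a b) u (z *\<^sub>R x) / u (z *\<^sub>R x)\<bar> \<le> C * norm (z *\<^sub>R x) powr (-1/2) / (1/2)"
        unfolding abs_divide using Su_bound[OF rz(1) ab] u_half(1)[OF rz(1)] C by (intro frac_le) auto
      then have "\<bar>ld (rot a b) u (z *\<^sub>R x) / u (z *\<^sub>R x)\<bar> * \<bar>QQ (z *\<^sub>R x)\<bar> \<le> C * norm (z *\<^sub>R x) powr (-1/2) / (1/2) * Qb"
        using Qb[OF rz(1)] C by (intro mult_mono) auto
      also have "\<dots> = A * norm x powr (-1/2) * z powr (-1/2)" unfolding rz(3) A_def by simp
      finally have "\<bar>(ld (rot a b) u (z *\<^sub>R x) / u (z *\<^sub>R x)) * QQ (z *\<^sub>R x)\<bar> / z\<^sup>2 \<le> A * norm x powr (-1/2) * z powr (-1/2) / z\<^sup>2"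
        unfolding abs_mult by (rule divide_right_mono) simp
      also have "\<dots> = A * norm x powr (-1/2) * z powr (- (3/2) - 1)"
      proof -
        have "z powr (- (3/2) - 1) = z powr (-1/2 - 2)" by simp
        also have "\<dots> = z powr (-1/2) / z\<^sup>2" unfolding powr_diff using z by simp
        finally show ?thesis by simp
      qed
      finally show "\<bar>(ld (rot a b) u (z *\<^sub>R x) / u (z *\<^sub>R x)) * QQ (z *\<^sub>R x) / z\<^sup>2\<bar> \<le> A * norm x powr (-1/2) * z powr (- (3/2) - 1)"
        unfolding abs_divide[of _ "z\<^sup>2"] by simp
    qed simp_all
    also have "\<dots> \<le> A * norm x powr (-1/2)" using A0 by simp
    finally show ?thesis by simp
  qed
  \<comment> \<open>If the derivative exceeds \<open>D\<close> at \<open>x\<close>, it exceeds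
    \<open>D + h\<close> on a short arc through \<open>x\<close>, and by \<open>var\<close> it
    exceeds \<open>h * s\<close> on the arc scaled by \<open>s\<close>. Over the fixed angle
    \<open>t0\<close> this changes V by more than \<open>2 * Vm\<close> when \<open>s\<close> is
    large.\<close>
  have main: "ld (rot a b) V x \<le> A * norm x powr (-1/2)" if x: "norm x \<ge> r1" and ab: "orth2 a b" for x a b
  proof (rule ccontr)
    define D where "D = A * norm x powr (-1/2)"
    assume "\<not> ?thesis"
    then have g: "ld (rot a b) V x > D" by (simp add: D_def)
    define h where "h = (ld (rot a b) V x - D) / 2"
    have h: "h > 0" using g by (simp add: h_def)
    have nc: "norm (cv a b x t) = norm x" for t by (rule norm_cv[OF ab])
    have cU: "cv a b x t \<in> U" for t using inU x nc by simp
    have "isCont (\<lambda>t. ld (rot a b) V (cv a b x t)) 0"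
      by (rule DERIV_isCont[OF cv_DERIV[OF ab]]) (intro diffble_U[OF _ cU] smooth_ld openU linear_rot sV)
    then have "((\<lambda>t. ld (rot a b) V (cv a b x t)) \<longlongrightarrow> ld (rot a b) V x) (at 0)" by (simp add: isCont_def)
    then have "\<forall>\<^sub>F t in at 0. ld (rot a b) V (cv a b x t) > D + h"
      by (rule order_tendstoD) (use h in \<open>simp add: h_def field_simps\<close>)
    then obtain d where d: "d > 0" "\<And>t. t \<noteq> 0 \<Longrightarrow> dist t 0 < d \<Longrightarrow> ld (rot a b) V (cv a b x t) > D + h"
      unfolding eventually_at by blast
    define t0 where "t0 = d/2"
    define s where "s = max 1 (2 * Vm / (t0 * h) + 1)"
    have t0: "t0 > 0" using d by (simp add: t0_def)
    have s1: "s \<ge> 1" "s > 2 * Vm / (t0 * h)" by (simp_all add: s_def)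
    define \<phi> where "\<phi> t = V (cv a b (s *\<^sub>R x) t)" for t
    have cU': "cv a b (s *\<^sub>R x) t \<in> U" for t unfolding rot_scale by (rule ray(2)[OF _ s1(1)]) (use nc x in simp)
    have D\<phi>: "(\<phi> has_real_derivative ld (rot a b) V (cv a b (s *\<^sub>R x) t)) (at t)" for t
      unfolding \<phi>_def by (rule cv_DERIV[OF ab diffble_U[OF sV cU']])
    obtain z where z: "0 < z" "z < t0" "\<phi> t0 - \<phi> 0 = (t0 - 0) * ld (rot a b) V (cv a b (s *\<^sub>R x) z)"
      using MVT2[OF t0, of \<phi> "\<lambda>t. ld (rot a b) V (cv a b (s *\<^sub>R x) t)", OF D\<phi>] by blast
    have "\<bar>ld (rot a b) V (s *\<^sub>R cv a b x z) / s - ld (rot a b) V (cv a b x z)\<bar> \<le> D"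
      using var[of "cv a b x z", OF _ ab s1(1)] x nc by (simp add: D_def)
    moreover have "ld (rot a b) V (cv a b x z) > D + h" by (rule d(2)) (use z d in \<open>auto simp: t0_def\<close>)
    ultimately have "ld (rot a b) V (s *\<^sub>R cv a b x z) / s > h" by linarith
    then have "ld (rot a b) V (cv a b (s *\<^sub>R x) z) > h * s" using s1(1) unfolding rot_scale by (simp add: less_divide_eq)
    then have "\<phi> t0 - \<phi> 0 > t0 * (h * s)" using z(3) t0 by simp
    moreover have "t0 * (h * s) > 2 * Vm" using s1(2) t0 h by (simp add: divide_less_eq mult_ac)
    moreover have "\<bar>\<phi> t0\<bar> \<le> Vm" "\<bar>\<phi> 0\<bar> \<le> Vm" unfolding \<phi>_def using Vm(2) cU' by blast+
    ultimately show False by linarith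
  qed
  have "\<bar>ld (rot a b) V x\<bar> \<le> A * norm x powr (-1/2)" if x: "norm x \<ge> r1" and ab: "orth2 a b" for x a b
  proof -
    have "orth2 b a" using ab by (simp add: orth2_def inner_commute)
    moreover have "ld (rot b a) V x = - ld (rot a b) V x"
    proof -
      have "rot b a x = - rot a b x" by (simp add: rot_def)
      then show ?thesis using dd_lin(4)[OF diffble_U[OF sV inU[OF x]]] by (simp add: ld_def)
    qed
    ultimately show ?thesis using main[OF x ab] main[OF x, of b a] by simp
  qed
  then show ?thesis using that A0 by blast
qed

lemma V_osc:
  assumes D: "\<And>x a b. norm x \<ge> r1 \<Longrightarrow> orth2 a b \<Longrightarrow> \<bar>ld (rot a b) V x\<bar> \<le> D * norm x powr (-1/2)"
    and x: "norm x \<ge> r1" "norm y = norm x"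
  shows "\<bar>V y - V x\<bar> \<le> pi * (D * norm x powr (-1/2))"
proof (rule sphere_osc[OF _ x(2)])
  show "CARD('n) \<ge> 2" using card3 by simp
  show "x \<noteq> 0" by (rule U0[OF inU[OF x(1)]])
  show "V differentiable (at z)" if "norm z = norm x" for z by (rule diffble_U[OF sV inU]) (use that x in simp)
  show "\<bar>ld (rot a b) V z\<bar> \<le> D * norm x powr (-1/2)" if "orth2 a b" "norm z = norm x" for a b z
    using D[of z a b] that x by simp
qed

text \<open>As for \<open>EV_bounded\<close>, but now V, u and \<open>Kf\<close> all oscillate by
  O(r^(-1/2)) on spheres. So \<open>EV\<close> at any point is close to a bounded multiple of its
  values at the extremal points of V, where one-sided bounds of order 1/r hold.\<close>

lemma EV_decay: obtains D where "D > 0" "\<And>x. norm x \<ge> r1 \<Longrightarrow> \<bar>EV x\<bar> \<le> D * norm x powr (-1/2)"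
proof -
  obtain D2 where D2: "D2 > 0" "\<And>x a b. norm x \<ge> r1 \<Longrightarrow> orth2 a b \<Longrightarrow> \<bar>ld (rot a b) V x\<bar> \<le> D2 * norm x powr (-1/2)" using SV_decay by blast
  define D1 where "D1 = pi * ((n - 1) * Vm * C * 2)"
  have D1: "D1 \<ge> 0" using n3 Vm C by (simp add: D1_def)
  define D where "D = 2 * D1 + pi * D2 + 4 * C * Vm"
  have D: "D > 0" using D1 D2 C Vm by (simp add: D_def add_pos_pos add_nonneg_pos)
  have cmp: "\<bar>EV x - u x / u z * EV z\<bar> \<le> D * norm x powr (-1/2)" if x: "norm x \<ge> r1" and zx: "norm z = norm x" for x z
  proof -
    define h where "h = norm x powr (-1/2)"
    have z: "norm z \<ge> r1" using x zx by simp
    have uz: "u z > 0" using u_half(1)[OF z] by simp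
    have e: "EV x - u x / u z * EV z = u x * (Kf x - Kf z) + (V x - V z) + V z * ((u z - u x) / u z)"
      unfolding Kf_facts(3)[OF inU[OF x]] Kf_facts(3)[OF inU[OF z]] using uz by (simp add: field_simps)
    have 1: "\<bar>u x * (Kf x - Kf z)\<bar> \<le> 2 * (D1 * h)"
      unfolding abs_mult using u_half[OF x] Kf_osc[OF z zx[symmetric]] zx D1 by (intro mult_mono) (auto simp: D1_def h_def)
    have 2: "\<bar>V x - V z\<bar> \<le> pi * (D2 * h)"
      using V_osc[OF D2(2) z zx[symmetric]] zx by (simp add: h_def)
    have "\<bar>u z - u x\<bar> \<le> 2 * C * (1 / norm x)" 
    proof -
      have "\<bar>u z - u x\<bar> \<le> C / norm x + C / norm x" using ua[OF x] ua[OF z] unfolding zx by linarith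
      then show ?thesis by simp
    qed
    also have "\<dots> \<le> 2 * C * h" using half(3)[OF x] C by (intro mult_left_mono) (auto simp: h_def)
    finally have "\<bar>(u z - u x) / u z\<bar> \<le> (2 * C * h) / (1/2)"
      unfolding abs_divide using u_half(1)[OF z] C half(1)[OF x] by (intro frac_le) (auto simp: h_def)
    then have 3: "\<bar>V z * ((u z - u x) / u z)\<bar> \<le> Vm * (4 * C * h)"
      unfolding abs_mult using Vm inU[OF z] by (intro mult_mono) auto
    have "D * h = 2 * (D1 * h) + pi * (D2 * h) + Vm * (4 * C * h)" by (simp add: D_def algebra_simps)
    then show ?thesis unfolding e h_def[symmetric] using 1 2 3 by linarith
  qed
  have "\<bar>EV x\<bar> \<le> (4 * m2 + D) * norm x powr (-1/2)" if x: "norm x \<ge> r1" for x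
  proof -
    define h where "h = norm x powr (-1/2)"
    obtain p p' where p: "norm p = norm x" "norm p' = norm x" "EV p \<ge> - (m2 / norm x)" "EV p' \<le> m2 / norm x" using extremal_points[OF x] .
    have mh: "m2 / norm x \<le> m2 * h" using half(3)[OF x] m2_pos mult_left_mono[of "1 / norm x" h m2] by (simp add: h_def)
    have rat: "u x / u z \<ge> 0" "u x / u z \<le> 4" if "norm z = norm x" for z
      using u_half[of z] u_half[OF x] x that by (auto simp: field_simps)
    have mh0: "m2 * h \<ge> 0" using m2_pos by (simp add: h_def)
    have "u x / u p' * EV p' \<le> u x / u p' * (m2 * h)" using rat(1)[OF p(2)] p(4) mh by (intro mult_left_mono) auto
    also have "\<dots> \<le> 4 * (m2 * h)" using rat(2)[OF p(2)] mh0 by (intro mult_right_mono) auto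
    finally have 1: "EV x \<le> 4 * (m2 * h) + D * h" using cmp[OF x p(2)] by (simp add: h_def)
    have "u x / u p * (- EV p) \<le> u x / u p * (m2 * h)" using rat(1)[OF p(1)] p(3) mh by (intro mult_left_mono) auto
    also have "\<dots> \<le> 4 * (m2 * h)" using rat(2)[OF p(1)] mh0 by (intro mult_right_mono) auto
    finally have 2: "- EV x \<le> 4 * (m2 * h) + D * h" using cmp[OF x p(1)] by (simp add: h_def)
    show ?thesis unfolding h_def[symmetric] using 1 2 by (simp add: algebra_simps abs_le_iff)
  qed
  then show ?thesis using that[of "4 * m2 + D"] D m2_pos by simp
qed

text \<open>The bound r^(-1/2) for \<open>EV\<close> is integrable against dr/r.\<close>

lemma V_ray: assumes D: "D > 0" "\<And>x. norm x \<ge> r1 \<Longrightarrow> \<bar>EV x\<bar> \<le> D * norm x powr (-1/2)" and x: "norm x \<ge> r1" and s: "s \<ge> 1"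
  shows "\<bar>V (s *\<^sub>R x) - V x\<bar> \<le> 2 * D * norm x powr (-1/2)"
proof -
  have "\<bar>V (s *\<^sub>R x) - V (1 *\<^sub>R x)\<bar> \<le> (D * norm x powr (-1/2)) / (1/2) * 1 powr (- (1/2))"
  proof (rule decay_integral[OF _ s])
    fix z :: real assume z: "1 \<le> z" "z \<le> s"
    note rz = ray[OF x z(1)]
    show "((\<lambda>s. V (s *\<^sub>R x)) has_real_derivative EV (z *\<^sub>R x) / z) (at z)"
      by (rule DERIV_radial) (use z diffble_U[OF sV rz(2)] in auto)
    have "\<bar>EV (z *\<^sub>R x) / z\<bar> \<le> D * norm (z *\<^sub>R x) powr (-1/2) / z" using D(2)[OF rz(1)] z by (simp add: abs_divide divide_right_mono)
    also have "\<dots> = D * norm x powr (-1/2) * (z powr (-1/2) / z powr 1)" unfolding rz(3) using z by simp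
    also have "z powr (-1/2) / z powr 1 = z powr (- (1/2) - 1)" unfolding powr_diff by simp
    finally show "\<bar>EV (z *\<^sub>R x) / z\<bar> \<le> D * norm x powr (-1/2) * z powr (- (1/2) - 1)" .
  qed simp_all
  then show ?thesis by simp
qed

text \<open>The sign of V is unknown, so V^2 is used. At its maximum on a sphere
  \<open>V * lapS V \<le> 0\<close>, and the trace equation almost makes the radial derivative of
  V^2 nonnegative; the factor \<open>exp (- C1 / norm x)\<close> makes up for the term with
  \<open>1 - om\<close>. Hence the maximum of |V| over spheres stays above a positive constant, and
  the decay of the oscillation carries this over to all points.\<close>

lemma V_lower: obtains m R where "m > 0" "R \<ge> r1" "\<And>x. norm x \<ge> R \<Longrightarrow> \<bar>V x\<bar> \<ge> m"
proof -
  obtain D2 where D2: "D2 > 0" "\<And>x a b. norm x \<ge> r1 \<Longrightarrow> orth2 a b \<Longrightarrow> \<bar>ld (rot a b) V x\<bar> \<le> D2 * norm x powr (-1/2)" using SV_decay by blast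
  obtain y where y: "norm y > r1" "V y \<noteq> 0"
  proof -
    have "\<exists>y. norm y > r1 \<and> V y \<noteq> 0"
    proof (rule ccontr)
      assume neg: "\<not> ?thesis"
      obtain z where z: "z \<in> U" "V z \<noteq> 0" using Vnz by blast
      obtain w :: "real^'n" where w: "norm w = r1 + 1" using vector_choose_size[of "r1 + 1"] r1 by auto
      have "V z = 0"
      proof (rule unique_continuation[OF connected_U, of "{y. norm y > r1}"])
        show "open {y::real^'n. norm y > r1}" by (intro open_Collect_less continuous_intros)
        show "{y. norm y > r1} \<noteq> ({}::(real^'n) set)" using w by (auto intro!: exI[of _ w])
        show "{y. norm y > r1} \<subseteq> U" using inU by force
      qed (use neg z in auto)
      then show False using z by simp
    qed
    then show ?thesis using that by blast
  qed
  \<comment> \<open>Twice the constant in the lower bound for \<open>V x * EV x\<close>, because V^2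
    is differentiated.\<close>
  define C1 where "C1 = 2 * (n - 2) * C"
  have C1: "C1 > 0" using n3 C by (simp add: C1_def)
  define H where "H x = (V x * V x) * exp (- C1 / norm x)" for x
  have He: "((\<lambda>r. exp (- C1 / r)) has_real_derivative C1 / r\<^sup>2 * exp (- C1 / r)) (at r)" if "r > 0" for r
    using that by (auto intro!: derivative_eq_intros simp: power2_eq_square)
  have dexp: "(\<lambda>x. exp (- C1 / norm x)) differentiable (at x)" "ld id (\<lambda>x. exp (- C1 / norm x)) x = C1 / norm x * exp (- C1 / norm x)" if x: "norm x \<ge> r1" for x :: "real^'n"
  proof -
    have x0: "x \<noteq> 0" "norm x > 0" using U0[OF inU[OF x]] by auto
    note rd = radial_diff[OF x0(1) He[OF x0(2)]]
    show "(\<lambda>x. exp (- C1 / norm x)) differentiable (at x)" by (rule rd(1))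
    show "ld id (\<lambda>x. exp (- C1 / norm x)) x = C1 / norm x * exp (- C1 / norm x)" unfolding rd(2) using x0 by (simp add: power2_eq_square)
  qed
  have sV2: "smooth_on (\<lambda>y. V y * V y) U" by (intro smooth_mult openU sV)
  have dH: "H differentiable (at x)" if "norm x \<ge> r1" for x
    unfolding H_def by (intro differentiable_mult dexp that diffble_U[OF sV inU[OF that]])
  have EH: "ld id H x \<ge> 0" if x: "norm x \<ge> norm y" and m: "\<And>z. norm z = norm x \<Longrightarrow> H z \<le> H x" for x
  proof -
    have xr: "norm x \<ge> r1" using x y by simp
    note xU = inU[OF xr]
    have "V z * V z \<le> V x * V x" if "norm z = norm x" for z using m[OF that] by (simp add: H_def that)
    note sm = spatial_max[OF xU sV2 this]
    have dV: "V differentiable (at x)" by (rule diffble_U[OF sV xU])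
    have "V x * lapS V x \<le> 0"
    proof -
      have "lapS (\<lambda>y. V y * V y) x = 2 * (V x * lapS V x) + (\<Sum>p\<in>UNIV. Lp p V x * Lp p V x)"
        unfolding lapS_mult[OF openU sV sV xU] by simp
      moreover have "(\<Sum>p\<in>UNIV. Lp p V x * Lp p V x) \<ge> 0" by (intro sum_nonneg) simp
      ultimately show ?thesis using sm(1) by linarith
    qed
    then have "(n - 1) * (V x * ((n - 2) / 2 * (1 - om x) * V x - om x * EV x)) \<le> 0" unfolding om_EV[OF xr] by (simp add: algebra_simps)
    then have "V x * ((n - 2) / 2 * (1 - om x) * V x - om x * EV x) \<le> 0" using n3 by (simp add: mult_le_0_iff)
    then have "om x * (V x * EV x) \<ge> (n - 2) / 2 * (1 - om x) * (V x * V x)" by (simp add: algebra_simps)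
    moreover have "(n - 2) / 2 * (1 - om x) * (V x * V x) \<ge> - ((n - 2) / 2 * (C / norm x) * (V x * V x))"
    proof -
      have "- (C / norm x) \<le> 1 - om x" using oma[OF xr] by linarith
      then have "(n - 2) / 2 * - (C / norm x) * (V x * V x) \<le> (n - 2) / 2 * (1 - om x) * (V x * V x)"
        using n3 by (intro mult_right_mono mult_left_mono) auto
      then show ?thesis by simp
    qed
    ultimately have oe: "om x * (V x * EV x) \<ge> - ((n - 2) / 2 * (C / norm x) * (V x * V x))" by linarith
    define W where "W = (n - 2) * (C / norm x) * (V x * V x)"
    have W0: "W \<ge> 0" using n3 C by (simp add: W_def)
    have oe': "om x * (V x * EV x) \<ge> - (W / 2)" using oe by (simp add: W_def)
    have "V x * EV x \<ge> - W"
    proof (cases "V x * EV x \<ge> 0")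
      case True then show ?thesis using W0 by linarith
    next
      case False
      have "om x * (V x * EV x) \<le> 1/2 * (V x * EV x)" using om_half[OF xr] False by (intro mult_right_mono_neg) auto
      then show ?thesis using oe' by simp
    qed
    moreover have "C1 / norm x * (V x * V x) = 2 * W" by (simp add: W_def C1_def)
    ultimately have "2 * (V x * EV x) + C1 / norm x * (V x * V x) \<ge> 0" by linarith
    moreover have "ld id H x = exp (- C1 / norm x) * (2 * (V x * EV x) + C1 / norm x * (V x * V x))"
    proof -
      have "ld id (\<lambda>y. V y * V y) x = 2 * (V x * EV x)" unfolding ld_simps(3)[OF dV dV] by simp
      then show ?thesis unfolding H_def ld_simps(3)[OF diffble_U[OF sV2 xU] dexp(1)[OF xr]] dexp(2)[OF xr] by (simp add: algebra_simps)
    qed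
    ultimately show ?thesis by simp
  qed
  define m where "m = sqrt (H y) / 2"
  have Hy: "H y > 0" unfolding H_def using y by (intro mult_pos_pos[OF _ exp_gt_zero]) (simp add: zero_less_mult_iff, linarith)
  then have m: "m > 0" by (simp add: m_def)
  have big: "\<exists>z. norm z = r \<and> \<bar>V z\<bar> \<ge> 2 * m" if r: "r > norm y" for r
  proof -
    have "0 \<le> r" using r norm_ge_zero[of y] by linarith
    then obtain x0 :: "real^'n" where x0: "norm x0 = r" using vector_choose_size by blast
    have cH: "continuous_on U H" unfolding H_def using U0 by (intro continuous_intros smooth_continuous[OF sV]) auto
    have x0r: "norm x0 > r0" using x0 r y r1 by linarith
    obtain z where z: "norm z = norm x0" "\<And>x. norm x = norm x0 \<Longrightarrow> H x \<le> H z"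
      using sphere_argmax[OF cH x0r] by blast
    have y0: "norm y > 0" using y r1 by linarith
    have "H y \<le> H z"
    proof (rule radial_max_increasing[OF y0 r])
      show "H differentiable (at x)" if "norm x \<ge> norm y" for x by (rule dH) (use that y in simp)
      show "ld id H x \<ge> 0" if "norm x \<ge> norm y" "\<And>z. norm z = norm x \<Longrightarrow> H z \<le> H x" for x by (rule EH[OF that])
    qed (use z x0 in auto)
    also have "\<dots> \<le> V z * V z" unfolding H_def using C1 by (intro mult_left_le) auto
    finally have "sqrt (H y) \<le> sqrt (V z * V z)" by (rule real_sqrt_le_mono)
    then have "2 * m \<le> \<bar>V z\<bar>" by (simp add: m_def)
    then show ?thesis using z(1) x0 by blast
  qed
  \<comment> \<open>From this radius on the oscillation of V on spheres is at most \<open>m\<close>,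
    half of the lower bound for the maximum of |V|.\<close>
  define R where "R = max (norm y + 1) ((pi * D2 / m)\<^sup>2 + 1)"
  have R: "R > norm y" "R \<ge> r1" "R \<ge> 1" "R \<ge> (pi * D2 / m)\<^sup>2" using y r1 by (auto simp: R_def)
  have "\<bar>V x\<bar> \<ge> m" if x: "norm x \<ge> R" for x
  proof -
    have xr: "norm x \<ge> r1" "norm x > 0" using x R by auto
    obtain z where z: "norm z = norm x" "\<bar>V z\<bar> \<ge> 2 * m" using big[of "norm x"] x R by auto
    have "\<bar>V z - V x\<bar> \<le> pi * (D2 * norm x powr (-1/2))"
      by (rule V_osc[OF D2(2) xr(1) z(1)])
    also have "\<dots> \<le> m"
    proof -
      have "(pi * D2 / m)\<^sup>2 \<le> norm x" using x R by simp
      then have "sqrt ((pi * D2 / m)\<^sup>2) \<le> sqrt (norm x)" by (rule real_sqrt_le_mono)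
      then have "pi * D2 / m \<le> norm x powr (1/2)" using D2 m xr by (simp add: powr_half_sqrt)
      then have "pi * D2 \<le> m * norm x powr (1/2)" using m by (simp add: divide_le_eq mult.commute)
      then have "pi * D2 * norm x powr (-1/2) \<le> m * norm x powr (1/2) * norm x powr (-1/2)" by (rule mult_right_mono) simp
      moreover have "norm x powr (1/2) * norm x powr (-1/2) = 1"
      proof -
        have "norm x powr (1/2) * norm x powr (-1/2) = norm x powr (1/2 + -1/2)" by (rule powr_add[symmetric])
        then show ?thesis using xr by simp
      qed
      ultimately show ?thesis by (simp add: mult.assoc)
    qed
    finally show ?thesis using z(2) by linarith
  qed
  then show ?thesis using that m R by blast
qed

text \<open>On the sphere through \<open>p\<close> the quotient Su / u is at most |d log u|, with
  equality at \<open>p\<close>. So it is maximal at \<open>p\<close> along the orbit of the rotation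
  and its \<open>S\<close>-derivative vanishes there; this is the relation between \<open>l\<close>
  and \<open>c\<close> assumed in \<open>eps\<close>.\<close>

lemma slice_contradiction:
  assumes p: "p \<in> U" and w0: "w0 > 0"
    and eps: "\<forall>Y Z w c l. Z \<noteq> 0 \<longrightarrow> \<bar>Z\<bar> < \<epsilon> \<longrightarrow> \<bar>w - w0\<bar> < \<epsilon> \<longrightarrow> \<bar>Y\<bar> \<le> (if w0 = 1 then 1 else \<epsilon>) * \<bar>Z\<bar> \<longrightarrow>
      (n - 1) * l = 2 * Z\<^sup>2 + 2 * c * Z \<longrightarrow> pPhi (n - 1) (Y + Z) (Z - Y) w c l = 0 \<longrightarrow> pF2 (n - 1) (Y + Z) (Z - Y) w c l = 0 \<longrightarrow>
      pF3 (n - 1) (Y + Z) (Z - Y) w c l \<noteq> 0"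
    and ab: "orth2 a b" "p = norm p *\<^sub>R a" "\<And>e. e \<bullet> a = 0 \<Longrightarrow> e \<bullet> b = 0 \<Longrightarrow> dd e u p = 0"
    and Su: "ld (rot a b) u p = sqrt (Qd u p)" and Q: "Qd u p > 0"
    and qm: "\<And>y. norm y = norm p \<Longrightarrow> Qd u y / (u y)\<^sup>2 \<le> Qd u p / (u p)\<^sup>2"
    and small: "sqrt (Qd u p) / u p < \<epsilon>" "\<bar>om p - w0\<bar> < \<epsilon>"
    and nz: "V p \<noteq> 0" "QQ p \<noteq> 0"
    and Y: "\<bar>ld (rot a b) V p\<bar> < \<bar>V p\<bar> * (sqrt (Qd u p) / u p)"
      "\<bar>ld (rot a b) V p\<bar> \<le> \<bar>V p\<bar> * ((if w0 = 1 then 1 else \<epsilon>) * (sqrt (Qd u p) / u p))"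
  shows False
proof -
  define Z where "Z = ld (rot a b) u p / u p"
  define y where "y = ld (rot a b) V p / V p"
  have up: "u p > 0" by (rule u0[OF p])
  have Z: "Z = sqrt (Qd u p) / u p" "Z > 0" using Su Q up by (simp_all add: Z_def)
  have yV: "\<bar>y\<bar> * \<bar>V p\<bar> = \<bar>ld (rot a b) V p\<bar>" using nz by (simp add: y_def abs_divide)
  have y1: "\<bar>y\<bar> < Z" using Y(1) nz unfolding yV[symmetric] Z(1)[symmetric] by (simp add: mult.commute)
  have y2: "\<bar>y\<bar> \<le> (if w0 = 1 then 1 else \<epsilon>) * \<bar>Z\<bar>" using Y(2) nz Z(2) unfolding yV[symmetric] Z(1)[symmetric] by (simp add: mult.commute split: if_splits)
  have nc: "norm (cv a b p t) = norm p" for t by (rule norm_cv[OF ab(1)])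
  have cU: "cv a b p t \<in> U" for t using p nc by (simp add: mem_U_iff)
  have sZ: "smooth_on (\<lambda>x. ld (rot a b) u x / u x) U" by (rule smooth_divide[OF openU u_nonzero smooth_ld[OF openU linear_rot su] su])
  have D: "((\<lambda>t. ld (rot a b) u (cv a b p t) / u (cv a b p t)) has_real_derivative ld (rot a b) (\<lambda>x. ld (rot a b) u x / u x) (cv a b p 0)) (at 0)"
    by (rule cv_DERIV[OF ab(1) diffble_U[OF sZ cU]])
  have "ld (rot a b) u (cv a b p t) / u (cv a b p t) \<le> ld (rot a b) u (cv a b p 0) / u (cv a b p 0)" for t
  proof -
    let ?c = "cv a b p t"
    have "(ld (rot a b) u ?c / u ?c)\<^sup>2 \<le> Qd u ?c / (u ?c)\<^sup>2"
      unfolding power_divide by (intro divide_right_mono Qd_rot[OF diffble_U[OF su cU] ab(1) U0[OF cU]]) simp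
    also have "\<dots> \<le> Qd u p / (u p)\<^sup>2" by (rule qm[OF nc])
    also have "\<dots> = Z\<^sup>2" using Q by (simp add: Z(1) power_divide)
    finally have "ld (rot a b) u ?c / u ?c \<le> Z" using Z(2) power2_le_imp_le by fastforce
    then show ?thesis by (simp add: Z_def)
  qed
  then have SZ: "ld (rot a b) (\<lambda>x. ld (rot a b) u x / u x) p = 0"
    using DERIV_local_max[OF D, of 1] by simp
  obtain c l where cl: "pPhi (n - 1) (y + Z) (Z - y) (om p) c l = 0" "pF2 (n - 1) (y + Z) (Z - y) (om p) c l = 0"
    "pF3 (n - 1) (y + Z) (Z - y) (om p) c l = 0"
    "(n - 1) * l = 2 * ld (rot a b) (\<lambda>x. ld (rot a b) u x / u x) p + 2 * Z\<^sup>2 + 2 * c * Z"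
  proof (rule slice_identities[OF n3 p, of a b Z y])
    show "a \<bullet> a = 1" "b \<bullet> b = 1" "a \<bullet> b = 0" using ab(1) by (auto simp: orth2_def)
    show "y + Z \<noteq> 0" "Z \<noteq> 0" using y1 Z(2) by auto
  qed (use ab nz Z_def y_def in auto)
  have Zn: "Z \<noteq> 0" and Ze: "\<bar>Z\<bar> < \<epsilon>" using Z(2) small(1) unfolding Z(1)[symmetric] by auto
  have l: "(n - 1) * l = 2 * Z\<^sup>2 + 2 * c * Z" using cl(4) unfolding SZ by simp
  show False using eps[rule_format, OF Zn Ze small(2) y2 l cl(1,2)] cl(3) by simp
qed

text \<open>The bound |Y| < Z comes from integrating \<open>SV_ray\<close> inward from infinity,
  where the quotient of SV by the radius tends to 0. At a maximum of a weighted |d log u| the weight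
  controls Su / u on the whole outward ray by its value at \<open>p\<close>.\<close>

lemma radial_near_infinity: obtains R where "R > r0" "\<And>x. norm x \<ge> R \<Longrightarrow> Qd u x = 0"
proof -
  obtain \<epsilon> where \<epsilon>: "\<epsilon> > 0" and eps: "\<forall>Y Z w c l. Z \<noteq> 0 \<longrightarrow> \<bar>Z\<bar> < \<epsilon> \<longrightarrow> \<bar>w - 1\<bar> < \<epsilon> \<longrightarrow> \<bar>Y\<bar> \<le> (if (1::real) = 1 then 1 else \<epsilon>) * \<bar>Z\<bar> \<longrightarrow>
      (n - 1) * l = 2 * Z\<^sup>2 + 2 * c * Z \<longrightarrow> pPhi (n - 1) (Y + Z) (Z - Y) w c l = 0 \<longrightarrow> pF2 (n - 1) (Y + Z) (Z - Y) w c l = 0 \<longrightarrow>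
      pF3 (n - 1) (Y + Z) (Z - Y) w c l \<noteq> 0" using no_small_solution[of "n - 1" 1] n3 by auto
  obtain D where D: "D > 0" "\<And>x. norm x \<ge> r1 \<Longrightarrow> \<bar>EV x\<bar> \<le> D * norm x powr (-1/2)" using EV_decay by blast
  obtain D2 where D2: "D2 > 0" "\<And>x a b. norm x \<ge> r1 \<Longrightarrow> orth2 a b \<Longrightarrow> \<bar>ld (rot a b) V x\<bar> \<le> D2 * norm x powr (-1/2)" using SV_decay by blast
  obtain m R0 where m: "m > 0" "R0 \<ge> r1" "\<And>x. norm x \<ge> R0 \<Longrightarrow> \<bar>V x\<bar> \<ge> m" using V_lower by blast
  \<comment> \<open>An upper bound for r^(-1/2): the first entry makes \<open>EV\<close> small
    compared with V, the second makes \<open>Z\<close> and \<open>1 - om\<close> smaller than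
    \<open>\<epsilon>\<close>.\<close>
  define k where "k = min (m / (8 * n * D)) (min (\<epsilon> / (4 * C)) 1)"
  have k: "k > 0" "8 * n * D * k \<le> m" "4 * C * k \<le> \<epsilon>" "k \<le> 1"
  proof -
    show "k > 0" using m \<epsilon> C D n3 by (simp add: k_def)
    have "k \<le> m / (8 * n * D)" "k \<le> \<epsilon> / (4 * C)" by (auto simp: k_def)
    then show "8 * n * D * k \<le> m" "4 * C * k \<le> \<epsilon>" using D C n3 by (simp_all add: le_divide_eq mult.commute)
  qed (simp add: k_def)
  define R where "R = max R0 (1 / k\<^sup>2)"
  have Rk: "norm x powr (-1/2) \<le> k" if "norm x \<ge> R" for x :: "real^'n"
  proof -
    have x: "norm x \<ge> 1 / k\<^sup>2" "norm x > 0" using that m r1 by (auto simp: R_def)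
    have "sqrt (1 / k\<^sup>2) \<le> sqrt (norm x)" using x(1) by (rule real_sqrt_le_mono)
    then have "1 / k \<le> norm x powr (1/2)" using k x by (simp add: powr_half_sqrt real_sqrt_divide)
    then have "1 / norm x powr (1/2) \<le> k" using k x by (simp add: field_simps)
    then show ?thesis by (simp add: powr_minus_divide)
  qed
  have R: "R \<ge> R0" "R \<ge> r1" "R > r0" using m r1 by (auto simp: R_def)
  have "Qd u x0 = 0" if x0: "norm x0 \<ge> R" for x0
  proof (rule ccontr)
    assume "Qd u x0 \<noteq> 0"
    then have Q0: "Qd u x0 > 0" using Qd_nonneg[of u x0] by simp
    \<comment> \<open>By \<open>Qa\<close> the weighted function \<open>f\<close> is O(r^(-1/4)), so
      its maximum is attained. On the other hand the integral of the ray equation has denominator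
      \<open>i + 1 = n - 5/4\<close>, which exceeds the factor \<open>n - 3/2\<close> of
      \<open>QQs\<close>; so |Y| / Z stays below 1.\<close>
    define i where "i = n - 9/4"
    have i: "i > 0" using n3 by (simp add: i_def)
    define f where "f x = norm x powr (2 * i) * (Qd u x / (u x)\<^sup>2)" for x
    have x0': "x0 \<in> U" "norm x0 > 0" using x0 R inU U0 by auto
    have f0: "f x0 > 0" using Q0 x0' u0[OF x0'(1)] by (simp add: f_def)
    have fb: "f x \<le> 4 * C\<^sup>2 * norm x powr (-1/4)" if x: "norm x \<ge> r1" for x
    proof -
      have "Qd u x / (u x)\<^sup>2 \<le> C\<^sup>2 * norm x powr (1/4 - 2 * (n - 2)) / (1/4)"
        using Qa[OF x] u_half(1)[OF x] Qd_nonneg[of u x] power_mono[of "1/2" "u x" 2] by (intro frac_le) (auto simp: power2_eq_square)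
      then have "f x \<le> norm x powr (2 * i) * (C\<^sup>2 * norm x powr (1/4 - 2 * (n - 2)) / (1/4))" unfolding f_def by (rule mult_left_mono) simp
      also have "\<dots> = 4 * C\<^sup>2 * (norm x powr (2 * i) * norm x powr (1/4 - 2 * (n - 2)))" by simp
      also have "norm x powr (2 * i) * norm x powr (1/4 - 2 * (n - 2)) = norm x powr (-1/4)"
        unfolding powr_add[symmetric] by (simp add: i_def)
      finally show ?thesis .
    qed
    define t where "t = f x0 / (4 * C\<^sup>2)"
    have t: "t > 0" using f0 C by (simp add: t_def)
    define R2 where "R2 = max (norm x0) (1 / t ^ 4)"
    have far: "f x \<le> f x0" if x: "norm x \<ge> R2" for x
    proof -
      have xx: "norm x \<ge> r1" "norm x > 0" "norm x \<ge> 1 / t ^ 4" using x x0 x0' R by (auto simp: R2_def)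
      have "norm x powr (-1/4) \<le> (1 / t ^ 4) powr (-1/4)" by (rule powr_mono2') (use xx t in auto)
      also have "(1 / t ^ 4) powr (-1/4) = t"
      proof -
        have "1 / t ^ 4 = t powr (-4)" using t by (simp add: powr_minus_divide)
        then show ?thesis using t by (simp add: powr_powr)
      qed
      finally have "4 * C\<^sup>2 * norm x powr (-1/4) \<le> 4 * C\<^sup>2 * t" using C by (intro mult_left_mono) auto
      also have "\<dots> = f x0" using C by (simp add: t_def)
      finally show ?thesis using fb[OF xx(1)] by linarith
    qed
    let ?A = "{x::real^'n. R \<le> norm x \<and> norm x \<le> R2}"
    have AU: "?A \<subseteq> U" using R by (auto simp: mem_U_iff)
    have "continuous_on U f" unfolding f_def using U0 u_nonzero
      by (intro continuous_intros smooth_continuous[OF smooth_Qd[OF openU su]] smooth_continuous[OF su]) auto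
    then have "continuous_on ?A f" by (rule continuous_on_subset[OF _ AU])
    moreover have xA: "x0 \<in> ?A" using x0 by (simp add: R2_def)
    ultimately obtain p where p: "p \<in> ?A" "\<And>x. x \<in> ?A \<Longrightarrow> f x \<le> f p"
      using continuous_attains_sup[OF compact_annulus[of R R2], of f] by blast
    have pm: "f x \<le> f p" if "norm x \<ge> R" for x
      using p(2)[of x] far[of x] p(2)[OF xA] that by (cases "norm x \<le> R2") auto
    have pR: "norm p \<ge> R" "norm p \<ge> r1" "norm p \<ge> R0" using p(1) R by auto
    have pU: "p \<in> U" "p \<noteq> 0" "norm p > 0" using inU[OF pR(2)] U0 by auto
    have up: "u p > 0" by (rule u0[OF pU(1)])
    have "f p > 0" using f0 pm[OF x0] by linarith
    then have Qp: "Qd u p > 0" using Qd_nonneg[of u p] by (cases "Qd u p = 0") (auto simp: f_def)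
    obtain a b where ab: "orth2 a b" "p = norm p *\<^sub>R a" "\<And>e. e \<bullet> a = 0 \<Longrightarrow> e \<bullet> b = 0 \<Longrightarrow> dd e u p = 0" "ld (rot a b) u p = sqrt (Qd u p)"
      using Qd_frame[OF diffble_U[OF su pU(1)] Qp pU(2)] by blast
    define h where "h = norm p powr (-1/2)"
    have h: "h \<le> k" "h > 0" "1 / norm p \<le> h" using Rk[OF pR(1)] half[OF pR(2)] by (auto simp: h_def)
    define Z where "Z = sqrt (Qd u p) / u p"
    have Z0: "Z > 0" using Qp up by (simp add: Z_def)
    have Zs: "Z \<le> 2 * C * h"
    proof -
      have "Z \<le> C * h / (1/2)" unfolding Z_def ab(4)[symmetric]
        using Su_bound[OF pR(2) ab(1)] u_half(1)[OF pR(2)] C h by (intro frac_le) (auto simp: h_def)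
      then show ?thesis by simp
    qed
    have Ch: "C * h \<le> C * k" using h C by (intro mult_left_mono) auto
    have Vp: "\<bar>V p\<bar> \<ge> m" "\<bar>V p\<bar> > 0" using m(1) m(3)[OF pR(3)] by auto
    have nDh: "8 * n * D * h \<le> \<bar>V p\<bar>"
    proof -
      have "8 * n * D * h \<le> 8 * n * D * k" using h D n3 by (intro mult_left_mono) auto
      then show ?thesis using k Vp by linarith
    qed
    have Dh: "8 * (D * h) \<le> 8 * n * D * h" "0 < D * h" using D h n3 by (auto simp: mult_ac)
    have QQs: "\<bar>QQ (s *\<^sub>R p)\<bar> \<le> (n - 3/2) * \<bar>V p\<bar>" if s: "s \<ge> 1" for s
    proof -
      note rs = ray[OF pR(2) s]
      have "s powr (-1/2) \<le> s powr 0" using s by (intro powr_mono) auto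
      then have "norm (s *\<^sub>R p) powr (-1/2) \<le> h" unfolding rs(3) h_def using s h by (simp add: mult_left_le_one_le h_def)
      then have "D * norm (s *\<^sub>R p) powr (-1/2) \<le> D * h" using D by (intro mult_left_mono) auto
      then have e: "\<bar>EV (s *\<^sub>R p)\<bar> \<le> D * h" using D(2)[OF rs(1)] by linarith
      have v: "\<bar>V (s *\<^sub>R p)\<bar> \<le> \<bar>V p\<bar> + 2 * (D * h)" using V_ray[OF D pR(2) s] by (simp add: h_def)
      have "\<bar>QQ (s *\<^sub>R p)\<bar> \<le> \<bar>EV (s *\<^sub>R p)\<bar> + (n - 2) * \<bar>V (s *\<^sub>R p)\<bar>"
        using n3 abs_triangle_ineq[of "EV (s *\<^sub>R p)" "(n - 2) * V (s *\<^sub>R p)"] by (simp add: QQ_def abs_mult)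
      also have "\<dots> \<le> D * h + (n - 2) * (\<bar>V p\<bar> + 2 * (D * h))" using e v n3 by (intro add_mono mult_left_mono) auto
      also have "\<dots> = (n - 2) * \<bar>V p\<bar> + (2 * (n * D * h) - 3 * (D * h))" by (simp add: algebra_simps)
      also have "\<dots> \<le> (n - 2) * \<bar>V p\<bar> + 1/2 * \<bar>V p\<bar>" using nDh Dh by linarith
      finally show ?thesis by (simp add: algebra_simps)
    qed
    have Zs': "\<bar>ld (rot a b) u (s *\<^sub>R p) / u (s *\<^sub>R p)\<bar> \<le> s powr (- i) * Z" if s: "s \<ge> 1" for s
    proof -
      note rs = ray[OF pR(2) s]
      let ?y = "s *\<^sub>R p"
      have s0: "s > 0" using s by simp
      have "1 * norm p \<le> s * norm p" using s by (intro mult_right_mono) auto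
      then have "f ?y \<le> f p" using pR s by (intro pm) auto
      then have "s powr (2 * i) * norm p powr (2 * i) * (Qd u ?y / (u ?y)\<^sup>2) \<le> norm p powr (2 * i) * Z\<^sup>2"
        unfolding f_def rs(3) using Qp by (simp add: Z_def power_divide)
      then have "norm p powr (2 * i) * (s powr (2 * i) * (Qd u ?y / (u ?y)\<^sup>2)) \<le> norm p powr (2 * i) * Z\<^sup>2" by (simp only: mult_ac)
      then have 1: "s powr (2 * i) * (Qd u ?y / (u ?y)\<^sup>2) \<le> Z\<^sup>2" by (rule mult_left_le_imp_le) (use pU in simp)
      have "(s powr i * (ld (rot a b) u ?y / u ?y))\<^sup>2 = s powr (2 * i) * ((ld (rot a b) u ?y)\<^sup>2 / (u ?y)\<^sup>2)"
        by (simp add: power_mult_distrib power_divide power2_eq_square powr_add[symmetric])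
      also have "\<dots> \<le> s powr (2 * i) * (Qd u ?y / (u ?y)\<^sup>2)"
        by (intro mult_left_mono divide_right_mono Qd_rot[OF diffble_U[OF su rs(2)] ab(1) U0[OF rs(2)]]) auto
      also have "\<dots> \<le> Z\<^sup>2" by (rule 1)
      finally have "\<bar>s powr i * (ld (rot a b) u ?y / u ?y)\<bar> \<le> \<bar>Z\<bar>" by (simp only: abs_le_square_iff)
      then have "s powr i * \<bar>ld (rot a b) u ?y / u ?y\<bar> \<le> Z" using Z0 by (simp add: abs_mult)
      then have "s powr (- i) * (s powr i * \<bar>ld (rot a b) u ?y / u ?y\<bar>) \<le> s powr (- i) * Z" by (rule mult_left_mono) simp
      moreover have "s powr (- i) * s powr i = 1" using s0 by (simp add: powr_add[symmetric])
      ultimately show ?thesis by (simp add: mult.assoc[symmetric])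
    qed
    define A where "A = Z * ((n - 3/2) * \<bar>V p\<bar>)"
    have A0: "A \<ge> 0" using Z0 n3 by (simp add: A_def)
    have var: "\<bar>ld (rot a b) V (s *\<^sub>R p) / s - ld (rot a b) V (1 *\<^sub>R p) / 1\<bar> \<le> A / (i + 1) * 1 powr (- (i + 1))" if s: "s \<ge> 1" for s
    proof (rule decay_integral[OF _ s])
      fix z :: real assume z: "1 \<le> z" "z \<le> s"
      note rz = ray[OF pR(2) z(1)]
      show "((\<lambda>s. ld (rot a b) V (s *\<^sub>R p) / s) has_real_derivative (ld (rot a b) u (z *\<^sub>R p) / u (z *\<^sub>R p)) * QQ (z *\<^sub>R p) / z\<^sup>2) (at z)"
        by (rule SV_ray) (use z rz in auto)
      have "\<bar>ld (rot a b) u (z *\<^sub>R p) / u (z *\<^sub>R p)\<bar> * \<bar>QQ (z *\<^sub>R p)\<bar> \<le> (z powr (- i) * Z) * ((n - 3/2) * \<bar>V p\<bar>)"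
        using QQs[OF z(1)] Zs'[OF z(1)] Z0 by (intro mult_mono) auto
      also have "\<dots> = A * z powr (- i)" by (simp add: A_def)
      finally have "\<bar>(ld (rot a b) u (z *\<^sub>R p) / u (z *\<^sub>R p)) * QQ (z *\<^sub>R p)\<bar> / z\<^sup>2 \<le> A * z powr (- i) / z\<^sup>2"
        unfolding abs_mult by (rule divide_right_mono) simp
      also have "\<dots> = A * z powr (- (i + 1) - 1)"
      proof -
        have "z powr (- (i + 1) - 1) = z powr (- i - 2)" by (rule arg_cong[where f="\<lambda>e. z powr e"]) simp
        also have "\<dots> = z powr (- i) / z\<^sup>2" unfolding powr_diff using z by simp
        finally show ?thesis by simp
      qed
      finally show "\<bar>(ld (rot a b) u (z *\<^sub>R p) / u (z *\<^sub>R p)) * QQ (z *\<^sub>R p) / z\<^sup>2\<bar> \<le> A * z powr (- (i + 1) - 1)"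
        unfolding abs_divide[of _ "z\<^sup>2"] by simp
    qed (use i in simp_all)
    \<comment> \<open>Let \<open>s\<close> tend to infinity in \<open>var\<close>: SV is bounded, so
      its quotient by \<open>s\<close> disappears.\<close>
    have SVp: "\<bar>ld (rot a b) V p\<bar> \<le> A / (i + 1)"
    proof (rule field_le_epsilon)
      fix e :: real assume e: "e > 0"
      define s where "s = max 1 (D2 / e)"
      have s: "s \<ge> 1" "D2 / e \<le> s" by (simp_all add: s_def)
      have v: "\<bar>ld (rot a b) V (s *\<^sub>R p) / s - ld (rot a b) V p\<bar> \<le> A / (i + 1)" using var[OF s(1)] by simp
      note rs = ray[OF pR(2) s(1)]
      have "\<bar>ld (rot a b) V (s *\<^sub>R p)\<bar> \<le> D2 * norm (s *\<^sub>R p) powr (-1/2)" by (rule D2(2)[OF rs(1) ab(1)])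
      also have "\<dots> \<le> D2 * 1" using half(2)[OF rs(1)] D2 by (intro mult_left_mono) auto
      finally have "\<bar>ld (rot a b) V (s *\<^sub>R p) / s\<bar> \<le> D2 / s" using s by (simp add: abs_divide divide_right_mono)
      also have "\<dots> \<le> e" using s e by (simp add: field_simps)
      finally show "\<bar>ld (rot a b) V p\<bar> \<le> A / (i + 1) + e" using v by linarith
    qed
    have "(n - 3/2) / (n - 5/4) < 1" using n3 by simp
    then have "(\<bar>V p\<bar> * Z) * ((n - 3/2) / (n - 5/4)) < (\<bar>V p\<bar> * Z) * 1" using Vp Z0 by (intro mult_strict_left_mono) auto
    moreover have "A / (i + 1) = (\<bar>V p\<bar> * Z) * ((n - 3/2) / (n - 5/4))" by (simp add: A_def i_def)
    ultimately have Yb: "\<bar>ld (rot a b) V p\<bar> < \<bar>V p\<bar> * Z" using SVp by linarith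
    show False
    proof (rule slice_contradiction[OF pU(1) _ eps ab(1,2,3) ab(4) Qp])
      show "Qd u y / (u y)\<^sup>2 \<le> Qd u p / (u p)\<^sup>2" if y: "norm y = norm p" for y
      proof -
        have "norm p powr (2 * i) * (Qd u y / (u y)\<^sup>2) \<le> norm p powr (2 * i) * (Qd u p / (u p)\<^sup>2)" using pm[of y] y pR by (simp only: f_def)
        then show ?thesis by (rule mult_left_le_imp_le) (use pU in simp)
      qed
      show "sqrt (Qd u p) / u p < \<epsilon>" using Zs Ch k C \<epsilon> unfolding Z_def[symmetric] by linarith
      have "\<bar>1 - om p\<bar> \<le> C * (1 / norm p)" using oma[OF pR(2)] by simp
      also have "\<dots> \<le> C * h" using h C by (intro mult_left_mono) auto
      finally show "\<bar>om p - 1\<bar> < \<epsilon>" using Ch k C \<epsilon> by linarith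
      show "V p \<noteq> 0" using Vp by auto
      show "QQ p \<noteq> 0"
      proof
        assume "QQ p = 0"
        then have "(n - 2) * V p = - EV p" by (simp add: QQ_def)
        then have "\<bar>(n - 2) * V p\<bar> = \<bar>EV p\<bar>" by simp
        then have "(n - 2) * \<bar>V p\<bar> = \<bar>EV p\<bar>" unfolding abs_mult using n3 by simp
        moreover have "1 * \<bar>V p\<bar> \<le> (n - 2) * \<bar>V p\<bar>" using n3 by (intro mult_right_mono) auto
        moreover have "\<bar>EV p\<bar> \<le> D * h" using D(2)[OF pR(2)] by (simp add: h_def)
        ultimately show False using nDh Dh Vp by linarith
      qed
      show "\<bar>ld (rot a b) V p\<bar> < \<bar>V p\<bar> * (sqrt (Qd u p) / u p)" using Yb by (simp add: Z_def)
      then show "\<bar>ld (rot a b) V p\<bar> \<le> \<bar>V p\<bar> * ((if (1::real) = 1 then 1 else \<epsilon>) * (sqrt (Qd u p) / u p))" by simp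
    qed simp
  qed
  then show ?thesis using that R by blast
qed

end

section \<open>Symmetry everywhere and the Schwarzschild form\<close>

context ext begin

lemma spherical_const:
  assumes x: "x \<in> U" and f: "smooth_on f U" and z: "\<And>a b z. orth2 a b \<Longrightarrow> norm z = norm x \<Longrightarrow> ld (rot a b) f z = 0"
  shows "norm y = norm x \<Longrightarrow> f y = f x" "lapS f x = 0"
proof -
  have c: "f y = f x" if "norm y = norm x" for y
  proof -
    have "\<bar>f y - f x\<bar> \<le> pi * 0"
    proof (rule sphere_osc[OF _ that U0[OF x]])
      show "CARD('n) \<ge> 2" using card3 by simp
      show "f differentiable (at w)" if "norm w = norm x" for w by (rule diffble_U[OF f]) (use that x in \<open>simp add: mem_U_iff\<close>)
      show "\<bar>ld (rot a b) f w\<bar> \<le> 0" if "orth2 a b" "norm w = norm x" for a b w using z[OF that] by simp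
    qed
    then show ?thesis by simp
  qed
  then show "norm y = norm x \<Longrightarrow> f y = f x" by blast
  have "lapS f x \<le> 0" by (rule spatial_max[OF x f]) (rule eq_refl[OF c])
  moreover have "lapS f x \<ge> 0" by (rule spatial_min[OF x f]) (rule eq_refl[OF c[symmetric]])
  ultimately show "lapS f x = 0" by simp
qed

lemma ray_const:
  assumes "x \<in> U" "s \<ge> 1" "\<And>y. norm y \<ge> norm x \<Longrightarrow> norm y \<le> s * norm x \<Longrightarrow> f differentiable (at y)"
    "\<And>y. norm y \<ge> norm x \<Longrightarrow> norm y \<le> s * norm x \<Longrightarrow> ld id f y = 0"
  shows "f (s *\<^sub>R x) = f x"
proof -
  have "\<bar>f (s *\<^sub>R x) - f (1 *\<^sub>R x)\<bar> \<le> 0 / 1 * 1 powr (- 1)"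
  proof (rule decay_integral[OF _ assms(2)])
    fix z :: real assume z: "1 \<le> z" "z \<le> s"
    have n: "norm x \<le> norm (z *\<^sub>R x)" "norm (z *\<^sub>R x) \<le> s * norm x"
      using z mult_right_mono[of 1 z "norm x"] mult_right_mono[of z s "norm x"] by auto
    show "((\<lambda>z. f (z *\<^sub>R x)) has_real_derivative ld id f (z *\<^sub>R x) / z) (at z)"
      by (rule DERIV_radial[OF assms(3)[OF n]]) (use z in auto)
    show "\<bar>ld id f (z *\<^sub>R x) / z\<bar> \<le> 0 * z powr (- 1 - 1)" using assms(4)[OF n] by simp
  qed simp_all
  then show ?thesis by simp
qed

text \<open>The points of a closed annulus that violate the inequality form a compact set; the
  largest norm in it is less than \<open>r\<close>.\<close>

lemma near_sphere:
  assumes "continuous_on U f" "r > r0" "\<And>x. norm x = r \<Longrightarrow> f x < (c::real)"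
  obtains r' where "r0 < r'" "r' < r" "\<And>x. r' \<le> norm x \<Longrightarrow> norm x \<le> r \<Longrightarrow> f x < c"
proof -
  define q where "q = (r0 + r) / 2"
  have q: "r0 < q" "q < r" using assms(2) by (auto simp: q_def)
  define A where "A = {x::real^'n. q \<le> norm x \<and> norm x \<le> r}"
  have cA: "compact A" unfolding A_def by (rule compact_annulus)
  have fA: "continuous_on A f" by (rule continuous_on_subset[OF assms(1)]) (use q in \<open>auto simp: A_def mem_U_iff\<close>)
  define K where "K = A \<inter> f -` {c..}"
  have "closed K" unfolding K_def
    by (rule continuous_closed_preimage[OF fA compact_imp_closed[OF cA] closed_atLeast])
  then have "compact (A \<inter> K)" using cA by (intro compact_Int_closed)
  moreover have "A \<inter> K = K" by (auto simp: K_def)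
  ultimately have cK: "compact K" by simp
  show ?thesis
  proof (cases "K = {}")
    case True
    then show ?thesis using that[of q] q by (force simp: K_def A_def)
  next
    case False
    obtain z where z: "z \<in> K" "\<And>x. x \<in> K \<Longrightarrow> norm x \<le> norm z"
      using continuous_attains_sup[OF cK False, of norm] continuous_on_norm_id by blast
    have "norm z < r" using z(1) assms(3)[of z] by (cases "norm z = r") (auto simp: K_def A_def)
    moreover have "norm z \<ge> q" using z(1) by (simp add: K_def A_def)
    moreover have "f x < c" if x: "(norm z + r) / 2 \<le> norm x" "norm x \<le> r" for x
    proof (rule ccontr)
      assume "\<not> f x < c"
      then have "x \<in> K" using x \<open>norm z < r\<close> \<open>norm z \<ge> q\<close> by (simp add: K_def A_def)
      then show False using z(2)[of x] x \<open>norm z < r\<close> by simp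
    qed
    ultimately show ?thesis
      using that[of "(norm z + r) / 2"] q by simp
  qed
qed

text \<open>Without spherical Laplacians the trace equations are ordinary differential equations in
  r with first integral u V. The one for \<open>QQ\<close> shows that \<open>QQ\<close> vanishes
  only together with V.\<close>

lemma radial_equations:
  assumes x: "x \<in> U" and l: "lapS u x = 0" "lapS V x = 0"
  shows "2 * om x * EV x = (n - 2) * (1 - om x) * V x" "2 * om x * Eu x = - (n - 2) * (1 - om x) * u x"
    "2 * om x * QQ x = (n - 2) * (1 + om x) * V x" "ld id (\<lambda>y. u y * V y) x = 0"
proof -
  have o: "om x > 0" using u0[OF x] by (simp add: om_def)
  have "(n - 1) * (2 * om x * EV x) = (n - 1) * ((n - 2) * (1 - om x) * V x)" using static_trace(1)[OF x] l(2) by argo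
  then show 1: "2 * om x * EV x = (n - 2) * (1 - om x) * V x" using n3 by simp
  define M where "M = Eu x / u x"
  have M: "Eu x = u x * M" using u_nonzero[OF x] by (simp add: M_def)
  have "- ((n - 1) * om x * M) = (n - 1) * (n - 2) / 2 * (1 - om x)" using scal_eq[OF connected_U Vnz x] l(1) by (simp add: M_def)
  then have "(n - 1) * (2 * om x * M) = - (n - 1) * (n - 2) * (1 - om x)" by argo
  then have "(n - 1) * (2 * om x * Eu x) = (n - 1) * (- (n - 2) * (1 - om x) * u x)" unfolding M by algebra
  then show 2: "2 * om x * Eu x = - (n - 2) * (1 - om x) * u x" using n3 by simp
  show "2 * om x * QQ x = (n - 2) * (1 + om x) * V x" unfolding QQ_def using 1 by (simp add: algebra_simps)
  have "2 * om x * (u x * EV x + Eu x * V x) = 0" using 1 2 by algebra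
  then have "u x * EV x + Eu x * V x = 0" using o by simp
  then show "ld id (\<lambda>y. u y * V y) x = 0" unfolding ld_simps(3)[OF diffble_U[OF su x] diffble_U[OF sV x]] .
qed

lemma Qd_zero_rot: "x \<in> U \<Longrightarrow> Qd u x = 0 \<Longrightarrow> orth2 a b \<Longrightarrow> ld (rot a b) u x = 0"
  using Qd_rot[OF diffble_U[OF su], of x a b] U0 by simp

end

context asy begin

text \<open>Beyond \<open>R\<close> the right hand side of \<open>SV_ray\<close> is 0, so SV grows
  linearly along rays unless it vanishes; but it is bounded.\<close>

lemma SV_zero:
  assumes "R > r0" "\<And>x. norm x \<ge> R \<Longrightarrow> Qd u x = 0" "norm x \<ge> R" "orth2 a b"
  shows "ld (rot a b) V x = 0"
proof -
  obtain D2 where D2: "D2 > 0" "\<And>x a b. norm x \<ge> r1 \<Longrightarrow> orth2 a b \<Longrightarrow> \<bar>ld (rot a b) V x\<bar> \<le> D2 * norm x powr (-1/2)" using SV_decay by blast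
  have xU: "x \<in> U" using assms by (simp add: mem_U_iff)
  have x0: "norm x > 0" using U0[OF xU] by simp
  have c: "ld (rot a b) V (s *\<^sub>R x) / s = ld (rot a b) V x" if s: "s \<ge> 1" for s
  proof -
    have "\<bar>ld (rot a b) V (s *\<^sub>R x) / s - ld (rot a b) V (1 *\<^sub>R x) / 1\<bar> \<le> 0 / 1 * 1 powr (- 1)"
    proof (rule decay_integral[OF _ s])
      fix z :: real assume z: "1 \<le> z" "z \<le> s"
      have n: "norm (z *\<^sub>R x) \<ge> R" using z assms(3) mult_right_mono[of 1 z "norm x"] by simp
      have zU: "z *\<^sub>R x \<in> U" using n assms(1) mem_U_iff[of "z *\<^sub>R x"] by linarith
      show "((\<lambda>s. ld (rot a b) V (s *\<^sub>R x) / s) has_real_derivative (ld (rot a b) u (z *\<^sub>R x) / u (z *\<^sub>R x)) * QQ (z *\<^sub>R x) / z\<^sup>2) (at z)"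
        by (rule SV_ray[OF _ zU]) (use z in simp)
      show "\<bar>(ld (rot a b) u (z *\<^sub>R x) / u (z *\<^sub>R x)) * QQ (z *\<^sub>R x) / z\<^sup>2\<bar> \<le> 0 * z powr (- 1 - 1)"
        using Qd_zero_rot[OF zU assms(2)[OF n] assms(4)] by simp
    qed simp_all
    then show ?thesis by simp
  qed
  have "\<bar>ld (rot a b) V x\<bar> \<le> 0"
  proof (rule field_le_epsilon)
    fix e :: real assume e: "e > 0"
    define s where "s = max 1 (max (D2 / e) (r1 / norm x))"
    have s: "s \<ge> 1" "D2 / e \<le> s" "r1 / norm x \<le> s" by (simp_all add: s_def)
    have n: "norm (s *\<^sub>R x) \<ge> r1" using s x0 by (simp add: divide_le_eq)
    have "\<bar>ld (rot a b) V (s *\<^sub>R x)\<bar> \<le> D2 * 1" using D2(2)[OF n assms(4)] half(2)[OF n] D2(1) mult_left_mono[OF half(2)[OF n], of D2] by linarith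
    then have "\<bar>ld (rot a b) V (s *\<^sub>R x) / s\<bar> \<le> D2 / s" using s by (simp add: abs_divide divide_right_mono)
    also have "\<dots> \<le> e" using s e by (simp add: field_simps)
    finally show "\<bar>ld (rot a b) V x\<bar> \<le> 0 + e" using c[OF s(1)] by simp
  qed
  then show ?thesis by simp
qed

text \<open>V has no zero where u is radial: u V is constant along rays, and V is bounded away from
  0 far out.\<close>

lemma radial_region:
  assumes R: "R > r0" "\<And>x. norm x \<ge> R \<Longrightarrow> Qd u x = 0" and x: "norm x \<ge> R"
  shows "lapS u x = 0" "lapS V x = 0" "norm y = norm x \<Longrightarrow> u y = u x" "norm y = norm x \<Longrightarrow> V y = V x" "V x \<noteq> 0" "QQ x \<noteq> 0"
proof -
  have UR: "z \<in> U" if "norm z \<ge> R" for z using that R by (simp add: mem_U_iff)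
  have cu: "lapS u z = 0 \<and> (norm y = norm z \<longrightarrow> u y = u z)" if z: "norm z \<ge> R" for y z
  proof -
    have "ld (rot a b) u w = 0" if "orth2 a b" "norm w = norm z" for a b w
      by (rule Qd_zero_rot[OF UR R(2) that(1)]) (use that z in simp_all)
    from spherical_const[OF UR[OF z] su this] show ?thesis by blast
  qed
  have cV: "lapS V z = 0 \<and> (norm y = norm z \<longrightarrow> V y = V z)" if z: "norm z \<ge> R" for y z
  proof -
    have "ld (rot a b) V w = 0" if "orth2 a b" "norm w = norm z" for a b w
      by (rule SV_zero[OF R _ that(1)]) (use that z in simp_all)
    from spherical_const[OF UR[OF z] sV this] show ?thesis by blast
  qed
  show l: "lapS u x = 0" "lapS V x = 0" "norm y = norm x \<Longrightarrow> u y = u x" "norm y = norm x \<Longrightarrow> V y = V x" using cu[OF x] cV[OF x] by blast+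
  show V0: "V x \<noteq> 0"
  proof -
    obtain m R0 where m: "m > 0" "R0 \<ge> r1" "\<And>x. norm x \<ge> R0 \<Longrightarrow> \<bar>V x\<bar> \<ge> m" using V_lower by blast
    have x0: "norm x > 0" using U0[OF UR[OF x]] by simp
    define s where "s = max 1 (R0 / norm x)"
    have s: "s \<ge> 1" "R0 / norm x \<le> s" by (simp_all add: s_def)
    have n: "norm (s *\<^sub>R x) \<ge> R0" using s x0 by (simp add: divide_le_eq)
    have "u (s *\<^sub>R x) * V (s *\<^sub>R x) = u x * V x"
    proof (rule ray_const[OF UR[OF x] s(1)])
      fix y :: "real^'n" assume y: "norm x \<le> norm y"
      then have yR: "norm y \<ge> R" using x by simp
      show "(\<lambda>y. u y * V y) differentiable (at y)" by (intro diffble_U[OF _ UR[OF yR]] smooth_mult openU su sV)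
      show "ld id (\<lambda>y. u y * V y) y = 0" using radial_equations(4)[OF UR[OF yR]] cu[OF yR] cV[OF yR] by simp
    qed
    moreover have "V (s *\<^sub>R x) \<noteq> 0" using m(1) m(3)[OF n] by auto
    moreover have "u (s *\<^sub>R x) \<noteq> 0" using u_nonzero[OF inU[of "s *\<^sub>R x"]] n m by simp
    ultimately show ?thesis by auto
  qed
  have "om x > 0" using u0[OF UR[OF x]] by (simp add: om_def)
  then show "QQ x \<noteq> 0" using radial_equations(3)[OF UR[OF x] l(1,2)] V0 n3 by auto
qed

lemma radial_extends:
  assumes R: "R > r0" "\<And>x. norm x \<ge> R \<Longrightarrow> Qd u x = 0"
  obtains R' where "r0 < R'" "R' < R" "\<And>x. norm x \<ge> R' \<Longrightarrow> Qd u x = 0"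
proof -
  have Rp: "R > 0" using R r0 by simp
  obtain x1 :: "real^'n" where x1: "norm x1 = R" using vector_choose_size[of R] Rp by auto
  note reg = radial_region[OF R]
  have UR: "z \<in> U" if "norm z = R" for z using that R by (simp add: mem_U_iff)
  define w0 where "w0 = om x1"
  have w0: "w0 > 0" using u0[OF UR[OF x1]] by (simp add: w0_def om_def)
  have omR: "om z = w0" if "norm z = R" for z 
  proof -
    have "u z = u x1" by (rule reg(3)) (use that x1 in simp_all)
    then show ?thesis by (simp add: w0_def om_def)
  qed
  have VR: "V z = V x1" if "norm z = R" for z by (rule reg(4)) (use that x1 in simp_all)
  have V1: "V x1 \<noteq> 0" using reg(5)[of x1] x1 by simp
  obtain \<epsilon> where \<epsilon>: "\<epsilon> > 0" and eps: "\<forall>Y Z w c l. Z \<noteq> 0 \<longrightarrow> \<bar>Z\<bar> < \<epsilon> \<longrightarrow> \<bar>w - w0\<bar> < \<epsilon> \<longrightarrow> \<bar>Y\<bar> \<le> (if w0 = 1 then 1 else \<epsilon>) * \<bar>Z\<bar> \<longrightarrow>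
      (n - 1) * l = 2 * Z\<^sup>2 + 2 * c * Z \<longrightarrow> pPhi (n - 1) (Y + Z) (Z - Y) w c l = 0 \<longrightarrow> pF2 (n - 1) (Y + Z) (Z - Y) w c l = 0 \<longrightarrow>
      pF3 (n - 1) (Y + Z) (Z - Y) w c l \<noteq> 0" using no_small_solution[of "n - 1" w0] n3 w0 by auto
  have cQ: "continuous_on U (Qd u)" "continuous_on U u" "continuous_on U V" "continuous_on U QQ" "continuous_on U om"
    by (intro smooth_continuous smooth_Qd openU su sV smooth_EV smom)+
  define q where "q x = Qd u x / (u x)\<^sup>2" for x
  have cq: "continuous_on U q" unfolding q_def using u_nonzero by (intro continuous_intros cQ) auto
  obtain a1 where a1: "r0 < a1" "a1 < R" "\<And>x. a1 \<le> norm x \<Longrightarrow> norm x \<le> R \<Longrightarrow> q x < \<epsilon>\<^sup>2"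
    using near_sphere[OF cq R(1), of "\<epsilon>\<^sup>2"] R(2) \<epsilon> by (auto simp: q_def)
  obtain a2 where a2: "r0 < a2" "a2 < R" "\<And>x. a2 \<le> norm x \<Longrightarrow> norm x \<le> R \<Longrightarrow> \<bar>om x - w0\<bar> < \<epsilon>"
  proof (rule near_sphere[of "\<lambda>x. \<bar>om x - w0\<bar>" R \<epsilon>, OF _ R(1)])
    show "continuous_on U (\<lambda>x. \<bar>om x - w0\<bar>)" by (intro continuous_intros cQ)
  qed (use omR \<epsilon> in auto)
  define v where "v = \<bar>V x1\<bar> / 2"
  have v: "v > 0" using V1 by (simp add: v_def)
  obtain a3 where a3: "r0 < a3" "a3 < R" "\<And>x. a3 \<le> norm x \<Longrightarrow> norm x \<le> R \<Longrightarrow> - \<bar>V x\<bar> < - v"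
  proof (rule near_sphere[of "\<lambda>x. - \<bar>V x\<bar>" R "- v", OF _ R(1)])
    show "continuous_on U (\<lambda>x. - \<bar>V x\<bar>)" by (intro continuous_intros cQ)
  qed (use VR V1 in \<open>auto simp: v_def\<close>)
  obtain a4 where a4: "r0 < a4" "a4 < R" "\<And>x. a4 \<le> norm x \<Longrightarrow> norm x \<le> R \<Longrightarrow> - \<bar>QQ x\<bar> < 0"
  proof (rule near_sphere[of "\<lambda>x. - \<bar>QQ x\<bar>" R 0, OF _ R(1)])
    show "continuous_on U (\<lambda>x. - \<bar>QQ x\<bar>)" by (intro continuous_intros cQ)
  qed (use reg(6) in auto)
  define a where "a = max a1 (max a2 (max a3 a4))"
  have a: "r0 < a" "a < R" "a1 \<le> a" "a2 \<le> a" "a3 \<le> a" "a4 \<le> a" using a1 a2 a3 a4 by (auto simp: a_def)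
  have "continuous_on {x. a \<le> norm x \<and> norm x \<le> R} QQ" by (rule continuous_on_subset[OF cQ(4)]) (use a in \<open>auto simp: mem_U_iff\<close>)
  then have "bounded (QQ ` {x. a \<le> norm x \<and> norm x \<le> R})" by (intro compact_imp_bounded compact_continuous_image compact_annulus)
  then obtain B0 where B0: "\<And>x. a \<le> norm x \<Longrightarrow> norm x \<le> R \<Longrightarrow> \<bar>QQ x\<bar> \<le> B0" unfolding bounded_iff by auto
  define B where "B = max B0 1"
  have B: "B > 0" "\<And>x. a \<le> norm x \<Longrightarrow> norm x \<le> R \<Longrightarrow> \<bar>QQ x\<bar> \<le> B" using B0 by (auto simp: B_def intro: le_max_iff_disj[THEN iffD2])
  define c1 where "c1 = min \<epsilon> 1"
  have c1: "c1 > 0" "c1 \<le> \<epsilon>" "c1 \<le> 1" using \<epsilon> by (auto simp: c1_def)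
  \<comment> \<open>So close to \<open>R\<close> that \<open>B * (R / R' - 1) \<le> c1 * v\<close>;
    the change of SV along a ray, relative to the radius, is then at most
    \<open>Z * (c1 * v)\<close>.\<close>
  define R' where "R' = max a (R / (1 + c1 * v / B))"
  have den: "1 + c1 * v / B > 1" using c1 v B by simp
  have "R / (1 + c1 * v / B) < R / 1" using den Rp by (intro divide_strict_left_mono) auto
  then have R': "r0 < R'" "R' < R" "a \<le> R'" using a by (auto simp: R'_def)
  have R'0: "R' > 0" using R' r0 by simp
  have R'q: "B * (R / R' - 1) \<le> c1 * v"
  proof -
    have "R / (1 + c1 * v / B) \<le> R'" by (simp add: R'_def)
    then have "R \<le> R' * (1 + c1 * v / B)" using den by (simp add: divide_le_eq)
    then have "R / R' \<le> 1 + c1 * v / B" using R'0 by (simp add: divide_le_eq mult.commute)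
    then have "B * (R / R' - 1) \<le> B * (c1 * v / B)" using B by (intro mult_left_mono) auto
    then show ?thesis using B by simp
  qed
  have "Qd u x = 0" if xR: "norm x \<ge> R'" for x
  proof (rule ccontr)
    assume nz: "Qd u x \<noteq> 0"
    then have xlt: "norm x < R" using R(2)[of x] by (cases "norm x < R") auto
    let ?A = "{x::real^'n. R' \<le> norm x \<and> norm x \<le> R}"
    have AU: "?A \<subseteq> U" using R' by (auto simp: mem_U_iff)
    have "continuous_on ?A q" by (rule continuous_on_subset[OF cq AU])
    moreover have xA: "x \<in> ?A" using xR xlt by simp
    ultimately obtain p where p: "p \<in> ?A" "\<And>x. x \<in> ?A \<Longrightarrow> q x \<le> q p"
      using continuous_attains_sup[OF compact_annulus[of R' R], of q] by blast
    have pU: "p \<in> U" "p \<noteq> 0" using p AU U0 by auto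
    have up: "u p > 0" by (rule u0[OF pU(1)])
    have "q x > 0" using nz Qd_nonneg[of u x] u0[of x] xA AU by (auto simp: q_def intro!: divide_pos_pos)
    then have "q p > 0" using p(2)[OF xA] by linarith
    then have Qp: "Qd u p > 0" using Qd_nonneg[of u p] by (cases "Qd u p = 0") (auto simp: q_def)
    have pl: "norm p < R" using R(2)[of p] Qp by (cases "norm p < R") auto
    have pa: "a \<le> norm p" "norm p \<le> R" "R' \<le> norm p" "norm p > 0" using p R' R'0 by auto
    obtain c b where cb: "orth2 c b" "p = norm p *\<^sub>R c" "\<And>e. e \<bullet> c = 0 \<Longrightarrow> e \<bullet> b = 0 \<Longrightarrow> dd e u p = 0" "ld (rot c b) u p = sqrt (Qd u p)"
      using Qd_frame[OF diffble_U[OF su pU(1)] Qp pU(2)] by blast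
    define Z where "Z = sqrt (Qd u p) / u p"
    have Z0: "Z > 0" using Qp up by (simp add: Z_def)
    have Z2: "Z\<^sup>2 = q p" using Qp by (simp add: Z_def q_def power_divide)
    have Zs: "Z < \<epsilon>"
    proof -
      have "Z\<^sup>2 < \<epsilon>\<^sup>2" unfolding Z2 using a1(3)[of p] pa a by simp
      then show ?thesis using \<epsilon> power2_less_imp_less by fastforce
    qed
    have Vp: "\<bar>V p\<bar> > v" using a3(3)[of p] pa a by simp
    define t where "t = R / norm p"
    have t: "t > 1" using pl pa by (simp add: t_def less_divide_eq)
    have st: "a \<le> norm (s *\<^sub>R p)" "norm (s *\<^sub>R p) \<le> R" "R' \<le> norm (s *\<^sub>R p)" "s *\<^sub>R p \<in> U" if s: "1 \<le> s" "s \<le> t" for s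
    proof -
      have "1 * norm p \<le> s * norm p" "s * norm p \<le> t * norm p" using s by (intro mult_right_mono; simp)+
      moreover have "t * norm p = R" using pa by (simp add: t_def)
      moreover have "norm (s *\<^sub>R p) = s * norm p" using s by simp
      ultimately show "a \<le> norm (s *\<^sub>R p)" "norm (s *\<^sub>R p) \<le> R" "R' \<le> norm (s *\<^sub>R p)" using pa by linarith+
      then show "s *\<^sub>R p \<in> U" using AU by blast
    qed
    define g where "g s = ld (rot c b) V (s *\<^sub>R p) / s" for s
    define g' where "g' s = (ld (rot c b) u (s *\<^sub>R p) / u (s *\<^sub>R p)) * QQ (s *\<^sub>R p) / s\<^sup>2" for s
    have Dg: "(g has_real_derivative g' s) (at s)" if "1 \<le> s" "s \<le> t" for s
      unfolding g_def g'_def by (rule SV_ray) (use st[OF that] that in auto)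
    have g'b: "\<bar>g' s\<bar> \<le> Z * B" if s: "1 \<le> s" "s \<le> t" for s
    proof -
      let ?y = "s *\<^sub>R p"
      have "(ld (rot c b) u ?y / u ?y)\<^sup>2 \<le> q ?y"
        unfolding power_divide q_def by (intro divide_right_mono Qd_rot[OF diffble_U[OF su st(4)[OF s]] cb(1) U0[OF st(4)[OF s]]]) simp
      also have "\<dots> \<le> Z\<^sup>2" unfolding Z2 by (rule p(2)) (use st[OF s] in auto)
      finally have "\<bar>ld (rot c b) u ?y / u ?y\<bar> \<le> \<bar>Z\<bar>" by (simp only: abs_le_square_iff)
      then have "\<bar>ld (rot c b) u ?y / u ?y\<bar> * \<bar>QQ ?y\<bar> \<le> Z * B" using B st[OF s] Z0 by (intro mult_mono) auto
      then have "\<bar>ld (rot c b) u ?y / u ?y\<bar> * \<bar>QQ ?y\<bar> / s\<^sup>2 \<le> Z * B / 1"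
        using s Z0 B by (intro frac_le) auto
      then show ?thesis unfolding g'_def abs_divide[of _ "s\<^sup>2"] abs_mult[of "ld (rot c b) u ?y / u ?y"] by simp
    qed
    obtain z where z: "1 < z" "z < t" "g t - g 1 = (t - 1) * g' z" using MVT2[OF t, of g g', OF Dg] by blast
    have "norm (t *\<^sub>R p) = t * norm p" using t by simp
    also have "\<dots> = R" using pa by (simp add: t_def)
    finally have "ld (rot c b) V (t *\<^sub>R p) = 0" by (intro SV_zero[OF R _ cb(1)]) simp_all
    then have "g t = 0" by (simp add: g_def)
    have "\<bar>g 1\<bar> = (t - 1) * \<bar>g' z\<bar>" 
    proof -
      have "\<bar>g 1\<bar> = \<bar>(t - 1) * g' z\<bar>" using z(3) \<open>g t = 0\<close> by simp
      then show ?thesis using t by (simp add: abs_mult)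
    qed
    also have "\<dots> \<le> (R / R' - 1) * (Z * B)"
    proof (rule mult_mono)
      have "t \<le> R / R'" unfolding t_def using pa R'0 Rp by (intro divide_left_mono) auto
      then show "t - 1 \<le> R / R' - 1" by simp
      then show "0 \<le> R / R' - 1" using t by linarith
    qed (use g'b[of z] z in auto)
    also have "\<dots> = Z * (B * (R / R' - 1))" by simp
    also have "\<dots> \<le> Z * (c1 * v)" using R'q Z0 by (intro mult_left_mono) auto
    also have "\<dots> < Z * (c1 * \<bar>V p\<bar>)" using Vp c1 Z0 by (intro mult_strict_left_mono) auto
    finally have S: "\<bar>ld (rot c b) V p\<bar> < \<bar>V p\<bar> * (c1 * Z)" by (simp add: g_def mult_ac)
    have "c1 * Z \<le> 1 * Z" "c1 * Z \<le> \<epsilon> * Z" using c1 Z0 by (intro mult_right_mono; simp)+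
    then have S2: "\<bar>V p\<bar> * (c1 * Z) \<le> \<bar>V p\<bar> * Z" "\<bar>V p\<bar> * (c1 * Z) \<le> \<bar>V p\<bar> * (\<epsilon> * Z)" by (intro mult_left_mono; simp)+
    show False
    proof (rule slice_contradiction[OF pU(1) w0 eps cb(1,2,3) cb(4) Qp])
      show "Qd u y / (u y)\<^sup>2 \<le> Qd u p / (u p)\<^sup>2" if "norm y = norm p" for y
        using p(2)[of y] that pa by (simp add: q_def)
      show "sqrt (Qd u p) / u p < \<epsilon>" using Zs by (simp add: Z_def)
      show "\<bar>om p - w0\<bar> < \<epsilon>" using a2(3)[of p] pa a by simp
      show "V p \<noteq> 0" using Vp v by auto
      show "QQ p \<noteq> 0" using a4(3)[of p] pa a by auto
      show "\<bar>ld (rot c b) V p\<bar> < \<bar>V p\<bar> * (sqrt (Qd u p) / u p)" using S S2 unfolding Z_def[symmetric] by linarith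
      show "\<bar>ld (rot c b) V p\<bar> \<le> \<bar>V p\<bar> * ((if w0 = 1 then 1 else \<epsilon>) * (sqrt (Qd u p) / u p))"
        using S S2 unfolding Z_def[symmetric] by (simp split: if_splits)
    qed
  qed
  then show ?thesis using that R' by blast
qed

text \<open>Continuity induction: the infimum of the radii beyond which u is radial has this
  property itself, by continuity, and \<open>radial_extends\<close> would go below it.\<close>

lemma radial_everywhere: assumes "x \<in> U" shows "Qd u x = 0"
proof -
  define T where "T = {R. R > r0 \<and> (\<forall>x. norm x \<ge> R \<longrightarrow> Qd u x = 0)}"
  obtain R0 where R0: "R0 \<in> T" using radial_near_infinity by (auto simp: T_def)
  have bd: "bdd_below T" unfolding T_def by (rule bdd_belowI[of _ r0]) auto
  define rs where "rs = Inf T"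
  have rs0: "rs \<ge> r0" unfolding rs_def by (rule cInf_greatest) (use R0 in \<open>auto simp: T_def\<close>)
  have out: "Qd u x = 0" if "norm x > rs" for x
  proof -
    obtain R where "R \<in> T" "R < norm x" using \<open>norm x > rs\<close> cInf_less_iff[OF _ bd] R0 unfolding rs_def by blast
    then show ?thesis by (auto simp: T_def)
  qed
  have "rs = r0"
  proof (rule ccontr)
    assume "rs \<noteq> r0"
    then have rs: "rs > r0" using rs0 by simp
    have z: "Qd u x = 0" if x: "norm x \<ge> rs" for x
    proof (cases "norm x > rs")
      case False
      then have nx: "norm x = rs" using x by simp
      then have xU: "x \<in> U" using rs by (simp add: mem_U_iff)
      have x0: "norm x > 0" using U0[OF xU] by simp
      have "isCont (Qd u) x" using smooth_diffble[OF openU smooth_Qd[OF openU su] xU] differentiable_imp_continuous_within by blast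
      moreover have "(\<lambda>k. (1 + 1 / real (Suc k)) *\<^sub>R x) \<longlonglongrightarrow> (1 + 0) *\<^sub>R x"
        by (intro tendsto_intros LIMSEQ_Suc[OF lim_1_over_n])
      ultimately have "(\<lambda>k. Qd u ((1 + 1 / real (Suc k)) *\<^sub>R x)) \<longlonglongrightarrow> Qd u x"
        using isCont_tendsto_compose[of x "Qd u"] by simp
      moreover have "Qd u ((1 + 1 / real (Suc k)) *\<^sub>R x) = 0" for k
        by (rule out) (use x0 nx in \<open>simp add: field_simps\<close>)
      ultimately show ?thesis using LIMSEQ_unique[OF tendsto_const] by fastforce
    qed (rule out)
    obtain R' where R': "r0 < R'" "R' < rs" "\<And>x. norm x \<ge> R' \<Longrightarrow> Qd u x = 0" using radial_extends[OF rs z] by blast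
    then have "R' \<in> T" by (simp add: T_def)
    then have "rs \<le> R'" unfolding rs_def by (rule cInf_lower[OF _ bd])
    then show False using R' by simp
  qed
  then show ?thesis using out[of x] assms by (simp add: mem_U_iff)
qed

end

context ext begin

lemma rotational_symmetry: assumes "x \<in> U"
  shows "lapS u x = 0" "lapS V x = 0" "norm y = norm x \<Longrightarrow> u y = u x" "norm y = norm x \<Longrightarrow> V y = V x"
proof -
  obtain C r1 Vm where "asy U u V n r0 C r1 Vm" using asy_ex .
  then interpret asy U u V n r0 C r1 Vm .
  have x: "norm x > r0" using assms by (simp add: mem_U_iff)
  have Q: "Qd u z = 0" if "norm z \<ge> norm x" for z by (rule radial_everywhere) (use that x in \<open>simp add: mem_U_iff\<close>)
  show "lapS u x = 0" "lapS V x = 0" "norm y = norm x \<Longrightarrow> u y = u x" "norm y = norm x \<Longrightarrow> V y = V x"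
    using radial_region[OF x Q order_refl] by blast+
qed

lemma radial_constant:
  assumes "\<And>x. x \<in> U \<Longrightarrow> f differentiable (at x)" "\<And>x. x \<in> U \<Longrightarrow> ld id f x = 0"
    "\<And>x y. x \<in> U \<Longrightarrow> norm y = norm x \<Longrightarrow> f y = (f x :: real)" "x \<in> U" "y \<in> U"
  shows "f y = f x"
proof -
  have *: "f y = f x" if xy: "x \<in> U" "y \<in> U" "norm x \<le> norm y" for x y
  proof -
    define s where "s = norm y / norm x"
    have x0: "norm x > 0" using U0[OF xy(1)] by simp
    have s: "s \<ge> 1" "s * norm x = norm y" using x0 xy(3) by (simp_all add: s_def le_divide_eq)
    have inU': "z \<in> U" if "norm z \<ge> norm x" for z using xy(1) that by (simp add: mem_U_iff)
    have "f (s *\<^sub>R x) = f x" by (rule ray_const[OF xy(1) s(1)]) (use assms(1,2) inU' in blast)+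
    moreover have "f y = f (s *\<^sub>R x)"
    proof (rule assms(3))
      show n: "norm y = norm (s *\<^sub>R x)" using s by simp
      show "s *\<^sub>R x \<in> U" using xy(2) n by (simp only: mem_U_iff)
    qed
    ultimately show ?thesis by simp
  qed
  show ?thesis using *[OF assms(4,5)] *[OF assms(5,4)] by (cases "norm x \<le> norm y") auto
qed

lemma schwarzschild:
  obtains m c where "\<And>x. x \<in> U \<Longrightarrow> om x = 1 - 2 * m * norm x powr (2 - n)" "\<And>x. x \<in> U \<Longrightarrow> V x = c / u x"
proof -
  obtain x0 where x0: "x0 \<in> U" using Vnz by blast
  define m where "m = Hm x0 / 2"
  have H: "Hm x = Hm x0" if "x \<in> U" for x
  proof (rule radial_constant[OF Hm_diff(1) _ _ x0 that])
    show "ld id Hm z = 0" if "z \<in> U" for z using Hm_diff(2)[OF that] rotational_symmetry(1)[OF that] by simp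
    show "Hm y = Hm z" if "z \<in> U" "norm y = norm z" for y z
      using rotational_symmetry(3)[OF that] that(2) by (simp add: Hm_def om_def)
  qed
  have uV: "u x * V x = u x0 * V x0" if "x \<in> U" for x
  proof (rule radial_constant[OF _ _ _ x0 that])
    show "(\<lambda>x. u x * V x) differentiable (at z)" if "z \<in> U" for z by (intro diffble_U[OF _ that] smooth_mult openU su sV)
    show "ld id (\<lambda>x. u x * V x) z = 0" if "z \<in> U" for z
      using radial_equations(4)[OF that] rotational_symmetry(1,2)[OF that] by simp
    show "u y * V y = u z * V z" if "z \<in> U" "norm y = norm z" for y z
      using rotational_symmetry(3,4)[OF that] by simp
  qed
  show ?thesis
  proof (rule that[of m "u x0 * V x0"])
    fix x assume x: "x \<in> U"
    have "norm x > 0" using U0[OF x] by simp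
    then have "norm x powr (n - 2) * norm x powr (2 - n) = 1" by (simp add: powr_add[symmetric])
    moreover have "(1 - om x) * norm x powr (n - 2) = 2 * m" using H[OF x] by (simp add: m_def Hm_def)
    ultimately have "1 - om x = 2 * m * norm x powr (2 - n)" by (metis mult.assoc mult.right_neutral)
    then show "om x = 1 - 2 * m * norm x powr (2 - n)" by simp
    show "V x = u x0 * V x0 / u x" using uV[OF x] u_nonzero[OF x] by (simp add: field_simps)
  qed
qed

end

theorem theorem1p2:
  fixes u V :: "real^'n::finite \<Rightarrow> real" and r0 :: real
  assumes n3: "CARD('n) \<ge> 3"
    and r0: "r0 > 0"
    and u_smooth: "smooth_on u (ext_region r0)"
    and u_pos: "\<forall>x\<in>ext_region r0. u x > 0"
    and V_smooth: "smooth_on V (ext_region r0)"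
    and V_bdd: "bounded (V ` ext_region r0)"
    and V_nontriv: "\<exists>x\<in>ext_region r0. V x \<noteq> 0"
    and static: "\<forall>x\<in>ext_region r0. \<forall>i j.
        hessian (warped_metric u) V i j x = V x * ricci (warped_metric u) i j x"
    and harmonic: "\<forall>x\<in>ext_region r0. laplacian (warped_metric u) V x = 0"
  shows "\<exists>m::real. r0 \<ge> schw_rm CARD('n) m
      \<and> (\<forall>x\<in>ext_region r0. u x = (1 - 2*m * norm x powr (2 - real CARD('n))) powr (-1/2))
      \<and> (\<exists>c::real. \<forall>x\<in>ext_region r0. V x = c * schw_V CARD('n) m (norm x))"
proof -
  have "{x::real^'n. norm x > r0} = - cball 0 r0" by auto
  then have op: "open (ext_region r0 :: (real^'n) set)" by (simp add: ext_region_def open_Compl)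
  interpret ext "ext_region r0" u V "real CARD('n)" r0
    using assms op by unfold_locales (auto simp: ext_region_def)
  note nC [simp del]
  obtain m c where m: "\<And>x. x \<in> ext_region r0 \<Longrightarrow> om x = 1 - 2 * m * norm x powr (2 - real CARD('n))"
    and c: "\<And>x. x \<in> ext_region r0 \<Longrightarrow> V x = c / u x" using schwarzschild by blast
  have sq: "sqrt (om x) = 1 / u x" if "x \<in> ext_region r0" for x using u0[OF that] by (simp add: om_def real_sqrt_divide)
  have om0: "om x > 0" if "x \<in> ext_region r0" for x using u0[OF that] by (simp add: om_def)
  have pw: "u x = om x powr (-1/2)" if "x \<in> ext_region r0" for x
  proof -
    have "om x powr (-1/2) = 1 / om x powr (1/2)" by (simp add: powr_minus_divide)
    then show ?thesis using sq[OF that] om0[OF that] u0[OF that] by (simp add: powr_half_sqrt)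
  qed
  define k where "k = CARD('n) - 2"
  have k: "k > 0" "real k = real CARD('n) - 2"
    unfolding k_def using of_nat_diff[of 2 "CARD('n)", where 'a=real] assms(1) by linarith+
  \<comment> \<open>Positivity of \<open>om\<close> on every sphere of radius r > \<open>r0\<close>
    bounds \<open>2 * m\<close> by \<open>r ^ k\<close>; the bound at \<open>r0\<close> itself is
    the limit from the right.\<close>
  have rm: "schw_rm CARD('n) m \<le> r0"
  proof -
    have "2 * m \<le> r0 ^ k"
    proof (rule tendsto_lowerbound)
      show "((\<lambda>r. r ^ k) \<longlongrightarrow> r0 ^ k) (at_right r0)" by (intro tendsto_intros)
      show "\<forall>\<^sub>F r in at_right r0. 2 * m \<le> r ^ k"
      proof (rule eventually_at_rightI)
        show "r0 < r0 + 1" by simp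
        fix r assume r: "r \<in> {r0<..<r0 + 1}"
        obtain x :: "real^'n" where x: "norm x = r" using vector_choose_size[of r] r r0 by auto
        have xE: "x \<in> ext_region r0" using x r by (simp add: ext_region_def)
        have rp: "r > 0" using r r0 by simp
        have "r powr (2 - real CARD('n)) = r powr (- real k)" using k(2) by simp
        also have "\<dots> = 1 / r ^ k" using rp by (simp add: powr_minus_divide powr_realpow)
        finally have "0 < 1 - 2 * m * (1 / r ^ k)" using m[OF xE] om0[OF xE] by (simp add: x)
        then show "2 * m \<le> r ^ k" using rp by (simp add: field_simps)
      qed
    qed simp
    then have "max (2 * m) 0 \<le> r0 ^ k" using r0 by simp
    then have "root k (max (2 * m) 0) \<le> root k (r0 ^ k)" using k(1) by (simp add: real_root_le_iff)
    then show ?thesis using k(1) r0 by (simp add: schw_rm_def k_def[symmetric] real_root_power_cancel)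
  qed
  have "u x = (1 - 2*m * norm x powr (2 - real CARD('n))) powr (-1/2)"
    "V x = c * schw_V CARD('n) m (norm x)" if x: "x \<in> ext_region r0" for x
    using pw[OF x] c[OF x] sq[OF x] unfolding m[OF x] by (simp_all add: schw_V_def)
  then show ?thesis using rm by blast
qed

end
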